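(* Let $\gamma\in(0,1/400]$. Then for every sufficiently large integer $n$, every $(n,(1\pm\gamma)d,\lambda)$-graph with $\lambda\le d/70000$ and $d\ge\log^6 n$ contains a Hamilton cycle.
   Context: For a graph $G$ with adjacency matrix $A$, let $s_1(A)\ge s_2(A)\ge\dots$ denote the singular values of $A$ (the nonnegative square roots of the eigenvalues of $A^{\mathsf T}A$) in nonincreasing order. For $d,\lambda>0$ and $\gamma\in[0,1)$, a graph $G$ is an $(n,(1\pm\gamma)d,\lambda)$-graph if $G$ has $n$ vertices, every vertex has degree in $[(1-\gamma)d,(1+\gamma)d]$, and $s_2(A(G))\le\lambda$. A Hamilton cycle is a cycle passing through every vertex exactly once. *)

theory Defs
  imports
    Complex_Main
    "Jordan_Normal_Form.Char_Poly"
    "Graph_Theory.Graph_Theory"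
begin

text \<open>
  A finite simple graph is a \<^locale>\<open>pair_graph\<close>: a finite loopfree digraph whose arcs are
  ordered pairs of vertices and whose arc set is symmetric. An edge \<open>{u, v}\<close> is the two
  arcs \<open>(u, v)\<close> and \<open>(v, u)\<close>, so the degree of a vertex is its \<^const>\<open>out_degree\<close>.
\<close>

text \<open>Only used for graphs with vertex set \<open>{0..<n}\<close>.\<close>

definition adjacency_matrix :: "nat \<Rightarrow> nat pair_pre_digraph \<Rightarrow> real mat" where
  "adjacency_matrix n G = mat n n (\<lambda>(i, j). if (i, j) \<in> parcs G then 1 else 0)"

text \<open>
  The eigenvalues are counted with algebraic multiplicity, as the roots of the characteristic
  polynomial. \<open>A\<^sup>T A\<close> is symmetric positive semidefinite, so the real polynomial splits into
  linear factors with nonnegative roots, and the list has \<open>dim_col A\<close> entries.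
\<close>

definition singular_values :: "real mat \<Rightarrow> real list" where
  "singular_values A =
     rev (sorted_list_of_multiset
       (image_mset sqrt (proots (char_poly (transpose_mat A * A)))))"

text \<open>Numbered from \<open>1\<close>; meaningful for \<open>1 \<le> k \<le> dim_col A\<close>.\<close>

definition singular_value :: "nat \<Rightarrow> real mat \<Rightarrow> real" where
  "singular_value k A = singular_values A ! (k - 1)"

text \<open>
  The \<open>(n, (1 \<plusminus> \<gamma>)d, \<lambda>)\<close>-graphs (\<open>\<lambda>\<close> is written \<open>lam\<close>), with the vertices labelled \<open>0, \<dots>, n - 1\<close>.
\<close>

definition pseudorandom_graph ::
    "nat \<Rightarrow> real \<Rightarrow> real \<Rightarrow> real \<Rightarrow> nat pair_pre_digraph \<Rightarrow> bool" where
  "pseudorandom_graph n \<gamma> d lam G \<longleftrightarrow>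
     0 < d \<and> 0 < lam \<and> 0 \<le> \<gamma> \<and> \<gamma> < 1 \<and>
     pair_graph G \<and> pverts G = {0..<n} \<and>
     (\<forall>v\<in>pverts G. real (out_degree (with_proj G) v) \<in> {(1 - \<gamma>) * d .. (1 + \<gamma>) * d}) \<and>
     singular_value 2 (adjacency_matrix n G) \<le> lam"

text \<open>
  A cycle is given by its list of arcs. The library's notion admits the closed walk
  \<open>(u, v), (v, u)\<close>, which is not a cycle of the undirected graph; hence the bound on the
  length. The library's notion already says that no vertex is repeated.
\<close>

definition hamilton_cycle :: "'a pair_pre_digraph \<Rightarrow> ('a \<times> 'a) list \<Rightarrow> bool" where
  "hamilton_cycle G p \<longleftrightarrow>
     pre_digraph.cycle (with_proj G) p \<and> 3 \<le> length p \<and> fst ` set p = pverts G"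

end

theory Submission
  imports Defs "HOL-Analysis.Analysis" "HOL-Real_Asymp.Real_Asymp"
begin

text \<open>
  The hypothesis on the second singular value bounds the norm of \<open>A - (d/n) J\<close> by \<open>d/150\<close>. Splitting a
  vertex set into \<open>K\<close> classes by a random transversal divides degrees and the norm of each block by \<open>K\<close>,
  up to constants, as long as \<open>d/K\<close> is a large multiple of \<open>log n\<close>; this follows from a moment method.

  Choose small reservoirs \<open>R1\<close>, \<open>R2\<close> and build, inside a third of the vertices, an absorber: a path that can
  swallow any subset of the reservoirs without changing its ends. Absorbers are assembled from ladders
  over odd cycles, whose pieces come from the Friedman-Pippenger method of growing trees
  while preserving an expansion condition. The remaining vertices are cut into about \<open>log^4 n\<close> layers of equal
  size, and Hall's theorem matches consecutive layers, which covers them by few paths. These paths and the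
  absorber are linked into a cycle through the reservoirs, and the absorber swallows what is left there.
\<close>

section \<open>Diagonalisation of selfadjoint operators\<close>

text \<open>Let \<open>l\<close> be log n rounded up. Absorbing one reservoir vertex costs of the
  order of \<open>l^2\<close> vertices, so reservoirs of about \<open>n / (3 * l^3)\<close> vertices
  keep the absorber at a small fraction of \<open>n\<close>. Joining \<open>M\<close> paths costs
  links of at most \<open>4 * l\<close> reservoir vertices each, so \<open>M * l\<close> must be
  small against \<open>n / l^3\<close>; hence \<open>200 * l^4\<close> layers on each of two sides.
  The degree into a layer is then of the order \<open>d / l^4\<close>, and concentration asks for a
  large multiple of \<open>l\<close>; the sixth power in the hypothesis leaves one more factor
  \<open>l\<close> for the constants. The obstacle in splitting is that the moment method treats the
  rows of a block as random and its columns as fixed. It says nothing about a block whose rows and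
  columns come from the same sample. So what lies outside absorber and reservoirs is divided into
  two sides: one is sampled first, its classes serve as fixed columns while the other is sampled,
  and the layers alternate between the sides. The reservoirs are exposed one after the other in the
  same way.\<close>

definition ip :: "nat \<Rightarrow> (nat \<Rightarrow> real) \<Rightarrow> (nat \<Rightarrow> real) \<Rightarrow> real" where
  "ip n x y = (\<Sum>i<n. x i * y i)"

text \<open>The space R^n, realised as the total functions that vanish from \<open>n\<close> on.
  Operators are total as well, and are controlled only on these functions.\<close>

definition vsp :: "nat \<Rightarrow> (nat \<Rightarrow> real) set" where
  "vsp n = {x. \<forall>i\<ge>n. x i = 0}"

definition selfadj :: "nat \<Rightarrow> ((nat \<Rightarrow> real) \<Rightarrow> (nat \<Rightarrow> real)) \<Rightarrow> bool" where
  "selfadj n T \<longleftrightarrow> (\<forall>x\<in>vsp n. T x \<in> vsp n) \<and>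
     (\<forall>x\<in>vsp n. \<forall>y\<in>vsp n. \<forall>a b. T (\<lambda>i. a * x i + b * y i) = (\<lambda>i. a * T x i + b * T y i)) \<and>
     (\<forall>x\<in>vsp n. \<forall>y\<in>vsp n. ip n (T x) y = ip n x (T y))"

definition unit_vec :: "nat \<Rightarrow> nat \<Rightarrow> real" where
  "unit_vec i = (\<lambda>j. if j = i then 1 else 0)"

definition onb :: "nat \<Rightarrow> (nat \<Rightarrow> nat \<Rightarrow> real) \<Rightarrow> nat \<Rightarrow> bool" where
  "onb n e k \<longleftrightarrow> (\<forall>i<k. e i \<in> vsp n) \<and> (\<forall>i<k. \<forall>j<k. ip n (e i) (e j) = (if i = j then 1 else 0))"

lemma ip_sym: "ip n x y = ip n y x"
  by (simp add: ip_def mult.commute)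

lemma ip_add_left: "ip n (\<lambda>i. a * x i + b * y i) z = a * ip n x z + b * ip n y z"
  by (simp add: ip_def algebra_simps sum.distrib sum_distrib_left)

lemma ip_add_right: "ip n z (\<lambda>i. a * x i + b * y i) = a * ip n z x + b * ip n z y"
  by (simp add: ip_def algebra_simps sum.distrib sum_distrib_left)

lemma ip_sum_left: "ip n (\<lambda>i. \<Sum>k\<in>K. c k * f k i) z = (\<Sum>k\<in>K. c k * ip n (f k) z)"
proof -
  have "ip n (\<lambda>i. \<Sum>k\<in>K. c k * f k i) z = (\<Sum>i<n. \<Sum>k\<in>K. c k * (f k i * z i))"
    by (simp add: ip_def sum_distrib_right mult.assoc)
  also have "\<dots> = (\<Sum>k\<in>K. \<Sum>i<n. c k * (f k i * z i))" by (rule sum.swap)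
  finally show ?thesis by (simp add: ip_def sum_distrib_left)
qed

lemma ip_sum_right: "ip n z (\<lambda>i. \<Sum>k\<in>K. c k * f k i) = (\<Sum>k\<in>K. c k * ip n z (f k))"
  using ip_sum_left[of n c f K z] by (simp add: ip_sym[of n _ z])

lemma ip_plus_left: "ip n (\<lambda>i. x i + y i) z = ip n x z + ip n y z"
  and ip_minus_left: "ip n (\<lambda>i. x i - y i) z = ip n x z - ip n y z"
  and ip_scale_left: "ip n (\<lambda>i. a * x i) z = a * ip n x z"
  and ip_plus_right: "ip n z (\<lambda>i. x i + y i) = ip n z x + ip n z y"
  and ip_minus_right: "ip n z (\<lambda>i. x i - y i) = ip n z x - ip n z y"
  and ip_scale_right: "ip n z (\<lambda>i. a * x i) = a * ip n z x"
  and ip_uminus_left: "ip n (\<lambda>i. - x i) z = - ip n x z"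
  and ip_uminus_right: "ip n z (\<lambda>i. - x i) = - ip n z x"
  by (simp_all add: ip_def algebra_simps sum.distrib sum_distrib_left sum_subtractf sum_negf)

lemmas ip_simps = ip_plus_left ip_minus_left ip_scale_left ip_plus_right ip_minus_right ip_scale_right
  ip_uminus_left ip_uminus_right ip_sum_left ip_sum_right

lemma ip_unit_unit: "i < n \<Longrightarrow> ip n (unit_vec i) (unit_vec i) = 1"
  by (simp add: ip_def unit_vec_def if_distrib[of "(*) _"] cong: if_cong)

lemma ip_ge0 [simp]: "0 \<le> ip n x x"
  by (simp add: ip_def sum_nonneg)

lemma ip_eq0: assumes "x \<in> vsp n" "ip n x x = 0" shows "x = (\<lambda>_. 0)"
proof
  fix i
  have "\<forall>i\<in>{..<n}. x i * x i = 0"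
    using assms(2) by (subst (asm) ip_def, subst (asm) sum_nonneg_eq_0_iff) auto
  then show "x i = 0" using assms(1) by (cases "i < n") (auto simp: vsp_def)
qed

lemma ip_unit: "i < n \<Longrightarrow> ip n (unit_vec i) x = x i"
proof -
  assume "i < n"
  have "ip n (unit_vec i) x = (\<Sum>j<n. if j = i then x j else 0)"
    unfolding ip_def unit_vec_def by (rule sum.cong) auto
  with \<open>i < n\<close> show ?thesis by simp
qed

lemma unit_vsp: "i < n \<Longrightarrow> unit_vec i \<in> vsp n"
  by (auto simp: vsp_def unit_vec_def)

lemma vsp_comb: "x \<in> vsp n \<Longrightarrow> y \<in> vsp n \<Longrightarrow> (\<lambda>i. a * x i + b * y i) \<in> vsp n"
  by (auto simp: vsp_def)

lemma vsp_sum: "(\<And>k. k \<in> K \<Longrightarrow> f k \<in> vsp n) \<Longrightarrow> (\<lambda>i. \<Sum>k\<in>K. c k * f k i) \<in> vsp n"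
  by (auto simp: vsp_def)

lemma vsp_zero [simp]: "(\<lambda>i. 0) \<in> vsp n"
  by (auto simp: vsp_def)

lemma ip_cs: "(ip n x y)\<^sup>2 \<le> ip n x x * ip n y y"
  unfolding ip_def using Cauchy_Schwarz_ineq_sum[of x y "{..<n}"] by (simp add: power2_eq_square)

section \<open>Residuals of orthonormal systems, and dimension by counting\<close>

definition resid :: "nat \<Rightarrow> (nat \<Rightarrow> nat \<Rightarrow> real) \<Rightarrow> nat \<Rightarrow> (nat \<Rightarrow> real) \<Rightarrow> nat \<Rightarrow> real" where
  "resid n e k x = (\<lambda>i. 1 * x i + (-1) * (\<Sum>j<k. ip n x (e j) * e j i))"

lemma resid_vsp: "onb n e k \<Longrightarrow> x \<in> vsp n \<Longrightarrow> resid n e k x \<in> vsp n"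
  unfolding resid_def by (intro vsp_comb vsp_sum) (auto simp: onb_def)

lemma resid_orth: assumes "onb n e k" "j < k" shows "ip n (resid n e k x) (e j) = 0"
proof -
  have "(\<Sum>ja<k. ip n x (e ja) * ip n (e ja) (e j)) = (\<Sum>ja<k. if ja = j then ip n x (e ja) else 0)"
    using assms by (intro sum.cong) (auto simp: onb_def)
  then show ?thesis using assms unfolding resid_def by (simp add: ip_simps)
qed

text \<open>Pythagoras. Since the left side is nonnegative, it also serves as Bessel's
  inequality.\<close>

lemma resid_norm: assumes "onb n e k"
  shows "ip n (resid n e k x) (resid n e k x) = ip n x x - (\<Sum>j<k. (ip n x (e j))\<^sup>2)"
proof -
  have "ip n (resid n e k x) (resid n e k x)
     = ip n (resid n e k x) x + (-1) * ip n (resid n e k x) (\<lambda>i. \<Sum>j<k. ip n x (e j) * e j i)"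
    by (subst (2) resid_def) (subst ip_add_right, simp)
  also have "ip n (resid n e k x) (\<lambda>i. \<Sum>j<k. ip n x (e j) * e j i) = 0"
    using assms by (simp add: ip_sum_right resid_orth)
  also have "ip n (resid n e k x) x = ip n x x - (\<Sum>j<k. (ip n x (e j))\<^sup>2)"
    unfolding resid_def by (simp add: ip_simps power2_eq_square ip_sym[of _ "e _" x])
  finally show ?thesis by simp
qed

text \<open>This is the trace of the projection onto the span, computed in the standard basis. It
  takes the place of dimension theory: \<open>onb_le\<close> and \<open>onb_orth_exists\<close> both
  compare it with \<open>n\<close>.\<close>

lemma onb_count: assumes "onb n e k"
  shows "(\<Sum>i<n. \<Sum>j<k. (ip n (unit_vec i) (e j))\<^sup>2) = real k"
proof -
  have "(\<Sum>i<n. \<Sum>j<k. (ip n (unit_vec i) (e j))\<^sup>2) = (\<Sum>j<k. \<Sum>i<n. (ip n (unit_vec i) (e j))\<^sup>2)"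
    by (rule sum.swap)
  also have "\<dots> = (\<Sum>j<k. ip n (e j) (e j))"
    by (intro sum.cong) (auto simp: ip_unit ip_def[of n "e _"] power2_eq_square)
  also have "\<dots> = real k" using assms by (simp add: onb_def)
  finally show ?thesis .
qed

lemma onb_le: assumes "onb n e k" shows "k \<le> n"
proof -
  have "(\<Sum>i<n. \<Sum>j<k. (ip n (unit_vec i) (e j))\<^sup>2) \<le> (\<Sum>i<n. 1)"
  proof (rule sum_mono)
    fix i assume "i \<in> {..<n}"
    then have "ip n (unit_vec i) (unit_vec i) = 1" by (simp add: ip_unit_unit)
    then show "(\<Sum>j<k. (ip n (unit_vec i) (e j))\<^sup>2) \<le> 1"
      using resid_norm[OF assms, of "unit_vec i"] ip_ge0[of n "resid n e k (unit_vec i)"] by linarith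
  qed
  then show ?thesis using onb_count[OF assms] by simp
qed

lemma onb_extend: assumes "onb n e k" "x \<in> vsp n" "ip n x x = 1" "\<And>j. j < k \<Longrightarrow> ip n x (e j) = 0"
  shows "onb n (e(k := x)) (Suc k)"
  using assms unfolding onb_def by (auto simp: less_Suc_eq ip_sym[of n "e _" x])

lemma normalize: assumes "x \<in> vsp n" "ip n x x \<noteq> 0"
  shows "\<exists>c. (\<lambda>i. c * x i) \<in> vsp n \<and> ip n (\<lambda>i. c * x i) (\<lambda>i. c * x i) = 1"
proof -
  let ?c = "1 / sqrt (ip n x x)"
  have "ip n (\<lambda>i. ?c * x i) (\<lambda>i. ?c * x i) = ?c * ?c * ip n x x"
    by (simp only: ip_scale_left ip_scale_right mult.assoc)
  also have "\<dots> = 1" using assms(2) ip_ge0[of n x] by (simp add: field_simps)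
  finally show ?thesis using assms(1) by (intro exI[of _ ?c]) (auto simp: vsp_def)
qed

text \<open>A nonzero residual, normalised, would extend the system to \<open>n + 1\<close>
  orthonormal vectors.\<close>

lemma onb_full: assumes "onb n e n" "x \<in> vsp n"
  shows "x = (\<lambda>i. \<Sum>j<n. ip n x (e j) * e j i)"
proof -
  have "ip n (resid n e n x) (resid n e n x) = 0"
  proof (rule ccontr)
    assume a: "ip n (resid n e n x) (resid n e n x) \<noteq> 0"
    obtain c where c: "(\<lambda>i. c * resid n e n x i) \<in> vsp n"
        "ip n (\<lambda>i. c * resid n e n x i) (\<lambda>i. c * resid n e n x i) = 1"
      using normalize[OF resid_vsp[OF assms] a] by auto
    have "ip n (\<lambda>i. c * resid n e n x i) (e j) = 0" if "j < n" for j
      using resid_orth[OF assms(1) that, of x] ip_add_left[of n c "resid n e n x" 0 "\<lambda>_. 0"] by simp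
    from onb_extend[OF assms(1) c this] onb_le show False by fastforce
  qed
  from ip_eq0[OF resid_vsp[OF assms] this] have "resid n e n x i = 0" for i by metis
  then show ?thesis unfolding resid_def by (auto simp: fun_eq_iff)
qed

lemma parseval: assumes "onb n e n" "x \<in> vsp n"
  shows "ip n x y = (\<Sum>j<n. ip n x (e j) * ip n (e j) y)"
  by (subst onb_full[OF assms]) (simp add: ip_sum_left)

text \<open>If every standard vector had zero residual, each would contribute exactly 1 to the trace
  in \<open>onb_count\<close>, and \<open>k\<close> would equal \<open>n\<close>.\<close>

lemma onb_orth_exists: assumes "onb n e k" "k < n"
  shows "\<exists>x\<in>vsp n. ip n x x = 1 \<and> (\<forall>j<k. ip n x (e j) = 0)"
proof -
  have "\<exists>i<n. ip n (resid n e k (unit_vec i)) (resid n e k (unit_vec i)) \<noteq> 0"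
  proof (rule ccontr)
    assume "\<not> ?thesis"
    then have "(\<Sum>j<k. (ip n (unit_vec i) (e j))\<^sup>2) = 1" if "i < n" for i
      using resid_norm[OF assms(1), of "unit_vec i"] that by (auto simp: ip_unit_unit)
    then have "(\<Sum>i<n. \<Sum>j<k. (ip n (unit_vec i) (e j))\<^sup>2) = real n" by simp
    with onb_count[OF assms(1)] assms(2) show False by simp
  qed
  then obtain i where i: "i < n" "ip n (resid n e k (unit_vec i)) (resid n e k (unit_vec i)) \<noteq> 0" by auto
  obtain c where c: "(\<lambda>j. c * resid n e k (unit_vec i) j) \<in> vsp n"
        "ip n (\<lambda>j. c * resid n e k (unit_vec i) j) (\<lambda>j. c * resid n e k (unit_vec i) j) = 1"
    using normalize[OF resid_vsp[OF assms(1) unit_vsp[OF i(1)]] i(2)] by auto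
  have "ip n (\<lambda>j. c * resid n e k (unit_vec i) j) (e j) = 0" if "j < k" for j
    using resid_orth[OF assms(1) that, of "unit_vec i"]
      ip_add_left[of n c "resid n e k (unit_vec i)" 0 "\<lambda>_. 0"] by simp
  with c show ?thesis by blast
qed

section \<open>Eigenvectors as maximisers of the Rayleigh quotient\<close>

lemma continuous_on_proj [continuous_intros]: "continuous_on S (\<lambda>x::nat\<Rightarrow>real. x i)"
  by (rule continuous_on_product_then_coordinatewise) (simp add: continuous_on_id)

lemma continuous_ip: assumes "\<And>i. i < n \<Longrightarrow> continuous_on S (\<lambda>x. f x i)" "\<And>i. i < n \<Longrightarrow> continuous_on S (\<lambda>x. g x i)"
  shows "continuous_on S (\<lambda>x. ip n (f x) (g x))"
  unfolding ip_def using assms by (intro continuous_intros) auto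

lemma selfadj_lin: "selfadj n T \<Longrightarrow> u \<in> vsp n \<Longrightarrow> v \<in> vsp n \<Longrightarrow>
    T (\<lambda>i. a * u i + b * v i) = (\<lambda>i. a * T u i + b * T v i)"
  and selfadj_sym: "selfadj n T \<Longrightarrow> u \<in> vsp n \<Longrightarrow> v \<in> vsp n \<Longrightarrow> ip n (T u) v = ip n u (T v)"
  and selfadj_vsp: "selfadj n T \<Longrightarrow> u \<in> vsp n \<Longrightarrow> T u \<in> vsp n"
  by (simp_all add: selfadj_def)

text \<open>On R^n the operator becomes a finite sum in the coordinates. That is the source of the
  continuity of its quadratic form in \<open>eigen_step\<close>.\<close>

lemma selfadj_expand: assumes "selfadj n T" "x \<in> vsp n"
  shows "T x = (\<lambda>i. \<Sum>j<n. x j * T (unit_vec j) i)"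
proof -
  have lin: "T (\<lambda>i. \<Sum>j<k. x j * unit_vec j i) = (\<lambda>i. \<Sum>j<k. x j * T (unit_vec j) i)" if "k \<le> n" for k
    using that
  proof (induction k)
    case 0
    have "T (\<lambda>i. 0 * x i + 0 * x i) = (\<lambda>i. 0 * T x i + 0 * T x i)"
      using assms unfolding selfadj_def by blast
    then show ?case by simp
  next
    case (Suc k)
    have "(\<lambda>i. \<Sum>j<k. x j * unit_vec j i) \<in> vsp n" using Suc.prems by (intro vsp_sum unit_vsp) auto
    moreover have "unit_vec k \<in> vsp n" using Suc.prems by (intro unit_vsp) auto
    ultimately have "T (\<lambda>i. 1 * (\<Sum>j<k. x j * unit_vec j i) + x k * unit_vec k i)
        = (\<lambda>i. 1 * T (\<lambda>i. \<Sum>j<k. x j * unit_vec j i) i + x k * T (unit_vec k) i)"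
      by (rule selfadj_lin[OF assms(1)])
    then show ?case using Suc by simp
  qed
  have "x = (\<lambda>i. \<Sum>j<n. x j * unit_vec j i)"
    using assms(2) by (auto simp: fun_eq_iff vsp_def unit_vec_def if_distrib[of "(*) _"] cong: if_cong)
  then show ?thesis using lin[of n] by simp
qed

text \<open>The first-order condition at a maximum.\<close>

lemma quad_linear_zero: assumes "\<And>t::real. 2 * t * b + t\<^sup>2 * c \<le> 0" shows "b = 0"
proof (rule ccontr)
  assume b: "b \<noteq> 0"
  \<comment> \<open>Small enough for the linear term, which becomes
    \<open>2 * t^2 * (\<bar>c\<bar> + 1)\<close>, to outweigh \<open>t^2 * c\<close>.\<close>
  define t where "t = b / (\<bar>c\<bar> + 1)"
  have pos: "\<bar>c\<bar> + 1 > 0" by simp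
  have tb: "b = t * (\<bar>c\<bar> + 1)" using pos unfolding t_def by simp
  then have "t \<noteq> 0" using b by auto
  then have t2: "t\<^sup>2 > 0" by simp
  have "2 * t * b + t\<^sup>2 * c = t\<^sup>2 * (2 * (\<bar>c\<bar> + 1) + c)"
    by (simp add: tb power2_eq_square algebra_simps)
  also have "\<dots> > 0" using t2 by (intro mult_pos_pos) auto
  finally show False using assms[of t] by simp
qed

text \<open>Let \<open>x\<close> maximise the quadratic form on the unit sphere of \<open>W\<close>,
  the orthogonal complement of the eigenvectors found so far. The defect
  \<open>r = T x - m x\<close> lies in \<open>W\<close> and is orthogonal to \<open>x\<close>, and
  the first-order condition in direction \<open>r\<close> makes \<open>r\<close> orthogonal to
  itself.\<close>

lemma eigen_step:
  assumes T: "selfadj n T" and e: "onb n e k" and ev: "\<And>j. j < k \<Longrightarrow> T (e j) = (\<lambda>i. \<mu> j * e j i)" and kn: "k < n"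
  shows "\<exists>x m. x \<in> vsp n \<and> ip n x x = 1 \<and> (\<forall>j<k. ip n x (e j) = 0) \<and> T x = (\<lambda>i. m * x i)"
proof -
  define W where "W = {x \<in> vsp n. \<forall>j<k. ip n x (e j) = 0}"
  define S where "S = {x \<in> W. ip n x x = 1}"
  \<comment> \<open>Vectors are functions on all naturals, so compactness of the sphere comes from
    Tychonoff's theorem for the cube.\<close>
  let ?B = "PiE UNIV (\<lambda>i::nat. {-1..1::real})"
  have "compactin (product_topology (\<lambda>i. euclidean) UNIV) ?B"
    by (subst compactin_PiE) (auto simp: compactin_euclidean_iff)
  then have cB: "compact ?B" by (simp add: euclidean_product_topology compactin_euclidean_iff)
  have cl: "closed S"
  proof -
    have "S = (\<Inter>i\<in>{n..}. {x. x i = 0}) \<inter> (\<Inter>j\<in>{..<k}. {x. ip n x (e j) = 0}) \<inter> {x. ip n x x = 1}"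
      by (auto simp: S_def W_def vsp_def)
    moreover have "closed \<dots>"
      by (intro closed_Int closed_INT ballI closed_Collect_eq continuous_ip continuous_intros)
    ultimately show ?thesis by simp
  qed
  have "S \<subseteq> ?B"
  proof
    fix x assume x: "x \<in> S"
    have "\<bar>x i\<bar> \<le> 1" for i
    proof (cases "i < n")
      case True
      have "x i * x i \<le> ip n x x" unfolding ip_def using True by (intro member_le_sum) auto
      then show ?thesis using x by (simp add: S_def abs_le_square_iff[of "x i" 1, simplified] power2_eq_square)
    next
      case False
      then show ?thesis using x by (auto simp: S_def W_def vsp_def)
    qed
    then show "x \<in> ?B" by (auto simp: abs_le_iff minus_le_iff)
  qed
  then have cS: "compact S" using compact_Int_closed[OF cB cl] by (simp add: Int_absorb1)
  have neS: "S \<noteq> {}" using onb_orth_exists[OF e kn] by (auto simp: S_def W_def)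
  have "continuous_on S (\<lambda>x. ip n (\<lambda>i. \<Sum>j<n. x j * T (unit_vec j) i) x)"
    by (intro continuous_ip continuous_intros)
  then obtain x where x: "x \<in> S" and mx: "\<And>y. y \<in> S \<Longrightarrow> ip n (\<lambda>i. \<Sum>j<n. y j * T (unit_vec j) i) y
       \<le> ip n (\<lambda>i. \<Sum>j<n. x j * T (unit_vec j) i) x"
    using continuous_attains_sup[OF cS neS] by blast
  have SV: "S \<subseteq> vsp n" by (auto simp: S_def W_def)
  define m where "m = ip n (T x) x"
  have mx': "ip n (T y) y \<le> m" if "y \<in> S" for y
    using mx[OF that] selfadj_expand[OF T subsetD[OF SV that]] selfadj_expand[OF T subsetD[OF SV x]]
    unfolding m_def by simp
  have xW: "x \<in> W" and xv: "x \<in> vsp n" and x1: "ip n x x = 1" using x by (auto simp: S_def W_def)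
  have lin: "T (\<lambda>i. a * u i + b * v i) = (\<lambda>i. a * T u i + b * T v i)" if "u \<in> vsp n" "v \<in> vsp n" for a b u v
    by (rule selfadj_lin[OF T that])
  have sym: "ip n (T u) v = ip n u (T v)" if "u \<in> vsp n" "v \<in> vsp n" for u v
    by (rule selfadj_sym[OF T that])
  have homog: "ip n (T y) y \<le> m * ip n y y" if "y \<in> W" for y
  proof (cases "ip n y y = 0")
    case True
    then have "y = (\<lambda>_. 0)" using that by (intro ip_eq0) (auto simp: W_def)
    then show ?thesis using True by (simp add: ip_def)
  next
    case False
    have yv: "y \<in> vsp n" using that by (simp add: W_def)
    obtain c where c: "(\<lambda>i. c * y i) \<in> vsp n" "ip n (\<lambda>i. c * y i) (\<lambda>i. c * y i) = 1"
      using normalize[OF yv False] by auto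
    have cc: "c\<^sup>2 * ip n y y = 1" using c(2) by (simp add: ip_def sum_distrib_left algebra_simps power2_eq_square)
    have "(\<lambda>i. c * y i) \<in> S" using c that ip_add_left[of n c y 0 y]
      by (auto simp: S_def W_def)
    from mx'[OF this] have "ip n (T (\<lambda>i. c * y i)) (\<lambda>i. c * y i) \<le> m" .
    moreover have "T (\<lambda>i. c * y i) = (\<lambda>i. c * T y i)" using lin[OF yv yv, of c 0] by simp
    ultimately have "c\<^sup>2 * ip n (T y) y \<le> m * (c\<^sup>2 * ip n y y)"
      using cc by (simp add: ip_def sum_distrib_left algebra_simps power2_eq_square)
    moreover have "c\<^sup>2 > 0" using cc by (metis mult_zero_left zero_less_power2 zero_neq_one zero_power2)
    ultimately show ?thesis by (simp add: mult.left_commute)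
  qed
  have crit: "ip n (T x) y = 0" if y: "y \<in> W" "ip n x y = 0" for y
  proof (rule quad_linear_zero)
    fix t :: real
    have yv: "y \<in> vsp n" using y by (simp add: W_def)
    let ?z = "\<lambda>i. 1 * x i + t * y i"
    have zW: "?z \<in> W" using xW y unfolding W_def by (auto simp: ip_simps vsp_def)
    have "ip n (T ?z) ?z = m + 2 * t * ip n (T x) y + t\<^sup>2 * ip n (T y) y"
    proof -
      have "ip n (T y) x = ip n (T x) y" using sym[OF yv xv] by (simp add: ip_sym)
      then show ?thesis
        unfolding lin[OF xv yv] ip_add_left ip_add_right m_def by (simp add: algebra_simps power2_eq_square)
    qed
    moreover have "ip n ?z ?z = 1 + t\<^sup>2 * ip n y y"
      unfolding ip_add_left ip_add_right using x1 y(2) ip_sym[of n y x] by (simp add: algebra_simps power2_eq_square)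
    ultimately show "2 * t * ip n (T x) y + t\<^sup>2 * (ip n (T y) y - m * ip n y y) \<le> 0"
      using homog[OF zW] by (simp add: algebra_simps)
  qed
  define r where "r = (\<lambda>i. 1 * T x i + (-m) * x i)"
  have Txv: "T x \<in> vsp n" using T xv by (auto simp: selfadj_def)
  have rv: "r \<in> vsp n" unfolding r_def by (rule vsp_comb[OF Txv xv])
  have "ip n r (e j) = 0" if "j < k" for j
  proof -
    have ej: "e j \<in> vsp n" using e that by (auto simp: onb_def)
    have "ip n (T x) (e j) = ip n x (\<lambda>i. \<mu> j * e j i)" using sym[OF xv ej] ev[OF that] by simp
    also have "\<dots> = 0" using xW that ip_add_right[of n x "\<mu> j" "e j" 0 x] by (auto simp: W_def)
    finally show ?thesis unfolding r_def ip_add_left using xW that by (auto simp: W_def)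
  qed
  then have rW: "r \<in> W" using rv by (auto simp: W_def)
  have xr: "ip n x r = 0" unfolding r_def ip_add_right using x1 m_def by (simp add: ip_sym)
  have "ip n r y = ip n (T x) y - m * ip n x y" for y
    unfolding r_def by (simp add: ip_simps)
  then have "ip n r r = 0" using crit[OF rW xr] xr by simp
  from ip_eq0[OF rv this] have "T x = (\<lambda>i. m * x i)" unfolding r_def by (auto simp: fun_eq_iff)
  then show ?thesis using xW xv x1 by (auto simp: W_def)
qed

theorem spectral_theorem:
  assumes T: "selfadj n T"
  shows "\<exists>e \<mu>. onb n e n \<and> (\<forall>j<n. T (e j) = (\<lambda>i. \<mu> j * e j i))"
proof -
  have "\<exists>e \<mu>. onb n e k \<and> (\<forall>j<k. T (e j) = (\<lambda>i. \<mu> j * e j i))" if "k \<le> n" for k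
    using that
  proof (induction k)
    case 0
    show ?case by (auto simp: onb_def)
  next
    case (Suc k)
    then obtain e \<mu> where em: "onb n e k" "\<And>j. j < k \<Longrightarrow> T (e j) = (\<lambda>i. \<mu> j * e j i)" by auto
    obtain x m where x: "x \<in> vsp n" "ip n x x = 1" "\<forall>j<k. ip n x (e j) = 0" "T x = (\<lambda>i. m * x i)"
      using eigen_step[OF T em] Suc.prems by auto
    have "onb n (e(k := x)) (Suc k)" using onb_extend[OF em(1) x(1,2)] x(3) by auto
    then show ?case using em(2) x(4)
      by (intro exI[of _ "e(k := x)"] exI[of _ "\<mu>(k := m)"]) (auto simp: less_Suc_eq simp del: fun_upd_apply, auto)
  qed
  then show ?thesis by blast
qed

section \<open>Traces of powers under rank-one updates\<close>

text \<open>\<open>L\<close> bounds the spectrum from below. A positive \<open>L\<close> makes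
  consecutive moments comparable (\<open>mom_grow\<close>), which plain semidefiniteness would
  not.\<close>

definition psd :: "nat \<Rightarrow> real \<Rightarrow> ((nat \<Rightarrow> real) \<Rightarrow> (nat \<Rightarrow> real)) \<Rightarrow> bool" where
  "psd n L T \<longleftrightarrow> selfadj n T \<and> (\<forall>x\<in>vsp n. L * ip n x x \<le> ip n x (T x))"

definition tr :: "nat \<Rightarrow> ((nat \<Rightarrow> real) \<Rightarrow> (nat \<Rightarrow> real)) \<Rightarrow> real" where
  "tr n T = (\<Sum>i<n. ip n (unit_vec i) (T (unit_vec i)))"

lemma psd_selfadj: "psd n L T \<Longrightarrow> selfadj n T"
  by (simp add: psd_def)

lemma selfadj_comb_sum:
  assumes T: "selfadj n T" and x: "x \<in> vsp n" and "finite K" and f: "\<And>k. k \<in> K \<Longrightarrow> f k \<in> vsp n"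
  shows "T (\<lambda>i. x i + (\<Sum>k\<in>K. c k * f k i)) = (\<lambda>i. T x i + (\<Sum>k\<in>K. c k * T (f k) i))"
  using \<open>finite K\<close> f
proof (induction K)
  case empty
  then show ?case by simp
next
  case (insert k K)
  have v: "(\<lambda>i. x i + (\<Sum>k\<in>K. c k * f k i)) \<in> vsp n" 
    using x insert.prems by (auto simp: vsp_def)
  have "T (\<lambda>i. x i + (\<Sum>k\<in>insert k K. c k * f k i))
      = T (\<lambda>i. 1 * (x i + (\<Sum>k\<in>K. c k * f k i)) + c k * f k i)"
    using insert.hyps by (simp add: algebra_simps)
  also have "\<dots> = (\<lambda>i. 1 * T (\<lambda>i. x i + (\<Sum>k\<in>K. c k * f k i)) i + c k * T (f k) i)"
    using insert.prems by (intro selfadj_lin[OF T v]) auto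
  finally show ?case using insert by (simp add: algebra_simps)
qed

lemma pow_vsp: "selfadj n T \<Longrightarrow> x \<in> vsp n \<Longrightarrow> (T ^^ k) x \<in> vsp n"
  by (induction k) (auto simp: selfadj_vsp)

lemma pow_sym: "selfadj n T \<Longrightarrow> x \<in> vsp n \<Longrightarrow> y \<in> vsp n \<Longrightarrow> ip n ((T ^^ k) x) y = ip n x ((T ^^ k) y)"
proof (induction k arbitrary: x)
  case (Suc k)
  have "ip n ((T ^^ Suc k) x) y = ip n ((T ^^ k) (T x)) y" by (simp add: funpow_swap1)
  also have "\<dots> = ip n (T x) ((T ^^ k) y)" using Suc by (simp add: selfadj_vsp)
  also have "\<dots> = ip n x (T ((T ^^ k) y))" using Suc by (simp add: selfadj_sym pow_vsp)
  finally show ?case by simp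
qed simp

lemma selfadj_pow: assumes "selfadj n T" shows "selfadj n (T ^^ k)"
proof -
  have lin: "(T ^^ k) (\<lambda>i. a * x i + b * y i) = (\<lambda>i. a * (T ^^ k) x i + b * (T ^^ k) y i)"
    if "x \<in> vsp n" "y \<in> vsp n" for x y a b
    by (induction k) (use assms that in \<open>simp_all add: selfadj_lin pow_vsp\<close>)
  show ?thesis unfolding selfadj_def
    using assms lin by (auto simp: pow_vsp pow_sym)
qed

lemma trace_onb: assumes T: "selfadj n T" and e: "onb n e n"
  shows "tr n T = (\<Sum>k<n. ip n (e k) (T (e k)))"
proof -
  have ev: "\<And>k. k < n \<Longrightarrow> e k \<in> vsp n" using e by (auto simp: onb_def)
  have "tr n T = (\<Sum>i<n. ip n (T (unit_vec i)) (unit_vec i))" by (simp add: tr_def ip_sym)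
  also have "\<dots> = (\<Sum>i<n. \<Sum>k<n. ip n (T (unit_vec i)) (e k) * ip n (e k) (unit_vec i))"
    using T e by (intro sum.cong refl parseval) (auto simp: selfadj_vsp unit_vsp)
  also have "\<dots> = (\<Sum>i<n. \<Sum>k<n. T (e k) i * e k i)"
    using T ev by (intro sum.cong refl) (auto simp: selfadj_sym unit_vsp ip_unit ip_sym[of _ "e _" "unit_vec _"])
  also have "\<dots> = (\<Sum>k<n. \<Sum>i<n. T (e k) i * e k i)" by (rule sum.swap)
  finally show ?thesis by (simp add: ip_def mult.commute)
qed

section \<open>Inequalities between the moments of a positive operator at a vector\<close>

lemma mom_nonneg: assumes "psd n L T" "0 \<le> L" "x \<in> vsp n"
  shows "0 \<le> ip n x ((T ^^ k) x)"
proof -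
  have sa: "selfadj n T" using assms by (simp add: psd_selfadj)
  define j where "j = k div 2"
  have "k = j + j \<or> k = j + Suc j" unfolding j_def by presburger
  then show ?thesis
  proof
    assume "k = j + j"
    then have "ip n x ((T ^^ k) x) = ip n ((T ^^ j) x) ((T ^^ j) x)"
      using sa assms by (simp add: funpow_add pow_sym pow_vsp)
    then show ?thesis by simp
  next
    assume "k = j + Suc j"
    then have "ip n x ((T ^^ k) x) = ip n ((T ^^ j) x) (T ((T ^^ j) x))"
      using sa assms by (simp only: funpow_add) (simp add: pow_sym pow_vsp selfadj_vsp)
    moreover have "L * ip n ((T ^^ j) x) ((T ^^ j) x) \<le> ip n ((T ^^ j) x) (T ((T ^^ j) x))"
      using assms sa by (simp add: psd_def pow_vsp)
    ultimately show ?thesis using assms(2) by (metis ip_ge0 mult_nonneg_nonneg order_trans)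
  qed
qed

lemma psd_cs: assumes "psd n L T" "0 \<le> L" "x \<in> vsp n" "y \<in> vsp n"
  shows "(ip n x (T y))\<^sup>2 \<le> ip n x (T x) * ip n y (T y)"
proof -
  have sa: "selfadj n T" using assms by (simp add: psd_selfadj)
  define a b c where "a = ip n y (T y)" "b = ip n x (T y)" "c = ip n x (T x)"
  have nn: "0 \<le> ip n z (T z)" if "z \<in> vsp n" for z using mom_nonneg[OF assms(1,2) that, of 1] by simp
  have q: "0 \<le> c * s\<^sup>2 + 2 * b * s * t + a * t\<^sup>2" for s t
  proof -
    have z: "(\<lambda>i. s * x i + t * y i) \<in> vsp n" using assms by (simp add: vsp_comb)
    have yx: "ip n y (T x) = b" using sa assms unfolding a_b_c_def by (metis ip_sym selfadj_sym)
    from nn[OF z] show ?thesis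
      unfolding selfadj_lin[OF sa assms(3,4)] ip_add_left ip_add_right
      by (simp add: yx a_b_c_def(2,3)[symmetric] a_b_c_def(1)[symmetric] power2_eq_square algebra_simps)
  qed
  have a0: "0 \<le> a" using nn assms a_b_c_def by simp
  show ?thesis
  proof (cases "a = 0")
    case True
    have "b = 0"
    proof (rule ccontr)
      assume "b \<noteq> 0"
      then have "2 * b * (-(c+1)/(2*b)) = -(c+1)" by simp
      with q[of 1 "-(c+1)/(2*b)"] True show False by simp
    qed
    then show ?thesis using True unfolding a_b_c_def by simp
  next
    case False
    with a0 have ap: "a > 0" by simp
    have "0 \<le> c * a\<^sup>2 - 2 * b * a * b + a * b\<^sup>2" using q[of a "-b"] by simp
    also have "\<dots> = a * (c * a - b\<^sup>2)" by (simp add: power2_eq_square algebra_simps)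
    finally have "b\<^sup>2 \<le> c * a" using ap by (simp add: zero_le_mult_iff)
    then show ?thesis unfolding a_b_c_def .
  qed
qed

text \<open>With \<open>y = T^(k div 2) x\<close> this is Cauchy-Schwarz for \<open>y\<close> and
  \<open>T y\<close>, in the inner product if \<open>k\<close> is even and in the form of
  \<open>T\<close> if \<open>k\<close> is odd.\<close>

lemma mom_logconvex: assumes "psd n L T" "0 \<le> L" "x \<in> vsp n"
  shows "(ip n x ((T ^^ Suc k) x))\<^sup>2 \<le> ip n x ((T ^^ k) x) * ip n x ((T ^^ Suc (Suc k)) x)"
proof -
  have sa: "selfadj n T" using assms by (simp add: psd_selfadj)
  define j where "j = k div 2"
  define y where "y = (T ^^ j) x"
  have y: "y \<in> vsp n" "T y \<in> vsp n" using sa assms unfolding y_def by (simp_all add: pow_vsp selfadj_vsp)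
  have sh: "ip n x ((T ^^ (j + i)) x) = ip n y ((T ^^ i) x)" for i
    using sa assms unfolding y_def by (simp add: funpow_add pow_sym pow_vsp)
  have "k = j + j \<or> k = j + Suc j" unfolding j_def by presburger
  then show ?thesis
  proof
    assume k: "k = j + j"
    have "ip n x ((T ^^ k) x) = ip n y y" using sh[of j] k y_def by simp
    moreover have "ip n x ((T ^^ Suc k) x) = ip n y (T y)" using sh[of "Suc j"] k y_def by simp
    moreover have "ip n x ((T ^^ Suc (Suc k)) x) = ip n (T y) (T y)"
      using sh[of "Suc (Suc j)"] k y_def y sa by (simp add: selfadj_sym)
    ultimately show ?thesis using ip_cs[of n y "T y"] by simp
  next
    assume k: "k = j + Suc j"
    have "ip n x ((T ^^ k) x) = ip n y (T y)" using sh[of "Suc j"] k y_def by simp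
    moreover have "ip n x ((T ^^ Suc k) x) = ip n y (T (T y))" using sh[of "Suc (Suc j)"] k y_def by simp
    moreover have "ip n x ((T ^^ Suc (Suc k)) x) = ip n (T y) (T (T y))"
      using sh[of "Suc (Suc (Suc j))"] k y_def y sa by (simp add: selfadj_sym selfadj_vsp)
    ultimately show ?thesis using psd_cs[OF assms(1,2) y] by simp
  qed
qed

text \<open>By log-convexity the ratios of consecutive moments increase, and the first of them is at
  least \<open>L\<close>.\<close>

lemma mom_grow: assumes "psd n L T" "0 < L" "x \<in> vsp n"
  shows "L * ip n x ((T ^^ k) x) \<le> ip n x ((T ^^ Suc k) x)"
proof (induction k)
  case 0
  then show ?case using assms by (simp add: psd_def)
next
  case (Suc k)
  let ?m = "\<lambda>k. ip n x ((T ^^ k) x)"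
  have nn: "0 \<le> ?m k" for k using mom_nonneg[OF assms(1) _ assms(3)] assms(2) by simp
  have lc: "(?m (Suc k))\<^sup>2 \<le> ?m k * ?m (Suc (Suc k))" using mom_logconvex[OF assms(1) _ assms(3)] assms(2) by simp
  show ?case
  proof (cases "?m (Suc k) = 0")
    case True
    then show ?thesis by (simp only: mult_zero_right nn)
  next
    case False
    then have p: "?m (Suc k) > 0" using nn[of "Suc k"] by simp
    have "L * (?m (Suc k))\<^sup>2 \<le> (L * ?m k) * ?m (Suc (Suc k))" 
      using mult_left_mono[OF lc, of L] assms(2) by (simp add: algebra_simps)
    also have "\<dots> \<le> ?m (Suc k) * ?m (Suc (Suc k))" by (intro mult_right_mono Suc nn)
    finally have "?m (Suc k) * (L * ?m (Suc k)) \<le> ?m (Suc k) * ?m (Suc (Suc k))"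
      by (simp add: power2_eq_square algebra_simps)
    then show ?thesis using p by (simp only: mult_le_cancel_left_pos)
  qed
qed

text \<open>Chebyshev's inequality: powers of \<open>T\<close> are increasing functions of the same
  variable, hence positively correlated. The inner fact \<open>step\<close> moves one power from the
  smaller exponent to the larger, by log-convexity, until the smaller one is used up.\<close>

lemma mom_cheb: assumes "psd n L T" "0 < L" "x \<in> vsp n"
  shows "ip n x ((T ^^ a) x) * ip n x ((T ^^ b) x) \<le> ip n x x * ip n x ((T ^^ (a + b)) x)"
proof (cases "ip n x x = 0")
  case True
  then have "x = (\<lambda>_. 0)" using assms by (simp add: ip_eq0)
  then show ?thesis by (simp add: ip_def)
next
  case False
  let ?m = "\<lambda>k. ip n x ((T ^^ k) x)"
  have nn: "0 \<le> ?m k" for k using mom_nonneg[OF assms(1) _ assms(3)] assms(2) by simp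
  have pos: "0 < ?m k" for k
  proof (induction k)
    case 0
    then show ?case using False ip_ge0[of n x] by (simp add: order_less_le)
  next
    case (Suc k)
    then show ?case using mom_grow[OF assms, of k] assms(2) by (smt (verit) mult_pos_pos)
  qed
  have lc: "(?m (Suc k))\<^sup>2 \<le> ?m k * ?m (Suc (Suc k))" for k using mom_logconvex[OF assms(1) _ assms(3)] assms(2) by simp
  have step: "?m (Suc a) * ?m b \<le> ?m a * ?m (Suc b)" if "a \<le> b" for a b
    using that
  proof (induction b rule: dec_induct)
    case base
    then show ?case by (simp add: mult.commute)
  next
    case (step b)
    have "(?m (Suc a) * ?m (Suc b)) * ?m (Suc b) = ?m (Suc a) * (?m (Suc b))\<^sup>2" by (simp add: power2_eq_square)
    also have "\<dots> \<le> ?m (Suc a) * (?m b * ?m (Suc (Suc b)))" by (intro mult_left_mono lc nn)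
    also have "\<dots> = (?m (Suc a) * ?m b) * ?m (Suc (Suc b))" by simp
    also have "\<dots> \<le> (?m a * ?m (Suc b)) * ?m (Suc (Suc b))" by (intro mult_right_mono step.IH nn)
    finally have "(?m (Suc a) * ?m (Suc b)) * ?m (Suc b) \<le> (?m a * ?m (Suc (Suc b))) * ?m (Suc b)" by (simp add: ac_simps)
    then show ?case using pos[of "Suc b"] by (simp only: mult_le_cancel_right_pos)
  qed
  have "?m a * ?m b \<le> ?m 0 * ?m (a + b)"
  proof (induction a arbitrary: b)
    case 0
    then show ?case by simp
  next
    case (Suc a)
    show ?case
    proof (cases "a \<le> b")
      case True
      then have "?m (Suc a) * ?m b \<le> ?m a * ?m (Suc b)" by (rule step)
      also have "\<dots> \<le> ?m 0 * ?m (a + Suc b)" by (rule Suc.IH)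
      finally show ?thesis by simp
    next
      case False
      have "?m k * ?m c \<le> ?m 0 * ?m (k + c)" if "k \<le> c" for k c
        using that
      proof (induction k arbitrary: c)
        case (Suc k)
        have "?m (Suc k) * ?m c \<le> ?m k * ?m (Suc c)" using Suc.prems by (intro step) simp
        also have "\<dots> \<le> ?m 0 * ?m (k + Suc c)" using Suc.prems by (intro Suc.IH) simp
        finally show ?case by simp
      qed simp
      from this[of b "Suc a"] False show ?thesis by (simp add: mult.commute add.commute)
    qed
  qed
  then show ?thesis by simp
qed

text \<open>Jensen's inequality for the q-th power, by repeated use of
  \<open>mom_cheb\<close>.\<close>

lemma mom_power: assumes "psd n L T" "0 < L" "x \<in> vsp n" "ip n x x = 1"
  shows "(ip n x (T x)) ^ q \<le> ip n x ((T ^^ q) x)"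
proof (induction q)
  case 0
  then show ?case using assms by simp
next
  case (Suc q)
  have "0 \<le> ip n x (T x)" using mom_nonneg[OF assms(1) _ assms(3), of 1] assms(2) by simp
  then have "ip n x (T x) ^ Suc q \<le> ip n x ((T ^^ 1) x) * ip n x ((T ^^ q) x)"
    using Suc by (simp add: mult_left_mono)
  also have "\<dots> \<le> ip n x x * ip n x ((T ^^ (1 + q)) x)" by (rule mom_cheb[OF assms(1-3)])
  finally show ?case using assms(4) by simp
qed

text \<open>For \<open>q = 2 j\<close> the trace is the squared Hilbert-Schmidt norm of
  \<open>T^j\<close>, which dominates its squared operator norm.\<close>

lemma mom_le_trace: assumes T: "selfadj n T" and x: "x \<in> vsp n" "ip n x x = 1" and q: "even q"
  shows "ip n x ((T ^^ q) x) \<le> tr n (T ^^ q)"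
proof -
  obtain j where j: "q = j + j" using q by (metis evenE mult_2)
  define y where "y = (T ^^ j) x"
  have yv: "y \<in> vsp n" using T x unfolding y_def by (simp add: pow_vsp)
  have u: "unit_vec i \<in> vsp n" if "i < n" for i using that by (rule unit_vsp)
  have yy: "ip n x ((T ^^ q) x) = ip n y y"
    unfolding y_def j using T x by (simp add: funpow_add pow_sym pow_vsp)
  have "ip n y y = (\<Sum>i<n. (ip n (unit_vec i) y)\<^sup>2)" by (simp add: ip_unit power2_eq_square ip_def[of n y y])
  also have "\<dots> \<le> (\<Sum>i<n. ip n (unit_vec i) ((T ^^ q) (unit_vec i)))"
  proof (rule sum_mono)
    fix i assume i: "i \<in> {..<n}"
    have "ip n (unit_vec i) y = ip n ((T ^^ j) (unit_vec i)) x"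
      unfolding y_def using T x i u by (simp add: pow_sym)
    then have "(ip n (unit_vec i) y)\<^sup>2 \<le> ip n ((T ^^ j) (unit_vec i)) ((T ^^ j) (unit_vec i)) * ip n x x"
      using ip_cs by simp
    then show "(ip n (unit_vec i) y)\<^sup>2 \<le> ip n (unit_vec i) ((T ^^ q) (unit_vec i))"
      unfolding j using T x i u by (simp add: funpow_add pow_sym pow_vsp)
  qed
  finally show ?thesis using yy by (simp add: tr_def)
qed

section \<open>The trace of a power after a rank-one update, from above and from below\<close>

definition rk :: "nat \<Rightarrow> (nat \<Rightarrow> real) \<Rightarrow> ((nat \<Rightarrow> real) \<Rightarrow> (nat \<Rightarrow> real)) \<Rightarrow> (nat \<Rightarrow> real) \<Rightarrow> nat \<Rightarrow> real" where
  "rk n v T x = (\<lambda>i. T x i + ip n v x * v i)"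

lemma rk_psd: assumes "psd n L T" "v \<in> vsp n" shows "psd n L (rk n v T)"
proof -
  have sa: "selfadj n T" using assms by (simp add: psd_selfadj)
  have "selfadj n (rk n v T)" unfolding selfadj_def
  proof (intro conjI ballI allI)
    fix x assume "x \<in> vsp n"
    then show "rk n v T x \<in> vsp n" using selfadj_vsp[OF sa] assms(2) by (auto simp: rk_def vsp_def)
  next
    fix x y a b assume "x \<in> vsp n" "y \<in> vsp n"
    then show "rk n v T (\<lambda>i. a * x i + b * y i) = (\<lambda>i. a * rk n v T x i + b * rk n v T y i)"
      unfolding rk_def by (simp add: selfadj_lin[OF sa] ip_simps algebra_simps)
  next
    fix x y assume xy: "x \<in> vsp n" "y \<in> vsp n"
    have "ip n (rk n v T x) y = ip n (T x) y + ip n v x * ip n v y" unfolding rk_def by (simp add: ip_simps)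
    moreover have "ip n x (rk n v T y) = ip n x (T y) + ip n v y * ip n x v" unfolding rk_def by (simp add: ip_simps)
    ultimately show "ip n (rk n v T x) y = ip n x (rk n v T y)" using selfadj_sym[OF sa xy] by (simp add: ip_sym)
  qed
  moreover have "L * ip n x x \<le> ip n x (rk n v T x)" if "x \<in> vsp n" for x
  proof -
    have "ip n x (rk n v T x) = ip n x (T x) + (ip n v x)\<^sup>2"
      unfolding rk_def by (simp add: ip_simps power2_eq_square ip_sym[of n x v])
    then show ?thesis using assms(1) that unfolding psd_def by (smt (verit) zero_le_power2)
  qed
  ultimately show ?thesis by (simp add: psd_def)
qed

text \<open>The terms are sorted by the last application of the rank-one part: before it stand
  \<open>k\<close> factors of the updated operator, after it only factors \<open>T\<close>.\<close>

lemma rk_pow_expand: assumes T: "selfadj n T" and v: "v \<in> vsp n" and x: "x \<in> vsp n"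
  shows "(rk n v T ^^ q) x = (\<lambda>i. (T ^^ q) x i + (\<Sum>k<q. ip n v ((rk n v T ^^ k) x) * (T ^^ (q - 1 - k)) v i))"
proof (induction q)
  case 0
  then show ?case by simp
next
  case (Suc q)
  let ?Z = "rk n v T"
  have "(?Z ^^ Suc q) x = (\<lambda>i. T ((?Z ^^ q) x) i + ip n v ((?Z ^^ q) x) * v i)" by (simp add: rk_def)
  also have "T ((?Z ^^ q) x) = (\<lambda>i. T ((T ^^ q) x) i + (\<Sum>k<q. ip n v ((?Z ^^ k) x) * T ((T ^^ (q - 1 - k)) v) i))"
    by (subst Suc.IH) (rule selfadj_comb_sum[OF T pow_vsp[OF T x] _ pow_vsp[OF T v]], simp)
  also have "(\<lambda>i. (T ((T ^^ q) x) i + (\<Sum>k<q. ip n v ((?Z ^^ k) x) * T ((T ^^ (q - 1 - k)) v) i)) + ip n v ((?Z ^^ q) x) * v i)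
      = (\<lambda>i. (T ^^ Suc q) x i + (\<Sum>k<Suc q. ip n v ((?Z ^^ k) x) * (T ^^ (Suc q - 1 - k)) v i))"
  proof
    fix i
    have "(\<Sum>k<q. ip n v ((?Z ^^ k) x) * T ((T ^^ (q - 1 - k)) v) i) = (\<Sum>k<q. ip n v ((?Z ^^ k) x) * (T ^^ (q - k)) v i)"
    proof (intro sum.cong refl)
      fix k assume "k \<in> {..<q}"
      then have "q - k = Suc (q - 1 - k)" by auto
      then show "ip n v ((?Z ^^ k) x) * T ((T ^^ (q - 1 - k)) v) i = ip n v ((?Z ^^ k) x) * (T ^^ (q - k)) v i" by simp
    qed
    then show "(T ((T ^^ q) x) i + (\<Sum>k<q. ip n v ((?Z ^^ k) x) * T ((T ^^ (q - 1 - k)) v) i)) + ip n v ((?Z ^^ q) x) * v i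
      = (T ^^ Suc q) x i + (\<Sum>k<Suc q. ip n v ((?Z ^^ k) x) * (T ^^ (Suc q - 1 - k)) v i)" by simp
  qed
  finally show ?case .
qed

lemma rk_trace: assumes P: "psd n L T" and v: "v \<in> vsp n"
  shows "tr n (rk n v T ^^ q) = tr n (T ^^ q) + (\<Sum>k<q. ip n v ((rk n v T ^^ k) ((T ^^ (q - 1 - k)) v)))"
proof -
  let ?Z = "rk n v T"
  have T: "selfadj n T" and Z: "selfadj n ?Z" using P rk_psd[OF P v] by (simp_all add: psd_selfadj)
  have "tr n (?Z ^^ q) = (\<Sum>i<n. ip n (unit_vec i) ((T ^^ q) (unit_vec i)) +
      (\<Sum>k<q. ip n v ((?Z ^^ k) (unit_vec i)) * ip n (unit_vec i) ((T ^^ (q - 1 - k)) v)))"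
    unfolding tr_def
  proof (intro sum.cong refl)
    fix i assume "i \<in> {..<n}"
    then have u: "unit_vec i \<in> vsp n" by (simp add: unit_vsp)
    show "ip n (unit_vec i) ((?Z ^^ q) (unit_vec i)) = ip n (unit_vec i) ((T ^^ q) (unit_vec i)) +
      (\<Sum>k<q. ip n v ((?Z ^^ k) (unit_vec i)) * ip n (unit_vec i) ((T ^^ (q - 1 - k)) v))"
      by (subst rk_pow_expand[OF T v u]) (simp add: ip_simps)
  qed
  also have "\<dots> = tr n (T ^^ q) + (\<Sum>i<n. \<Sum>k<q. (?Z ^^ k) v i * (T ^^ (q - 1 - k)) v i)"
  proof -
    have "ip n v ((?Z ^^ k) (unit_vec i)) = (?Z ^^ k) v i" if "i < n" for i k
      using pow_sym[OF Z v unit_vsp[OF that], of k] that by (simp add: ip_unit ip_sym[of n _ "unit_vec i"])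
    then show ?thesis by (simp add: sum.distrib tr_def ip_unit)
  qed
  also have "(\<Sum>i<n. \<Sum>k<q. (?Z ^^ k) v i * (T ^^ (q - 1 - k)) v i) = (\<Sum>k<q. ip n ((?Z ^^ k) v) ((T ^^ (q - 1 - k)) v))"
    unfolding ip_def by (rule sum.swap)
  also have "\<dots> = (\<Sum>k<q. ip n v ((?Z ^^ k) ((T ^^ (q - 1 - k)) v)))"
    using T Z v by (simp add: pow_sym pow_vsp)
  finally show ?thesis .
qed

text \<open>Each updated factor is replaced by \<open>T\<close> at the price of a factor
  \<open>1 + ip n v v / L\<close>. Where the rank-one part is used, the word breaks into a product
  of two moments; \<open>mom_cheb\<close> merges them and \<open>mom_grow\<close> restores the
  missing power.\<close>

lemma rk_word:
  assumes P: "psd n L T" and L: "0 < L" and v: "v \<in> vsp n"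
  shows "ip n v ((rk n v T ^^ k) ((T ^^ b) v)) \<le> (1 + ip n v v / L) ^ k * ip n v ((T ^^ (b + k)) v)"
proof (induction k arbitrary: b)
  case 0
  then show ?case by simp
next
  case (Suc k)
  let ?Z = "rk n v T" and ?m = "\<lambda>k. ip n v ((T ^^ k) v)"
  have T: "selfadj n T" and Z: "selfadj n ?Z" using P rk_psd[OF P v] by (simp_all add: psd_selfadj)
  have nn: "0 \<le> ?m k" for k using mom_nonneg[OF P _ v] L by simp
  have d: "0 \<le> ip n v v / L" using L by simp
  have "(?Z ^^ Suc k) ((T ^^ b) v) = (?Z ^^ k) (\<lambda>i. 1 * (T ^^ Suc b) v i + ?m b * v i)"
    by (simp add: funpow_swap1[symmetric] rk_def del: funpow.simps(2)) (simp add: rk_def funpow_swap1)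
  also have "\<dots> = (\<lambda>i. 1 * (?Z ^^ k) ((T ^^ Suc b) v) i + ?m b * (?Z ^^ k) v i)"
    by (rule selfadj_lin[OF selfadj_pow[OF Z] pow_vsp[OF T v] v])
  finally have "ip n v ((?Z ^^ Suc k) ((T ^^ b) v)) = ip n v ((?Z ^^ k) ((T ^^ Suc b) v)) + ?m b * ip n v ((?Z ^^ k) ((T ^^ 0) v))"
    by (simp only: ip_add_right, simp)
  also have "\<dots> \<le> (1 + ip n v v / L) ^ k * ?m (Suc b + k) + ?m b * ((1 + ip n v v / L) ^ k * ?m (0 + k))"
    using Suc.IH[of "Suc b"] mult_left_mono[OF Suc.IH[of 0] nn[of b]] by linarith
  also have "\<dots> = (1 + ip n v v / L) ^ k * (?m (b + Suc k) + ?m b * ?m k)" by (simp add: algebra_simps)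
  also have "\<dots> \<le> (1 + ip n v v / L) ^ k * (?m (b + Suc k) + ip n v v / L * ?m (b + Suc k))"
  proof (intro mult_left_mono add_left_mono zero_le_power)
    have "?m b * ?m k \<le> ip n v v * ?m (b + k)" by (rule mom_cheb[OF P L v])
    also have "\<dots> = ip n v v / L * (L * ?m (b + k))" using L by simp
    also have "\<dots> \<le> ip n v v / L * ?m (Suc (b + k))" using d by (intro mult_left_mono mom_grow[OF P L v])
    finally show "?m b * ?m k \<le> ip n v v / L * ?m (b + Suc k)" by simp
  qed (use d in simp)
  also have "\<dots> = (1 + ip n v v / L) ^ Suc k * ?m (b + Suc k)" by (simp add: algebra_simps)
  finally show ?case .
qed

text \<open>The update raises the trace by at most 7/5 of the first-order term: the condition on
  \<open>L\<close> keeps the factors from \<open>rk_word\<close> below \<open>exp (1/3)\<close>,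
  which is less than 7/5.\<close>

lemma rk_trace_le:
  assumes P: "psd n L T" and v: "v \<in> vsp n" and L: "0 < L" "3 * real q * ip n v v \<le> L"
  shows "tr n (rk n v T ^^ q) \<le> tr n (T ^^ q) + 7/5 * real q * ip n v ((T ^^ (q - 1)) v)"
proof -
  have nn: "0 \<le> ip n v ((T ^^ k) v)" for k using mom_nonneg[OF P _ v] L by simp
  have "(1 + ip n v v / L) ^ k \<le> 7/5" if "k < q" for k
  proof -
    have "(1 + ip n v v / L) ^ k \<le> exp (ip n v v / L) ^ k" 
      using L by (intro power_mono exp_ge_add_one_self) simp
    also have "\<dots> = exp (real k * (ip n v v / L))" by (simp only: exp_of_nat_mult)
    also have "\<dots> \<le> exp (1/3)"
    proof -
      have "real k * ip n v v \<le> real q * ip n v v" using that by (intro mult_right_mono) auto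
      then show ?thesis using L by (simp add: field_simps)
    qed
    also have "\<dots> \<le> 7/5"
    proof -
      have "exp (1/3::real) ^ Suc 2 = exp (real (Suc 2) * (1/3))" by (simp only: exp_of_nat_mult)
      also have "\<dots> \<le> 2.72" using e_less_272 by simp
      also have "\<dots> \<le> (7/5) ^ Suc 2" by (simp add: power_divide)
      finally show ?thesis by (rule power_le_imp_le_base) simp
    qed
    finally show ?thesis .
  qed
  then have "(\<Sum>k<q. ip n v ((rk n v T ^^ k) ((T ^^ (q - 1 - k)) v))) \<le> (\<Sum>k<q. 7/5 * ip n v ((T ^^ (q - 1)) v))"
  proof (intro sum_mono)
    fix k assume k: "k \<in> {..<q}"
    have "ip n v ((rk n v T ^^ k) ((T ^^ (q - 1 - k)) v)) \<le> (1 + ip n v v / L) ^ k * ip n v ((T ^^ (q - 1 - k + k)) v)"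
      by (rule rk_word[OF P L(1) v])
    also have "\<dots> \<le> 7/5 * ip n v ((T ^^ (q - 1 - k + k)) v)"
      using nn k \<open>\<And>k. k < q \<Longrightarrow> (1 + ip n v v / L) ^ k \<le> 7/5\<close> by (intro mult_right_mono) auto
    finally show "ip n v ((rk n v T ^^ k) ((T ^^ (q - 1 - k)) v)) \<le> 7/5 * ip n v ((T ^^ (q - 1)) v)" using k by simp
  qed
  then show ?thesis using rk_trace[OF P v, of q] by simp
qed

text \<open>The graph of the convex function x^q lies above its tangent at \<open>m\<close>.\<close>

lemma power_tangent: "(0::real) \<le> x \<Longrightarrow> 0 \<le> m \<Longrightarrow> m ^ q + real q * m ^ (q - 1) * (x - m) \<le> x ^ q"
proof (induction q)
  case (Suc q)
  show ?case
  proof (cases q)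
    case (Suc p)
    have "x * (m ^ q + real q * m ^ (q - 1) * (x - m)) \<le> x * x ^ q" using Suc.IH Suc.prems by (intro mult_left_mono) auto
    moreover have "x * (m ^ q + real q * m ^ (q - 1) * (x - m)) = m ^ Suc q + real (Suc q) * m ^ q * (x - m) + real q * m ^ (q - 1) * (x - m)\<^sup>2"
      unfolding Suc by (simp add: algebra_simps power2_eq_square)
    moreover have "0 \<le> real q * m ^ (q - 1) * (x - m)\<^sup>2" using Suc.prems by simp
    ultimately show ?thesis by simp
  qed simp
qed simp

text \<open>Klein's inequality for the q-th power: by convexity the trace lies above its first-order
  expansion at \<open>M\<close>. In an eigenbasis of \<open>M\<close>, \<open>power_tangent\<close>
  applies to the diagonal entries of \<open>Z\<close>, and \<open>mom_power\<close> passes from the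
  powers of these entries to the diagonal entries of the power.\<close>

lemma klein:
  assumes M: "psd n L M" and Z: "psd n L Z" and L: "0 < L" and K: "finite K"
    and w: "\<And>k. k \<in> K \<Longrightarrow> w k \<in> vsp n"
    and ZM: "\<And>x. x \<in> vsp n \<Longrightarrow> Z x = (\<lambda>i. M x i + (\<Sum>k\<in>K. c k * (ip n (w k) x * w k i)))"
  shows "tr n (M ^^ q) + real q * (\<Sum>k\<in>K. c k * ip n (w k) ((M ^^ (q - 1)) (w k))) \<le> tr n (Z ^^ q)"
proof -
  have sM: "selfadj n M" and sZ: "selfadj n Z" using M Z by (simp_all add: psd_selfadj)
  obtain e \<mu> where e: "onb n e n" and ev: "\<And>j. j < n \<Longrightarrow> M (e j) = (\<lambda>i. \<mu> j * e j i)"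
    using spectral_theorem[OF sM] by auto
  have ein: "\<And>j. j < n \<Longrightarrow> e j \<in> vsp n" and e1: "\<And>j. j < n \<Longrightarrow> ip n (e j) (e j) = 1" using e by (auto simp: onb_def)
  have pw: "(M ^^ k) (e j) = (\<lambda>i. \<mu> j ^ k * e j i)" if "j < n" for j k
  proof (induction k)
    case (Suc k)
    have "(M ^^ Suc k) (e j) = M (\<lambda>i. \<mu> j ^ k * e j i)" using Suc by simp
    also have "\<dots> = (\<lambda>i. \<mu> j ^ k * M (e j) i)" using selfadj_lin[OF sM ein[OF that] ein[OF that], of "\<mu> j ^ k" 0] by simp
    finally show ?case using ev[OF that] by (simp add: ac_simps)
  qed simp
  have mu: "0 \<le> \<mu> j" if "j < n" for j
  proof -
    have "L * 1 \<le> ip n (e j) (M (e j))" using M ein[OF that] e1[OF that] unfolding psd_def by metis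
    then show ?thesis using L e1[OF that] by (simp add: ev[OF that] ip_simps)
  qed
  have "tr n (M ^^ q) + real q * (\<Sum>k\<in>K. c k * ip n (w k) ((M ^^ (q - 1)) (w k)))
      = (\<Sum>j<n. \<mu> j ^ q + real q * \<mu> j ^ (q - 1) * (ip n (e j) (Z (e j)) - \<mu> j))"
  proof -
    have a: "tr n (M ^^ q) = (\<Sum>j<n. \<mu> j ^ q)"
      unfolding trace_onb[OF selfadj_pow[OF sM] e] by (intro sum.cong refl) (simp add: pw ip_simps e1)
    have b: "ip n (w k) ((M ^^ (q - 1)) (w k)) = (\<Sum>j<n. \<mu> j ^ (q - 1) * (ip n (w k) (e j))\<^sup>2)" if "k \<in> K" for k
    proof -
      have "ip n (w k) ((M ^^ (q - 1)) (w k)) = (\<Sum>j<n. ip n (w k) (e j) * ip n (e j) ((M ^^ (q - 1)) (w k)))"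
        by (rule parseval[OF e w[OF that]])
      also have "\<dots> = (\<Sum>j<n. ip n (w k) (e j) * ip n ((M ^^ (q - 1)) (e j)) (w k))"
        using sM ein w[OF that] by (intro sum.cong refl) (simp add: pow_sym)
      also have "\<dots> = (\<Sum>j<n. \<mu> j ^ (q - 1) * (ip n (w k) (e j))\<^sup>2)"
        by (intro sum.cong refl, simp only: pw lessThan_iff ip_scale_left) (simp add: power2_eq_square ip_sym[of n "e _" "w _"])
      finally show ?thesis .
    qed
    have c: "ip n (e j) (Z (e j)) - \<mu> j = (\<Sum>k\<in>K. c k * (ip n (w k) (e j))\<^sup>2)" if "j < n" for j
      using that by (simp add: ZM ein ip_simps ev e1 power2_eq_square ip_sym[of n "e _" "w _"] sum_distrib_left mult.assoc)
    have "real q * (\<Sum>k\<in>K. c k * ip n (w k) ((M ^^ (q - 1)) (w k)))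
        = (\<Sum>k\<in>K. \<Sum>j<n. real q * \<mu> j ^ (q - 1) * (c k * (ip n (w k) (e j))\<^sup>2))"
      by (simp add: b[unfolded One_nat_def] sum_distrib_left ac_simps)
    also have "\<dots> = (\<Sum>j<n. \<Sum>k\<in>K. real q * \<mu> j ^ (q - 1) * (c k * (ip n (w k) (e j))\<^sup>2))" by (rule sum.swap)
    also have "\<dots> = (\<Sum>j<n. real q * \<mu> j ^ (q - 1) * (ip n (e j) (Z (e j)) - \<mu> j))"
      by (intro sum.cong refl) (simp add: c sum_distrib_left)
    finally show ?thesis by (simp add: a sum.distrib)
  qed
  also have "\<dots> \<le> (\<Sum>j<n. (ip n (e j) (Z (e j))) ^ q)"
  proof (intro sum_mono power_tangent)
    fix j assume "j \<in> {..<n}"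
    then show "0 \<le> ip n (e j) (Z (e j))" using mom_nonneg[OF Z _ ein, of j 1] L by simp
  qed (use mu in auto)
  also have "\<dots> \<le> (\<Sum>j<n. ip n (e j) ((Z ^^ q) (e j)))"
    by (intro sum_mono mom_power[OF Z L]) (auto simp: ein e1)
  also have "\<dots> = tr n (Z ^^ q)" by (rule trace_onb[OF selfadj_pow[OF sZ] e, symmetric])
  finally show ?thesis .
qed

text \<open>A weighted sum of projections \<open>b b^T\<close> on top of \<open>L\<close> times the
  identity. The identity part makes each single summand small against the whole, as
  \<open>rk_trace_le\<close> demands.\<close>

definition qop :: "nat \<Rightarrow> real \<Rightarrow> 'v set \<Rightarrow> ('v \<Rightarrow> real) \<Rightarrow> ('v \<Rightarrow> nat \<Rightarrow> real) \<Rightarrow> (nat \<Rightarrow> real) \<Rightarrow> nat \<Rightarrow> real" where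
  "qop n L S w b x = (\<lambda>i. L * x i + (\<Sum>s\<in>S. w s * (ip n (b s) x * b s i)))"

lemma qop_quad: "ip n x (qop n L S w b x) = L * ip n x x + (\<Sum>s\<in>S. w s * (ip n (b s) x)\<^sup>2)"
proof -
  have e: "qop n L S w b x = (\<lambda>i. L * x i + (\<Sum>s\<in>S. (w s * ip n (b s) x) * b s i))"
    by (simp add: qop_def mult.assoc)
  show ?thesis unfolding e by (simp only: ip_simps) (simp add: power2_eq_square ip_sym[of n x "b _"] mult.assoc)
qed

lemma qop_psd: assumes "\<And>s. s \<in> S \<Longrightarrow> b s \<in> vsp n" "\<And>s. s \<in> S \<Longrightarrow> 0 \<le> w s"
  shows "psd n L (qop n L S w b)"
proof -
  have e: "qop n L S w b x = (\<lambda>i. L * x i + (\<Sum>s\<in>S. (w s * ip n (b s) x) * b s i))" for x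
    by (simp add: qop_def mult.assoc)
  have "selfadj n (qop n L S w b)" unfolding selfadj_def
  proof (intro conjI ballI allI)
    fix x assume "x \<in> vsp n"
    then show "qop n L S w b x \<in> vsp n" using assms(1) by (auto simp: qop_def vsp_def)
  next
    fix x y a c assume "x \<in> vsp n" "y \<in> vsp n"
    show "qop n L S w b (\<lambda>i. a * x i + c * y i) = (\<lambda>i. a * qop n L S w b x i + c * qop n L S w b y i)"
      unfolding e by (simp add: ip_simps algebra_simps sum.distrib sum_distrib_left)
  next
    fix x y assume "x \<in> vsp n" "y \<in> vsp n"
    show "ip n (qop n L S w b x) y = ip n x (qop n L S w b y)"
      unfolding e by (simp only: ip_simps) (simp add: ip_sym[of n x "b _"] ac_simps)
  qed
  moreover have "L * ip n x x \<le> ip n x (qop n L S w b x)" for x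
    unfolding qop_quad using assms(2) by (simp add: sum_nonneg)
  ultimately show ?thesis by (simp add: psd_def)
qed

section \<open>Random transversals\<close>

text \<open>With its counterpart \<open>trace_bound_quad\<close>: the trace of the q-th power
  determines the largest eigenvalue up to the factor \<open>n^(1/q)\<close>, which is bounded once
  \<open>q\<close> is a multiple of log n.\<close>

lemma trace_pow_le:
  assumes N: "psd n L N" and L: "0 < L" and up: "\<And>x. x \<in> vsp n \<Longrightarrow> ip n x (N x) \<le> \<tau> * ip n x x"
  shows "tr n (N ^^ q) \<le> real n * \<tau> ^ q"
proof -
  have sN: "selfadj n N" using N by (simp add: psd_selfadj)
  obtain e \<mu> where e: "onb n e n" and ev: "\<And>j. j < n \<Longrightarrow> N (e j) = (\<lambda>i. \<mu> j * e j i)"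
    using spectral_theorem[OF sN] by auto
  have ein: "\<And>j. j < n \<Longrightarrow> e j \<in> vsp n" and e1: "\<And>j. j < n \<Longrightarrow> ip n (e j) (e j) = 1" using e by (auto simp: onb_def)
  have pw: "(N ^^ k) (e j) = (\<lambda>i. \<mu> j ^ k * e j i)" if "j < n" for j k
  proof (induction k)
    case (Suc k)
    have "(N ^^ Suc k) (e j) = N (\<lambda>i. \<mu> j ^ k * e j i)" using Suc by simp
    also have "\<dots> = (\<lambda>i. \<mu> j ^ k * N (e j) i)" using selfadj_lin[OF sN ein[OF that] ein[OF that], of "\<mu> j ^ k" 0] by simp
    finally show ?case using ev[OF that] by (simp add: ac_simps)
  qed simp
  have mu: "\<mu> j = ip n (e j) (N (e j))" if "j < n" for j
    using that by (simp add: ev ip_simps e1)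
  have "tr n (N ^^ q) = (\<Sum>j<n. \<mu> j ^ q)"
    unfolding trace_onb[OF selfadj_pow[OF sN] e] by (intro sum.cong refl) (simp add: pw ip_simps e1)
  also have "\<dots> \<le> (\<Sum>j<n. \<tau> ^ q)"
  proof (intro sum_mono power_mono)
    fix j assume j: "j \<in> {..<n}"
    then show "\<mu> j \<le> \<tau>" using up[OF ein[of j]] e1[of j] mu[of j] by simp
    show "0 \<le> \<mu> j" using j mu[of j] mom_nonneg[OF N _ ein[of j], of 1] L by simp
  qed
  finally show ?thesis by simp
qed

lemma trace_bound_quad:
  assumes N: "psd n L N" and L: "0 < L" and q: "even q" "0 < q" and tau: "0 \<le> \<tau>" and t: "tr n (N ^^ q) \<le> \<tau> ^ q" and x: "x \<in> vsp n"
  shows "ip n x (N x) \<le> \<tau> * ip n x x"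
proof (cases "ip n x x = 0")
  case True
  then show ?thesis using ip_eq0[OF x True] by (simp add: ip_def)
next
  case False
  have sN: "selfadj n N" using N by (simp add: psd_selfadj)
  obtain c where c: "(\<lambda>i. c * x i) \<in> vsp n" "ip n (\<lambda>i. c * x i) (\<lambda>i. c * x i) = 1"
    using normalize[OF x False] by auto
  have "(ip n (\<lambda>i. c * x i) (N (\<lambda>i. c * x i))) ^ q \<le> \<tau> ^ q"
    using mom_power[OF N L c, of q] mom_le_trace[OF sN c q(1)] t by linarith
  then have "ip n (\<lambda>i. c * x i) (N (\<lambda>i. c * x i)) \<le> \<tau>"
    using power_strict_mono[OF _ tau q(2)] by (meson not_le)
  moreover have "N (\<lambda>i. c * x i) = (\<lambda>i. c * N x i)" using selfadj_lin[OF sN x x, of c 0] by simp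
  ultimately have "c\<^sup>2 * ip n x (N x) \<le> \<tau> * (c\<^sup>2 * ip n x x)"
    using c(2) by (simp add: ip_simps power2_eq_square mult.assoc)
  moreover have "c\<^sup>2 > 0" using c(2) by (cases "c = 0") (auto simp: ip_def)
  ultimately show ?thesis by (simp add: mult.left_commute)
qed

text \<open>Both sides are compared with \<open>M\<close>, the operator without the group. Choosing
  member \<open>j\<close> costs at most 7/5 of its first-order term (\<open>rk_trace_le\<close>);
  giving every member the weight \<open>7/5 / K\<close> gains at least the first-order terms with
  that weight (\<open>klein\<close>). Summed over \<open>j\<close> the two amounts agree, so the
  inflated average dominates the random choice.\<close>

lemma qop_group_step:
  assumes S: "finite S" and b: "\<And>s. s \<in> S \<Longrightarrow> b s \<in> vsp n" and w: "\<And>s. s \<in> S \<Longrightarrow> 0 \<le> w s"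
    and g: "inj_on h {..<K}" "h ` {..<K} \<subseteq> S" and K: "0 < K"
    and wg: "\<And>j. j < K \<Longrightarrow> w (h j) = 7/5 / real K"
    and L: "0 < L" "\<And>s. s \<in> S \<Longrightarrow> 3 * real q * ip n (b s) (b s) \<le> L"
  shows "(\<Sum>j<K. tr n (qop n L S (\<lambda>s. if s \<in> h ` {..<K} then (if s = h j then 1 else 0) else w s) b ^^ q))
      \<le> real K * tr n (qop n L S w b ^^ q)"
proof -
  define w0 where "w0 = (\<lambda>s. if s \<in> h ` {..<K} then 0 else w s)"
  define M where "M = qop n L S w0 b"
  have M: "psd n L M" unfolding M_def using b w by (intro qop_psd) (auto simp: w0_def)
  have hS: "h j \<in> S" if "j < K" for j using g that by auto
  have step: "tr n (qop n L S (\<lambda>s. if s \<in> h ` {..<K} then (if s = h j then 1 else 0) else w s) b ^^ q)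
      \<le> tr n (M ^^ q) + 7/5 * real q * ip n (b (h j)) ((M ^^ (q - 1)) (b (h j)))" if j: "j < K" for j
  proof -
    have "qop n L S (\<lambda>s. if s \<in> h ` {..<K} then (if s = h j then 1 else 0) else w s) b = rk n (b (h j)) M"
    proof (intro ext)
      fix x i
      have "(\<Sum>s\<in>S. (if s \<in> h ` {..<K} then (if s = h j then 1 else 0) else w s) * (ip n (b s) x * b s i))
         = (\<Sum>s\<in>S. w0 s * (ip n (b s) x * b s i) + (if s = h j then ip n (b s) x * b s i else 0))"
        using j by (intro sum.cong refl) (auto simp: w0_def)
      then show "qop n L S (\<lambda>s. if s \<in> h ` {..<K} then (if s = h j then 1 else 0) else w s) b x i = rk n (b (h j)) M x i"
        using S hS[OF j] by (simp add: qop_def rk_def M_def sum.distrib)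
    qed
    then show ?thesis using rk_trace_le[OF M b[OF hS[OF j]] L(1) L(2)[OF hS[OF j]]] by simp
  qed
  have Z: "qop n L S w b x = (\<lambda>i. M x i + (\<Sum>k<K. (7/5 / real K) * (ip n (b (h k)) x * b (h k) i)))" for x
  proof
    fix i
    let ?f = "\<lambda>s. ip n (b s) x * b s i"
    have "(\<Sum>s\<in>S. w s * ?f s) = (\<Sum>s\<in>S. w0 s * ?f s + (if s \<in> h ` {..<K} then w s * ?f s else 0))"
      by (intro sum.cong refl) (auto simp: w0_def)
    also have "\<dots> = (\<Sum>s\<in>S. w0 s * ?f s) + (\<Sum>s\<in>h ` {..<K}. w s * ?f s)"
      using S g(2) by (simp add: sum.distrib sum.If_cases Int_absorb1)
    also have "(\<Sum>s\<in>h ` {..<K}. w s * ?f s) = (\<Sum>k<K. (7/5 / real K) * ?f (h k))"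
      using g(1) by (simp add: sum.reindex wg)
    finally show "qop n L S w b x i = M x i + (\<Sum>k<K. (7/5 / real K) * ?f (h k))"
      by (simp add: qop_def M_def)
  qed
  have "psd n L (qop n L S w b)" using b w by (intro qop_psd) auto
  from klein[OF M this L(1), of "{..<K}" "b \<circ> h" "\<lambda>_. 7/5 / real K" q]
  have kl: "tr n (M ^^ q) + real q * (\<Sum>k<K. 7/5 / real K * ip n (b (h k)) ((M ^^ (q - 1)) (b (h k)))) \<le> tr n (qop n L S w b ^^ q)"
    using Z b hS by simp
  have "(\<Sum>j<K. tr n (qop n L S (\<lambda>s. if s \<in> h ` {..<K} then (if s = h j then 1 else 0) else w s) b ^^ q))
     \<le> (\<Sum>j<K. tr n (M ^^ q) + 7/5 * real q * ip n (b (h j)) ((M ^^ (q - 1)) (b (h j))))"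
    by (intro sum_mono step) simp
  also have "\<dots> = real K * (tr n (M ^^ q) + real q * (\<Sum>k<K. 7/5 / real K * ip n (b (h k)) ((M ^^ (q - 1)) (b (h k)))))"
    using K by (simp add: sum.distrib sum_distrib_left algebra_simps)
  also have "\<dots> \<le> real K * tr n (qop n L S w b ^^ q)" using kl by (intro mult_left_mono) auto
  finally show ?thesis .
qed

section \<open>Averaging over all transversals\<close>

definition choices :: "nat \<Rightarrow> nat \<Rightarrow> (nat \<Rightarrow> nat) set" where
  "choices G K = PiE {..<G} (\<lambda>_. {..<K})"

lemma card_choices: "card (choices G K) = K ^ G"
  by (simp add: choices_def card_PiE)

lemma finite_choices [simp]: "finite (choices G K)"
  by (simp add: choices_def finite_PiE)

lemma sum_choices_Suc: "(\<Sum>t\<in>choices (Suc r) K. F t) = (\<Sum>t\<in>choices r K. \<Sum>j<K. F (t(r := j)))"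
proof -
  have "choices (Suc r) K = (\<lambda>(y, g). g(r := y)) ` ({..<K} \<times> choices r K)"
    unfolding choices_def lessThan_Suc by (simp add: PiE_insert_eq)
  moreover have "inj_on (\<lambda>(y, g). g(r := y)) ({..<K} \<times> choices r K)"
    unfolding choices_def by (rule inj_combinator) simp
  ultimately have "(\<Sum>t\<in>choices (Suc r) K. F t) = (\<Sum>(y, g)\<in>{..<K} \<times> choices r K. F (g(r := y)))"
    by (simp add: sum.reindex case_prod_unfold)
  also have "\<dots> = (\<Sum>j<K. \<Sum>t\<in>choices r K. F (t(r := j)))" by (simp add: sum.cartesian_product)
  also have "\<dots> = (\<Sum>t\<in>choices r K. \<Sum>j<K. F (t(r := j)))" by (rule sum.swap)
  finally show ?thesis .
qed

text \<open>The moment method in place of a matrix Chernoff bound: the groups are processed one at a time,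
  and the trace of a power grows by at most what replacing the chosen vector by its average would give.\<close>

lemma trace_average:
  fixes b :: "nat \<times> nat \<Rightarrow> nat \<Rightarrow> real"
  assumes b: "\<And>s. s \<in> {..<G} \<times> {..<K} \<Longrightarrow> b s \<in> vsp n" and K: "0 < K" and L: "0 < L"
    "\<And>s. s \<in> {..<G} \<times> {..<K} \<Longrightarrow> 3 * real q * ip n (b s) (b s) \<le> L"
  shows "(\<Sum>t\<in>choices G K. tr n (qop n L ({..<G} \<times> {..<K}) (\<lambda>(c, j). if t c = j then 1 else 0) b ^^ q))
    \<le> real K ^ G * tr n (qop n L ({..<G} \<times> {..<K}) (\<lambda>_. 7/5 / real K) b ^^ q)"
proof -
  let ?S = "{..<G} \<times> {..<K}"
  \<comment> \<open>Hybrid weights: groups below \<open>r\<close> follow the choice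
    \<open>t\<close>, all later ones still carry the inflated average.\<close>
  define W where "W = (\<lambda>r (t::nat\<Rightarrow>nat) (c, j). if c < r then (if t c = j then 1 else 0) else 7/5 / real K)"
  have Wnn: "0 \<le> W r t s" for r t s by (auto simp: W_def split: prod.splits)
  have "(\<Sum>t\<in>choices r K. tr n (qop n L ?S (W r t) b ^^ q)) \<le> real K ^ r * tr n (qop n L ?S (\<lambda>_. 7/5 / real K) b ^^ q)"
    if "r \<le> G" for r using that
  proof (induction r)
    case 0
    have "W 0 t = (\<lambda>_. 7/5 / real K)" for t by (auto simp: W_def)
    then show ?case by (simp add: choices_def)
  next
    case (Suc r)
    let ?h = "\<lambda>j. (r, j)"
    have inj: "inj_on ?h {..<K}" by (simp add: inj_on_def)
    have sub: "?h ` {..<K} \<subseteq> ?S" using Suc.prems by auto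
    have "(\<Sum>t\<in>choices (Suc r) K. tr n (qop n L ?S (W (Suc r) t) b ^^ q))
        = (\<Sum>t\<in>choices r K. \<Sum>j<K. tr n (qop n L ?S (W (Suc r) (t(r := j))) b ^^ q))" by (rule sum_choices_Suc)
    also have "\<dots> \<le> (\<Sum>t\<in>choices r K. real K * tr n (qop n L ?S (W r t) b ^^ q))"
    proof (rule sum_mono)
      fix t assume "t \<in> choices r K"
      have eq: "qop n L ?S (W (Suc r) (t(r := j))) b = qop n L ?S (\<lambda>s. if s \<in> ?h ` {..<K} then (if s = ?h j then 1 else 0) else W r t s) b" for j
      proof -
        have "W (Suc r) (t(r := j)) (c, i) = (if (c, i) \<in> ?h ` {..<K} then (if (c, i) = ?h j then 1 else 0) else W r t (c, i))"
          if "i < K" for c i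
          using that by (cases "c = r") (auto simp: W_def less_Suc_eq image_iff)
        then show ?thesis
          unfolding qop_def by (intro ext arg_cong2[where f="(+)"] arg_cong2[where f="(*)"] refl sum.cong) (auto split: if_splits)
      qed
      show "(\<Sum>j<K. tr n (qop n L ?S (W (Suc r) (t(r := j))) b ^^ q)) \<le> real K * tr n (qop n L ?S (W r t) b ^^ q)"
        unfolding eq by (rule qop_group_step[OF _ b Wnn inj sub K _ L]) (auto simp: W_def)
    qed
    also have "\<dots> = real K * (\<Sum>t\<in>choices r K. tr n (qop n L ?S (W r t) b ^^ q))" by (simp add: sum_distrib_left)
    also have "\<dots> \<le> real K * (real K ^ r * tr n (qop n L ?S (\<lambda>_. 7/5 / real K) b ^^ q))"
      using Suc by (intro mult_left_mono) auto
    finally show ?case by simp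
  qed
  from this[of G] have "(\<Sum>t\<in>choices G K. tr n (qop n L ?S (W G t) b ^^ q)) \<le> real K ^ G * tr n (qop n L ?S (\<lambda>_. 7/5 / real K) b ^^ q)" by simp
  moreover have "qop n L ?S (W G t) b = qop n L ?S (\<lambda>(c, j). if t c = j then 1 else 0) b" for t
    unfolding qop_def by (intro ext arg_cong2[where f="(+)"] refl sum.cong) (auto simp: W_def)
  ultimately show ?thesis by simp
qed

lemma sum_choice_indicator: 
  assumes "t \<in> choices G K"
  shows "(\<Sum>s\<in>{..<G} \<times> {..<K}. (case s of (c, j) \<Rightarrow> if t c = j then 1 else 0) * (f s::real)) = (\<Sum>c<G. f (c, t c))"
proof -
  have "(\<Sum>s\<in>{..<G} \<times> {..<K}. (case s of (c, j) \<Rightarrow> if t c = j then 1 else 0) * f s)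
     = (\<Sum>(c, j)\<in>{..<G} \<times> {..<K}. if t c = j then f (c, j) else 0)"
    by (intro sum.cong refl) auto
  also have "\<dots> = (\<Sum>c<G. \<Sum>j<K. if t c = j then f (c, j) else 0)"
    by (rule sum.cartesian_product[symmetric])
  also have "\<dots> = (\<Sum>c<G. f (c, t c))"
    using assms by (intro sum.cong refl) (auto simp: choices_def PiE_iff)
  finally show ?thesis .
qed

section \<open>Tail bounds for a random transversal, as counts of transversals\<close>

lemma markov_card:
  assumes "finite \<Omega>" "\<And>t. t \<in> \<Omega> \<Longrightarrow> 0 \<le> F t" "(\<Sum>t\<in>\<Omega>. F t) \<le> real (card \<Omega>) * m" "0 < a"
  shows "real (card {t\<in>\<Omega>. a < F t}) \<le> real (card \<Omega>) * (m / a)"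
proof -
  have "a * real (card {t\<in>\<Omega>. a < F t}) = (\<Sum>t\<in>{t\<in>\<Omega>. a < F t}. a)" by simp
  also have "\<dots> \<le> (\<Sum>t\<in>{t\<in>\<Omega>. a < F t}. F t)" by (intro sum_mono) auto
  also have "\<dots> \<le> (\<Sum>t\<in>\<Omega>. F t)" using assms by (intro sum_mono2) auto
  finally show ?thesis using assms by (simp add: field_simps)
qed

lemma transversal_quad:
  fixes b :: "nat \<times> nat \<Rightarrow> nat \<Rightarrow> real"
  assumes b: "\<And>s. s \<in> {..<G} \<times> {..<K} \<Longrightarrow> b s \<in> vsp n" and K: "0 < K" and s0: "0 < s0"
    and s: "\<And>s. s \<in> {..<G} \<times> {..<K} \<Longrightarrow> ip n (b s) (b s) \<le> s0"
    and T: "\<And>x. x \<in> vsp n \<Longrightarrow> (\<Sum>s\<in>{..<G} \<times> {..<K}. (ip n (b s) x)\<^sup>2) \<le> T * ip n x x" and T0: "0 \<le> T"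
    and l: "0 < l" "real n \<le> exp (real l)"
  shows "real (card {t\<in>choices G K. \<exists>x\<in>vsp n. (\<Sum>c<G. (ip n (b (c, t c)) x)\<^sup>2) > (47 * real l * s0 + 9/5 * T / K) * ip n x x})
     \<le> real K ^ G * exp (- 2 * real l)"
proof -
  let ?S = "{..<G} \<times> {..<K}"
  \<comment> \<open>\<open>L = 3 * q * s0\<close> is the smallest shift that
    \<open>rk_trace_le\<close> allows. The factor \<open>exp (1/4)\<close> in \<open>\<tau>\<close>
    becomes \<open>exp (3 * l)\<close> in the q-th power; this beats the factor \<open>n\<close>, at
    most \<open>exp l\<close>, and leaves \<open>exp (- 2 * l)\<close>. The constants 47 and 9/5 of
    the statement are 36 and 7/5 times \<open>exp (1/4)\<close>, rounded up.\<close>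
  define q where "q = 12 * l"
  define L where "L = 36 * real l * s0"
  define m where "m = L + 7/5 * T / real K"
  define \<tau> where "\<tau> = exp (1/4) * m"
  define N where "N = (\<lambda>t. qop n L ?S (\<lambda>(c, j). if t c = j then 1 else 0) b)"
  have L0: "0 < L" using l s0 by (simp add: L_def)
  have m0: "0 < m" using L0 T0 K by (simp add: m_def add_pos_nonneg)
  have t0: "0 < \<tau>" using m0 by (simp add: \<tau>_def)
  have L3: "3 * real q * ip n (b s) (b s) \<le> L" if "s \<in> ?S" for s
    using s[OF that] l by (simp add: q_def L_def)
  have psdN: "psd n L (N t)" for t unfolding N_def using b by (intro qop_psd) (auto)
  have trN: "0 \<le> tr n (N t ^^ q)" for t unfolding tr_def
    using L0 by (intro sum_nonneg mom_nonneg[OF psdN]) (auto simp: unit_vsp)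
  have "tr n (qop n L ?S (\<lambda>_. 7/5 / real K) b ^^ q) \<le> real n * m ^ q"
  proof (rule trace_pow_le[OF _ L0])
    show "psd n L (qop n L ?S (\<lambda>_. 7/5 / real K) b)" using b by (intro qop_psd) auto
    fix x assume x: "x \<in> vsp n"
    have "ip n x (qop n L ?S (\<lambda>_. 7/5 / real K) b x) = L * ip n x x + 7/5 / real K * (\<Sum>s\<in>?S. (ip n (b s) x)\<^sup>2)"
      by (simp add: qop_quad sum_distrib_left)
    also have "\<dots> \<le> L * ip n x x + 7/5 / real K * (T * ip n x x)"
      using T[OF x] K by (intro add_left_mono mult_left_mono) auto
    also have "\<dots> = m * ip n x x" by (simp add: m_def algebra_simps)
    finally show "ip n x (qop n L ?S (\<lambda>_. 7/5 / real K) b x) \<le> m * ip n x x" .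
  qed
  then have "(\<Sum>t\<in>choices G K. tr n (N t ^^ q)) \<le> real K ^ G * (real n * m ^ q)"
    using order_trans[OF trace_average[of G K b n L q, OF b K L0 L3] mult_left_mono[of _ _ "real K ^ G"]]
    unfolding N_def by simp
  then have "real (card {t\<in>choices G K. \<tau> ^ q < tr n (N t ^^ q)}) \<le> real K ^ G * (real n * m ^ q / \<tau> ^ q)"
    using markov_card[of "choices G K" "\<lambda>t. tr n (N t ^^ q)" "real n * m ^ q" "\<tau> ^ q"] trN t0 by (simp add: card_choices)
  also have "real n * m ^ q / \<tau> ^ q = real n * exp (- (3 * real l))"
  proof -
    have "exp (1/4::real) ^ q = exp (3 * real l)" by (simp add: q_def exp_of_nat_mult[symmetric])
    then show ?thesis using m0 by (simp add: \<tau>_def power_mult_distrib exp_minus field_simps)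
  qed
  also have "real n * exp (- (3 * real l)) \<le> exp (real l) * exp (- (3 * real l))" using l by (intro mult_right_mono) auto
  also have "\<dots> = exp (- 2 * real l)" by (simp add: exp_add[symmetric])
  finally have A: "real (card {t\<in>choices G K. \<tau> ^ q < tr n (N t ^^ q)}) \<le> real K ^ G * exp (- 2 * real l)"
    by (simp add: mult_left_mono)
  have "{t\<in>choices G K. \<exists>x\<in>vsp n. (\<Sum>c<G. (ip n (b (c, t c)) x)\<^sup>2) > (47 * real l * s0 + 9/5 * T / K) * ip n x x}
     \<subseteq> {t\<in>choices G K. \<tau> ^ q < tr n (N t ^^ q)}"
  proof safe
    fix t x assume t: "t \<in> choices G K" and x: "x \<in> vsp n"
      and big: "(\<Sum>c<G. (ip n (b (c, t c)) x)\<^sup>2) > (47 * real l * s0 + 9/5 * T / K) * ip n x x"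
    show "\<tau> ^ q < tr n (N t ^^ q)"
    proof (rule ccontr)
      assume "\<not> ?thesis"
      then have "ip n x (N t x) \<le> \<tau> * ip n x x"
        using l t0 by (intro trace_bound_quad[OF psdN L0 _ _ _ _ x, of q]) (auto simp: q_def)
      moreover have "ip n x (N t x) = L * ip n x x + (\<Sum>c<G. (ip n (b (c, t c)) x)\<^sup>2)"
        unfolding N_def qop_quad by (subst sum_choice_indicator[OF t]) simp
      moreover have "0 \<le> L * ip n x x" using L0 by simp
      moreover have "\<tau> * ip n x x \<le> (47 * real l * s0 + 9/5 * T / K) * ip n x x"
      proof (rule mult_right_mono)
        have "exp (1/4::real) ^ Suc 3 = exp (real (Suc 3) * (1/4))" by (simp only: exp_of_nat_mult)
        also have "\<dots> \<le> 2.72" using e_less_272 by simp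
        also have "\<dots> \<le> (1.285) ^ Suc 3" by (simp add: power_divide)
        finally have e: "exp (1/4::real) \<le> 1.285" by (rule power_le_imp_le_base) simp
        have "\<tau> \<le> 1.285 * m" unfolding \<tau>_def using e m0 by (intro mult_right_mono) auto
        also have "\<dots> = 46.26 * (real l * s0) + 1.799 * (T / K)" by (simp add: m_def L_def)
        also have "\<dots> \<le> 47 * (real l * s0) + 1.8 * (T / K)" using s0 T0 by (intro add_mono mult_right_mono) auto
        finally show "\<tau> \<le> 47 * real l * s0 + 9/5 * T / K" by simp
      qed simp
      ultimately show False using big by linarith
    qed
  qed
  then have "real (card {t\<in>choices G K. \<exists>x\<in>vsp n. (\<Sum>c<G. (ip n (b (c, t c)) x)\<^sup>2) > (47 * real l * s0 + 9/5 * T / K) * ip n x x})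
     \<le> real (card {t\<in>choices G K. \<tau> ^ q < tr n (N t ^^ q)})" by (intro of_nat_mono card_mono) auto
  with A show ?thesis by linarith
qed

text \<open>The groups choose independently, so the exponential moment is a product over the
  groups.\<close>

lemma transversal_mgf:
  assumes K: "0 < K"
  shows "(\<Sum>t\<in>choices G K. exp (\<theta> * (\<Sum>c<G. (if P c (t c) then 1 else 0)))) 
    \<le> real K ^ G * exp ((exp \<theta> - 1) * ((\<Sum>c<G. \<Sum>j<K. (if P c j then 1 else 0)) / real K))"
proof -
  define cn where "cn = (\<lambda>c. (\<Sum>j<K. (if P c j then 1 else 0::real)))"
  have "(\<Sum>t\<in>choices G K. exp (\<theta> * (\<Sum>c<G. (if P c (t c) then 1 else 0)))) 
     = (\<Sum>t\<in>choices G K. \<Prod>c<G. exp (\<theta> * (if P c (t c) then 1 else 0)))"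
    by (simp only: sum_distrib_left exp_sum finite_lessThan)
  also have "\<dots> = (\<Prod>c<G. \<Sum>j<K. exp (\<theta> * (if P c j then 1 else 0)))"
    unfolding choices_def by (rule prod_sum_PiE[symmetric]) auto
  also have "\<dots> \<le> (\<Prod>c<G. real K * exp ((exp \<theta> - 1) * (cn c / real K)))"
  proof (intro prod_mono conjI sum_nonneg)
    fix c
    have "(\<Sum>j<K. exp (\<theta> * (if P c j then 1 else 0))) = (\<Sum>j<K. 1 + (exp \<theta> - 1) * (if P c j then 1 else 0))"
      by (intro sum.cong) auto
    also have "\<dots> = real K + (exp \<theta> - 1) * cn c" by (simp only: sum.distrib sum_distrib_left[symmetric] cn_def) simp
    also have "\<dots> = real K * (1 + (exp \<theta> - 1) * (cn c / real K))" using K by (simp add: field_simps)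
    also have "\<dots> \<le> real K * exp ((exp \<theta> - 1) * (cn c / real K))" by (intro mult_left_mono exp_ge_add_one_self) auto
    finally show "(\<Sum>j<K. exp (\<theta> * (if P c j then 1 else 0))) \<le> real K * exp ((exp \<theta> - 1) * (cn c / real K))" .
  qed auto
  also have "\<dots> = real K ^ G * exp ((exp \<theta> - 1) * ((\<Sum>c<G. cn c) / real K))"
    by (simp add: prod.distrib exp_sum[symmetric] sum_distrib_left[symmetric] sum_divide_distrib[symmetric])
  finally show ?thesis unfolding cn_def .
qed

text \<open>Chernoff's bound with parameter -1/10: the resulting rate
  \<open>exp (-1/10) - 1 + 9/100\<close> is below -1/200, so that 400 l in the mean gives 2 l in the
  exponent.\<close>

lemma transversal_lower:
  assumes K: "0 < K" and \<mu>: "\<mu> = (\<Sum>c<G. \<Sum>j<K. (if P c j then 1 else 0)) / real K" and l: "400 * real l \<le> \<mu>"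
  shows "real (card {t\<in>choices G K. (\<Sum>c<G. (if P c (t c) then 1 else 0)) < 9/10 * \<mu>}) \<le> real K ^ G * exp (- 2 * real l)"
proof -
  let ?X = "\<lambda>t. \<Sum>c<G. (if P c (t c) then 1 else 0::real)"
  have mu0: "0 \<le> \<mu>" using l by (rule order_trans[rotated]) simp
  have "{t\<in>choices G K. ?X t < 9/10 * \<mu>} \<subseteq> {t\<in>choices G K. exp (- (9/100) * \<mu>) < exp (- (1/10) * ?X t)}" by auto
  then have "real (card {t\<in>choices G K. ?X t < 9/10 * \<mu>}) \<le> real (card {t\<in>choices G K. exp (- (9/100) * \<mu>) < exp (- (1/10) * ?X t)})"
    by (intro of_nat_mono card_mono) auto
  also have "\<dots> \<le> real (card (choices G K)) * (exp ((exp (-(1/10)) - 1) * \<mu>) / exp (- (9/100) * \<mu>))"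
    using transversal_mgf[OF K, of "-(1/10)" P G] by (intro markov_card) (auto simp: \<mu> card_choices)
  also have "\<dots> = real K ^ G * exp ((exp (-(1/10)) - 1 + 9/100) * \<mu>)"
    by (simp add: card_choices exp_diff[symmetric] algebra_simps)
  also have "\<dots> \<le> real K ^ G * exp (- 2 * real l)"
  proof (intro mult_left_mono)
    have "exp (1/10::real) \<ge> 1 + 1/10 + (1/10)^2/2" using exp_lower_Taylor_quadratic[of "1/10::real"] by simp
    then have "exp (-(1/10::real)) \<le> 1 / (1 + 1/10 + (1/10)^2/2)" by (simp add: exp_minus field_simps power2_eq_square)
    also have "\<dots> \<le> 0.905" by (simp add: power2_eq_square)
    finally have "exp (-(1/10)) - 1 + 9/100 \<le> - (1/200::real)" by simp
    then have "(exp (-(1/10)) - 1 + 9/100) * \<mu> \<le> - (1/200) * \<mu>" using mu0 by (intro mult_right_mono) auto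
    also have "\<dots> \<le> - 2 * real l" using l by simp
    finally show "exp ((exp (-(1/10)) - 1 + 9/100) * \<mu>) \<le> exp (- 2 * real l)" by simp
  qed auto
  finally show ?thesis .
qed

text \<open>Chernoff's bound with parameter 1/2, which turns the threshold \<open>2 * \<mu>\<close>
  into \<open>exp \<mu>\<close>. Here \<open>\<mu>\<close> is an upper bound for the mean, so that
  one value can serve all vertices.\<close>

lemma transversal_upper:
  assumes K: "0 < K" and \<mu>: "(\<Sum>c<G. \<Sum>j<K. (if P c j then 1 else 0)) / real K \<le> \<mu>" and l: "400 * real l \<le> \<mu>"
  shows "real (card {t\<in>choices G K. 2 * \<mu> < (\<Sum>c<G. (if P c (t c) then 1 else 0))}) \<le> real K ^ G * exp (- 2 * real l)"
proof -
  let ?X = "\<lambda>t. \<Sum>c<G. (if P c (t c) then 1 else 0::real)"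
  have mu0: "0 \<le> \<mu>" using l by (rule order_trans[rotated]) simp
  have "{t\<in>choices G K. 2 * \<mu> < ?X t} \<subseteq> {t\<in>choices G K. exp \<mu> < exp (1/2 * ?X t)}" by auto
  then have "real (card {t\<in>choices G K. 2 * \<mu> < ?X t}) \<le> real (card {t\<in>choices G K. exp \<mu> < exp (1/2 * ?X t)})"
    by (intro of_nat_mono card_mono) auto
  also have "\<dots> \<le> real (card (choices G K)) * (exp ((exp (1/2) - 1) * \<mu>) / exp \<mu>)"
  proof (intro markov_card)
    have "(exp (1/2) - 1) * ((\<Sum>c<G. \<Sum>j<K. (if P c j then 1 else 0)) / real K) \<le> (exp (1/2) - 1) * \<mu>"
      using \<mu> by (intro mult_left_mono) auto
    then have "real K ^ G * exp ((exp (1/2) - 1) * ((\<Sum>c<G. \<Sum>j<K. (if P c j then 1 else 0)) / real K)) \<le> real K ^ G * exp ((exp (1/2) - 1) * \<mu>)"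
      by (intro mult_left_mono) auto
    with transversal_mgf[OF K, of "1/2" P G] show "(\<Sum>t\<in>choices G K. exp (1/2 * ?X t)) \<le> real (card (choices G K)) * exp ((exp (1/2) - 1) * \<mu>)"
      by (simp add: card_choices)
  qed auto
  also have "\<dots> = real K ^ G * exp ((exp (1/2) - 1 - 1) * \<mu>)"
    by (simp add: card_choices exp_diff[symmetric] algebra_simps)
  also have "\<dots> \<le> real K ^ G * exp (- 2 * real l)"
  proof (intro mult_left_mono)
    have "exp (1/2::real) ^ Suc 1 = exp (real (Suc 1) * (1/2))" by (simp only: exp_of_nat_mult)
    also have "\<dots> \<le> 2.72" using e_less_272 by simp
    also have "\<dots> \<le> (1.65) ^ Suc 1" by (simp add: power2_eq_square)
    finally have e: "exp (1/2::real) \<le> 1.65" by (rule power_le_imp_le_base) simp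
    then have "(exp (1/2) - 1 - 1) * \<mu> \<le> - (1/200) * \<mu>" using mu0 by (intro mult_right_mono) auto
    also have "\<dots> \<le> - 2 * real l" using l by simp
    finally show "exp ((exp (1/2) - 1 - 1) * \<mu>) \<le> exp (- 2 * real l)" by simp
  qed auto
  finally show ?thesis .
qed

section \<open>Cyclic shifts of a transversal and the union bound\<close>

definition shift :: "nat \<Rightarrow> nat \<Rightarrow> nat \<Rightarrow> (nat \<Rightarrow> nat) \<Rightarrow> nat \<Rightarrow> nat" where
  "shift G K k s = (\<lambda>c\<in>{..<G}. (s c + k) mod K)"

lemma shift_choices: "0 < K \<Longrightarrow> shift G K k s \<in> choices G K"
  by (auto simp: shift_def choices_def)

lemma shift_cancel: "(a + k) mod K = (b + k) mod K \<Longrightarrow> a < K \<Longrightarrow> b < K \<Longrightarrow> a = (b::nat)"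
proof (induction a b rule: linorder_wlog)
  case (le a b)
  then have "K dvd (b + k) - (a + k)" by (subst mod_eq_dvd_iff_nat[symmetric]) auto
  then have "K dvd b - a" by simp
  with le show ?case by (auto dest: dvd_imp_le)
qed simp

lemma shift_inj: "0 < K \<Longrightarrow> inj_on (shift G K k) (choices G K)"
proof (rule inj_onI, rule ext)
  fix s t c assume K: "0 < K" and s: "s \<in> choices G K" and t: "t \<in> choices G K" and e: "shift G K k s = shift G K k t"
  show "s c = t c"
  proof (cases "c < G")
    case True
    then have "(s c + k) mod K = (t c + k) mod K" using e by (metis shift_def lessThan_iff restrict_apply')
    moreover have "s c < K" "t c < K" using s t True by (auto simp: choices_def PiE_iff)
    ultimately show ?thesis by (rule shift_cancel)
  next
    case False
    then show ?thesis using s t by (simp add: choices_def PiE_def extensional_def)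
  qed
qed

text \<open>The union bound over all properties and all shifts. Shifting is injective on
  transversals, so a property fails for a shifted transversal no more often than for an unshifted
  one.\<close>

lemma union_shift:
  assumes K: "0 < K" and I: "finite I" and P: "\<And>i. i \<in> I \<Longrightarrow> real (card {t\<in>choices G K. P i t}) \<le> real K ^ G * e"
    and e: "real (card I) * real K * e < 1"
  shows "\<exists>s\<in>choices G K. \<forall>k<K. \<forall>i\<in>I. \<not> P i (shift G K k s)"
proof (rule ccontr)
  assume "\<not> ?thesis"
  then have "choices G K \<subseteq> (\<Union>(k, i)\<in>{..<K} \<times> I. {s\<in>choices G K. P i (shift G K k s)})" by auto
  then have "card (choices G K) \<le> card (\<Union>(k, i)\<in>{..<K} \<times> I. {s\<in>choices G K. P i (shift G K k s)})"
    using I by (intro card_mono finite_UN_I) auto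
  also have "\<dots> \<le> (\<Sum>(k, i)\<in>{..<K} \<times> I. card {s\<in>choices G K. P i (shift G K k s)})"
    using card_UN_le[of "{..<K} \<times> I" "\<lambda>(k, i). {s\<in>choices G K. P i (shift G K k s)}"] I by (simp add: case_prod_unfold)
  finally have "real K ^ G \<le> real (\<Sum>(k, i)\<in>{..<K} \<times> I. card {s\<in>choices G K. P i (shift G K k s)})"
    unfolding card_choices of_nat_power[symmetric] of_nat_le_iff .
  also have "\<dots> = (\<Sum>(k, i)\<in>{..<K} \<times> I. real (card {s\<in>choices G K. P i (shift G K k s)}))"
    by (simp add: case_prod_unfold)
  also have "\<dots> \<le> (\<Sum>(k, i)\<in>{..<K} \<times> I. real K ^ G * e)"
  proof (rule sum_mono, clarify)
    fix k i assume i: "i \<in> I"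
    have "card {s\<in>choices G K. P i (shift G K k s)} = card (shift G K k ` {s\<in>choices G K. P i (shift G K k s)})"
      by (rule card_image[symmetric]) (rule inj_on_subset[OF shift_inj[OF K]], auto)
    also have "\<dots> \<le> card {t\<in>choices G K. P i t}"
      using K by (intro card_mono) (auto simp: shift_choices)
    finally show "real (card {s\<in>choices G K. P i (shift G K k s)}) \<le> real K ^ G * e" using P[OF i] by linarith
  qed
  also have "\<dots> = real K ^ G * (real (card I) * real K * e)" by (simp add: card_cartesian_product)
  finally have A: "real K ^ G \<le> real K ^ G * (real (card I) * real K * e)" .
  have "real K ^ G * (real (card I) * real K * e) < real K ^ G * 1" using e K by (intro mult_strict_left_mono) auto
  with A show False by simp
qed

section \<open>Extendable embeddings of forests\<close>

text \<open>\<open>Nb u\<close> may be a restricted, one-directional neighbourhood: later uses send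
  new vertices only into a prescribed set. \<open>cap\<close> limits the number of vertices in use.
  By \<open>big\<close>, sets of between \<open>m\<close> and \<open>2 * m\<close> vertices expand
  far beyond what the embedding can consume.\<close>

locale extendable =
  fixes V :: "'a set" and Nb :: "'a \<Rightarrow> 'a set" and D m cap :: nat
  assumes finV: "finite V" and Nb_sub: "\<And>u. u \<in> V \<Longrightarrow> Nb u \<subseteq> V" and D3: "3 \<le> D" and m1: "1 \<le> m"
    and big: "\<And>U. U \<subseteq> V \<Longrightarrow> m \<le> card U \<Longrightarrow> card U \<le> 2 * m \<Longrightarrow> cap + 2 * D * m + 1 \<le> card (\<Union>u\<in>U. Nb u)"
begin

definition NB :: "'a set \<Rightarrow> 'a set" where "NB U = (\<Union>u\<in>U. Nb u)"

text \<open>Slack in the Friedman-Pippenger condition: with \<open>\<delta>\<close> the degree in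
  the embedded forest, \<open>U\<close> should have at least \<open>(D - 1) * card U\<close>
  neighbours outside \<open>B\<close>, less \<open>\<delta> u - 1\<close> for every \<open>u\<close>
  in \<open>U \<inter> B\<close>.\<close>

definition excess :: "'a set \<Rightarrow> ('a \<Rightarrow> nat) \<Rightarrow> 'a set \<Rightarrow> int" where
  "excess B \<delta> U = int (card (NB U - B)) + int (\<Sum>u\<in>U \<inter> B. \<delta> u) - (int D - 1) * int (card U) - int (card (U \<inter> B))"

definition ext :: "'a set \<Rightarrow> ('a \<Rightarrow> nat) \<Rightarrow> bool" where
  "ext B \<delta> \<longleftrightarrow> B \<subseteq> V \<and> (\<forall>U\<subseteq>V. card U \<le> 2 * m \<longrightarrow> 0 \<le> excess B \<delta> U)"

lemma NB_sub: "U \<subseteq> V \<Longrightarrow> NB U \<subseteq> V"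
  unfolding NB_def using Nb_sub by blast

lemma fin: "U \<subseteq> V \<Longrightarrow> finite U" using finV by (rule finite_subset[rotated])

lemma finNB: "U \<subseteq> V \<Longrightarrow> finite (NB U)" by (rule fin[OF NB_sub])

text \<open>The count of neighbours is submodular and all other terms are modular.\<close>

lemma excess_submodular:
  assumes U: "U \<subseteq> V" and W: "W \<subseteq> V"
  shows "excess B \<delta> (U \<union> W) + excess B \<delta> (U \<inter> W) \<le> excess B \<delta> U + excess B \<delta> W"
proof -
  have fU: "finite U" "finite W" "finite (NB U)" "finite (NB W)" using fin[OF U] fin[OF W] finNB[OF U] finNB[OF W] by blast+
  have a: "card (U \<union> W) + card (U \<inter> W) = card U + card W"
    using card_Un_Int[OF fU(1,2)] by simp
  have UWB: "(U \<union> W) \<inter> B = (U \<inter> B) \<union> (W \<inter> B)" "(U \<inter> W) \<inter> B = (U \<inter> B) \<inter> (W \<inter> B)" by auto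
  have b: "card ((U \<union> W) \<inter> B) + card ((U \<inter> W) \<inter> B) = card (U \<inter> B) + card (W \<inter> B)"
    unfolding UWB using card_Un_Int[of "U \<inter> B" "W \<inter> B"] fU by simp
  have c: "sum \<delta> ((U \<union> W) \<inter> B) + sum \<delta> ((U \<inter> W) \<inter> B) = sum \<delta> (U \<inter> B) + sum \<delta> (W \<inter> B)"
    unfolding UWB using sum.union_inter[of "U \<inter> B" "W \<inter> B" \<delta>] fU by simp
  have "card (NB (U \<union> W) - B) + card (NB (U \<inter> W) - B) \<le> card ((NB U - B) \<union> (NB W - B)) + card ((NB U - B) \<inter> (NB W - B))"
    using fU by (intro add_mono card_mono) (auto simp: NB_def)
  also have "\<dots> = card (NB U - B) + card (NB W - B)" using card_Un_Int[of "NB U - B" "NB W - B"] fU by simp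
  finally have d: "int (card (NB (U \<union> W) - B)) + int (card (NB (U \<inter> W) - B)) \<le> int (card (NB U - B)) + int (card (NB W - B))" by linarith
  have a': "(int D - 1) * int (card (U \<union> W)) + (int D - 1) * int (card (U \<inter> W)) = (int D - 1) * int (card U) + (int D - 1) * int (card W)"
    by (simp only: distrib_left[symmetric] of_nat_add[symmetric] a)
  show ?thesis unfolding excess_def using a' b c d by linarith
qed

text \<open>\<open>B\<close> takes away at most \<open>cap\<close> neighbours, so by
  \<open>big\<close> a set of between \<open>m\<close> and \<open>2 * m\<close> vertices keeps more
  than \<open>2 * D * m\<close> of them, which exceeds everything that is subtracted. Sizes of
  critical sets thus jump over this range.\<close>

lemma crit_small:
  assumes e: "ext B \<delta>" and cB: "card B \<le> cap" and U: "U \<subseteq> V" "card U \<le> 2 * m" "excess B \<delta> U \<le> 0"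
  shows "card U < m"
proof (rule ccontr)
  assume "\<not> ?thesis"
  then have "m \<le> card U" by simp
  from big[OF U(1) this U(2)] have "cap + 2 * D * m + 1 \<le> card (NB U)" by (simp add: NB_def)
  moreover have "card (NB U) \<le> card (NB U - B) + card B"
  proof -
    have "finite B" using e fin by (auto simp: ext_def)
    then have "card (NB U) \<le> card ((NB U - B) \<union> B)" using finNB[OF U(1)] by (intro card_mono) auto
    also have "\<dots> \<le> card (NB U - B) + card B" by (rule card_Un_le)
    finally show ?thesis .
  qed
  ultimately have "2 * D * m < card (NB U - B)" using cB by linarith
  moreover have "card (U \<inter> B) \<le> card U" using fin[OF U(1)] by (intro card_mono) auto
  moreover have "D * card U \<le> 2 * D * m" using mult_le_mono2[OF U(2), of D] by (simp add: ac_simps)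
  ultimately have "int (D * card U) < int (card (NB U - B))" "int (card (U \<inter> B)) \<le> int (card U)" by linarith+
  moreover have "(int D - 1) * int (card U) = int (D * card U) - int (card U)" by (simp add: algebra_simps)
  moreover have "0 \<le> int (sum \<delta> (U \<inter> B))" by (rule of_nat_0_le_iff)
  ultimately have "0 < excess B \<delta> U" unfolding excess_def by linarith
  with U(3) show False by simp
qed

text \<open>Both sets have fewer than \<open>m\<close> vertices, so the union is still covered by
  the condition; submodularity and the nonnegative excess of the intersection make it
  critical.\<close>

lemma crit_Un:
  assumes e: "ext B \<delta>" and cB: "card B \<le> cap" and U: "U \<subseteq> V" "card U \<le> 2 * m" "excess B \<delta> U \<le> 0"
    and W: "W \<subseteq> V" "card W \<le> 2 * m" "excess B \<delta> W \<le> 0"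
  shows "card (U \<union> W) \<le> 2 * m \<and> excess B \<delta> (U \<union> W) \<le> 0"
proof -
  have "card (U \<union> W) \<le> 2 * m"
    using crit_small[OF e cB U] crit_small[OF e cB W] card_Un_le[of U W] by linarith
  moreover have "0 \<le> excess B \<delta> (U \<inter> W)"
  proof -
    have "card (U \<inter> W) \<le> card U" using fin[OF U(1)] by (intro card_mono) auto
    then have "card (U \<inter> W) \<le> 2 * m" using U by linarith
    then show ?thesis using e U(1) unfolding ext_def by (simp add: le_infI1)
  qed
  ultimately show ?thesis using excess_submodular[OF U(1) W(1), of B \<delta>] U(3) W(3) by linarith
qed

lemma crit_Union:
  assumes e: "ext B \<delta>" and cB: "card B \<le> cap" and "finite Y"
    and U: "\<And>y. y \<in> Y \<Longrightarrow> U y \<subseteq> V \<and> card (U y) \<le> 2 * m \<and> excess B \<delta> (U y) \<le> 0"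
  shows "card (\<Union>(U ` Y)) \<le> 2 * m \<and> excess B \<delta> (\<Union>(U ` Y)) \<le> 0"
  using \<open>finite Y\<close> U
proof (induction Y)
  case empty
  then show ?case by (simp add: excess_def NB_def)
next
  case (insert y Y)
  have "\<Union> (U ` Y) \<subseteq> V" using insert by blast
  then show ?case using crit_Un[OF e cB, of "U y" "\<Union>(U ` Y)"] insert by auto
qed

text \<open>The leaf itself counts once in the degrees and once in the size of the intersection, and
  the two cancel. What remains is the neighbour \<open>y\<close> that is lost and the degree that
  \<open>s\<close> gains.\<close>

lemma excess_insert:
  assumes U: "U \<subseteq> V" and B: "B \<subseteq> V" and y: "y \<notin> B" and s: "s \<in> B"
  shows "excess (insert y B) (\<delta>(s := Suc (\<delta> s), y := 1)) U
     = excess B \<delta> U - (if y \<in> NB U then 1 else 0) + (if s \<in> U then 1 else 0)"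
proof -
  have fU: "finite U" "finite (NB U)" using fin[OF U] finNB[OF U] by blast+
  have ys: "y \<noteq> s" using y s by auto
  have a: "int (card (NB U - insert y B)) = int (card (NB U - B)) - (if y \<in> NB U then 1 else 0)"
  proof (cases "y \<in> NB U")
    case True
    then have "y \<in> NB U - B" using y by simp
    then have "card (NB U - B - {y}) = card (NB U - B) - 1" by (rule card_Diff_singleton)
    moreover have "card (NB U - B) \<noteq> 0" using \<open>y \<in> NB U - B\<close> fU by (metis card_0_eq empty_iff finite_Diff)
    moreover have "NB U - insert y B = NB U - B - {y}" by auto
    ultimately show ?thesis using True by simp
  next
    case False
    then have "NB U - insert y B = NB U - B" by auto
    then show ?thesis using False by simp
  qed
  have UB: "U \<inter> insert y B = (if y \<in> U then insert y (U \<inter> B) else U \<inter> B)" by auto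
  have b: "int (card (U \<inter> insert y B)) = int (card (U \<inter> B)) + (if y \<in> U then 1 else 0)"
    unfolding UB using fU y by simp
  have c0: "sum (\<delta>(s := Suc (\<delta> s), y := 1)) (U \<inter> B) = sum \<delta> (U \<inter> B) + (if s \<in> U then 1 else 0)"
  proof -
    have "sum (\<delta>(s := Suc (\<delta> s), y := 1)) (U \<inter> B) = (\<Sum>u\<in>U \<inter> B. \<delta> u + (if u = s then 1 else 0))"
      using y by (intro sum.cong) auto
    then show ?thesis using s fU by (simp add: sum.distrib)
  qed
  have c1: "sum (\<delta>(s := Suc (\<delta> s), y := 1)) (U \<inter> insert y B) = sum \<delta> (U \<inter> B) + (if s \<in> U then 1 else 0) + (if y \<in> U then 1 else 0)"
  proof (cases "y \<in> U")
    case True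
    have "sum (\<delta>(s := Suc (\<delta> s), y := 1)) (insert y (U \<inter> B)) = (\<delta>(s := Suc (\<delta> s), y := 1)) y + sum (\<delta>(s := Suc (\<delta> s), y := 1)) (U \<inter> B)"
      using fU y by (intro sum.insert) auto
    then show ?thesis using True c0 unfolding UB by simp
  next
    case False
    then show ?thesis using c0 unfolding UB by simp
  qed
  have c: "int (sum (\<delta>(s := Suc (\<delta> s), y := 1)) (U \<inter> insert y B)) = int (sum \<delta> (U \<inter> B)) + (if s \<in> U then 1 else 0) + (if y \<in> U then 1 else 0)"
    unfolding c1 by (simp del: of_nat_sum)
  show ?thesis unfolding excess_def a b c by simp
qed

text \<open>The Friedman-Pippenger step. If every candidate fails, each one is a neighbour of a
  critical set avoiding \<open>s\<close>. The union \<open>W\<close> of these sets is critical, has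
  fewer than \<open>m\<close> vertices, and sees all free neighbours of \<open>s\<close>. Adding
  \<open>s\<close> to \<open>W\<close> then brings no new neighbour outside \<open>B\<close>, while
  the excess falls by \<open>D - \<delta> s\<close>, which is positive.\<close>

lemma add_leaf:
  assumes e: "ext B \<delta>" and cB: "card B \<le> cap" and s: "s \<in> B" "\<delta> s < D"
  shows "\<exists>y\<in>Nb s - B. ext (insert y B) (\<delta>(s := Suc (\<delta> s), y := 1))"
proof (rule ccontr)
  assume neg: "\<not> ?thesis"
  have BV: "B \<subseteq> V" using e by (simp add: ext_def)
  have sV: "s \<in> V" using s BV by auto
  define Y where "Y = Nb s - B"
  have YV: "Y \<subseteq> V" using Nb_sub[OF sV] by (auto simp: Y_def)
  have "\<forall>y\<in>Y. \<exists>U. U \<subseteq> V \<and> card U \<le> 2 * m \<and> excess B \<delta> U \<le> 0 \<and> y \<in> NB U \<and> s \<notin> U"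
  proof
    fix y assume y: "y \<in> Y"
    then have "\<not> ext (insert y B) (\<delta>(s := Suc (\<delta> s), y := 1))" using neg by (auto simp: Y_def)
    then obtain U where U: "U \<subseteq> V" "card U \<le> 2 * m" "excess (insert y B) (\<delta>(s := Suc (\<delta> s), y := 1)) U < 0"
      using BV y YV unfolding ext_def by (auto simp: not_le)
    have "y \<notin> B" using y by (simp add: Y_def)
    from excess_insert[OF U(1) BV this s(1), of \<delta>] U(3)
    have "excess B \<delta> U - (if y \<in> NB U then 1 else 0) + (if s \<in> U then 1 else 0) < 0" by simp
    moreover have "0 \<le> excess B \<delta> U" using e U unfolding ext_def by simp
    ultimately show "\<exists>U. U \<subseteq> V \<and> card U \<le> 2 * m \<and> excess B \<delta> U \<le> 0 \<and> y \<in> NB U \<and> s \<notin> U"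
      using U(1,2) by (intro exI[of _ U]) (auto split: if_splits)
  qed
  then obtain U where U: "\<And>y. y \<in> Y \<Longrightarrow> U y \<subseteq> V \<and> card (U y) \<le> 2 * m \<and> excess B \<delta> (U y) \<le> 0 \<and> y \<in> NB (U y) \<and> s \<notin> U y"
    using bchoice[of Y "\<lambda>y U. U \<subseteq> V \<and> card U \<le> 2 * m \<and> excess B \<delta> U \<le> 0 \<and> y \<in> NB U \<and> s \<notin> U"] by blast
  define W where "W = \<Union>(U ` Y)"
  have W: "card W \<le> 2 * m" "excess B \<delta> W \<le> 0"
    using crit_Union[OF e cB fin[OF YV], of U] U unfolding W_def by auto
  have WV: "W \<subseteq> V" and sW: "s \<notin> W" using U unfolding W_def by auto
  have cW: "card W < m" by (rule crit_small[OF e cB WV W])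
  have "Y \<subseteq> NB W"
  proof
    fix y assume "y \<in> Y"
    with U have "y \<in> NB (U y)" by blast
    with \<open>y \<in> Y\<close> show "y \<in> NB W" unfolding W_def NB_def by blast
  qed
  then have nb: "NB (insert s W) - B = NB W - B" unfolding Y_def NB_def by auto
  have fW: "finite W" by (rule fin[OF WV])
  have iB: "insert s W \<inter> B = insert s (W \<inter> B)" using s by auto
  have "excess B \<delta> (insert s W) = excess B \<delta> W + int (\<delta> s) - int D"
    unfolding excess_def nb iB using fW sW by (simp add: algebra_simps)
  moreover have "card (insert s W) \<le> 2 * m" using cW fW sW m1 by simp
  then have "0 \<le> excess B \<delta> (insert s W)" using e WV sV unfolding ext_def by simp
  ultimately show False using W s(2) by linarith
qed

lemma ext_mono: assumes "ext B \<delta>" "\<And>u. u \<in> B \<Longrightarrow> \<delta> u \<le> \<delta>' u" shows "ext B \<delta>'"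
proof -
  have "excess B \<delta> U \<le> excess B \<delta>' U" for U
    unfolding excess_def using sum_mono[of "U \<inter> B" \<delta> \<delta>'] assms(2) by (simp del: of_nat_sum)
  then show ?thesis using assms(1) unfolding ext_def by (meson order_trans)
qed

text \<open>A set containing \<open>s\<close> has \<open>y\<close> in its neighbourhood, so the
  freed neighbour makes up for the degree that \<open>s\<close> loses. Large trees can therefore be
  grown for a search and given back afterwards.\<close>

lemma remove_leaf:
  assumes e: "ext (insert y B) \<delta>'" and y: "y \<notin> B" and s: "s \<in> B" "y \<in> Nb s"
    and d: "\<And>u. u \<in> B \<Longrightarrow> \<delta>' u \<le> (if u = s then Suc (\<delta> u) else \<delta> u)" "\<delta>' y \<le> 1"
  shows "ext B \<delta>"
proof -
  have BV: "B \<subseteq> V" and yV: "y \<in> V" using e by (auto simp: ext_def)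
  have e': "ext (insert y B) (\<delta>(s := Suc (\<delta> s), y := 1))"
  proof (rule ext_mono[OF e])
    fix u assume "u \<in> insert y B"
    then show "\<delta>' u \<le> (\<delta>(s := Suc (\<delta> s), y := 1)) u" using d(1)[of u] d(2) by (cases "u = y") (auto split: if_splits)
  qed
  show ?thesis unfolding ext_def
  proof (intro conjI allI impI)
    fix U assume U: "U \<subseteq> V" "card U \<le> 2 * m"
    have "0 \<le> excess (insert y B) (\<delta>(s := Suc (\<delta> s), y := 1)) U" using e' U unfolding ext_def by blast
    also have "\<dots> = excess B \<delta> U - (if y \<in> NB U then 1 else 0) + (if s \<in> U then 1 else 0)"
      by (rule excess_insert[OF U(1) BV y s(1)])
    finally show "0 \<le> excess B \<delta> U" using s(2) by (auto simp: NB_def split: if_splits)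
  qed (rule BV)
qed

text \<open>A vertex of \<open>B\<close> that carries no edges yet costs one more than a vertex
  outside, hence the factor \<open>D\<close> instead of \<open>D - 1\<close>.\<close>

lemma ext_start:
  assumes "B \<subseteq> V" "\<And>U. U \<subseteq> V \<Longrightarrow> card U \<le> 2 * m \<Longrightarrow> D * card U \<le> card (NB U - B)"
  shows "ext B (\<lambda>_. 0)"
  unfolding ext_def
proof (intro conjI allI impI)
  fix U assume U: "U \<subseteq> V" "card U \<le> 2 * m"
  have "card (U \<inter> B) \<le> card U" using fin[OF U(1)] by (intro card_mono) auto
  then have "int (card (U \<inter> B)) \<le> int (card U)" by simp
  moreover have "int D * int (card U) \<le> int (card (NB U - B))" using assms(2)[OF U] by (simp only: of_nat_mult[symmetric] of_nat_le_iff)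
  ultimately show "0 \<le> excess B (\<lambda>_. 0) U" unfolding excess_def by (simp add: algebra_simps)
qed (rule assms)

section \<open>Growing and pruning forests\<close>

text \<open>A forest grown on \<open>B\<close>, as the list of its (child, parent) pairs, the most recent first.\<close>

fun chl :: "('a \<times> 'a) list \<Rightarrow> 'a set" where
  "chl [] = {}"
| "chl (p # ws) = insert (fst p) (chl ws)"

lemma chl_append [simp]: "chl (us @ vs) = chl us \<union> chl vs"
  by (induction us) auto

lemma chl_mem: "(y, s) \<in> set ws \<Longrightarrow> y \<in> chl ws"
  by (induction ws) auto

lemma finite_chl [simp]: "finite (chl ws)"
  by (induction ws) auto

lemma card_chl: "card (chl ws) \<le> length ws"
  by (induction ws) (auto intro: order_trans[OF card_insert_le_m1] simp: card_insert_if)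

lemma chl_filter: "chl (filter (\<lambda>p. fst p \<in> W) ws) = chl ws \<inter> W"
  by (induction ws) auto

fun forest :: "'a set \<Rightarrow> ('a \<times> 'a) list \<Rightarrow> bool" where
  "forest B [] \<longleftrightarrow> True"
| "forest B ((y, s) # ws) \<longleftrightarrow> y \<notin> B \<union> chl ws \<and> s \<in> B \<union> chl ws \<and> y \<in> Nb s \<and> forest B ws"

text \<open>The 1 for vertices outside \<open>B\<close> is the edge to the parent.\<close>

definition fdeg :: "'a set \<Rightarrow> ('a \<Rightarrow> nat) \<Rightarrow> ('a \<times> 'a) list \<Rightarrow> 'a \<Rightarrow> nat" where
  "fdeg B \<delta> ws u = (if u \<in> B then \<delta> u else 1) + length (filter (\<lambda>p. snd p = u) ws)"

definition extf :: "'a set \<Rightarrow> ('a \<Rightarrow> nat) \<Rightarrow> ('a \<times> 'a) list \<Rightarrow> bool" where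
  "extf B \<delta> ws \<longleftrightarrow> forest B ws \<and> ext (B \<union> chl ws) (fdeg B \<delta> ws)"

lemma forest_append_parent:
  "forest B (us @ (y, s) # vs) \<Longrightarrow> y \<notin> B \<union> chl vs \<and> y \<notin> chl us \<and> s \<in> B \<union> chl vs \<and> y \<in> Nb s"
  by (induction us) auto

lemma forest_no_child: "forest B vs \<Longrightarrow> z \<notin> B \<union> chl vs \<Longrightarrow> p \<in> set vs \<Longrightarrow> snd p \<noteq> z"
  by (induction vs) (auto dest: chl_mem)

lemma forest_disjoint: "forest B (us @ vs) \<Longrightarrow> chl us \<inter> (B \<union> chl vs) = {}"
  by (induction us) auto

lemma fdeg_new: assumes "extf B \<delta> vs" "z \<notin> B \<union> chl vs" shows "fdeg B \<delta> vs z = 1"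
proof -
  have "filter (\<lambda>p. snd p = z) vs = []"
    using forest_no_child[of B vs z] assms by (auto simp: filter_empty_conv extf_def)
  then show ?thesis using assms(2) by (simp add: fdeg_def)
qed

lemma forest_remove:
  "forest B (us @ (y, s) # vs) \<Longrightarrow> \<forall>p\<in>set us. snd p \<noteq> y \<Longrightarrow> forest B (us @ vs)"
  by (induction us) auto

lemma extf_remove:
  assumes e: "extf B \<delta> (us @ (y, s) # vs)" and us: "\<forall>p\<in>set us. snd p \<noteq> y"
  shows "extf B \<delta> (us @ vs)"
proof -
  let ?ws = "us @ (y, s) # vs"
  have f: "forest B ?ws" and x: "ext (B \<union> chl ?ws) (fdeg B \<delta> ?ws)" using e by (auto simp: extf_def)
  have y: "y \<notin> B \<union> chl vs" "y \<notin> chl us" "s \<in> B \<union> chl vs" "y \<in> Nb s"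
    using forest_append_parent[OF f] by auto
  have vs: "snd p \<noteq> y" if "p \<in> set vs" for p
  proof -
    have "forest B vs" using f by (induction us) auto
    then show ?thesis using forest_no_child[of B vs y p] y(1) that by blast
  qed
  have "ext (insert y (B \<union> chl (us @ vs))) (fdeg B \<delta> ?ws)"
    using x by (simp add: Un_ac)
  then have "ext (B \<union> chl (us @ vs)) (fdeg B \<delta> (us @ vs))"
  proof (rule remove_leaf)
    have "filter (\<lambda>p. snd p = y) ?ws = []" using us vs y(1,3) by (auto simp: filter_empty_conv)
    then show "fdeg B \<delta> ?ws y \<le> 1" using y by (simp add: fdeg_def)
  qed (use y in \<open>auto simp: fdeg_def\<close>)
  then show ?thesis using forest_remove[OF f us] by (simp add: extf_def)
qed

text \<open>Pairs are inspected from the newest to the oldest. When the turn of a child outside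
  \<open>W\<close> comes, its own children have already gone, because \<open>W\<close> is closed
  under parents up to \<open>B\<close>; so it is a leaf.\<close>

lemma extf_prune:
  assumes e: "extf B \<delta> ws" and cl: "\<And>y s. (y, s) \<in> set ws \<Longrightarrow> y \<in> W \<Longrightarrow> s \<in> B \<union> W"
  shows "extf B \<delta> (filter (\<lambda>p. fst p \<in> W) ws)"
proof -
  have "extf B \<delta> (filter (\<lambda>p. fst p \<in> W) us @ vs)" if "ws = us @ vs" for us vs
    using that
  proof (induction us arbitrary: vs rule: rev_induct)
    case Nil
    then show ?case using e by simp
  next
    case (snoc p us)
    obtain y s where p: "p = (y, s)" by fastforce
    from snoc.IH[of "p # vs"] snoc.prems have ih: "extf B \<delta> (filter (\<lambda>p. fst p \<in> W) us @ p # vs)" by simp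
    show ?case
    proof (cases "y \<in> W")
      case True
      then show ?thesis using ih p by simp
    next
      case False
      have "y \<notin> B" using forest_append_parent[of B "filter (\<lambda>p. fst p \<in> W) us" y s vs] ih p by (simp add: extf_def)
      have "\<forall>r\<in>set (filter (\<lambda>p. fst p \<in> W) us). snd r \<noteq> y"
      proof (rule ballI)
        fix r assume "r \<in> set (filter (\<lambda>p. fst p \<in> W) us)"
        then have "(fst r, snd r) \<in> set ws" "fst r \<in> W" using snoc.prems by auto
        then show "snd r \<noteq> y" using cl False \<open>y \<notin> B\<close> by blast
      qed
      from extf_remove[OF ih[unfolded p] this] show ?thesis using False p by simp
    qed
  qed
  from this[of ws "[]"] show ?thesis by simp
qed

lemma extf_add:
  assumes e: "extf B \<delta> ws" and c: "card B + length ws \<le> cap" and s: "s \<in> B \<union> chl ws" "fdeg B \<delta> ws s < D"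
  shows "\<exists>y. y \<in> Nb s \<and> y \<notin> B \<union> chl ws \<and> extf B \<delta> ((y, s) # ws)"
proof -
  have x: "ext (B \<union> chl ws) (fdeg B \<delta> ws)" using e by (simp add: extf_def)
  have "card (B \<union> chl ws) \<le> card B + card (chl ws)" by (rule card_Un_le)
  also have "card (chl ws) \<le> length ws" by (rule card_chl)
  finally have "card (B \<union> chl ws) \<le> cap" using c by linarith
  from add_leaf[OF x this s] obtain y where y: "y \<in> Nb s - (B \<union> chl ws)"
    "ext (insert y (B \<union> chl ws)) ((fdeg B \<delta> ws)(s := Suc (fdeg B \<delta> ws s), y := 1))" by blast
  have "ext (B \<union> chl ((y, s) # ws)) (fdeg B \<delta> ((y, s) # ws))"
  proof -
    have "ext (insert y (B \<union> chl ws)) (fdeg B \<delta> ((y, s) # ws))"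
      using y(2) by (rule ext_mono) (use y(1) in \<open>auto simp: fdeg_def\<close>)
    then show ?thesis by simp
  qed
  then show ?thesis using y e s by (auto simp: extf_def)
qed

fun fpath :: "('a \<times> 'a) list \<Rightarrow> 'a \<Rightarrow> 'a list \<Rightarrow> bool" where
  "fpath ws x [] \<longleftrightarrow> True"
| "fpath ws x (p # ps) \<longleftrightarrow> (p, x) \<in> set ws \<and> fpath ws p ps"

lemma fpath_mono: "fpath ws x ps \<Longrightarrow> set ws \<subseteq> set ws' \<Longrightarrow> fpath ws' x ps"
  by (induction ps arbitrary: x) auto

text \<open>A full binary tree below \<open>x\<close>, with \<open>2 ^ k\<close> leaves and at most
  \<open>2 * 2 ^ k - 2\<close> new vertices. The subtree of the first child is completed before the
  second child is attached; the last conjunct guarantees that meanwhile no degree of an older vertex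
  other than the root changes.\<close>

lemma extf_grow:
  assumes "extf B \<delta> ws" "x \<in> B \<union> chl ws" "fdeg B \<delta> ws x \<le> D - 2" "card B + length ws + 2 * 2 ^ k \<le> cap + 2"
  shows "\<exists>us Lf. extf B \<delta> (us @ ws) \<and> length us + 2 \<le> 2 * 2 ^ k \<and> card Lf = 2 ^ k \<and> finite Lf \<and> Lf \<subseteq> insert x (chl us) \<and>
     (\<forall>z\<in>Lf. \<exists>ps. length ps = k \<and> fpath us x ps \<and> last (x # ps) = z \<and> distinct ps \<and> set ps \<subseteq> chl us) \<and>
     (\<forall>u\<in>B \<union> chl ws. u \<noteq> x \<longrightarrow> fdeg B \<delta> (us @ ws) u = fdeg B \<delta> ws u)"
  using assms
proof (induction k arbitrary: ws x)
  case 0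
  then show ?case by (intro exI[of _ "[]"] exI[of _ "{x}"]) auto
next
  case (Suc k)
  have k1: "(2::nat) ^ k \<ge> 1" by simp
  have cap0: "card B + length ws + 4 * 2 ^ k \<le> cap + 2" using Suc.prems by simp
  have a1: "card B + length ws \<le> cap" using cap0 k1 by linarith
  have a2: "fdeg B \<delta> ws x < D" using Suc.prems(3) D3 by linarith
  obtain y1 where y1: "y1 \<in> Nb x" "y1 \<notin> B \<union> chl ws" "extf B \<delta> ((y1, x) # ws)"
    using extf_add[OF Suc.prems(1) _ Suc.prems(2)] a1 a2 by blast
  let ?w1 = "(y1, x) # ws"
  have "fdeg B \<delta> ws y1 = 1" by (rule fdeg_new[OF Suc.prems(1) y1(2)])
  then have d1: "fdeg B \<delta> ?w1 y1 \<le> D - 2" using y1(2) Suc.prems(2) D3 by (auto simp: fdeg_def)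
  have "card B + length ?w1 + 2 * 2 ^ k \<le> cap + 2" using cap0 k1 unfolding list.size by linarith
  from Suc.IH[OF y1(3) _ d1 this] obtain us1 L1 where
    u1: "extf B \<delta> (us1 @ ?w1)" "length us1 + 2 \<le> 2 * 2 ^ k" "card L1 = 2 ^ k" "finite L1" "L1 \<subseteq> insert y1 (chl us1)"
     "\<forall>z\<in>L1. \<exists>ps. length ps = k \<and> fpath us1 y1 ps \<and> last (y1 # ps) = z \<and> distinct ps \<and> set ps \<subseteq> chl us1"
     "\<forall>u\<in>B \<union> chl ?w1. u \<noteq> y1 \<longrightarrow> fdeg B \<delta> (us1 @ ?w1) u = fdeg B \<delta> ?w1 u" by auto
  let ?w2 = "us1 @ ?w1"
  have xin: "x \<in> B \<union> chl ?w2" using Suc.prems(2) by auto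
  have xy1: "x \<noteq> y1" using y1 Suc.prems(2) by auto
  have dx: "fdeg B \<delta> ?w2 x = Suc (fdeg B \<delta> ws x)"
    using u1(7) xy1 Suc.prems(2) by (auto simp: fdeg_def)
  have "card B + length ?w2 \<le> cap" "fdeg B \<delta> ?w2 x < D" using cap0 u1(2) dx Suc.prems(3) D3 by auto
  then obtain y2 where y2: "y2 \<in> Nb x" "y2 \<notin> B \<union> chl ?w2" "extf B \<delta> ((y2, x) # ?w2)"
    using extf_add[OF u1(1) _ xin] by auto
  let ?w3 = "(y2, x) # ?w2"
  have "fdeg B \<delta> ?w2 y2 = 1" by (rule fdeg_new[OF u1(1) y2(2)])
  then have d2: "fdeg B \<delta> ?w3 y2 \<le> D - 2" using y2(2) xin D3 by (auto simp: fdeg_def)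
  have "card B + length ?w3 + 2 * 2 ^ k \<le> cap + 2" using cap0 u1(2) by simp
  from Suc.IH[OF y2(3) _ d2 this] obtain us2 L2 where
    u2: "extf B \<delta> (us2 @ ?w3)" "length us2 + 2 \<le> 2 * 2 ^ k" "card L2 = 2 ^ k" "finite L2" "L2 \<subseteq> insert y2 (chl us2)"
     "\<forall>z\<in>L2. \<exists>ps. length ps = k \<and> fpath us2 y2 ps \<and> last (y2 # ps) = z \<and> distinct ps \<and> set ps \<subseteq> chl us2"
     "\<forall>u\<in>B \<union> chl ?w3. u \<noteq> y2 \<longrightarrow> fdeg B \<delta> (us2 @ ?w3) u = fdeg B \<delta> ?w3 u" by auto
  let ?us = "us2 @ (y2, x) # us1 @ [(y1, x)]"
  have fr2: "chl us2 \<inter> (B \<union> chl ?w3) = {}"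
    using forest_disjoint[of B us2] u2(1) unfolding extf_def by blast
  have fr1: "chl us1 \<inter> (B \<union> chl ?w1) = {}"
    using forest_disjoint[of B us1] u1(1) unfolding extf_def by blast
  have "z \<notin> L2" if "z \<in> L1" for z
  proof
    assume "z \<in> L2"
    have "z = y1 \<or> z \<in> chl us1" "z = y2 \<or> z \<in> chl us2" using u1(5) u2(5) that \<open>z \<in> L2\<close> by auto
    then show False using fr2 y2(2) by auto
  qed
  then have "L1 \<inter> L2 = {}" by auto
  then have "card (L1 \<union> L2) = 2 ^ Suc k" using u1 u2 by (simp add: card_Un_disjoint)
  moreover have "\<exists>ps. length ps = Suc k \<and> fpath ?us x ps \<and> last (x # ps) = z \<and> distinct ps \<and> set ps \<subseteq> chl ?us" if "z \<in> L1 \<union> L2" for z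
    using that
  proof
    assume "z \<in> L1"
    then obtain ps where ps: "length ps = k" "fpath us1 y1 ps" "last (y1 # ps) = z" "distinct ps" "set ps \<subseteq> chl us1"
      using u1(6) by blast
    have "fpath ?us y1 ps" using ps(2) by (rule fpath_mono) auto
    then show ?thesis using ps fr1 by (intro exI[of _ "y1 # ps"]) auto
  next
    assume "z \<in> L2"
    then obtain ps where ps: "length ps = k" "fpath us2 y2 ps" "last (y2 # ps) = z" "distinct ps" "set ps \<subseteq> chl us2"
      using u2(6) by blast
    have "fpath ?us y2 ps" using ps(2) by (rule fpath_mono) auto
    then show ?thesis using ps fr2 by (intro exI[of _ "y2 # ps"]) auto
  qed
  moreover have "\<forall>u\<in>B \<union> chl ws. u \<noteq> x \<longrightarrow> fdeg B \<delta> (?us @ ws) u = fdeg B \<delta> ws u"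
  proof (intro ballI impI)
    fix u assume u: "u \<in> B \<union> chl ws" "u \<noteq> x"
    have "u \<noteq> y1" "u \<noteq> y2" using u y1 y2 by auto
    have "fdeg B \<delta> (us2 @ ?w3) u = fdeg B \<delta> ?w3 u" using u2(7) u \<open>u \<noteq> y2\<close> by auto
    also have "\<dots> = fdeg B \<delta> ?w2 u" using u(2) by (simp add: fdeg_def)
    also have "\<dots> = fdeg B \<delta> ?w1 u" using u1(7) u \<open>u \<noteq> y1\<close> by auto
    also have "\<dots> = fdeg B \<delta> ws u" using u(2) by (simp add: fdeg_def)
    finally show "fdeg B \<delta> (?us @ ws) u = fdeg B \<delta> ws u" by simp
  qed
  ultimately show ?case using u1 u2
    by (intro exI[of _ ?us] exI[of _ "L1 \<union> L2"]) auto
qed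

end

section \<open>Connecting two vertices by a path\<close>

context extendable begin

fun nbchain :: "'a \<Rightarrow> 'a list \<Rightarrow> bool" where
  "nbchain x [] \<longleftrightarrow> True"
| "nbchain x (p # ps) \<longleftrightarrow> p \<in> Nb x \<and> nbchain p ps"

lemma forest_Nb: "forest B ws \<Longrightarrow> (y, s) \<in> set ws \<Longrightarrow> y \<in> Nb s"
  by (induction ws) auto

lemma forest_unique: "forest B ws \<Longrightarrow> (y, s) \<in> set ws \<Longrightarrow> (y, s') \<in> set ws \<Longrightarrow> s = s'"
  by (induction ws) (auto dest: chl_mem)

lemma forest_distinct: "forest B ws \<Longrightarrow> distinct ws"
  by (induction ws) (auto dest: chl_mem)

lemma fpath_nbchain: "forest B ws \<Longrightarrow> fpath ws x ps \<Longrightarrow> nbchain x ps"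
  by (induction ps arbitrary: x) (auto dest: forest_Nb)

lemma fpath_parent: "fpath ws x ps \<Longrightarrow> c \<in> set ps \<Longrightarrow> \<exists>s\<in>insert x (set ps). (c, s) \<in> set ws"
proof (induction ps arbitrary: x)
  case (Cons p ps)
  then show ?case by (cases "c = p") auto
qed simp

lemma fpath_child_unique:
  assumes f: "forest B ws"
  shows "fpath ws x ps \<Longrightarrow> distinct (x # ps) \<Longrightarrow> (c, u) \<in> set ws \<Longrightarrow> (c', u) \<in> set ws \<Longrightarrow>
    c \<in> set ps \<Longrightarrow> c' \<in> set ps \<Longrightarrow> c = c'"
proof (induction ps arbitrary: x)
  case (Cons p ps)
  have px: "(p, x) \<in> set ws" and fp: "fpath ws p ps" using Cons.prems by auto
  have no: "d = p" if "d \<in> set (p # ps)" "(d, x) \<in> set ws" for d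
  proof (rule ccontr)
    assume "d \<noteq> p"
    then have "d \<in> set ps" using that by simp
    from fpath_parent[OF fp this] obtain s where "s \<in> insert p (set ps)" "(d, s) \<in> set ws" by auto
    then have "x \<in> insert p (set ps)" using forest_unique[OF f that(2)] by auto
    then show False using Cons.prems(2) by auto
  qed
  show ?case
  proof (cases "c = p \<or> c' = p")
    case True
    then have "u = x" using forest_unique[OF f px] Cons.prems(3,4) by auto
    then show ?thesis using no Cons.prems by blast
  next
    case False
    then show ?thesis using Cons.IH[OF fp] Cons.prems by auto
  qed
qed simp

lemma length_le_1: "distinct xs \<Longrightarrow> (\<And>a b. a \<in> set xs \<Longrightarrow> b \<in> set xs \<Longrightarrow> a = b) \<Longrightarrow> length xs \<le> 1"
proof (cases xs)
  case (Cons a ys)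
  assume d: "distinct xs" and e: "\<And>a b. a \<in> set xs \<Longrightarrow> b \<in> set xs \<Longrightarrow> a = b"
  show ?thesis
  proof (cases ys)
    case (Cons b zs)
    then show ?thesis using d e[of a b] \<open>xs = a # ys\<close> by auto
  qed (use Cons in simp)
qed simp

text \<open>Binary trees of depth \<open>k\<close> are grown from \<open>x\<close> and from
  \<open>y\<close>, the hypothesis on \<open>J\<close> supplies a pair of leaves, and everything but
  their two branches is pruned. \<open>J\<close> is only asked about leaves reached by
  \<open>k\<close> steps that avoid \<open>B\<close>; in \<open>link_stage\<close> this tells on
  which side the leaves lie.\<close>

theorem connect:
  assumes e: "ext B \<delta>" and xy: "x \<in> B" "y \<in> B" "x \<noteq> y" and d: "\<delta> x \<le> D - 2" "\<delta> y \<le> D - 2"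
    and k: "1 \<le> k" and c: "card B + 4 * 2 ^ k \<le> cap + 4"
    and J: "\<And>X Y. X \<subseteq> V - B \<Longrightarrow> Y \<subseteq> V - B \<Longrightarrow> X \<inter> Y = {} \<Longrightarrow> card X = 2 ^ k \<Longrightarrow> card Y = 2 ^ k \<Longrightarrow>
      \<forall>z\<in>X. \<exists>ps. length ps = k \<and> nbchain x ps \<and> last ps = z \<and> set ps \<inter> B = {} \<Longrightarrow>
      \<forall>z\<in>Y. \<exists>ps. length ps = k \<and> nbchain y ps \<and> last ps = z \<and> set ps \<inter> B = {} \<Longrightarrow> \<exists>u\<in>X. \<exists>w\<in>Y. J u w"
  shows "\<exists>ps qs. length ps = k \<and> length qs = k \<and> distinct (ps @ qs) \<and> set (ps @ qs) \<subseteq> V - B \<and>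
    nbchain x ps \<and> nbchain y qs \<and> J (last ps) (last qs) \<and>
    ext (B \<union> set (ps @ qs)) (\<lambda>u. if u = x \<or> u = y then Suc (\<delta> u) else if u \<in> B then \<delta> u else 2)"
proof -
  have e0: "extf B \<delta> []"
    unfolding extf_def using ext_mono[OF e, of "fdeg B \<delta> []"] by (simp add: fdeg_def)
  have k2: "(2::nat) ^ k \<ge> 1" by simp
  have c1: "card B + length ([]::('a\<times>'a) list) + 2 * 2 ^ k \<le> cap + 2" using c k2 unfolding list.size by linarith
  have d1: "fdeg B \<delta> [] x \<le> D - 2" using d xy by (simp add: fdeg_def)
  obtain us X where us: "extf B \<delta> (us @ [])" "length us + 2 \<le> 2 * 2 ^ k" "card X = 2 ^ k" "finite X" "X \<subseteq> insert x (chl us)"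
     "\<forall>z\<in>X. \<exists>ps. length ps = k \<and> fpath us x ps \<and> last (x # ps) = z \<and> distinct ps \<and> set ps \<subseteq> chl us"
     "\<forall>u\<in>B \<union> chl []. u \<noteq> x \<longrightarrow> fdeg B \<delta> (us @ []) u = fdeg B \<delta> [] u"
    using extf_grow[OF e0 _ d1 c1] xy by auto
  have u1: "extf B \<delta> us" using us(1) by simp
  have c2: "card B + length us + 2 * 2 ^ k \<le> cap + 2" using c us(2) by linarith
  have d2: "fdeg B \<delta> us y \<le> D - 2" using us(7) d xy by (simp add: fdeg_def)
  obtain vs Y where vs: "extf B \<delta> (vs @ us)" "length vs + 2 \<le> 2 * 2 ^ k" "card Y = 2 ^ k" "finite Y" "Y \<subseteq> insert y (chl vs)"
     "\<forall>z\<in>Y. \<exists>ps. length ps = k \<and> fpath vs y ps \<and> last (y # ps) = z \<and> distinct ps \<and> set ps \<subseteq> chl vs"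
    using extf_grow[OF u1 _ d2 c2] xy by auto
  let ?ws = "vs @ us"
  have fw: "forest B ?ws" and xw: "ext (B \<union> chl ?ws) (fdeg B \<delta> ?ws)" using vs(1) by (auto simp: extf_def)
  have fu: "forest B us" using u1 by (simp add: extf_def)
  have dj: "chl vs \<inter> (B \<union> chl us) = {}" by (rule forest_disjoint[OF fw])
  have dj2: "chl us \<inter> B = {}" using forest_disjoint[of B us "[]"] fu by simp
  have cV: "chl ?ws \<subseteq> V" using xw by (auto simp: ext_def)
  have lastne: "last (a # ps) = last ps" if "length ps = k" for a and ps :: "'a list" using that k by (cases ps) auto
  have lastin: "last ps \<in> set ps" if "length ps = k" for ps :: "'a list" using that k by (cases ps) auto
  have PX: "\<exists>ps. length ps = k \<and> fpath ?ws x ps \<and> last ps = z \<and> distinct ps \<and> set ps \<subseteq> chl us" if "z \<in> X" for z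
  proof -
    obtain ps where "length ps = k" "fpath us x ps" "last (x # ps) = z" "distinct ps" "set ps \<subseteq> chl us" using us(6) \<open>z \<in> X\<close> by blast
    then show ?thesis using fpath_mono[of us x ps ?ws] lastne by (intro exI[of _ ps]) auto
  qed
  have PY: "\<exists>ps. length ps = k \<and> fpath ?ws y ps \<and> last ps = z \<and> distinct ps \<and> set ps \<subseteq> chl vs" if "z \<in> Y" for z
  proof -
    obtain ps where "length ps = k" "fpath vs y ps" "last (y # ps) = z" "distinct ps" "set ps \<subseteq> chl vs" using vs(6) \<open>z \<in> Y\<close> by blast
    then show ?thesis using fpath_mono[of vs y ps ?ws] lastne by (intro exI[of _ ps]) auto
  qed
  have X: "X \<subseteq> chl us" using PX lastin by blast
  have Y: "Y \<subseteq> chl vs" using PY lastin by blast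
  have "\<exists>u\<in>X. \<exists>w\<in>Y. J u w"
  proof (rule J)
    show "\<forall>z\<in>X. \<exists>ps. length ps = k \<and> nbchain x ps \<and> last ps = z \<and> set ps \<inter> B = {}"
    proof
      fix z assume "z \<in> X"
      then obtain ps where ps: "length ps = k" "fpath ?ws x ps" "last ps = z" "distinct ps" "set ps \<subseteq> chl us" using PX by blast
      have "set ps \<inter> B = {}" using ps(5) dj2 by blast
      then show "\<exists>ps. length ps = k \<and> nbchain x ps \<and> last ps = z \<and> set ps \<inter> B = {}"
        using ps fpath_nbchain[OF fw ps(2)] by blast
    qed
    show "\<forall>z\<in>Y. \<exists>ps. length ps = k \<and> nbchain y ps \<and> last ps = z \<and> set ps \<inter> B = {}"
    proof
      fix z assume "z \<in> Y"
      then obtain ps where ps: "length ps = k" "fpath ?ws y ps" "last ps = z" "distinct ps" "set ps \<subseteq> chl vs" using PY by blast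
      have "set ps \<inter> B = {}" using ps(5) dj by blast
      then show "\<exists>ps. length ps = k \<and> nbchain y ps \<and> last ps = z \<and> set ps \<inter> B = {}"
        using ps fpath_nbchain[OF fw ps(2)] by blast
    qed
  qed (use X Y dj dj2 cV us(3) vs(3) in auto)
  then obtain u w where uw: "u \<in> X" "w \<in> Y" "J u w" by blast
  obtain ps where ps: "length ps = k" "fpath ?ws x ps" "last ps = u" "distinct ps" "set ps \<subseteq> chl us" using PX[OF uw(1)] by blast
  obtain qs where qs: "length qs = k" "fpath ?ws y qs" "last qs = w" "distinct qs" "set qs \<subseteq> chl vs" using PY[OF uw(2)] by blast
  define W where "W = set (ps @ qs)"
  have WV: "W \<subseteq> V - B" using ps(5) qs(5) dj dj2 cV by (auto simp: W_def)
  have dis: "distinct (ps @ qs)" using ps qs dj by auto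
  have xW: "x \<notin> W" "y \<notin> W" using WV xy by auto
  define ws' where "ws' = filter (\<lambda>p. fst p \<in> W) ?ws"
  have par: "s \<in> insert x (set ps)" if cs: "(c, s) \<in> set ?ws" "c \<in> set ps" for c s
  proof -
    obtain s' where "s' \<in> insert x (set ps)" "(c, s') \<in> set ?ws" using fpath_parent[OF ps(2) cs(2)] by auto
    then show ?thesis using forest_unique[OF fw cs(1)] by auto
  qed
  have par': "s \<in> insert y (set qs)" if cs: "(c, s) \<in> set ?ws" "c \<in> set qs" for c s
  proof -
    obtain s' where "s' \<in> insert y (set qs)" "(c, s') \<in> set ?ws" using fpath_parent[OF qs(2) cs(2)] by auto
    then show ?thesis using forest_unique[OF fw cs(1)] by auto
  qed
  have e': "extf B \<delta> ws'" unfolding ws'_def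
  proof (rule extf_prune[OF vs(1)])
    fix c s assume cs: "(c, s) \<in> set ?ws" "c \<in> W"
    then have "s \<in> insert x (set ps) \<or> s \<in> insert y (set qs)" using par par' unfolding W_def by auto
    then show "s \<in> B \<union> W" using xy unfolding W_def by auto
  qed
  have "chl ws' = W"
  proof -
    have "W \<subseteq> chl ?ws" using ps(5) qs(5) by (auto simp: W_def)
    then show ?thesis unfolding ws'_def chl_filter by blast
  qed
  then have e2: "ext (B \<union> W) (fdeg B \<delta> ws')" using e' by (simp add: extf_def)
  \<comment> \<open>A vertex keeps at most one child on the two branches. So new vertices end with
    degree at most 2, and \<open>x\<close> and \<open>y\<close> gain at most one.\<close>
  have one: "length (filter (\<lambda>p. snd p = u) ws') \<le> 1" for u
  proof (rule length_le_1)
    show "distinct (filter (\<lambda>p. snd p = u) ws')" unfolding ws'_def by (intro distinct_filter forest_distinct[OF fw])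
    fix a b assume a: "a \<in> set (filter (\<lambda>p. snd p = u) ws')" and b: "b \<in> set (filter (\<lambda>p. snd p = u) ws')"
    define ca cb where "ca = fst a" "cb = fst b"
    have sab: "snd a = u" "snd b = u" "a \<in> set ws'" "b \<in> set ws'" using a b unfolding set_filter by blast+
    then have ab: "a = (ca, u)" "b = (cb, u)" by (auto simp: ca_cb_def prod_eq_iff)
    have in1: "(ca, u) \<in> set ?ws" "(cb, u) \<in> set ?ws" "ca \<in> W" "cb \<in> W"
      using sab(3,4) unfolding ab ws'_def by auto
    have "ca \<in> set ps \<and> cb \<in> set ps \<or> ca \<in> set qs \<and> cb \<in> set qs"
    proof (rule ccontr)
      assume "\<not> ?thesis"
      then have "u \<in> insert x (set ps)" "u \<in> insert y (set qs)" using in1 par par' unfolding W_def by auto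
      then show False using xW xy dis unfolding W_def by auto
    qed
    then have "ca = cb"
      using fpath_child_unique[OF fw ps(2) _ in1(1,2)] fpath_child_unique[OF fw qs(2) _ in1(1,2)] ps(4) qs(4) xW
      unfolding W_def by auto
    then show "a = b" using ab by simp
  qed
  have none: "filter (\<lambda>p. snd p = u) ws' = []" if "u \<in> B" "u \<noteq> x" "u \<noteq> y" for u
  proof -
    have "snd p \<noteq> u" if "p \<in> set ws'" for p
    proof -
      obtain c s where p: "p = (c, s)" by fastforce
      have "(c, s) \<in> set ?ws" "c \<in> W" using that unfolding ws'_def p by auto
      then have "s \<in> insert x (set ps) \<or> s \<in> insert y (set qs)" using par par' unfolding W_def by fastforce
      then show ?thesis using \<open>u \<in> B\<close> \<open>u \<noteq> x\<close> \<open>u \<noteq> y\<close> WV unfolding W_def p by auto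
    qed
    then show ?thesis by (auto simp: filter_empty_conv)
  qed
  have "ext (B \<union> W) (\<lambda>u. if u = x \<or> u = y then Suc (\<delta> u) else if u \<in> B then \<delta> u else 2)"
  proof (rule ext_mono[OF e2])
    fix u assume "u \<in> B \<union> W"
    then show "fdeg B \<delta> ws' u \<le> (if u = x \<or> u = y then Suc (\<delta> u) else if u \<in> B then \<delta> u else 2)"
      using one[of u] none[of u] xy unfolding fdeg_def by (cases "u = x \<or> u = y") auto
  qed
  then show ?thesis
    using ps qs dis WV uw fpath_nbchain[OF fw ps(2)] fpath_nbchain[OF fw qs(2)]
    unfolding W_def by (intro exI[of _ ps] exI[of _ qs]) auto
qed

end

section \<open>Absorbers\<close>

text \<open>The ends do not depend on the subset, so absorbers can be strung together and closed to
  a cycle before the subset is known.\<close>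

definition absorbs :: "('a \<Rightarrow> 'a \<Rightarrow> bool) \<Rightarrow> 'a \<Rightarrow> 'a \<Rightarrow> 'a set \<Rightarrow> 'a set \<Rightarrow> bool" where
  "absorbs E s t S R \<longleftrightarrow> (\<forall>R'\<subseteq>R. \<exists>xs. distinct xs \<and> successively E xs \<and> set xs = S \<union> R' \<and> xs \<noteq> [] \<and> hd xs = s \<and> last xs = t)"

definition spanning_path :: "('a \<Rightarrow> 'a \<Rightarrow> bool) \<Rightarrow> 'a \<Rightarrow> 'a \<Rightarrow> 'a set \<Rightarrow> bool" where
  "spanning_path E s t S \<longleftrightarrow> (\<exists>xs. distinct xs \<and> successively E xs \<and> set xs = S \<and> xs \<noteq> [] \<and> hd xs = s \<and> last xs = t)"

lemma absorbs_alt: "absorbs E s t S R \<longleftrightarrow> (\<forall>R'\<subseteq>R. spanning_path E s t (S \<union> R'))"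
  by (simp add: absorbs_def spanning_path_def)

lemma spanning_singleton: "spanning_path E s s {s}"
  unfolding spanning_path_def by (intro exI[of _ "[s]"]) auto

lemma successively_link: 
  "successively E xs \<Longrightarrow> successively E ys \<Longrightarrow> xs \<noteq> [] \<Longrightarrow> ys \<noteq> [] \<Longrightarrow> E (last xs) (hd ys) \<Longrightarrow> successively E (xs @ ys)"
  by (simp add: successively_append_iff)

lemma spanning_join:
  assumes "spanning_path E s t S" "spanning_path E s' t' S'" "E t s'" "S \<inter> S' = {}"
  shows "spanning_path E s t' (S \<union> S')"
proof -
  obtain xs where xs: "distinct xs" "successively E xs" "set xs = S" "xs \<noteq> []" "hd xs = s" "last xs = t"
    using assms(1) unfolding spanning_path_def by auto
  obtain ys where ys: "distinct ys" "successively E ys" "set ys = S'" "ys \<noteq> []" "hd ys = s'" "last ys = t'"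
    using assms(2) unfolding spanning_path_def by auto
  have "successively E (xs @ ys)" using xs ys assms(3) by (intro successively_link) auto
  then show ?thesis unfolding spanning_path_def using xs ys assms(4)
    by (intro exI[of _ "xs @ ys"]) auto
qed

lemma spanning_cons: "spanning_path E s t S \<Longrightarrow> E u s \<Longrightarrow> u \<notin> S \<Longrightarrow> spanning_path E u t (insert u S)"
  using spanning_join[OF spanning_singleton, of E s t S u] by auto

lemma spanning_list: "distinct xs \<Longrightarrow> successively E xs \<Longrightarrow> xs \<noteq> [] \<Longrightarrow> spanning_path E (hd xs) (last xs) (set xs)"
  unfolding spanning_path_def by blast

text \<open>The two routes through a ladder both end in \<open>t\<close>: one starts at the rail vertex \<open>u\<close>, the other at \<open>w\<close>.\<close>

definition ladder :: "('a \<Rightarrow> 'a \<Rightarrow> bool) \<Rightarrow> 'a \<Rightarrow> 'a \<Rightarrow> 'a set \<Rightarrow> 'a \<Rightarrow> bool" where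
  "ladder E u w S t \<longleftrightarrow> spanning_path E u t S \<and> spanning_path E w t S"

text \<open>A rung exchanges the routes: the one from \<open>p\<close> runs along the rung to
  \<open>b\<close> and continues as the old route from \<open>w\<close>, the one from
  \<open>b\<close> runs back to \<open>p\<close> and continues from \<open>u\<close>. Both visit the
  whole rung.\<close>

lemma ladder_step:
  assumes l: "ladder E u w S t" and sym: "\<And>a b. E a b \<Longrightarrow> E b a" and e: "E p u" "E b w"
    and ls: "distinct (p # ls @ [b])" "successively E (p # ls @ [b])" and dj: "set (p # ls @ [b]) \<inter> S = {}"
  shows "ladder E p b (set (p # ls @ [b]) \<union> S) t"
proof -
  have r: "spanning_path E p b (set (p # ls @ [b]))"
    using spanning_list[of "p # ls @ [b]" E] ls by simp
  have sr: "successively E (rev (p # ls @ [b]))"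
    unfolding successively_rev using ls(2) sym by (rule successively_mono) auto
  have r': "spanning_path E b p (set (p # ls @ [b]))"
  proof -
    have "distinct (rev (p # ls @ [b]))" using ls(1) by auto
    from spanning_list[OF this sr] ls(1) show ?thesis by (auto simp: insert_commute)
  qed
  show ?thesis using l spanning_join[OF r _ e(2) dj, of t] spanning_join[OF r' _ e(1) dj, of t]
    unfolding ladder_def by auto
qed

lemma absorbs_join:
  assumes a: "absorbs E s t S R" "absorbs E s' t' S' R'" and ls: "distinct ls" "successively E (t # ls @ [s'])"
    and dj: "(S \<union> R) \<inter> (S' \<union> R') = {}" "set ls \<inter> (S \<union> R) = {}" "set ls \<inter> (S' \<union> R') = {}"
  shows "absorbs E s t' (S \<union> set ls \<union> S') (R \<union> R')"
  unfolding absorbs_alt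
proof (intro allI impI)
  fix Q assume Q: "Q \<subseteq> R \<union> R'"
  have 1: "spanning_path E s t (S \<union> (Q \<inter> R))" and 2: "spanning_path E s' t' (S' \<union> (Q \<inter> R'))"
    using a(1)[unfolded absorbs_alt, rule_format, of "Q \<inter> R"] a(2)[unfolded absorbs_alt, rule_format, of "Q \<inter> R'"] by simp_all
  have "spanning_path E s t' ((S \<union> (Q \<inter> R)) \<union> set ls \<union> (S' \<union> (Q \<inter> R')))"
  proof (cases "ls = []")
    case True
    then show ?thesis using spanning_join[OF 1 2] ls dj by auto
  next
    case False
    have sl: "successively E ls" "E t (hd ls)" "E (last ls) s'"
      using ls(2) False by (auto simp: successively_Cons successively_append_iff)
    have 3: "spanning_path E (hd ls) (last ls) (set ls)" using ls(1) sl(1) False by (intro spanning_list)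
    have 4: "spanning_path E s (last ls) ((S \<union> (Q \<inter> R)) \<union> set ls)"
      using dj by (intro spanning_join[OF 1 3 sl(2)]) auto
    show ?thesis using dj by (intro spanning_join[OF 4 2 sl(3)]) auto
  qed
  moreover have "(S \<union> (Q \<inter> R)) \<union> set ls \<union> (S' \<union> (Q \<inter> R')) = S \<union> set ls \<union> S' \<union> Q" using Q by auto
  ultimately show "spanning_path E s t' (S \<union> set ls \<union> S' \<union> Q)" by simp
qed

section \<open>Absorbers inside a host graph\<close>

locale extendable_graph = extendable V Nb D m cap
  for V :: "'a set" and Nb D m cap +
  fixes E :: "'a \<Rightarrow> 'a \<Rightarrow> bool"
  assumes Esym: "\<And>u w. E u w \<Longrightarrow> E w u" and NbE: "\<And>u w. w \<in> Nb u \<Longrightarrow> E u w"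
begin

lemma nbchain_successively: "nbchain x ps \<Longrightarrow> successively E (x # ps)"
  by (induction ps arbitrary: x) (auto simp: successively_Cons NbE)

lemma connect_path:
  assumes e: "ext B \<delta>" and xy: "x \<in> B" "y \<in> B" "x \<noteq> y" and d: "\<delta> x \<le> D - 2" "\<delta> y \<le> D - 2"
    and k: "1 \<le> k" and c: "card B + 4 * 2 ^ k \<le> cap + 4"
    and J: "\<And>X Y. X \<subseteq> V - B \<Longrightarrow> Y \<subseteq> V - B \<Longrightarrow> X \<inter> Y = {} \<Longrightarrow> card X = 2 ^ k \<Longrightarrow> card Y = 2 ^ k \<Longrightarrow>
      \<forall>z\<in>X. \<exists>ps. length ps = k \<and> nbchain x ps \<and> last ps = z \<and> set ps \<inter> B = {} \<Longrightarrow>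
      \<forall>z\<in>Y. \<exists>ps. length ps = k \<and> nbchain y ps \<and> last ps = z \<and> set ps \<inter> B = {} \<Longrightarrow> \<exists>u\<in>X. \<exists>w\<in>Y. E u w"
  shows "\<exists>ps qs. length ps = k \<and> length qs = k \<and> distinct (ps @ rev qs) \<and> set (ps @ rev qs) \<subseteq> V - B \<and>
    successively E (x # ps @ rev qs @ [y]) \<and>
    ext (B \<union> set (ps @ rev qs)) (\<lambda>u. if u = x \<or> u = y then Suc (\<delta> u) else if u \<in> B then \<delta> u else 2)"
proof -
  obtain ps qs where p: "length ps = k" "length qs = k" "distinct (ps @ qs)" "set (ps @ qs) \<subseteq> V - B"
    "nbchain x ps" "nbchain y qs" "E (last ps) (last qs)"
    "ext (B \<union> set (ps @ qs)) (\<lambda>u. if u = x \<or> u = y then Suc (\<delta> u) else if u \<in> B then \<delta> u else 2)"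
    using connect[OF e xy d k c, of E] J by blast
  have ne: "ps \<noteq> []" "qs \<noteq> []" using p(1,2) k by auto
  have a: "successively E (x # ps)" using nbchain_successively[OF p(5)] .
  have "successively E (rev (y # qs))" unfolding successively_rev
    using nbchain_successively[OF p(6)] by (rule successively_mono) (auto intro: Esym)
  then have b: "successively E (rev qs @ [y])" by simp
  have "successively E ((x # ps) @ rev qs @ [y])"
  proof (rule successively_link[OF a b])
    show "E (last (x # ps)) (hd (rev qs @ [y]))" using ne p(7) by (simp add: hd_append hd_rev)
  qed simp_all
  then show ?thesis using p by (intro exI[of _ ps] exI[of _ qs]) auto
qed

end

text \<open>Vertices of degree 2, such as those on a rail, must still be linked, and growing a tree
  from a vertex needs degree at most \<open>D - 2\<close>; hence \<open>4 \<le> D\<close>. By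
  \<open>km\<close> the leaves of two trees are numerous enough for \<open>edge\<close>.\<close>

locale absorber_host = extendable_graph V Nb D m cap E
  for V :: "'a set" and Nb D m cap E +
  fixes k :: nat
  assumes D4: "4 \<le> D" and km: "m \<le> 2 ^ k" and k1: "1 \<le> k"
    and edge: "\<And>X Y. X \<subseteq> V \<Longrightarrow> Y \<subseteq> V \<Longrightarrow> m \<le> card X \<Longrightarrow> m \<le> card Y \<Longrightarrow> \<exists>u\<in>X. \<exists>w\<in>Y. E u w"
begin

lemma link:
  assumes e: "ext B \<delta>" and xy: "x \<in> B" "y \<in> B" "x \<noteq> y" and d: "\<delta> x \<le> 2" "\<delta> y \<le> 2" and c: "card B + 4 * 2 ^ k \<le> cap"
  shows "\<exists>ps qs. length ps = k \<and> length qs = k \<and> distinct (ps @ rev qs) \<and> set (ps @ rev qs) \<subseteq> V - B \<and>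
    successively E (x # ps @ rev qs @ [y]) \<and>
    ext (B \<union> set (ps @ rev qs)) (\<lambda>u. if u = x \<or> u = y then Suc (\<delta> u) else if u \<in> B then \<delta> u else 2)"
proof (rule connect_path[OF e xy _ _ k1])
  show "\<delta> x \<le> D - 2" "\<delta> y \<le> D - 2" using d D4 by linarith+
  show "card B + 4 * 2 ^ k \<le> cap + 4" using c by linarith
next
  fix X Y assume X: "X \<subseteq> V - B" "Y \<subseteq> V - B" and c: "card X = 2 ^ k" "card Y = 2 ^ k"
  then show "\<exists>u\<in>X. \<exists>w\<in>Y. E u w" using edge[of X Y] km by auto
qed

text \<open>The rails \<open>ps\<close> and \<open>bs\<close> run towards a common end
  \<open>t\<close>. The ladder is built from \<open>t\<close> outwards, with one linking path for
  every rung.\<close>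

lemma rungs:
  assumes "length ps = length bs" "distinct (ps @ bs)" "set (ps @ bs) \<subseteq> B" "ext B \<delta>" "\<And>v. v \<in> set (ps @ bs) \<Longrightarrow> \<delta> v \<le> 2"
    "successively E (ps @ [t])" "successively E (bs @ [t])" "t \<in> B" "t \<notin> set (ps @ bs)"
    "card B + length ps * (2 * k) + 4 * 2 ^ k \<le> cap"
  shows "\<exists>Q \<delta>'. Q \<subseteq> V - B \<and> finite Q \<and> card Q \<le> length ps * (2 * k) \<and> ext (B \<union> Q) \<delta>' \<and>
    (\<forall>v\<in>B. v \<notin> set (ps @ bs) \<longrightarrow> \<delta>' v = \<delta> v) \<and>
    ladder E (hd (ps @ [t])) (hd (bs @ [t])) (set (ps @ bs) \<union> Q \<union> {t}) t"
  using assms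
proof (induction ps bs rule: list_induct2)
  case Nil
  then show ?case
    by (intro exI[of _ "{}"] exI[of _ \<delta>]) (auto simp: ladder_def spanning_singleton)
next
  case (Cons p ps b bs)
  have pre: "distinct (ps @ bs)" "set (ps @ bs) \<subseteq> B" "ext B \<delta>" "\<And>v. v \<in> set (ps @ bs) \<Longrightarrow> \<delta> v \<le> 2"
    "successively E (ps @ [t])" "successively E (bs @ [t])" "t \<in> B" "t \<notin> set (ps @ bs)"
    "card B + length ps * (2 * k) + 4 * 2 ^ k \<le> cap"
    using Cons.prems by (auto simp: successively_Cons)
  obtain Q \<delta>' where Q: "Q \<subseteq> V - B" "finite Q" "card Q \<le> length ps * (2 * k)" "ext (B \<union> Q) \<delta>'"
    "\<forall>v\<in>B. v \<notin> set (ps @ bs) \<longrightarrow> \<delta>' v = \<delta> v"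
    "ladder E (hd (ps @ [t])) (hd (bs @ [t])) (set (ps @ bs) \<union> Q \<union> {t}) t"
    using Cons.IH[OF pre] by blast
  have pb: "p \<in> B" "b \<in> B" "p \<noteq> b" "p \<notin> set (ps @ bs)" "b \<notin> set (ps @ bs)" "p \<noteq> t" "b \<noteq> t" using Cons.prems by auto
  have dd: "\<delta>' p \<le> 2" "\<delta>' b \<le> 2" using Q(5) pb Cons.prems(4)[of p] Cons.prems(4)[of b] by auto
  have cb: "card (B \<union> Q) + 4 * 2 ^ k \<le> cap"
    using card_Un_le[of B Q] Q(3) Cons.prems(9) by simp
  obtain us vs where uv: "length us = k" "length vs = k" "distinct (us @ rev vs)" "set (us @ rev vs) \<subseteq> V - (B \<union> Q)"
    "successively E (p # us @ rev vs @ [b])"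
    "ext ((B \<union> Q) \<union> set (us @ rev vs)) (\<lambda>u. if u = p \<or> u = b then Suc (\<delta>' u) else if u \<in> B \<union> Q then \<delta>' u else 2)"
    using link[OF Q(4) _ _ pb(3) dd cb] pb by blast
  let ?ls = "us @ rev vs"
  have E1: "E p (hd (ps @ [t]))" "E b (hd (bs @ [t]))"
    using Cons.prems(5,6) by (auto simp: successively_Cons split: if_splits)
  have dj: "set (p # ?ls @ [b]) \<inter> (set (ps @ bs) \<union> Q \<union> {t}) = {}"
    using uv(4) pb Q(1) pre(2,7) by auto
  have dis: "distinct (p # ?ls @ [b])" using uv(3,4) pb by auto
  have suc: "successively E (p # ?ls @ [b])" using uv(5) by simp
  have lad: "ladder E p b (set (p # ?ls @ [b]) \<union> (set (ps @ bs) \<union> Q \<union> {t})) t"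
    by (rule ladder_step[OF Q(6) Esym E1 dis suc dj])
  show ?case
  proof (intro exI conjI)
    show "Q \<union> set ?ls \<subseteq> V - B" using Q(1) uv(4) by auto
    show "finite (Q \<union> set ?ls)" using Q(2) by simp
    have "card (set ?ls) \<le> 2 * k" using card_length[of ?ls] uv(1,2) by simp
    then show "card (Q \<union> set ?ls) \<le> length (p # ps) * (2 * k)"
      using card_Un_le[of Q "set ?ls"] Q(3) by simp
    show "ext (B \<union> (Q \<union> set ?ls)) (\<lambda>u. if u = p \<or> u = b then Suc (\<delta>' u) else if u \<in> B \<union> Q then \<delta>' u else 2)"
      using uv(6) by (simp add: Un_assoc)
    show "\<forall>v\<in>B. v \<notin> set ((p # ps) @ b # bs) \<longrightarrow> (if v = p \<or> v = b then Suc (\<delta>' v) else if v \<in> B \<union> Q then \<delta>' v else 2) = \<delta> v"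
      using Q(5) by auto
    have "set (p # ?ls @ [b]) \<union> (set (ps @ bs) \<union> Q \<union> {t}) = set ((p # ps) @ b # bs) \<union> (Q \<union> set ?ls) \<union> {t}" by auto
    then show "ladder E (hd ((p # ps) @ [t])) (hd ((b # bs) @ [t])) (set ((p # ps) @ b # bs) \<union> (Q \<union> set ?ls) \<union> {t}) t"
      using lad by simp
  qed
qed

text \<open>Two neighbours \<open>x\<close> and \<open>y\<close> of \<open>r\<close> are joined by a
  path with \<open>2 * k\<close> inner vertices, which closes a cycle of odd length
  \<open>2 * k + 3\<close> through \<open>r\<close>. Leaving out \<open>r\<close> and
  \<open>x\<close>, the rest falls into two rails of \<open>k\<close> vertices with the common end
  \<open>t\<close>. From \<open>x\<close> one may enter the ladder by the first rail, or go through
  \<open>r\<close> to \<open>y\<close> and enter by the second; either way the whole ladder is swept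
  and the path ends in \<open>t\<close>.\<close>

lemma absorber_one:
  assumes e: "ext B \<delta>" and r: "r \<in> B" "\<delta> r = 0" and c: "card B + (2 * k + 2) + k * (2 * k) + 4 * 2 ^ k \<le> cap"
  shows "\<exists>x t S \<delta>'. S \<subseteq> V - B \<and> finite S \<and> card S \<le> (2 * k + 2) + k * (2 * k) \<and> ext (B \<union> S) \<delta>' \<and>
    x \<in> S \<and> t \<in> S \<and> x \<noteq> t \<and> \<delta>' x \<le> 2 \<and> \<delta>' t \<le> 2 \<and> (\<forall>v\<in>B. v \<noteq> r \<longrightarrow> \<delta>' v = \<delta> v) \<and> absorbs E x t S {r}"
proof -
  have BV: "B \<subseteq> V" using e by (simp add: ext_def)
  have fB: "finite B" using fin BV by blast
  obtain x where x: "x \<in> Nb r - B" "ext (insert x B) (\<delta>(r := Suc (\<delta> r), x := 1))"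
    using add_leaf[OF e _ r(1)] c r D4 by auto
  let ?B1 = "insert x B" and ?d1 = "\<delta>(r := Suc (\<delta> r), x := 1)"
  have cB1: "card ?B1 \<le> Suc (card B)" using fB by (simp add: card_insert_if)
  obtain y where y: "y \<in> Nb r - ?B1" "ext (insert y ?B1) (?d1(r := Suc (?d1 r), y := 1))"
  proof -
    have "card ?B1 \<le> cap" using cB1 c by linarith
    moreover have "?d1 r < D" using r x(1) D4 by auto
    ultimately show ?thesis using add_leaf[OF x(2), of r] r(1) that by blast
  qed
  let ?B2 = "insert y ?B1" and ?d2 = "?d1(r := Suc (?d1 r), y := 1)"
  have cB2: "card ?B2 \<le> card B + 2" using fB cB1 by (simp add: card_insert_if)
  have xy: "x \<noteq> y" "x \<noteq> r" "y \<noteq> r" using x y r by auto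
  have c2: "card ?B2 + 4 * 2 ^ k \<le> cap" using c cB2 by linarith
  obtain ps qs where pq: "length ps = k" "length qs = k" "distinct (ps @ rev qs)" "set (ps @ rev qs) \<subseteq> V - ?B2"
    "successively E (x # ps @ rev qs @ [y])"
    "ext (?B2 \<union> set (ps @ rev qs)) (\<lambda>u. if u = x \<or> u = y then Suc (?d2 u) else if u \<in> ?B2 then ?d2 u else 2)"
    using link[OF y(2) _ _ xy(1) _ _ c2] xy by auto
  let ?B3 = "?B2 \<union> set (ps @ rev qs)" and ?d3 = "\<lambda>u. if u = x \<or> u = y then Suc (?d2 u) else if u \<in> ?B2 then ?d2 u else 2"
  \<comment> \<open>\<open>y\<close> heads this rail and \<open>last qs\<close> becomes the common
    end, so both rails have \<open>k\<close> vertices. \<open>x\<close> stays outside, since the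
    choice between the routes is made there.\<close>
  define bs where "bs = y # butlast qs"
  define t where "t = last qs"
  have qne: "qs \<noteq> []" and pne: "ps \<noteq> []" using pq(1,2) k1 by auto
  have bst: "bs @ [t] = y # qs" using qne by (simp add: bs_def t_def)
  have lb: "length bs = k" using pq(2) k1 by (simp add: bs_def)
  have sets: "set (ps @ bs) \<union> {t} = insert y (set (ps @ rev qs))"
    using arg_cong[OF bst, of set] by auto
  have dis0: "distinct (y # qs)" using pq(3,4) by auto
  then have dis1: "distinct (bs @ [t])" by (simp only: bst)
  have sbs: "set bs \<subseteq> insert y (set qs)" "t \<in> set qs"
  proof -
    have "set (bs @ [t]) = insert y (set qs)" by (simp only: bst) simp
    then show "set bs \<subseteq> insert y (set qs)" by auto
    show "t \<in> set qs" using qne by (simp add: t_def)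
  qed
  have psd: "set ps \<inter> insert y (set qs) = {}" using pq(3,4) by auto
  have s1: "successively E (x # ps @ [t])"
  proof -
    have "successively E ((x # ps) @ (rev qs @ [y]))" using pq(5) by simp
    then have a: "successively E (x # ps)" "E (last (x # ps)) (hd (rev qs @ [y]))"
      using qne by (simp_all only: successively_append_iff) auto
    have "hd (rev qs @ [y]) = t" using qne by (simp add: hd_rev t_def)
    then show ?thesis using a successively_link[of E "x # ps" "[t]"] by simp
  qed
  have s2: "successively E (y # qs)"
  proof -
    have "successively E ((x # ps) @ (rev qs @ [y]))" using pq(5) by simp
    then have "successively E (rev qs @ [y])" by (simp only: successively_append_iff)
    then have "successively E (rev (y # qs))" by simp
    then have "successively (\<lambda>a b. E b a) (y # qs)" by (simp only: successively_rev)
    then show ?thesis by (rule successively_mono) (auto intro: Esym)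
  qed
  have e3: "ext ?B3 ?d3" by (rule pq(6))
  have cB3: "card ?B3 \<le> card B + 2 + 2 * k"
    using card_Un_le[of ?B2 "set (ps @ rev qs)"] card_length[of "ps @ rev qs"] cB2 pq(1,2) by simp
  have r0: "length ps = length bs" using pq(1) lb by simp
  have r1: "distinct (ps @ bs)" using pq(3) dis1 psd sbs by auto
  have r2: "set (ps @ bs) \<subseteq> ?B3" using sbs(1) by auto
  have r4: "\<And>v. v \<in> set (ps @ bs) \<Longrightarrow> ?d3 v \<le> 2"
    using pq(4) sbs(1) xy by auto
  have r5: "successively E (ps @ [t])" using s1 pne by (auto simp: successively_Cons)
  have r6: "successively E (bs @ [t])" using s2 by (simp only: bst)
  have r7: "t \<in> ?B3" using sbs(2) by auto
  have r8: "t \<notin> set (ps @ bs)" using dis1 psd sbs(2) by auto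
  have r9: "card ?B3 + length ps * (2 * k) + 4 * 2 ^ k \<le> cap" using c cB3 pq(1) by simp
  obtain Q \<delta>' where Q: "Q \<subseteq> V - ?B3" "finite Q" "card Q \<le> length ps * (2 * k)" "ext (?B3 \<union> Q) \<delta>'"
    "\<forall>v\<in>?B3. v \<notin> set (ps @ bs) \<longrightarrow> \<delta>' v = ?d3 v"
    "ladder E (hd (ps @ [t])) (hd (bs @ [t])) (set (ps @ bs) \<union> Q \<union> {t}) t"
    using rungs[OF r0 r1 r2 e3 r4 r5 r6 r7 r8 r9] by blast
  let ?W = "set (ps @ bs) \<union> Q \<union> {t}"
  have hb: "hd (bs @ [t]) = y" by (simp add: bs_def)
  have Ex: "E x (hd (ps @ [t]))" using s1 pne by (cases ps) (auto simp: successively_Cons)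
  have W: "?W = insert y (set (ps @ rev qs)) \<union> Q" using sets by auto
  have xW: "x \<notin> ?W" "r \<notin> ?W" "r \<notin> insert x ?W" unfolding W using pq(4) Q(1) x(1) y(1) xy r by auto
  have Exr: "E x r" "E r y" using NbE x y by (auto intro: Esym)
  have ab: "absorbs E x t (insert x ?W) {r}" unfolding absorbs_alt
  proof (intro allI impI)
    fix R' assume "R' \<subseteq> {r}"
    then consider "R' = {}" | "R' = {r}" by auto
    then show "spanning_path E x t (insert x ?W \<union> R')"
    proof cases
      case 1
      have "spanning_path E x t (insert x ?W)"
        using Q(6) Ex xW(1) unfolding ladder_def by (intro spanning_cons) auto
      then show ?thesis using 1 by simp
    next
      case 2
      have "spanning_path E r t (insert r ?W)"
        using Q(6) Exr xW(2) unfolding ladder_def hb by (intro spanning_cons) auto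
      then have "spanning_path E x t (insert x (insert r ?W))"
        using Exr(1) xW xy by (intro spanning_cons) auto
      moreover have "insert x (insert r ?W) = insert x ?W \<union> R'" using 2 by auto
      ultimately show ?thesis by (simp only:)
    qed
  qed
  let ?S = "insert x ?W"
  have SS: "?S = {x, y} \<union> set (ps @ rev qs) \<union> Q" unfolding W by auto
  have BS: "?B3 \<union> Q = B \<union> ?S" unfolding SS by auto
  show ?thesis
  proof (intro exI conjI)
    have "x \<in> V" "y \<in> V" using y(2) by (auto simp: ext_def)
    then show "?S \<subseteq> V - B" unfolding SS using x(1) y(1) pq(4) Q(1) by auto
    show "finite ?S" using Q(2) by simp
    have "card ?S \<le> card {x, y} + card (set (ps @ rev qs)) + card Q"
      unfolding SS by (meson add_le_mono1 card_Un_le order_trans)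
    then show "card ?S \<le> (2 * k + 2) + k * (2 * k)"
      using xy(1) card_length[of "ps @ rev qs"] pq(1,2) Q(3) by simp
    show "ext (B \<union> ?S) \<delta>'" using Q(4) unfolding BS .
    show "x \<in> ?S" "t \<in> ?S" by auto
    show "x \<noteq> t" using xW by auto
    have "x \<in> ?B3" "x \<notin> set (ps @ bs)" using xW by auto
    then show "\<delta>' x \<le> 2" using Q(5) xy by auto
    have "\<delta>' t = ?d3 t" using Q(5) r7 r8 by blast
    moreover have "t \<notin> ?B2" using sbs(2) pq(4) by auto
    ultimately show "\<delta>' t \<le> 2" by auto
    show "\<forall>v\<in>B. v \<noteq> r \<longrightarrow> \<delta>' v = \<delta> v"
    proof (intro ballI impI)
      fix v assume v: "v \<in> B" "v \<noteq> r"
      then have "v \<notin> set (ps @ bs)" "v \<in> ?B3" using pq(4) sbs(1) y(1) by auto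
      then have "\<delta>' v = ?d3 v" using Q(5) by blast
      then show "\<delta>' v = \<delta> v" using v x(1) y(1) by auto
    qed
    show "absorbs E x t ?S {r}" by (rule ab)
  qed
qed

text \<open>The absorbers of single vertices are strung together; besides its own size each one
  costs \<open>2 * k\<close> vertices for the link to its predecessor.\<close>

lemma absorber_many:
  assumes "distinct rs" "rs \<noteq> []" "set rs \<subseteq> B" "ext B \<delta>" "\<And>r. r \<in> set rs \<Longrightarrow> \<delta> r = 0"
    "card B + length rs * (4 * k + 2 + k * (2 * k)) + 4 * 2 ^ k \<le> cap"
  shows "\<exists>x t S \<delta>'. S \<subseteq> V - B \<and> finite S \<and> card S \<le> length rs * (4 * k + 2 + k * (2 * k)) \<and> ext (B \<union> S) \<delta>' \<and>
    x \<in> S \<and> t \<in> S \<and> x \<noteq> t \<and> \<delta>' x \<le> 3 \<and> \<delta>' t \<le> 2 \<and> (\<forall>v\<in>B. v \<notin> set rs \<longrightarrow> \<delta>' v = \<delta> v) \<and> absorbs E x t S (set rs)"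
  using assms(2,1,3-)
proof (induction rs rule: rev_nonempty_induct)
  case (single r)
  obtain x t S \<delta>' where S: "S \<subseteq> V - B" "finite S" "card S \<le> (2 * k + 2) + k * (2 * k)" "ext (B \<union> S) \<delta>'"
    "x \<in> S" "t \<in> S" "x \<noteq> t" "\<delta>' x \<le> 2" "\<delta>' t \<le> 2" "\<forall>v\<in>B. v \<noteq> r \<longrightarrow> \<delta>' v = \<delta> v" "absorbs E x t S {r}"
    using absorber_one[of B \<delta> r] single by auto
  then show ?case by (intro exI[of _ x] exI[of _ t] exI[of _ S] exI[of _ \<delta>']) auto
next
  case (snoc r rs)
  let ?w = "4 * k + 2 + k * (2 * k)"
  have cap0: "card B + length rs * ?w + ?w + 4 * 2 ^ k \<le> cap" using snoc.prems(5) by (simp add: algebra_simps)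
  have rB: "r \<in> B" "r \<notin> set rs" using snoc.prems by auto
  obtain x t S \<delta>1 where S: "S \<subseteq> V - B" "finite S" "card S \<le> length rs * ?w" "ext (B \<union> S) \<delta>1"
    "x \<in> S" "t \<in> S" "x \<noteq> t" "\<delta>1 x \<le> 3" "\<delta>1 t \<le> 2" "\<forall>v\<in>B. v \<notin> set rs \<longrightarrow> \<delta>1 v = \<delta> v" "absorbs E x t S (set rs)"
  proof -
    have "distinct rs" "set rs \<subseteq> B" "\<And>r. r \<in> set rs \<Longrightarrow> \<delta> r = 0" using snoc.prems by auto
    moreover have "card B + length rs * ?w + 4 * 2 ^ k \<le> cap" using cap0 by linarith
    ultimately show ?thesis using snoc.IH snoc.prems(3) that by blast
  qed
  have cBS: "card (B \<union> S) \<le> card B + length rs * ?w" using card_Un_le[of B S] S(3) by linarith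
  have r1: "r \<in> B \<union> S" "\<delta>1 r = 0" using S(10) rB snoc.prems(4)[of r] by auto
  have c1: "card (B \<union> S) + (2 * k + 2) + k * (2 * k) + 4 * 2 ^ k \<le> cap" using cBS cap0 by linarith
  obtain x2 t2 S2 \<delta>2 where S2: "S2 \<subseteq> V - (B \<union> S)" "finite S2" "card S2 \<le> (2 * k + 2) + k * (2 * k)" "ext ((B \<union> S) \<union> S2) \<delta>2"
    "x2 \<in> S2" "t2 \<in> S2" "x2 \<noteq> t2" "\<delta>2 x2 \<le> 2" "\<delta>2 t2 \<le> 2" "\<forall>v\<in>B \<union> S. v \<noteq> r \<longrightarrow> \<delta>2 v = \<delta>1 v" "absorbs E x2 t2 S2 {r}"
    using absorber_one[OF S(4) r1 c1] by blast
  have BV: "B \<subseteq> V" using snoc.prems by (simp add: ext_def)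
  have tne: "t \<noteq> r" "x \<noteq> r" using S(1,5,6) rB by auto
  have dt: "\<delta>2 t \<le> 2" "\<delta>2 x \<le> 3" using S2(10) S(5,6,8,9) tne by auto
  have ttx: "t \<noteq> x2" using S2(1,5) S(6) by auto
  have cU: "card ((B \<union> S) \<union> S2) + 4 * 2 ^ k \<le> cap"
    using card_Un_le[of "B \<union> S" S2] cBS S2(3) cap0 by linarith
  obtain ps qs where pq: "length ps = k" "length qs = k" "distinct (ps @ rev qs)" "set (ps @ rev qs) \<subseteq> V - ((B \<union> S) \<union> S2)"
    "successively E (t # ps @ rev qs @ [x2])"
    "ext (((B \<union> S) \<union> S2) \<union> set (ps @ rev qs)) (\<lambda>u. if u = t \<or> u = x2 then Suc (\<delta>2 u) else if u \<in> (B \<union> S) \<union> S2 then \<delta>2 u else 2)"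
    using link[OF S2(4) _ _ ttx dt(1) S2(8) cU] S(6) S2(5) by blast
  let ?ls = "ps @ rev qs"
  have rsB: "set rs \<subseteq> B" using snoc.prems by auto
  have ab: "absorbs E x t2 (S \<union> set ?ls \<union> S2) (set rs \<union> {r})"
  proof (rule absorbs_join[OF S(11) S2(11) pq(3)])
    show "successively E (t # ?ls @ [x2])" using pq(5) by simp
    show "(S \<union> set rs) \<inter> (S2 \<union> {r}) = {}" using S(1) S2(1) rsB rB by auto
    show "set ?ls \<inter> (S \<union> set rs) = {}" "set ?ls \<inter> (S2 \<union> {r}) = {}" using pq(4) rsB rB by auto
  qed
  show ?case
  proof (intro exI conjI)
    show "S \<union> set ?ls \<union> S2 \<subseteq> V - B" using S(1) S2(1) pq(4) by auto
    show "finite (S \<union> set ?ls \<union> S2)" using S(2) S2(2) by simp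
    have "card (S \<union> set ?ls \<union> S2) \<le> card S + card (set ?ls) + card S2"
      by (meson add_le_mono1 card_Un_le order_trans)
    then show "card (S \<union> set ?ls \<union> S2) \<le> length (rs @ [r]) * ?w"
      using card_length[of ?ls] pq(1,2) S(3) S2(3) by (simp add: algebra_simps)
    have "((B \<union> S) \<union> S2) \<union> set ?ls = B \<union> (S \<union> set ?ls \<union> S2)" by auto
    then show "ext (B \<union> (S \<union> set ?ls \<union> S2)) (\<lambda>u. if u = t \<or> u = x2 then Suc (\<delta>2 u) else if u \<in> (B \<union> S) \<union> S2 then \<delta>2 u else 2)"
      using pq(6) by simp
    show "x \<in> S \<union> set ?ls \<union> S2" "t2 \<in> S \<union> set ?ls \<union> S2" using S(5) S2(6) by auto
    show "x \<noteq> t2" using S(5) S2(1,6) by auto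
    have "x \<noteq> x2" using S(5) S2(1,5) by auto
    then show "(if x = t \<or> x = x2 then Suc (\<delta>2 x) else if x \<in> (B \<union> S) \<union> S2 then \<delta>2 x else 2) \<le> 3"
      using S(5,7) dt by auto
    have "t2 \<noteq> t" using S(6) S2(1,6) by auto
    then show "(if t2 = t \<or> t2 = x2 then Suc (\<delta>2 t2) else if t2 \<in> (B \<union> S) \<union> S2 then \<delta>2 t2 else 2) \<le> 2"
      using S2(6,7,9) by auto
    show "\<forall>v\<in>B. v \<notin> set (rs @ [r]) \<longrightarrow> (if v = t \<or> v = x2 then Suc (\<delta>2 v) else if v \<in> (B \<union> S) \<union> S2 then \<delta>2 v else 2) = \<delta> v"
    proof (intro ballI impI)
      fix v assume v: "v \<in> B" "v \<notin> set (rs @ [r])"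
      then have "v \<noteq> t" "v \<noteq> x2" using S(1,6) S2(1,5) by auto
      moreover have "\<delta>2 v = \<delta> v" using S2(10) S(10) v by auto
      ultimately show "(if v = t \<or> v = x2 then Suc (\<delta>2 v) else if v \<in> (B \<union> S) \<union> S2 then \<delta>2 v else 2) = \<delta> v" using v by auto
    qed
    show "absorbs E x t2 (S \<union> set ?ls \<union> S2) (set (rs @ [r]))" using ab by simp
  qed
qed

text \<open>This adjusts the number of vertices left over modulo the number of layers.\<close>

lemma absorber_extend:
  assumes "ext (B \<union> S) \<delta>" "x \<in> S" "t \<in> S" "x \<noteq> t" "\<delta> t \<le> 2" "absorbs E x t S R" "R \<subseteq> B" "S \<subseteq> V - B" "finite S"
    "card (B \<union> S) + j \<le> cap"
  shows "\<exists>t' S' \<delta>'. S' \<subseteq> V - B \<and> finite S' \<and> card S' = card S + j \<and> x \<in> S' \<and> t' \<in> S' \<and> x \<noteq> t' \<and> absorbs E x t' S' R"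
  using assms
proof (induction j arbitrary: S t \<delta>)
  case 0
  then show ?case by auto
next
  case (Suc j)
  have "\<delta> t < D" using Suc.prems(5) D4 by linarith
  then obtain z where z: "z \<in> Nb t - (B \<union> S)" "ext (insert z (B \<union> S)) (\<delta>(t := Suc (\<delta> t), z := 1))"
    using add_leaf[OF Suc.prems(1)] Suc.prems(3,10) by auto
  have zV: "z \<in> V" using z(2) by (auto simp: ext_def)
  have Etz: "E t z" using z NbE by auto
  have ab: "absorbs E x z (insert z S) R" unfolding absorbs_alt
  proof (intro allI impI)
    fix R' assume R': "R' \<subseteq> R"
    then have P1: "spanning_path E x t (S \<union> R')" using Suc.prems(6) by (simp add: absorbs_alt)
    have P2: "(S \<union> R') \<inter> {z} = {}" using z(1) R' Suc.prems(7) by auto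
    have "spanning_path E x z ((S \<union> R') \<union> {z})"
      by (rule spanning_join[OF P1 spanning_singleton[of E z] Etz P2])
    then show "spanning_path E x z (insert z S \<union> R')" by (simp add: Un_commute Un_left_commute)
  qed
  have e: "ext (B \<union> insert z S) (\<delta>(t := Suc (\<delta> t), z := 1))" using z(2) by simp
  have fB: "finite (B \<union> S)" using Suc.prems(1) fin by (auto simp: ext_def)
  have "card (B \<union> insert z S) + j \<le> cap" using Suc.prems(10) fB by (simp add: card_insert_if)
  from Suc.IH[OF e _ _ _ _ ab Suc.prems(7) _ _ this]
  obtain t' S' where "S' \<subseteq> V - B" "finite S'" "card S' = card (insert z S) + j" "x \<in> S'" "t' \<in> S'" "x \<noteq> t'" "absorbs E x t' S' R"
    using Suc.prems(2,8,9) z(1) zV by auto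
  then show ?case using z(1) Suc.prems(9) by auto
qed

end

section \<open>Matchings and linking paths\<close>

text \<open>The argument of Halmos and Vaughan. If all nonempty proper subsets have more neighbours
  than elements, any one vertex may be matched arbitrarily; otherwise the problem splits at a tight
  subset \<open>X\<close>, whose neighbours are withdrawn from the rest.\<close>

theorem Hall:
  assumes "finite A" "\<And>a. a \<in> A \<Longrightarrow> finite (N a)" "\<And>X. X \<subseteq> A \<Longrightarrow> card X \<le> card (\<Union>a\<in>X. N a)"
  shows "\<exists>f. inj_on f A \<and> (\<forall>a\<in>A. f a \<in> N a)"
  using assms
proof (induction "card A" arbitrary: A N rule: less_induct)
  case less
  have finU: "finite (\<Union>a\<in>X. N a)" if "X \<subseteq> A" for X
    using that less.prems(1,2) finite_subset by blast
  show ?case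
  proof (cases "A = {}")
    case False
    then obtain a where a: "a \<in> A" by blast
    show ?thesis
    proof (cases "\<forall>X. X \<subset> A \<longrightarrow> X \<noteq> {} \<longrightarrow> card X < card (\<Union>a\<in>X. N a)")
      case True
      have "card {a} \<le> card (\<Union>a\<in>{a}. N a)" using a by (intro less.prems(3)) simp
      then obtain b where b: "b \<in> N a" by fastforce
      let ?N = "\<lambda>x. N x - {b}"
      have "\<exists>f. inj_on f (A - {a}) \<and> (\<forall>x\<in>A - {a}. f x \<in> ?N x)"
      proof (rule less.hyps)
        show "card (A - {a}) < card A" using less.prems(1) a by (meson card_Diff1_less)
        fix X assume X: "X \<subseteq> A - {a}"
        show "card X \<le> card (\<Union>x\<in>X. ?N x)"
        proof (cases "X = {}")
          case False
          have "X \<subset> A" using X a by auto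
          then have lt: "card X < card (\<Union>a\<in>X. N a)" using True False by blast
          have "(\<Union>x\<in>X. ?N x) = (\<Union>a\<in>X. N a) - {b}" by auto
          then have "card (\<Union>a\<in>X. N a) - 1 \<le> card (\<Union>x\<in>X. ?N x)" using card_Diff1_le
            by (metis card_Diff_singleton_if diff_le_self order_refl)
          then show ?thesis using lt by linarith
        qed simp
      qed (use less.prems in auto)
      then obtain f where f: "inj_on f (A - {a})" "\<forall>x\<in>A - {a}. f x \<in> ?N x" by blast
      have "inj_on (f(a := b)) A"
        using f by (intro inj_onI) (auto simp: inj_on_def split: if_splits)
      moreover have "\<forall>x\<in>A. (f(a := b)) x \<in> N x" using f(2) b by auto
      ultimately show ?thesis by blast
    next
      case False
      then obtain X where X: "X \<subset> A" "X \<noteq> {}" "\<not> card X < card (\<Union>a\<in>X. N a)" by blast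
      have XA: "X \<subseteq> A" using X(1) by blast
      have fX: "finite X" using finite_subset[OF XA less.prems(1)] .
      have eq: "card (\<Union>a\<in>X. N a) = card X" using less.prems(3)[OF XA] X(3) by linarith
      have "\<exists>f. inj_on f X \<and> (\<forall>a\<in>X. f a \<in> N a)"
      proof (rule less.hyps)
        show "card X < card A" using X(1) less.prems(1) by (rule psubset_card_mono[rotated])
      qed (use less.prems XA fX in auto)
      then obtain f where f: "inj_on f X" "\<forall>a\<in>X. f a \<in> N a" by blast
      let ?U = "\<Union>a\<in>X. N a"
      let ?N = "\<lambda>x. N x - ?U"
      have "\<exists>g. inj_on g (A - X) \<and> (\<forall>a\<in>A - X. g a \<in> ?N a)"
      proof (rule less.hyps)
        show "card (A - X) < card A" using X less.prems(1) by (intro psubset_card_mono) auto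
        fix Y assume Y: "Y \<subseteq> A - X"
        have fY: "finite Y" using finite_subset[OF Y] less.prems(1) by blast
        have "card Y + card X = card (Y \<union> X)" using fY fX Y by (subst card_Un_disjoint) auto
        also have "\<dots> \<le> card (\<Union>a\<in>Y \<union> X. N a)" using Y XA by (intro less.prems(3)) auto
        also have "(\<Union>a\<in>Y \<union> X. N a) = (\<Union>a\<in>Y. ?N a) \<union> ?U" by auto
        also have "card \<dots> \<le> card (\<Union>a\<in>Y. ?N a) + card ?U" by (rule card_Un_le)
        finally show "card Y \<le> card (\<Union>a\<in>Y. ?N a)" using eq by linarith
      qed (use less.prems in auto)
      then obtain g where g: "inj_on g (A - X)" "\<forall>a\<in>A - X. g a \<in> ?N a" by blast
      let ?h = "\<lambda>x. if x \<in> X then f x else g x"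
      have sep: "f x \<noteq> g y" if "x \<in> X" "y \<in> A" "y \<notin> X" for x y
      proof -
        have "f x \<in> ?U" using f(2) that(1) by blast
        moreover have "g y \<notin> ?U" using g(2) that by blast
        ultimately show ?thesis by auto
      qed
      have "inj_on ?h A"
      proof (rule inj_onI)
        fix x y assume xy: "x \<in> A" "y \<in> A" "?h x = ?h y"
        show "x = y"
        proof (cases "x \<in> X"; cases "y \<in> X")
          assume "x \<in> X" "y \<in> X" then show ?thesis using xy f(1) by (auto dest: inj_onD)
        next
          assume "x \<in> X" "y \<notin> X" then show ?thesis using xy sep[of x y] by auto
        next
          assume "x \<notin> X" "y \<in> X" then show ?thesis using xy sep[of y x] by auto
        next
          assume "x \<notin> X" "y \<notin> X" then show ?thesis using xy g(1) by (auto dest: inj_onD)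
        qed
      qed
      moreover have "\<forall>a\<in>A. ?h a \<in> N a" using f(2) g(2) by auto
      ultimately show ?thesis by blast
    qed
  qed simp
qed

lemma layered_paths:
  fixes Ls :: "nat \<Rightarrow> 'a set"
  assumes fin: "\<And>i. i \<le> h \<Longrightarrow> finite (Ls i)" and M: "\<And>i. i \<le> h \<Longrightarrow> card (Ls i) = M"
    and dj: "\<And>i j. i \<le> h \<Longrightarrow> j \<le> h \<Longrightarrow> i \<noteq> j \<Longrightarrow> Ls i \<inter> Ls j = {}"
    and match: "\<And>i. i < h \<Longrightarrow> \<exists>f. inj_on f (Ls i) \<and> (\<forall>a\<in>Ls i. f a \<in> Ls (Suc i) \<and> E a (f a))"
  shows "\<exists>P. \<forall>a\<in>Ls 0. distinct (P a) \<and> successively E (P a) \<and> length (P a) = Suc h \<and> hd (P a) = a \<and> last (P a) \<in> Ls h \<and>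
     (\<forall>b\<in>Ls 0. a \<noteq> b \<longrightarrow> set (P a) \<inter> set (P b) = {}) \<and> (\<Union>a\<in>Ls 0. set (P a)) = (\<Union>i\<le>h. Ls i)"
  using assms
proof (induction h)
  case 0
  then show ?case by (intro exI[of _ "\<lambda>a. [a]"]) auto
next
  case (Suc h)
  have "\<exists>P. \<forall>a\<in>Ls 0. distinct (P a) \<and> successively E (P a) \<and> length (P a) = Suc h \<and> hd (P a) = a \<and> last (P a) \<in> Ls h \<and>
     (\<forall>b\<in>Ls 0. a \<noteq> b \<longrightarrow> set (P a) \<inter> set (P b) = {}) \<and> (\<Union>a\<in>Ls 0. set (P a)) = (\<Union>i\<le>h. Ls i)"
    using Suc.prems by (intro Suc.IH) auto
  then obtain P where P': "\<forall>a\<in>Ls 0. distinct (P a) \<and> successively E (P a) \<and> length (P a) = Suc h \<and> hd (P a) = a \<and> last (P a) \<in> Ls h \<and>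
     (\<forall>b\<in>Ls 0. a \<noteq> b \<longrightarrow> set (P a) \<inter> set (P b) = {}) \<and> (\<Union>a\<in>Ls 0. set (P a)) = (\<Union>i\<le>h. Ls i)" ..
  have P: "a \<in> Ls 0 \<Longrightarrow> distinct (P a) \<and> successively E (P a) \<and> length (P a) = Suc h \<and> hd (P a) = a \<and> last (P a) \<in> Ls h \<and>
     (\<forall>b\<in>Ls 0. a \<noteq> b \<longrightarrow> set (P a) \<inter> set (P b) = {}) \<and> (\<Union>a\<in>Ls 0. set (P a)) = (\<Union>i\<le>h. Ls i)" for a
    by (rule bspec[OF P'])
  obtain f where f: "inj_on f (Ls h)" "\<And>a. a \<in> Ls h \<Longrightarrow> f a \<in> Ls (Suc h) \<and> E a (f a)"
    using Suc.prems(4)[of h] by blast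
  \<comment> \<open>Equal sizes make the injection onto, so the prolonged paths miss no vertex of
    the new layer.\<close>
  have fim: "f ` Ls h = Ls (Suc h)"
    using f Suc.prems(1)[of "Suc h"] Suc.prems(2)[of h] Suc.prems(2)[of "Suc h"]
    by (intro card_subset_eq) (auto simp: card_image)
  have ne: "P a \<noteq> []" if "a \<in> Ls 0" for a using P[OF that] by auto
  have sub: "set (P a) \<subseteq> (\<Union>i\<le>h. Ls i)" if "a \<in> Ls 0" for a using P[OF that] that by blast
  have new: "f (last (P a)) \<notin> (\<Union>i\<le>h. Ls i)" if "a \<in> Ls 0" for a
  proof
    assume "f (last (P a)) \<in> (\<Union>i\<le>h. Ls i)"
    then obtain i where "i \<le> h" "f (last (P a)) \<in> Ls i" by blast
    moreover have "f (last (P a)) \<in> Ls (Suc h)" using P[OF that] f(2) by blast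
    ultimately show False using Suc.prems(3)[of i "Suc h"] by auto
  qed
  have lastinj: "inj_on (\<lambda>a. last (P a)) (Ls 0)"
  proof (rule inj_onI, rule ccontr)
    fix a b assume ab: "a \<in> Ls 0" "b \<in> Ls 0" "last (P a) = last (P b)" "a \<noteq> b"
    then have "last (P a) \<in> set (P a) \<inter> set (P b)" using ne[OF ab(1)] ne[OF ab(2)] by (metis IntI last_in_set)
    then show False using P[OF ab(1)] ab by blast
  qed
  have lastim: "(\<lambda>a. last (P a)) ` Ls 0 = Ls h"
    using P lastinj Suc.prems(1)[of h] Suc.prems(2)[of h] Suc.prems(2)[of 0]
    by (intro card_subset_eq) (auto simp: card_image)
  show ?case
  proof (intro exI[of _ "\<lambda>a. P a @ [f (last (P a))]"] ballI conjI impI)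
    fix a assume a: "a \<in> Ls 0"
    show "distinct (P a @ [f (last (P a))])" using P[OF a] new[OF a] sub[OF a] by auto
    have "E (last (P a)) (f (last (P a)))" using f(2) P[OF a] by blast
    then show "successively E (P a @ [f (last (P a))])"
      using P[OF a] ne[OF a] by (intro successively_link) auto
    show "length (P a @ [f (last (P a))]) = Suc (Suc h)" using P[OF a] by simp
    show "hd (P a @ [f (last (P a))]) = a" using P[OF a] ne[OF a] by simp
    show "last (P a @ [f (last (P a))]) \<in> Ls (Suc h)" using f(2) P[OF a] by simp
    show "set (P a @ [f (last (P a))]) \<inter> set (P b @ [f (last (P b))]) = {}" if b: "b \<in> Ls 0" "a \<noteq> b" for b
    proof -
      have "last (P a) \<noteq> last (P b)" using lastinj a b by (auto dest: inj_onD)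
      moreover have "last (P a) \<in> Ls h" "last (P b) \<in> Ls h" using P a b by auto
      ultimately have "f (last (P a)) \<noteq> f (last (P b))" using f(1) by (auto dest: inj_onD)
      moreover have "set (P a) \<inter> set (P b) = {}" using P[OF a] b by blast
      moreover have "f (last (P a)) \<notin> set (P b)" using new[OF a] sub[OF b(1)] by blast
      moreover have "f (last (P b)) \<notin> set (P a)" using new[OF b(1)] sub[OF a] by blast
      ultimately show ?thesis by auto
    qed
    have "(\<Union>a\<in>Ls 0. set (P a @ [f (last (P a))])) = (\<Union>a\<in>Ls 0. set (P a)) \<union> f ` (\<lambda>a. last (P a)) ` Ls 0" by auto
    also have "\<dots> = (\<Union>i\<le>h. Ls i) \<union> Ls (Suc h)" using P[OF a] unfolding lastim fim by simp
    also have "\<dots> = (\<Union>i\<le>Suc h. Ls i)" by (auto simp: atMost_Suc)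
    finally show "(\<Union>a\<in>Ls 0. set (P a @ [f (last (P a))])) = (\<Union>i\<le>Suc h. Ls i)" .
  qed
qed

section \<open>Linking many paths into one\<close>

context extendable_graph begin

text \<open>\<open>B\<close> grows by the links already made, while \<open>B0\<close> records the
  initial set, so that the hypothesis on \<open>J\<close> stays applicable. The given paths meet the
  host only inside \<open>B\<close>, and links avoid \<open>B\<close>, so a link never runs into a
  path.\<close>

lemma link_all:
  assumes "ext B \<delta>" "B0 \<subseteq> B" "b \<in> B" "a0 \<in> B" "b \<in> Ends" "a0 \<in> Starts"
    "\<And>p. p \<in> set ps \<Longrightarrow> p \<noteq> [] \<and> hd p \<in> B \<inter> Starts \<and> last p \<in> B \<inter> Ends \<and> set p \<inter> V \<subseteq> B \<and> successively E p \<and> distinct p"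
    "distinct (b # a0 # map hd ps @ map last ps)" "\<And>v. v \<in> set (b # a0 # map hd ps @ map last ps) \<Longrightarrow> \<delta> v = 0"
    "distinct (concat ps)" "card B + Suc (length ps) * (2 * k) + 4 * 2 ^ k \<le> cap" "1 \<le> k"
    and J: "\<And>x y B X Y. x \<in> Ends \<Longrightarrow> y \<in> Starts \<Longrightarrow> B0 \<subseteq> B \<Longrightarrow> X \<subseteq> V - B \<Longrightarrow> Y \<subseteq> V - B \<Longrightarrow> X \<inter> Y = {} \<Longrightarrow> card X = 2 ^ k \<Longrightarrow> card Y = 2 ^ k \<Longrightarrow>
      \<forall>z\<in>X. \<exists>ps. length ps = k \<and> nbchain x ps \<and> last ps = z \<and> set ps \<inter> B = {} \<Longrightarrow>
      \<forall>z\<in>Y. \<exists>ps. length ps = k \<and> nbchain y ps \<and> last ps = z \<and> set ps \<inter> B = {} \<Longrightarrow> \<exists>u\<in>X. \<exists>w\<in>Y. E u w"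
  shows "\<exists>ts Q. set ts = set (concat ps) \<union> Q \<and> Q \<subseteq> V - B \<and> distinct ts \<and> successively E (b # ts @ [a0])"
  using assms(1-12)
proof (induction ps arbitrary: B \<delta> b)
  case Nil
  have c: "card B + 4 * 2 ^ k \<le> cap + 4" using Nil.prems(11) by simp
  have d: "b \<noteq> a0" "\<delta> b \<le> D - 2" "\<delta> a0 \<le> D - 2" using Nil.prems(8,9) by auto
  from connect_path[OF Nil.prems(1,3,4) d Nil.prems(12) c J[OF Nil.prems(5,6,2)]] obtain us vs where "distinct (us @ rev vs)" "set (us @ rev vs) \<subseteq> V - B" "successively E (b # us @ rev vs @ [a0])"
    by blast
  then show ?case by (intro exI[of _ "us @ rev vs"] exI[of _ "set (us @ rev vs)"]) auto
next
  case (Cons p ps)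
  have p: "p \<noteq> []" "hd p \<in> B" "hd p \<in> Starts" "last p \<in> B" "last p \<in> Ends" "set p \<inter> V \<subseteq> B" "successively E p" "distinct p"
    using Cons.prems(7)[of p] by auto
  have c: "card B + 4 * 2 ^ k \<le> cap + 4" using Cons.prems(11) by simp
  have d: "b \<noteq> hd p" "\<delta> b \<le> D - 2" "\<delta> (hd p) \<le> D - 2" using Cons.prems(8,9) by auto
  from connect_path[OF Cons.prems(1,3) p(2) d Cons.prems(12) c J[OF Cons.prems(5) p(3) Cons.prems(2)]] obtain us vs where uv: "length us = k" "length vs = k" "distinct (us @ rev vs)" "set (us @ rev vs) \<subseteq> V - B"
      "successively E (b # us @ rev vs @ [hd p])"
      "ext (B \<union> set (us @ rev vs)) (\<lambda>u. if u = b \<or> u = hd p then Suc (\<delta> u) else if u \<in> B then \<delta> u else 2)"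
    by blast
  let ?ls = "us @ rev vs"
  let ?B = "B \<union> set ?ls" and ?d = "\<lambda>u. if u = b \<or> u = hd p then Suc (\<delta> u) else if u \<in> B then \<delta> u else 2"
  have "\<exists>ts Q. set ts = set (concat ps) \<union> Q \<and> Q \<subseteq> V - ?B \<and> distinct ts \<and> successively E (last p # ts @ [a0])"
  proof (rule Cons.IH[OF uv(6)])
    show "B0 \<subseteq> ?B" "last p \<in> ?B" "a0 \<in> ?B" "last p \<in> Ends" "a0 \<in> Starts" "1 \<le> k" using Cons.prems p by auto
    show "distinct (last p # a0 # map hd ps @ map last ps)" using Cons.prems(8) by auto
    show "distinct (concat ps)" using Cons.prems(10) by simp
    have "card ?B \<le> card B + 2 * k" using card_Un_le[of B "set ?ls"] card_length[of ?ls] uv(1,2) by simp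
    then show "card ?B + Suc (length ps) * (2 * k) + 4 * 2 ^ k \<le> cap" using Cons.prems(11) by simp
    show "q \<noteq> [] \<and> hd q \<in> ?B \<inter> Starts \<and> last q \<in> ?B \<inter> Ends \<and> set q \<inter> V \<subseteq> ?B \<and> successively E q \<and> distinct q" if "q \<in> set ps" for q
      using Cons.prems(7)[of q] that by auto
    fix v assume v: "v \<in> set (last p # a0 # map hd ps @ map last ps)"
    have "v \<noteq> b" "v \<noteq> hd p" using v Cons.prems(8) by auto
    moreover have "\<delta> v = 0" using v Cons.prems(9)[of v] by auto
    moreover have "v \<in> B" using v Cons.prems(4,7) by auto
    ultimately show "?d v = 0" by simp
  qed
  then obtain ts Q where ts: "set ts = set (concat ps) \<union> Q" "Q \<subseteq> V - ?B" "distinct ts" "successively E (last p # ts @ [a0])" by blast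
  have pp: "set p \<inter> set (concat ps) = {}" using Cons.prems(10) by auto
  have psV: "set (concat ps) \<inter> V \<subseteq> B" using Cons.prems(7) by fastforce
  have "distinct (?ls @ p @ ts)"
    using uv(3,4) p(6,8) ts(1,2,3) pp psV by auto
  moreover have "successively E (b # (?ls @ p @ ts) @ [a0])"
  proof -
    have a: "successively E (b # ?ls)" "E (last (b # ?ls)) (hd p)"
    proof -
      have "successively E ((b # ?ls) @ [hd p])" using uv(5) by simp
      then show "successively E (b # ?ls)" "E (last (b # ?ls)) (hd p)" by (simp_all only: successively_append_iff) auto
    qed
    have c': "successively E (ts @ [a0])" "E (last p) (hd (ts @ [a0]))"
      using ts(4) by (cases ts; simp add: successively_Cons)+
    have d': "successively E (p @ ts @ [a0])" by (rule successively_link[OF p(7) c'(1) p(1) _ c'(2)]) simp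
    have "successively E ((b # ?ls) @ (p @ ts @ [a0]))" using successively_link[OF a(1) d'] a(2) p(1) by simp
    then show ?thesis by simp
  qed
  moreover have "set (?ls @ p @ ts) = set (concat (p # ps)) \<union> (set ?ls \<union> Q)" using ts(1) by auto
  moreover have "set ?ls \<union> Q \<subseteq> V - B" using uv(4) ts(2) by auto
  ultimately show ?case by blast
qed

end

text \<open>The links have used an uncontrolled part \<open>Q\<close> of the reservoir; the absorber
  is asked to take exactly \<open>R - Q\<close>.\<close>

lemma absorb_close:
  assumes ab: "absorbs E a0 b0 S R" and ts: "distinct ts" "successively E (b0 # ts @ [a0])" "set ts = C \<union> Q" "Q \<subseteq> R" "ts \<noteq> []"
    and dj: "S \<inter> R = {}" "C \<inter> (S \<union> R) = {}"
  shows "\<exists>cs. distinct cs \<and> successively E cs \<and> set cs = S \<union> R \<union> C \<and> cs \<noteq> [] \<and> E (last cs) (hd cs)"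
proof -
  obtain xs where xs: "distinct xs" "successively E xs" "set xs = S \<union> (R - Q)" "xs \<noteq> []" "hd xs = a0" "last xs = b0"
    using ab unfolding absorbs_def by (meson Diff_subset)
  have t: "successively E ts" "E b0 (hd ts)" "E (last ts) a0"
    using ts(2,5) by (auto simp: successively_Cons successively_append_iff)
  have "distinct (xs @ ts)" using xs ts dj by auto
  moreover have "successively E (xs @ ts)" using xs t ts(5) by (intro successively_link) auto
  moreover have "set (xs @ ts) = S \<union> R \<union> C" using xs(3) ts(3,4) by auto
  moreover have "E (last (xs @ ts)) (hd (xs @ ts))" using t(3) xs(4,5) ts(5) by simp
  ultimately show ?thesis using xs(4) by blast
qed

section \<open>Quadratic bounds for the adjacency form\<close>

locale expander =
  fixes n :: nat and E :: "nat \<Rightarrow> nat \<Rightarrow> bool" and d :: real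
  assumes Esym: "\<And>u v. E u v \<Longrightarrow> E v u" and Eirr: "\<And>u. \<not> E u u" and EV: "\<And>u v. E u v \<Longrightarrow> v < n" and n0: "0 < n" and d0: "0 < d"
begin

definition nb :: "nat \<Rightarrow> nat set" where "nb v = {u. E v u}"

definition wt :: "nat \<Rightarrow> nat \<Rightarrow> real" where
  "wt w u = (if E w u then 1 else 0) - d / real n"

text \<open>A bound on the squared operator norm of the block of \<open>A - (d/n) J\<close> with rows in \<open>X\<close> and columns in \<open>Y\<close>.\<close>

definition qb :: "nat set \<Rightarrow> nat set \<Rightarrow> real \<Rightarrow> bool" where
  "qb X Y \<tau> \<longleftrightarrow> 0 \<le> \<tau> \<and> (\<forall>x. (\<Sum>w\<in>X. (\<Sum>u\<in>Y. wt w u * x u)\<^sup>2) \<le> \<tau> * (\<Sum>u\<in>Y. (x u)\<^sup>2))"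

lemma nb_sub: "nb v \<subseteq> {..<n}" using EV by (auto simp: nb_def)

lemma finite_nb [simp]: "finite (nb v)" using nb_sub finite_subset by blast

lemma wt_sym: "wt w u = wt u w" using Esym by (auto simp: wt_def)

lemma qb_mono:
  assumes "qb X Y \<tau>" "X' \<subseteq> X" "Y' \<subseteq> Y" "finite X" "finite Y"
  shows "qb X' Y' \<tau>"
  unfolding qb_def
proof (intro conjI allI)
  show "0 \<le> \<tau>" using assms(1) by (simp add: qb_def)
  fix x :: "nat \<Rightarrow> real"
  let ?x = "\<lambda>u. if u \<in> Y' then x u else 0"
  have e1: "(\<Sum>u\<in>Y. wt w u * ?x u) = (\<Sum>u\<in>Y'. wt w u * x u)" for w
    using assms(3,5) by (intro sum.mono_neutral_cong_right) auto
  have e2: "(\<Sum>u\<in>Y. (?x u)\<^sup>2) = (\<Sum>u\<in>Y'. (x u)\<^sup>2)"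
    using assms(3,5) by (intro sum.mono_neutral_cong_right) auto
  have "(\<Sum>w\<in>X'. (\<Sum>u\<in>Y'. wt w u * x u)\<^sup>2) \<le> (\<Sum>w\<in>X. (\<Sum>u\<in>Y'. wt w u * x u)\<^sup>2)"
    using assms(2,4) by (intro sum_mono2) auto
  also have "\<dots> = (\<Sum>w\<in>X. (\<Sum>u\<in>Y. wt w u * ?x u)\<^sup>2)" unfolding e1 ..
  also have "\<dots> \<le> \<tau> * (\<Sum>u\<in>Y. (?x u)\<^sup>2)"
    using assms(1)[unfolded qb_def, THEN conjunct2] by (rule spec)
  finally show "(\<Sum>w\<in>X'. (\<Sum>u\<in>Y'. wt w u * x u)\<^sup>2) \<le> \<tau> * (\<Sum>u\<in>Y'. (x u)\<^sup>2)" unfolding e2 .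
qed

lemma qb_weaken: "qb X Y \<tau> \<Longrightarrow> \<tau> \<le> \<tau>' \<Longrightarrow> qb X Y \<tau>'"
  unfolding qb_def by (auto intro: order_trans[OF _ mult_right_mono] simp: sum_nonneg)

text \<open>A matrix and its transpose have the same norm. With \<open>y\<close> the image of
  \<open>z\<close> under the transpose, the squared norm of \<open>y\<close> is the product of
  \<open>z\<close> with the image of \<open>y\<close>; Cauchy-Schwarz and the hypothesis bound that
  product.\<close>

lemma qb_sym:
  assumes "qb X Y \<tau>"
  shows "qb Y X \<tau>"
  unfolding qb_def
proof (intro conjI allI)
  show t0: "0 \<le> \<tau>" using assms by (simp add: qb_def)
  fix z :: "nat \<Rightarrow> real"
  define y where "y = (\<lambda>u. \<Sum>w\<in>X. wt u w * z w)"
  define S where "S = (\<Sum>u\<in>Y. (y u)\<^sup>2)"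
  define Z where "Z = (\<Sum>w\<in>X. (z w)\<^sup>2)"
  define R where "R = (\<Sum>w\<in>X. (\<Sum>u\<in>Y. wt w u * y u)\<^sup>2)"
  have nn: "0 \<le> S" "0 \<le> Z" unfolding S_def Z_def by (simp_all add: sum_nonneg)
  have R: "R \<le> \<tau> * S" unfolding R_def S_def using assms[unfolded qb_def, THEN conjunct2] by (rule spec)
  have "S = (\<Sum>u\<in>Y. \<Sum>w\<in>X. y u * (wt u w * z w))"
    by (simp add: S_def power2_eq_square sum_distrib_left[symmetric]) (simp add: y_def)
  also have "\<dots> = (\<Sum>w\<in>X. \<Sum>u\<in>Y. y u * (wt u w * z w))" by (rule sum.swap)
  also have "\<dots> = (\<Sum>w\<in>X. z w * (\<Sum>u\<in>Y. wt w u * y u))"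
    by (intro sum.cong refl) (simp add: sum_distrib_left wt_sym[of _ "_::nat"] ac_simps)
  finally have Se: "S = (\<Sum>w\<in>X. z w * (\<Sum>u\<in>Y. wt w u * y u))" .
  have "S\<^sup>2 \<le> Z * R" unfolding Se Z_def R_def by (rule Cauchy_Schwarz_ineq_sum)
  also have "\<dots> \<le> Z * (\<tau> * S)" using R nn by (intro mult_left_mono)
  finally have SS: "S * S \<le> (\<tau> * Z) * S" by (simp add: power2_eq_square ac_simps)
  show "(\<Sum>u\<in>Y. (\<Sum>w\<in>X. wt u w * z w)\<^sup>2) \<le> \<tau> * (\<Sum>w\<in>X. (z w)\<^sup>2)"
  proof (cases "S = 0")
    case True
    have "0 \<le> \<tau> * Z" using t0 nn by simp
    then have "S \<le> \<tau> * Z" using True by simp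
    then show ?thesis by (simp add: S_def Z_def y_def)
  next
    case False
    then have "S \<le> \<tau> * Z" using SS nn by simp
    then show ?thesis by (simp add: S_def Z_def y_def)
  qed
qed

text \<open>The expander mixing lemma for a block: the test vector is the indicator of
  \<open>W\<close>, and Cauchy-Schwarz sums the rows of \<open>U\<close>.\<close>

lemma qb_edges:
  assumes q: "qb X Y (\<sigma>\<^sup>2)" and s: "0 \<le> \<sigma>" and U: "U \<subseteq> X" "W \<subseteq> Y" "finite X" "finite Y"
  shows "\<bar>(\<Sum>w\<in>U. real (card (nb w \<inter> W))) - d / n * real (card U) * real (card W)\<bar> \<le> \<sigma> * sqrt (real (card U) * real (card W))"
proof -
  have fU: "finite U" "finite W" using finite_subset[OF U(1,3)] finite_subset[OF U(2,4)] .
  have "qb U W (\<sigma>\<^sup>2)" by (rule qb_mono[OF q U])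
  from spec[OF this[unfolded qb_def, THEN conjunct2], of "\<lambda>_. 1"]
  have a: "(\<Sum>w\<in>U. (\<Sum>u\<in>W. wt w u)\<^sup>2) \<le> \<sigma>\<^sup>2 * real (card W)" by simp
  have "(\<Sum>w\<in>U. 1 * (\<Sum>u\<in>W. wt w u))\<^sup>2 \<le> (\<Sum>w\<in>U. 1\<^sup>2) * (\<Sum>w\<in>U. (\<Sum>u\<in>W. wt w u)\<^sup>2)"
    by (rule Cauchy_Schwarz_ineq_sum)
  also have "\<dots> \<le> real (card U) * (\<sigma>\<^sup>2 * real (card W))"
  proof -
    have "(\<Sum>w\<in>U. 1\<^sup>2) = real (card U)" by simp
    then show ?thesis using a by (simp only: mult_left_mono of_nat_0_le_iff)
  qed
  finally have b1: "(\<Sum>w\<in>U. \<Sum>u\<in>W. wt w u)\<^sup>2 \<le> real (card U) * (\<sigma>\<^sup>2 * real (card W))" by (simp only: mult_1)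
  define r where "r = sqrt (real (card U) * real (card W))"
  have r: "0 \<le> r" "r\<^sup>2 = real (card U) * real (card W)" by (simp_all add: r_def)
  have "(\<sigma> * r)\<^sup>2 = real (card U) * (\<sigma>\<^sup>2 * real (card W))" unfolding power_mult_distrib r(2) by (rule mult.left_commute)
  from this b1 have "\<bar>\<Sum>w\<in>U. \<Sum>u\<in>W. wt w u\<bar>\<^sup>2 \<le> (\<sigma> * r)\<^sup>2" unfolding power2_abs by (rule ord_le_eq_trans[OF _ sym, rotated])
  then have b: "\<bar>\<Sum>w\<in>U. \<Sum>u\<in>W. wt w u\<bar> \<le> \<sigma> * sqrt (real (card U) * real (card W))"
    unfolding r_def[symmetric] by (rule power2_le_imp_le[OF _ mult_nonneg_nonneg[OF s r(1)]])
  have "(\<Sum>u\<in>W. wt w u) = real (card (nb w \<inter> W)) - d / n * real (card W)" for w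
  proof -
    have "(\<Sum>u\<in>W. if E w u then 1 else 0::real) = real (card {u\<in>W. E w u})"
      using fU by (simp add: sum.If_cases Int_def)
    moreover have "{u\<in>W. E w u} = nb w \<inter> W" by (auto simp: nb_def)
    ultimately show ?thesis by (simp add: wt_def sum_subtractf)
  qed
  then have "(\<Sum>w\<in>U. \<Sum>u\<in>W. wt w u) = (\<Sum>w\<in>U. real (card (nb w \<inter> W))) - d / n * real (card U) * real (card W)"
    by (simp add: sum_subtractf)
  then show ?thesis using b by simp
qed

text \<open>\<open>W\<close> contains all neighbours of \<open>U\<close> in \<open>Y\<close> and is
  so small that the main term of the mixing lemma accounts for at most half of the edges. The error
  term has to provide the other half, which forces \<open>W\<close> to be large compared with
  \<open>U\<close>.\<close>

lemma qb_expand: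
  assumes q: "qb X Y (\<sigma>\<^sup>2)" and s: "0 < \<sigma>" and U: "U \<subseteq> X" "finite X" "finite Y"
    and deg: "\<And>u. u \<in> U \<Longrightarrow> \<delta> \<le> real (card (nb u \<inter> Y))" and del: "0 \<le> \<delta>"
    and W: "(\<Union>u\<in>U. nb u \<inter> Y) \<subseteq> W" "W \<subseteq> Y" "2 * d * real (card W) \<le> \<delta> * n"
  shows "(\<delta> / (2 * \<sigma>))\<^sup>2 * real (card U) \<le> real (card W)"
proof (cases "card U = 0")
  case False
  have fU: "finite U" using finite_subset[OF U(1,2)] .
  have "\<delta> * real (card U) \<le> (\<Sum>w\<in>U. real (card (nb w \<inter> W)))"
  proof -
    have "nb w \<inter> W = nb w \<inter> Y" if "w \<in> U" for w using W that by blast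
    then have "(\<Sum>w\<in>U. \<delta>) \<le> (\<Sum>w\<in>U. real (card (nb w \<inter> W)))" using deg by (intro sum_mono) auto
    then show ?thesis by (simp add: mult.commute)
  qed
  also have "\<dots> \<le> d / n * real (card U) * real (card W) + \<sigma> * sqrt (real (card U) * real (card W))"
    using qb_edges[OF q _ U(1) W(2) U(2,3)] s by linarith
  also have "d / n * real (card U) * real (card W) \<le> \<delta> / 2 * real (card U)"
  proof -
    have "d / n * real (card W) \<le> \<delta> / 2" using W(3) n0 by (simp add: field_simps)
    from mult_right_mono[OF this, of "real (card U)"] show ?thesis by (simp add: ac_simps)
  qed
  finally have "\<delta> / 2 * real (card U) \<le> \<sigma> * sqrt (real (card U) * real (card W))" by (simp add: algebra_simps)
  then have "(\<delta> / 2 * real (card U))\<^sup>2 \<le> (\<sigma> * sqrt (real (card U) * real (card W)))\<^sup>2" using del by (intro power_mono) auto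
  then have "(\<delta> / 2)\<^sup>2 * real (card U) * real (card U) \<le> \<sigma>\<^sup>2 * real (card W) * real (card U)"
    by (simp add: power_mult_distrib power2_eq_square ac_simps)
  then have "(\<delta> / 2)\<^sup>2 * real (card U) \<le> \<sigma>\<^sup>2 * real (card W)" using False by simp
  then show ?thesis using s by (simp add: power_divide power_mult_distrib field_simps)
qed simp

text \<open>Without edges the whole main term of the mixing lemma is error.\<close>

lemma qb_nonadjacent:
  assumes q: "qb X Y (\<sigma>\<^sup>2)" and s: "0 \<le> \<sigma>" and U: "U \<subseteq> X" "W \<subseteq> Y" "finite X" "finite Y"
    and no: "\<And>u w. u \<in> U \<Longrightarrow> w \<in> W \<Longrightarrow> \<not> E u w"
  shows "real (card U) * real (card W) \<le> (\<sigma> * n / d)\<^sup>2"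
proof (cases "card U = 0 \<or> card W = 0")
  case False
  have "nb u \<inter> W = {}" if "u \<in> U" for u using no that by (auto simp: nb_def)
  then have "(\<Sum>w\<in>U. real (card (nb w \<inter> W))) = 0" by simp
  then have e: "d / n * real (card U) * real (card W) \<le> \<sigma> * sqrt (real (card U) * real (card W))"
    using qb_edges[OF q s U] by linarith
  define p where "p = sqrt (real (card U) * real (card W))"
  have pp: "real (card U) * real (card W) = p * p" by (simp add: p_def)
  have p0: "0 < p" using False unfolding p_def by (intro real_sqrt_gt_zero mult_pos_pos) auto
  have "d / n * p * p = d / n * real (card U) * real (card W)" unfolding mult.assoc pp ..
  also have "\<dots> \<le> \<sigma> * p" using e unfolding p_def .
  finally have "d / n * p * p \<le> \<sigma> * p" .
  then have "d / n * p \<le> \<sigma>" using p0 by (rule mult_right_le_imp_le)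
  then have "p \<le> \<sigma> * n / d" using d0 n0 by (simp add: field_simps)
  then have "p\<^sup>2 \<le> (\<sigma> * n / d)\<^sup>2" using p0 by (intro power_mono) auto
  then show ?thesis unfolding pp power2_eq_square .
qed auto

lemma row_norm:
  assumes "S \<subseteq> {..<n}"
  shows "(\<Sum>u\<in>S. (wt w u)\<^sup>2) \<le> real (card (nb w \<inter> S)) + real (card S) * (d / n)\<^sup>2"
proof -
  have fS: "finite S" by (rule finite_subset[OF assms]) simp
  have "(\<Sum>u\<in>S. (wt w u)\<^sup>2) \<le> (\<Sum>u\<in>S. (if E w u then 1 else 0) + (d / n)\<^sup>2)"
    using d0 by (intro sum_mono) (auto simp: wt_def power2_diff)
  also have "\<dots> = real (card {u\<in>S. E w u}) + real (card S) * (d / n)\<^sup>2"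
    using fS by (simp add: sum.distrib sum.If_cases Int_def)
  also have "{u\<in>S. E w u} = nb w \<inter> S" by (auto simp: nb_def)
  finally show ?thesis .
qed

text \<open>One random transversal and all its cyclic shifts give a partition; a union bound handles all
  classes, degrees and blocks at once.\<close>

theorem sampling:
  fixes J :: "nat set set" and s T :: "nat set \<Rightarrow> real"
  assumes Y: "Y \<subseteq> {..<n}" "card Y = G * K" and K: "0 < K" and l: "0 < l" "real n \<le> exp (real l)" and J: "finite J"
    and lower: "\<And>v. v < n \<Longrightarrow> 400 * real l \<le> real (card (nb v \<inter> Y)) / K"
    and upper: "\<And>v. v < n \<Longrightarrow> real (card (nb v)) \<le> D"
    and q: "\<And>S. S \<in> J \<Longrightarrow> S \<subseteq> {..<n} \<and> qb Y S (T S)" and row: "\<And>S w. S \<in> J \<Longrightarrow> w < n \<Longrightarrow> (\<Sum>u\<in>S. (wt w u)\<^sup>2) \<le> s S"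
    and s0: "\<And>S. S \<in> J \<Longrightarrow> 0 < s S"
    and cnt: "(2 * real n + real (card J)) * real K * exp (- 2 * real l) < 1"
  shows "\<exists>C. (\<forall>k<K. C k \<subseteq> Y \<and> card (C k) = G) \<and> (\<forall>k<K. \<forall>k'<K. k \<noteq> k' \<longrightarrow> C k \<inter> C k' = {}) \<and> (\<Union>k<K. C k) = Y \<and>
     (\<forall>k<K. \<forall>v<n. 9/10 * (real (card (nb v \<inter> Y)) / K) \<le> real (card (nb v \<inter> C k)) \<and> real (card (nb v \<inter> C k)) \<le> 2 * (D / K)) \<and>
     (\<forall>k<K. \<forall>S\<in>J. qb (C k) S (47 * real l * s S + 9/5 * T S / K))"
proof -
  have fY: "finite Y" by (rule finite_subset[OF Y(1)]) simp
  obtain e where e: "bij_betw e {..<G * K} Y"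
    using ex_bij_betw_nat_finite[OF fY] Y(2) by (auto simp: atLeast0LessThan)
  \<comment> \<open>\<open>Y\<close> is enumerated and cut into \<open>G\<close> groups of
    \<open>K\<close> consecutive elements; a transversal takes one element of each.\<close>
  define g where "g = (\<lambda>c j. e (c * K + j))"
  have idx: "c * K + j < G * K" if "c < G" "j < K" for c j
  proof -
    have "c * K + j < Suc c * K" using that by simp
    also have "\<dots> \<le> G * K" using that by (intro mult_right_mono) auto
    finally show ?thesis .
  qed
  have gY: "g c j \<in> Y" if "c < G" "j < K" for c j
    using idx[OF that] e unfolding g_def bij_betw_def by auto
  have ginj: "c = c' \<and> j = j'" if "c < G" "j < K" "c' < G" "j' < K" "g c j = g c' j'" for c j c' j'
  proof -
    have "c * K + j = c' * K + j'"
      using e idx[of c j] idx[of c' j'] that unfolding g_def bij_betw_def by (auto dest: inj_onD)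
    then have "(c * K + j) div K = (c' * K + j') div K" "(c * K + j) mod K = (c' * K + j') mod K" by simp_all
    then show ?thesis using that by simp
  qed
  have gsurj: "\<exists>c<G. \<exists>j<K. g c j = y" if "y \<in> Y" for y
  proof -
    have "y \<in> e ` {..<G * K}" using bij_betw_imp_surj_on[OF e] that by simp
    then obtain i where i: "i < G * K" "e i = y" by auto
    have "i div K < G" using i(1) K by (simp add: less_mult_imp_div_less)
    moreover have "i mod K < K" using K by simp
    moreover have "g (i div K) (i mod K) = y" using i(2) by (simp add: g_def)
    ultimately show ?thesis by blast
  qed
  have gbij: "bij_betw (\<lambda>(c, j). g c j) ({..<G} \<times> {..<K}) Y"
    unfolding bij_betw_def
  proof
    show "inj_on (\<lambda>(c, j). g c j) ({..<G} \<times> {..<K})"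
    proof (rule inj_onI, clarify)
      fix c j c' j' assume "c < G" "j < K" "c' < G" "j' < K" "g c j = g c' j'"
      then show "c = c' \<and> j = j'" by (intro ginj)
    qed
    show "(\<lambda>(c, j). g c j) ` ({..<G} \<times> {..<K}) = Y"
    proof
      show "(\<lambda>(c, j). g c j) ` ({..<G} \<times> {..<K}) \<subseteq> Y"
      proof
        fix y assume "y \<in> (\<lambda>(c, j). g c j) ` ({..<G} \<times> {..<K})"
        then obtain c j where "c < G" "j < K" "y = g c j" by auto
        then show "y \<in> Y" using gY by simp
      qed
      show "Y \<subseteq> (\<lambda>(c, j). g c j) ` ({..<G} \<times> {..<K})"
      proof
        fix y assume "y \<in> Y"
        then obtain c j where "c < G" "j < K" "g c j = y" using gsurj by metis
        then show "y \<in> (\<lambda>(c, j). g c j) ` ({..<G} \<times> {..<K})" by force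
      qed
    qed
  qed
  define cl where "cl = (\<lambda>t::nat\<Rightarrow>nat. (\<lambda>c. g c (t c)) ` {..<G})"
  define \<mu> where "\<mu> = (\<lambda>v. (\<Sum>c<G. \<Sum>j<K. (if E v (g c j) then 1 else 0::real)) / real K)"
  have mu: "\<mu> v = real (card (nb v \<inter> Y)) / K" for v
  proof -
    have "(\<Sum>c<G. \<Sum>j<K. (if E v (g c j) then 1 else 0::real)) = (\<Sum>(c, j)\<in>{..<G} \<times> {..<K}. (if E v (g c j) then 1 else 0))"
      by (rule sum.cartesian_product)
    also have "\<dots> = (\<Sum>p\<in>{..<G} \<times> {..<K}. (if E v ((\<lambda>(c, j). g c j) p) then 1 else 0))"
      by (intro sum.cong refl) auto
    also have "\<dots> = (\<Sum>y\<in>Y. if E v y then 1 else 0)" by (rule sum.reindex_bij_betw[OF gbij])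
    also have "\<dots> = real (card {y\<in>Y. E v y})" using fY by (simp add: sum.If_cases Int_def)
    also have "{y\<in>Y. E v y} = nb v \<inter> Y" by (auto simp: nb_def)
    finally show ?thesis by (simp add: \<mu>_def)
  qed
  have clinj: "inj_on (\<lambda>c. g c (t c)) {..<G}" if t: "t \<in> choices G K" for t
  proof (rule inj_onI)
    fix c c' assume c: "c \<in> {..<G}" "c' \<in> {..<G}" "g c (t c) = g c' (t c')"
    have "t c < K" "t c' < K" using t c(1,2) by (auto simp: choices_def PiE_iff)
    then show "c = c'" using ginj[of c "t c" c' "t c'"] c by simp
  qed
  have clcard: "(\<Sum>c<G. (if E v (g c (t c)) then 1 else 0)) = real (card (nb v \<inter> cl t))" if t: "t \<in> choices G K" for v t
  proof -
    have inj: "inj_on (\<lambda>c. g c (t c)) {..<G}" by (rule clinj[OF t])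
    have "(\<Sum>c<G. (if E v (g c (t c)) then 1 else 0)) = (\<Sum>y\<in>cl t. if E v y then 1 else 0::real)"
      unfolding cl_def using inj by (simp add: sum.reindex)
    also have "\<dots> = real (card {y\<in>cl t. E v y})" by (simp add: sum.If_cases Int_def cl_def)
    also have "{y\<in>cl t. E v y} = nb v \<inter> cl t" by (auto simp: nb_def)
    finally show ?thesis .
  qed
  have clsum: "(\<Sum>w\<in>cl t. f w) = (\<Sum>c<G. f (g c (t c)))" if t: "t \<in> choices G K" for t and f :: "nat \<Rightarrow> real"
  proof -
    have inj: "inj_on (\<lambda>c. g c (t c)) {..<G}" by (rule clinj[OF t])
    then show ?thesis unfolding cl_def by (simp add: sum.reindex)
  qed
  define bv where "bv = (\<lambda>S (c, j) u. if u \<in> S then wt (g c j) u else 0)"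
  have bvv: "bv S p \<in> vsp n" if "S \<in> J" for S p using q[OF that] by (auto simp: bv_def vsp_def split: prod.splits)
  have ipb: "ip n (bv S (c, j)) x = (\<Sum>u\<in>S. wt (g c j) u * x u)" if "S \<in> J" for S c j x
  proof -
    have "S \<subseteq> {..<n}" using q[OF that] by blast
    then have "(\<Sum>i<n. bv S (c, j) i * x i) = (\<Sum>u\<in>S. bv S (c, j) u * x u)"
      by (intro sum.mono_neutral_right) (auto simp: bv_def)
    then show ?thesis by (simp add: ip_def bv_def)
  qed
  \<comment> \<open>The bad events: for every vertex a degree that is too small and one that is too
    large, and for every column set a block of large norm.\<close>
  define I :: "(nat \<times> bool + nat set) set" where "I = Inl ` ({..<n} \<times> UNIV) \<union> Inr ` J"
  define P where "P = (\<lambda>(i :: nat \<times> bool + nat set) t. case i of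
      Inl (v, b) \<Rightarrow> (if b then (\<Sum>c<G. (if E v (g c (t c)) then 1 else 0)) < 9/10 * \<mu> v
                      else 2 * (D / K) < (\<Sum>c<G. (if E v (g c (t c)) then 1 else 0)))
    | Inr S \<Rightarrow> \<exists>x\<in>vsp n. (\<Sum>c<G. (ip n (bv S (c, t c)) x)\<^sup>2) > (47 * real l * s S + 9/5 * T S / K) * ip n x x)"
  have "\<exists>t\<in>choices G K. \<forall>k<K. \<forall>i\<in>I. \<not> P i (shift G K k t)"
  proof (rule union_shift[OF K])
    show "finite I" using J by (simp add: I_def)
    have "card I \<le> card (Inl ` ({..<n} \<times> (UNIV::bool set)) :: (nat \<times> bool + nat set) set) + card (Inr ` J :: (nat \<times> bool + nat set) set)"
      unfolding I_def by (rule card_Un_le)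
    also have "\<dots> = 2 * n + card J" by (simp add: card_image card_cartesian_product)
    finally have cI: "real (card I) \<le> 2 * real n + real (card J)" by linarith
    have "real (card I) * real K * exp (- 2 * real l) \<le> (2 * real n + real (card J)) * real K * exp (- 2 * real l)"
      using cI by (intro mult_right_mono) auto
    then show "real (card I) * real K * exp (- 2 * real l) < 1" using cnt by linarith
    fix i assume "i \<in> I"
    then consider v where "v < n" "i = Inl (v, True)" | v where "v < n" "i = Inl (v, False)" | S where "S \<in> J" "i = Inr S"
      unfolding I_def by (auto split: bool.splits)
    then show "real (card {t \<in> choices G K. P i t}) \<le> real K ^ G * exp (- 2 * real l)"
    proof cases
      case 1
      have "400 * real l \<le> \<mu> v" using lower[OF 1(1)] by (simp add: mu)
      from transversal_lower[OF K \<mu>_def[THEN fun_cong, of v] this] show ?thesis unfolding 1 P_def by simp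
    next
      case 2
      have "real (card (nb v \<inter> Y)) \<le> D"
        using upper[OF 2(1)] card_mono[OF finite_nb, of "nb v \<inter> Y" v] by auto
      then have "\<mu> v \<le> D / K" using K by (simp add: mu divide_right_mono)
      moreover have "400 * real l \<le> D / K" using lower[OF 2(1)] \<open>\<mu> v \<le> D / K\<close> mu[of v] by linarith
      ultimately show ?thesis using transversal_upper[OF K, of "\<lambda>c j. E v (g c j)" G "D / K" l] unfolding 2 P_def \<mu>_def by simp
    next
      case 3
      have "real (card {t\<in>choices G K. \<exists>x\<in>vsp n. (\<Sum>c<G. (ip n (bv S (c, t c)) x)\<^sup>2) > (47 * real l * s S + 9/5 * T S / K) * ip n x x})
        \<le> real K ^ G * exp (- 2 * real l)"
      proof (rule transversal_quad[OF _ K s0[OF 3(1)] _ _ _ l])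
        fix p assume "p \<in> {..<G} \<times> {..<K}"
        show "bv S p \<in> vsp n" by (rule bvv[OF 3(1)])
        obtain c j where p: "p = (c, j)" by fastforce
        have cj: "c < G" "j < K" using p \<open>p \<in> _\<close> by auto
        have "ip n (bv S p) (bv S p) = (\<Sum>u\<in>S. (wt (g c j) u)\<^sup>2)"
          unfolding p by (subst ipb[OF 3(1)]) (auto simp: bv_def power2_eq_square intro: sum.cong)
        also have "\<dots> \<le> s S" using row[OF 3(1)] gY[OF cj] Y(1) by auto
        finally show "ip n (bv S p) (bv S p) \<le> s S" .
      next
        fix x assume "x \<in> vsp n"
        have Sn: "S \<subseteq> {..<n}" and qS: "qb Y S (T S)" using q[OF 3(1)] by auto
        have "(\<Sum>p\<in>{..<G} \<times> {..<K}. (ip n (bv S p) x)\<^sup>2) = (\<Sum>p\<in>{..<G} \<times> {..<K}. (\<Sum>u\<in>S. wt (case p of (c, j) \<Rightarrow> g c j) u * x u)\<^sup>2)"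
          by (intro sum.cong refl) (auto simp: ipb[OF 3(1)])
        also have "\<dots> = (\<Sum>w\<in>Y. (\<Sum>u\<in>S. wt w u * x u)\<^sup>2)"
          by (rule sum.reindex_bij_betw[OF gbij])
        also have "\<dots> \<le> T S * (\<Sum>u\<in>S. (x u)\<^sup>2)" using qS[unfolded qb_def, THEN conjunct2] by (rule spec)
        also have "\<dots> \<le> T S * ip n x x"
          unfolding ip_def power2_eq_square[symmetric] using Sn qS by (intro mult_left_mono sum_mono2) (auto simp: qb_def)
        finally show "(\<Sum>p\<in>{..<G} \<times> {..<K}. (ip n (bv S p) x)\<^sup>2) \<le> T S * ip n x x" .
      next
        show "0 \<le> T S" using q[OF 3(1)] by (simp add: qb_def)
      qed
      then show ?thesis unfolding 3 P_def by simp
    qed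
  qed
  then obtain t where t: "t \<in> choices G K" and good: "\<And>k i. k < K \<Longrightarrow> i \<in> I \<Longrightarrow> \<not> P i (shift G K k t)" by blast
  define C where "C = (\<lambda>k. cl (shift G K k t))"
  have sc: "shift G K k t \<in> choices G K" for k using K by (rule shift_choices)
  have shv: "shift G K k t c = (t c + k) mod K" if "c < G" for k c using that by (simp add: shift_def)
  have C1: "C k \<subseteq> Y" "card (C k) = G" if "k < K" for k
  proof -
    show "C k \<subseteq> Y" unfolding C_def cl_def using gY K by (auto simp: shv)
    have "inj_on (\<lambda>c. g c (shift G K k t c)) {..<G}" by (rule clinj[OF sc])
    then show "card (C k) = G" unfolding C_def cl_def by (simp add: card_image)
  qed
  have C2: "C k \<inter> C k' = {}" if kk: "k < K" "k' < K" "k \<noteq> k'" for k k'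
  proof (rule ccontr)
    assume "C k \<inter> C k' \<noteq> {}"
    then obtain z where z: "z \<in> C k" "z \<in> C k'" by blast
    then obtain c c' where c0: "c < G" "c' < G" "z = g c (shift G K k t c)" "z = g c' (shift G K k' t c')"
      unfolding C_def cl_def by auto
    then have cc: "c < G" "c' < G" "g c ((t c + k) mod K) = g c' ((t c' + k') mod K)" by (simp_all add: shv)
    then have "c = c' \<and> (t c + k) mod K = (t c' + k') mod K" using K by (intro ginj) auto
    then have "(k + t c) mod K = (k' + t c) mod K" by (metis add.commute)
    then show False using shift_cancel kk by blast
  qed
  have C3: "(\<Union>k<K. C k) = Y"
  proof
    show "(\<Union>k<K. C k) \<subseteq> Y" using C1 by blast
    show "Y \<subseteq> (\<Union>k<K. C k)"
    proof
      fix y assume "y \<in> Y"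
      then obtain c j where cj: "c < G" "j < K" "g c j = y" using gsurj by blast
      have tc: "t c < K" using t cj(1) by (auto simp: choices_def PiE_iff)
      \<comment> \<open>The shift that carries \<open>t c\<close> to \<open>j\<close>; adding
        \<open>K\<close> first keeps the difference natural.\<close>
      let ?k = "(K - t c + j) mod K"
      have "(t c + ?k) mod K = (t c + (K - t c + j)) mod K" by (rule mod_add_right_eq)
      also have "\<dots> = (K + j) mod K" using tc by simp
      also have "\<dots> = j" using cj(2) by simp
      finally have "y = g c (shift G K ?k t c)" using cj shv[OF cj(1)] by simp
      then have "y \<in> C ?k" unfolding C_def cl_def using cj(1) by blast
      then show "y \<in> (\<Union>k<K. C k)" using K by auto
    qed
  qed
  have C4: "9/10 * (real (card (nb v \<inter> Y)) / K) \<le> real (card (nb v \<inter> C k)) \<and> real (card (nb v \<inter> C k)) \<le> 2 * (D / K)" if kv: "k < K" "v < n" for k v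
  proof -
    have "Inl (v, True) \<in> I" "Inl (v, False) \<in> I" using kv unfolding I_def by auto
    from good[OF kv(1) this(1)] good[OF kv(1) this(2)]
    show ?thesis unfolding P_def by (simp add: clcard[OF sc] mu C_def)
  qed
  have C5: "qb (C k) S (47 * real l * s S + 9/5 * T S / K)" if k: "k < K" and S: "S \<in> J" for k S
    unfolding qb_def
  proof (intro conjI allI)
    fix x :: "nat \<Rightarrow> real"
    have Sn: "S \<subseteq> {..<n}" and T0: "0 \<le> T S" using q[OF S] by (auto simp: qb_def)
    show "0 \<le> 47 * real l * s S + 9/5 * T S / K" using s0[OF S] T0 by (intro add_nonneg_nonneg) auto
    let ?x = "\<lambda>u. if u \<in> S then x u else 0"
    have xv: "?x \<in> vsp n" using Sn by (auto simp: vsp_def)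
    have "Inr S \<in> I" using S by (simp add: I_def)
    from good[OF k this] xv have "(\<Sum>c<G. (ip n (bv S (c, shift G K k t c)) ?x)\<^sup>2) \<le> (47 * real l * s S + 9/5 * T S / K) * ip n ?x ?x"
      unfolding P_def by (simp add: not_less)
    moreover have "(\<Sum>c<G. (ip n (bv S (c, shift G K k t c)) ?x)\<^sup>2) = (\<Sum>w\<in>C k. (\<Sum>u\<in>S. wt w u * x u)\<^sup>2)"
      unfolding C_def clsum[OF sc] by (intro sum.cong refl) (simp add: ipb[OF S])
    moreover have "ip n ?x ?x = (\<Sum>u\<in>S. (x u)\<^sup>2)"
    proof -
      have "ip n ?x ?x = (\<Sum>u\<in>S. ?x u * ?x u)" unfolding ip_def using Sn by (intro sum.mono_neutral_right) auto
      then show ?thesis by (simp add: power2_eq_square)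
    qed
    ultimately show "(\<Sum>w\<in>C k. (\<Sum>u\<in>S. wt w u * x u)\<^sup>2) \<le> (47 * real l * s S + 9/5 * T S / K) * (\<Sum>u\<in>S. (x u)\<^sup>2)" by simp
  qed
  show ?thesis
  proof (intro exI[of _ C] conjI allI impI ballI)
  qed (use C1 C2 C3 C4 C5 in simp_all)
qed

end

section \<open>Matchings, and the hosts for absorber and links\<close>

context expander
begin

lemma nb_sym: "u \<in> nb v \<longleftrightarrow> v \<in> nb u"
  using Esym by (auto simp: nb_def)

lemma qb_Un:
  assumes "qb X Y \<tau>" "qb X' Y \<tau>'" "finite X" "finite X'"
  shows "qb (X \<union> X') Y (\<tau> + \<tau>')"
  unfolding qb_def
proof (intro conjI allI)
  show "0 \<le> \<tau> + \<tau>'" using assms(1,2) by (simp add: qb_def)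
  fix x :: "nat \<Rightarrow> real"
  have "(\<Sum>w\<in>X \<union> X'. (\<Sum>u\<in>Y. wt w u * x u)\<^sup>2) \<le> (\<Sum>w\<in>X. (\<Sum>u\<in>Y. wt w u * x u)\<^sup>2) + (\<Sum>w\<in>X'. (\<Sum>u\<in>Y. wt w u * x u)\<^sup>2)"
    using sum.union_inter[OF assms(3,4), of "\<lambda>w. (\<Sum>u\<in>Y. wt w u * x u)\<^sup>2"]
      sum_nonneg[of "X \<inter> X'" "\<lambda>w. (\<Sum>u\<in>Y. wt w u * x u)\<^sup>2"] by simp
  also have "\<dots> \<le> \<tau> * (\<Sum>u\<in>Y. (x u)\<^sup>2) + \<tau>' * (\<Sum>u\<in>Y. (x u)\<^sup>2)"
    using assms(1,2)[unfolded qb_def, THEN conjunct2, THEN spec, of x] by (rule add_mono)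
  finally show "(\<Sum>w\<in>X \<union> X'. (\<Sum>u\<in>Y. wt w u * x u)\<^sup>2) \<le> (\<tau> + \<tau>') * (\<Sum>u\<in>Y. (x u)\<^sup>2)"
    by (simp only: distrib_right)
qed

lemma qb_row:
  assumes "(\<Sum>u\<in>Y. (wt w u)\<^sup>2) \<le> s"
  shows "qb {w} Y s"
  unfolding qb_def
proof (intro conjI allI)
  have "0 \<le> (\<Sum>u\<in>Y. (wt w u)\<^sup>2)" by (intro sum_nonneg) simp
  then show "0 \<le> s" using assms by simp
  fix x :: "nat \<Rightarrow> real"
  have "(\<Sum>u\<in>Y. wt w u * x u)\<^sup>2 \<le> (\<Sum>u\<in>Y. (wt w u)\<^sup>2) * (\<Sum>u\<in>Y. (x u)\<^sup>2)" by (rule Cauchy_Schwarz_ineq_sum)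
  also have "\<dots> \<le> s * (\<Sum>u\<in>Y. (x u)\<^sup>2)" using assms by (intro mult_right_mono sum_nonneg) auto
  finally show "(\<Sum>w\<in>{w}. (\<Sum>u\<in>Y. wt w u * x u)\<^sup>2) \<le> s * (\<Sum>u\<in>Y. (x u)\<^sup>2)" by simp
qed

text \<open>Below this size \<open>qb_expand\<close> applies to the neighbourhood, with a factor of
  at least 1, so Hall's condition holds.\<close>

lemma small_neighbourhood:
  assumes q: "qb L L' (\<sigma>\<^sup>2)" and s: "0 < \<sigma>" "2 * \<sigma> < \<delta>" and fin: "finite L" "finite L'" and X: "X \<subseteq> L"
    and deg: "\<And>a. a \<in> L \<Longrightarrow> \<delta> \<le> real (card (nb a \<inter> L'))"
    and c: "card (\<Union>a\<in>X. nb a \<inter> L') < card X"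
  shows "\<delta> * n / (2 * d) < real (card X)"
proof (rule ccontr)
  let ?W = "\<Union>a\<in>X. nb a \<inter> L'"
  assume "\<not> \<delta> * n / (2 * d) < real (card X)"
  then have "real (card X) \<le> \<delta> * n / (2 * d)" by simp
  moreover have "real (card ?W) \<le> real (card X)" using c by simp
  ultimately have "real (card ?W) \<le> \<delta> * n / (2 * d)" by linarith
  then have W: "2 * d * real (card ?W) \<le> \<delta> * n" using d0 by (simp add: field_simps)
  have e: "(\<delta> / (2 * \<sigma>))\<^sup>2 * real (card X) \<le> real (card ?W)"
    by (rule qb_expand[OF q s(1) X fin _ _ _ _ W]) (use deg X s in auto)
  have "1 \<le> \<delta> / (2 * \<sigma>)" using s by simp
  then have "1 \<le> (\<delta> / (2 * \<sigma>))\<^sup>2" by (rule one_le_power)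
  from mult_right_mono[OF this, of "real (card X)"] have "real (card X) \<le> real (card ?W)" using e by linarith
  then show False using c by linarith
qed

text \<open>If \<open>X\<close> violates Hall's condition, the vertices of \<open>L'\<close> without
  neighbours in \<open>X\<close> violate it from the other side, because the two sides have equal
  size. By \<open>small_neighbourhood\<close> both sets have more than
  \<open>\<delta> * n / (2 * d)\<close> elements, but no edge runs between them, so the product of
  their sizes is at most \<open>(\<sigma> * n / d)^2\<close>, which is less.\<close>

lemma matching:
  assumes q: "qb L L' (\<sigma>\<^sup>2)" and s: "0 < \<sigma>" "2 * \<sigma> < \<delta>" and fin: "finite L" "finite L'" and c: "card L = card L'"
    and deg: "\<And>a. a \<in> L \<Longrightarrow> \<delta> \<le> real (card (nb a \<inter> L'))" and deg': "\<And>b. b \<in> L' \<Longrightarrow> \<delta> \<le> real (card (nb b \<inter> L))"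
  shows "\<exists>f. inj_on f L \<and> (\<forall>a\<in>L. f a \<in> L' \<and> E a (f a))"
proof -
  have "\<exists>f. inj_on f L \<and> (\<forall>a\<in>L. f a \<in> nb a \<inter> L')"
  proof (rule Hall[OF fin(1)])
    fix X assume X: "X \<subseteq> L"
    show "card X \<le> card (\<Union>a\<in>X. nb a \<inter> L')"
    proof (rule ccontr)
      let ?W = "\<Union>a\<in>X. nb a \<inter> L'"
      let ?X = "L' - ?W"
      assume "\<not> card X \<le> card ?W"
      then have lt: "card ?W < card X" by simp
      have a: "\<delta> * n / (2 * d) < real (card X)" by (rule small_neighbourhood[OF q s fin X deg lt])
      have WL: "?W \<subseteq> L'" by blast
      have fW: "finite ?W" by (rule finite_subset[OF WL fin(2)])
      have fX: "finite X" by (rule finite_subset[OF X fin(1)])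
      have cX: "card ?X = card L' - card ?W" by (rule card_Diff_subset[OF fW WL])
      have sub: "(\<Union>b\<in>?X. nb b \<inter> L) \<subseteq> L - X" using nb_sym by blast
      have "card (\<Union>b\<in>?X. nb b \<inter> L) \<le> card (L - X)" using sub fin by (intro card_mono) auto
      also have "\<dots> = card L - card X" by (rule card_Diff_subset[OF fX X])
      also have "\<dots> < card ?X" using cX lt c card_mono[OF fin(1) X] by linarith
      finally have lt': "card (\<Union>b\<in>?X. nb b \<inter> L) < card ?X" .
      have b: "\<delta> * n / (2 * d) < real (card ?X)"
        by (rule small_neighbourhood[OF qb_sym[OF q] s fin(2,1) _ deg' lt']) auto
      have up: "real (card X) * real (card ?X) \<le> (\<sigma> * n / d)\<^sup>2"
        by (rule qb_nonadjacent[OF q _ X _ fin]) (use s in \<open>auto simp: nb_def\<close>)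
      have le: "\<sigma> * n / d \<le> \<delta> * n / (2 * d)"
      proof -
        have "\<sigma> * (n / d) \<le> (\<delta> / 2) * (n / d)" using s d0 by (intro mult_right_mono) auto
        then show ?thesis by simp
      qed
      have nn: "0 \<le> \<sigma> * n / d" using s d0 by simp
      have p: "0 \<le> \<delta> * n / (2 * d)" by (rule order_trans[OF nn le])
      have "(\<delta> * n / (2 * d)) * (\<delta> * n / (2 * d)) < real (card X) * real (card ?X)"
        by (rule mult_strict_mono'[OF a b p p])
      also note up
      also have "(\<sigma> * n / d)\<^sup>2 \<le> (\<delta> * n / (2 * d)) * (\<delta> * n / (2 * d))"
        unfolding power2_eq_square by (rule mult_mono[OF le le p nn])
      finally show False by (rule less_irrefl[THEN notE])
    qed
  qed simp
  then show ?thesis by (auto simp: nb_def)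
qed

text \<open>\<open>c\<close> is fixed before \<open>j\<close>, so the caller can adjust the size of
  the absorber to any residue it wants.\<close>

lemma absorb_stage:
  assumes q: "qb {..<n} {..<n} ((d / 150)\<^sup>2)" and Z: "Z \<subseteq> {..<n}" "real n / 4 \<le> real (card Z)"
    and R: "R \<subseteq> {..<n}" "R \<noteq> {}" "Z \<inter> R = {}"
    and deg: "\<And>v. v < n \<Longrightarrow> 29/100 * d \<le> real (card (nb v \<inter> Z))" and n': "1000000 \<le> real n"
    and small: "\<And>k. 2 ^ k \<le> n \<Longrightarrow> real (card R + card R * (4 * k + 2 + k * (2 * k))) \<le> real n / 1000"
  shows "\<exists>c. real c \<le> n / 1000 \<and> (\<forall>j. real j \<le> n / 50 \<longrightarrow> (\<exists>x t S. S \<subseteq> Z \<and> card S = c + j \<and> x \<in> S \<and> t \<in> S \<and> x \<noteq> t \<and> absorbs E x t S R))"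
proof -
  \<comment> \<open>The norm bound joins any two sets of more than \<open>n / 150\<close> vertices
    by an edge; \<open>m\<close> stays above \<open>n / 149\<close>.\<close>
  define m where "m = nat \<lfloor>real n / 148\<rfloor>"
  have m: "real n / 149 \<le> real m" "real m \<le> real n / 148" "1 \<le> m"
    using n' unfolding m_def by linarith+
  define cap where "cap = nat \<lfloor>real n / 10\<rfloor>"
  have cap: "real cap \<le> real n / 10" "real n / 11 \<le> real cap" using n' unfolding cap_def by linarith+
  have "\<exists>k. m \<le> 2 ^ k \<and> 2 ^ k < 2 * m"
  proof -
    define k where "k = (LEAST k. m \<le> 2 ^ k)"
    have ex: "m \<le> 2 ^ m" using less_exp[of m] by simp
    have k: "m \<le> 2 ^ k" unfolding k_def using ex by (rule LeastI)
    have "(2::nat) ^ k < 2 * m"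
    proof (cases k)
      case 0 then show ?thesis using m(3) by simp
    next
      case (Suc i)
      then have "i < (LEAST k. m \<le> 2 ^ k)" by (simp add: k_def)
      from not_less_Least[OF this] show ?thesis using Suc by simp
    qed
    then show ?thesis using k by blast
  qed
  then obtain k where k: "m \<le> 2 ^ k" "2 ^ k < 2 * m" by blast
  have k1: "1 \<le> k" using k(1) m(1) n' by (cases k) auto
  define V where "V = R \<union> Z"
  \<comment> \<open>New vertices are taken from \<open>Z\<close> only, so growing never consumes
    reservoir vertices.\<close>
  define Nb where "Nb = (\<lambda>u. nb u \<inter> Z)"
  have Vn: "V \<subseteq> {..<n}" using R Z by (auto simp: V_def)
  have fZ: "finite Z" by (rule finite_subset[OF Z(1)]) simp
  have fR: "finite R" by (rule finite_subset[OF R(1)]) simp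
  have fV: "finite V" using fZ fR by (simp add: V_def)
  have big: "cap + 2 * 4 * m + 1 \<le> card (\<Union>u\<in>U. Nb u)" if U: "U \<subseteq> V" "m \<le> card U" for U
  proof -
    let ?W = "Z - (\<Union>u\<in>U. Nb u)"
    have "real (card U) * real (card ?W) \<le> (d / 150 * n / d)\<^sup>2"
      by (rule qb_nonadjacent[OF q]) (use U Vn Z d0 in \<open>auto simp: Nb_def nb_def\<close>)
    also have "d / 150 * n / d = n / 150" using d0 by simp
    finally have "real (card U) * real (card ?W) \<le> (n / 150)\<^sup>2" .
    moreover have "(n / 149) * real (card ?W) \<le> real (card U) * real (card ?W)"
      using m(1) U(2) by (intro mult_right_mono) auto
    ultimately have "(n / 149) * real (card ?W) \<le> (n / 150)\<^sup>2" by linarith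
    then have "real (card ?W) \<le> 149 * (n / 22500)" using n0 by (simp add: power2_eq_square field_simps)
    moreover have "card ?W = card Z - card (\<Union>u\<in>U. Nb u)" "card (\<Union>u\<in>U. Nb u) \<le> card Z"
    proof -
      have s: "(\<Union>u\<in>U. Nb u) \<subseteq> Z" by (auto simp: Nb_def)
      show "card ?W = card Z - card (\<Union>u\<in>U. Nb u)" by (rule card_Diff_subset[OF finite_subset[OF s fZ] s])
      show "card (\<Union>u\<in>U. Nb u) \<le> card Z" by (rule card_mono[OF fZ s])
    qed
    ultimately have "real (card (\<Union>u\<in>U. Nb u)) \<ge> real (card Z) - 149 * (n / 22500)" by (simp add: of_nat_diff)
    then have "real (cap + 2 * 4 * m + 1) \<le> real (card (\<Union>u\<in>U. Nb u))" using cap(1) m(2) Z(2) n' by simp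
    then show ?thesis by (simp only: of_nat_le_iff)
  qed
  interpret absorber_host V Nb 4 m cap E k
  proof
    show "finite V" by (rule fV)
    show "Nb u \<subseteq> V" for u by (auto simp: Nb_def V_def)
    show "cap + 2 * 4 * m + 1 \<le> card (\<Union>u\<in>U. Nb u)" if "U \<subseteq> V" "m \<le> card U" for U using big[OF that] .
    show "E w u" if "E u w" for u w using that by (rule Esym)
    show "E u w" if "w \<in> Nb u" for u w using that by (simp add: Nb_def nb_def)
    show "\<exists>u\<in>X. \<exists>w\<in>Y. E u w" if XY: "X \<subseteq> V" "Y \<subseteq> V" "m \<le> card X" "m \<le> card Y" for X Y
    proof (rule ccontr)
      assume no: "\<not> (\<exists>u\<in>X. \<exists>w\<in>Y. E u w)"
      have "real (card X) * real (card Y) \<le> (d / 150 * n / d)\<^sup>2"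
        by (rule qb_nonadjacent[OF q]) (use XY Vn d0 no in auto)
      also have "d / 150 * n / d = n / 150" using d0 by simp
      finally have "real (card X) * real (card Y) \<le> (n / 150)\<^sup>2" .
      moreover have "(n / 149) * (n / 149) \<le> real (card X) * real (card Y)"
        using m(1) XY by (intro mult_mono) auto
      moreover have "(n / 150)\<^sup>2 < (n / 149) * (n / 149)" using n0 by (simp add: power2_eq_square field_simps)
      ultimately show False by linarith
    qed
  qed (use m k k1 in auto)
  have st: "ext R (\<lambda>_. 0)"
  proof (rule ext_start)
    show "R \<subseteq> V" by (simp add: V_def)
    fix U assume U: "U \<subseteq> V" "card U \<le> 2 * m"
    let ?W = "\<Union>u\<in>U. nb u \<inter> Z"
    have NB: "NB U - R = ?W" unfolding NB_def using R(3) by (auto simp: Nb_def)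
    have "4 * real (card U) \<le> real (card ?W)"
    \<comment> \<open>Either the neighbourhood is small enough for \<open>qb_expand\<close>, which
      gives the factor \<open>(435/20)^2\<close>, or it has more than \<open>29/200 * n\<close>
      vertices, well above the \<open>8 * m\<close> that are asked for.\<close>
    proof (cases "2 * d * real (card ?W) \<le> (29/100 * d) * n")
      case True
      have "(29/100 * d / (2 * (d / 150)))\<^sup>2 * real (card U) \<le> real (card ?W)"
      proof (rule qb_expand[OF _ _ _ _ _ _ _ _ _ True])
        show "qb {..<n} Z ((d / 150)\<^sup>2)" by (rule qb_mono[OF q]) (use Z in auto)
        show "29/100 * d \<le> real (card (nb u \<inter> Z))" if "u \<in> U" for u by (rule deg) (use that U Vn in auto)
      qed (use U Vn d0 fZ in auto)
      moreover have "29/100 * d / (2 * (d / 150)) = 435/20" using d0 by simp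
      ultimately have "(435/20)\<^sup>2 * real (card U) \<le> real (card ?W)" by (simp only:)
      moreover have "4 * real (card U) \<le> (435/20)\<^sup>2 * real (card U)" by (intro mult_right_mono) (auto simp: power2_eq_square)
      ultimately show ?thesis by (rule order_trans[rotated])
    next
      case False
      then have "29/100 * n * d < 2 * real (card ?W) * d" by (simp add: ac_simps)
      then have "29/100 * real n < 2 * real (card ?W)" using d0 by simp
      moreover have "real (card U) \<le> 2 * real m" using U(2) by (metis of_nat_le_iff of_nat_mult of_nat_numeral)
      ultimately show ?thesis using m(2) n' by linarith
    qed
    then have "real (4 * card U) \<le> real (card ?W)" by simp
    then show "4 * card U \<le> card (NB U - R)" unfolding NB by (simp only: of_nat_le_iff)
  qed
  obtain rs where rs: "set rs = R" "distinct rs" using finite_distinct_list[OF fR] by blast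
  have lrs: "length rs = card R" using rs distinct_card by metis
  let ?b = "card R * (4 * k + 2 + k * (2 * k))"
  have "(2::nat) ^ k \<le> n"
  proof -
    have "real (2 ^ k) < real (2 * m)" using k(2) by (simp only: of_nat_less_iff)
    then have "real (2 ^ k) \<le> real n" using m(2) n' by linarith
    then show ?thesis by (simp only: of_nat_le_iff)
  qed
  from small[OF this] have sm: "real (card R) + real ?b \<le> n / 1000" by simp
  have p2: "real (2 ^ k) \<le> n / 74"
  proof -
    have "real (2 ^ k) < real (2 * m)" using k(2) by (simp only: of_nat_less_iff)
    then show ?thesis using m(2) by linarith
  qed
  have "\<exists>x t S \<delta>'. S \<subseteq> V - R \<and> finite S \<and> card S \<le> length rs * (4 * k + 2 + k * (2 * k)) \<and> ext (R \<union> S) \<delta>' \<and>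
    x \<in> S \<and> t \<in> S \<and> x \<noteq> t \<and> \<delta>' x \<le> 3 \<and> \<delta>' t \<le> 2 \<and> (\<forall>v\<in>R. v \<notin> set rs \<longrightarrow> \<delta>' v = (\<lambda>_. 0) v) \<and> absorbs E x t S (set rs)"
  proof (rule absorber_many[OF rs(2) _ _ st])
    have "real (card R + ?b + 4 * 2 ^ k) \<le> real cap" using sm p2 cap(2) n' by simp
    then show "card R + length rs * (4 * k + 2 + k * (2 * k)) + 4 * 2 ^ k \<le> cap" unfolding lrs by (simp only: of_nat_le_iff)
  qed (use rs R in auto)
  then obtain x t S \<delta>' where S: "S \<subseteq> V - R" "finite S" "card S \<le> ?b" "ext (R \<union> S) \<delta>'"
    "x \<in> S" "t \<in> S" "x \<noteq> t" "\<delta>' t \<le> 2" "absorbs E x t S R" unfolding lrs rs(1) by blast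
  have cS: "real (card S) \<le> real ?b" using S(3) by (simp only: of_nat_le_iff)
  show ?thesis
  proof (rule exI[of _ "card S"], intro conjI allI impI)
    show "real (card S) \<le> n / 1000" using cS sm by linarith
    fix j assume j: "real j \<le> n / 50"
    have "\<exists>t' S' \<delta>''. S' \<subseteq> V - R \<and> finite S' \<and> card S' = card S + j \<and> x \<in> S' \<and> t' \<in> S' \<and> x \<noteq> t' \<and> absorbs E x t' S' R"
    proof -
      have "card (R \<union> S) \<le> card R + card S" by (rule card_Un_le)
      then have "real (card (R \<union> S) + j) \<le> real (card R) + real (card S) + real j" by linarith
      then have "real (card (R \<union> S) + j) \<le> real cap" using j cS sm cap(2) n' by linarith
      then have "card (R \<union> S) + j \<le> cap" by (simp only: of_nat_le_iff)
      from absorber_extend[OF S(4,5,6,7,8,9) order.refl S(1,2) this] show ?thesis by blast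
    qed
    then obtain t' S' where S': "S' \<subseteq> V - R" "card S' = card S + j" "x \<in> S'" "t' \<in> S'" "x \<noteq> t'" "absorbs E x t' S' R" by auto
    have "S' \<subseteq> Z" using S'(1) by (auto simp: V_def)
    then show "\<exists>x t S'. S' \<subseteq> Z \<and> card S' = card S + j \<and> x \<in> S' \<and> t \<in> S' \<and> x \<noteq> t \<and> absorbs E x t S' R"
      by (intro exI[of _ x] exI[of _ t'] exI[of _ S'] conjI S')
  qed
qed

text \<open>Vertices of \<open>R1\<close> and of \<open>Starts\<close> only look for neighbours in \<open>R2\<close>, those of \<open>R2\<close> and \<open>Ends\<close> in \<open>R1\<close>;
  so the leaves of a tree grown from a start and of one grown from an end lie on opposite sides, whatever the parity of \<open>k\<close>.\<close>

lemma link_stage: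
  fixes R1 R2 Starts Ends :: "nat set" and N k :: nat and ps :: "nat list list" and \<sigma> \<delta> :: real
  assumes An: "A1 \<subseteq> {..<n}" "A2 \<subseteq> {..<n}" "A1 \<inter> A2 = {}" and A: "A1 = R1 \<union> Starts" "A2 = R2 \<union> Ends" "R1 \<inter> Starts = {}" "R2 \<inter> Ends = {}"
    and c: "card R1 = N" "card R2 = N" "10000 \<le> real N"
    and q: "qb A1 R2 (\<sigma>\<^sup>2)" "qb A2 R1 (\<sigma>\<^sup>2)" and s: "0 < \<sigma>" "8 * \<sigma> \<le> \<delta>" "6/10 * d * N \<le> \<delta> * n" "\<sigma> * n \<le> 53/1000 * N * d"
    and deg: "\<And>v. v < n \<Longrightarrow> \<delta> \<le> real (card (nb v \<inter> R1))" "\<And>v. v < n \<Longrightarrow> \<delta> \<le> real (card (nb v \<inter> R2))"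
    and k: "53/1000 * real N < 2 ^ k" "2 ^ k \<le> 107/1000 * real N"
    and ba: "b \<in> Ends" "a0 \<in> Starts"
    and ps: "\<And>p. p \<in> set ps \<Longrightarrow> p \<noteq> [] \<and> hd p \<in> Starts \<and> last p \<in> Ends \<and> set p \<inter> (R1 \<union> R2) = {} \<and> successively E p \<and> distinct p"
      "distinct (b # a0 # map hd ps @ map last ps)" "distinct (concat ps)"
    and small: "real (card (Starts \<union> Ends) + Suc (length ps) * (2 * k)) \<le> real N / 20"
  shows "\<exists>ts Q. set ts = set (concat ps) \<union> Q \<and> Q \<subseteq> R1 \<union> R2 \<and> distinct ts \<and> successively E (b # ts @ [a0])"
proof -
  define m where "m = nat \<lfloor>real N / 50\<rfloor>"
  have m: "real N / 50 - 1 \<le> real m" "real m \<le> real N / 50" "1 \<le> m"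
    using c(3) unfolding m_def by linarith+
  \<comment> \<open>Room for the two trees of a link, \<open>4 * 2 ^ k \<le> 428/1000 * N\<close>,
    together with the \<open>N / 20\<close> for terminals and finished links.\<close>
  define cap where "cap = nat \<lfloor>real N * 48 / 100\<rfloor>"
  have cap: "real cap \<le> real N * 48 / 100" "real N * 48 / 100 - 1 \<le> real cap" using c(3) unfolding cap_def by linarith+
  define V where "V = A1 \<union> A2"
  define Nb where "Nb = (\<lambda>u. if u \<in> A1 then nb u \<inter> R2 else nb u \<inter> R1)"
  define B where "B = Starts \<union> Ends"
  have Vn: "V \<subseteq> {..<n}" using An by (simp add: V_def)
  have fA: "finite A1" "finite A2" using finite_subset[OF An(1)] finite_subset[OF An(2)] by simp_all
  have fR: "finite R1" "finite R2" using fA A by simp_all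
  have fV: "finite V" using fA by (simp add: V_def)
  have rel: "\<sigma> * n / d \<le> 53/1000 * N" using s(4) d0 by (simp add: field_simps)
  have rel2: "(\<sigma> * n / d)\<^sup>2 \<le> (53/1000 * N)\<^sup>2" using rel s d0 by (intro power_mono) auto
  have N0: "0 < real N" using c(3) by linarith
  \<comment> \<open>A set of at least \<open>98/10000 * N\<close> vertices on one side misses at
    most \<open>(53/1000)^2 / (98/10000) * N\<close> vertices of the opposite reservoir, which is
    less than \<open>29/100 * N\<close>.\<close>
  have bigpart: "real N * 71 / 100 \<le> real (card (\<Union>u\<in>U. nb u \<inter> R))"
    if U: "U \<subseteq> A" "real m / 2 \<le> real (card U)" and qA: "qb A R (\<sigma>\<^sup>2)" "finite A" "finite R" "card R = N" for U A R
  proof -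
    let ?N = "\<Union>u\<in>U. nb u \<inter> R"
    let ?W = "R - ?N"
    have sub: "?N \<subseteq> R" by blast
    have "real (card U) * real (card ?W) \<le> (\<sigma> * n / d)\<^sup>2"
      by (rule qb_nonadjacent[OF qA(1)]) (use U qA s in \<open>auto simp: nb_def\<close>)
    moreover have "(real N / 100 - 1/2) * real (card ?W) \<le> real (card U) * real (card ?W)"
      using m(1) U(2) by (intro mult_right_mono) auto
    moreover have "(real N * 98 / 10000) * real (card ?W) \<le> (real N / 100 - 1/2) * real (card ?W)"
      using c(3) by (intro mult_right_mono) auto
    ultimately have "(real N * 98 / 10000) * real (card ?W) \<le> (53/1000 * real N)\<^sup>2" using rel2 by linarith
    also have "\<dots> = real N * (2809/1000000 * real N)" by (simp add: power2_eq_square)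
    finally have "real N * (98 / 10000 * real (card ?W)) \<le> real N * (2809/1000000 * real N)" by (simp only: mult.assoc times_divide_eq_right times_divide_eq_left mult.commute)
    then have "98 / 10000 * real (card ?W) \<le> 2809/1000000 * real N" using N0 by (rule mult_left_le_imp_le)
    moreover have "card ?W = card R - card ?N" by (rule card_Diff_subset[OF finite_subset[OF sub qA(3)] sub])
    moreover have "card ?N \<le> card R" by (rule card_mono[OF qA(3) sub])
    ultimately show ?thesis using qA(4) by linarith
  qed
  have half: "real (card U) / 2 \<le> real (card (U \<inter> A1)) \<or> real (card U) / 2 \<le> real (card (U \<inter> A2))" if "U \<subseteq> V" for U
  proof -
    have "U = (U \<inter> A1) \<union> (U \<inter> A2)" using that by (auto simp: V_def)
    then have "card U \<le> card (U \<inter> A1) + card (U \<inter> A2)" by (metis card_Un_le)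
    then show ?thesis by linarith
  qed
  have NB1: "(\<Union>u\<in>U \<inter> A1. nb u \<inter> R2) \<subseteq> (\<Union>u\<in>U. Nb u)" for U unfolding Nb_def by force
  have NB2: "(\<Union>u\<in>U \<inter> A2. nb u \<inter> R1) \<subseteq> (\<Union>u\<in>U. Nb u)" for U using An(3) unfolding Nb_def by force
  have NbR: "(\<Union>u\<in>U. Nb u) \<subseteq> R1 \<union> R2" for U unfolding Nb_def by auto
  have fNb: "finite (\<Union>u\<in>U. Nb u)" for U by (rule finite_subset[OF NbR]) (simp add: fR)
  \<comment> \<open>A set may spread over both sides. An estimate for the side that holds at least
    half of it passes to its whole neighbourhood.\<close>
  have lift: "P (real (card (\<Union>u\<in>U. Nb u)))" if U: "U \<subseteq> V"
    and h: "\<And>A R. (A = A1 \<and> R = R2) \<or> (A = A2 \<and> R = R1) \<Longrightarrow> real (card U) / 2 \<le> real (card (U \<inter> A)) \<Longrightarrow> P (real (card (\<Union>u\<in>U \<inter> A. nb u \<inter> R)))"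
    and mono: "\<And>x y. P x \<Longrightarrow> x \<le> y \<Longrightarrow> P y" for U and P :: "real \<Rightarrow> bool"
    using half[OF U]
  proof
    assume "real (card U) / 2 \<le> real (card (U \<inter> A1))"
    from h[OF _ this, of R2] show ?thesis by (rule mono) (use card_mono[OF fNb NB1] in auto)
  next
    assume "real (card U) / 2 \<le> real (card (U \<inter> A2))"
    from h[OF _ this, of R1] show ?thesis by (rule mono) (use card_mono[OF fNb NB2] in auto)
  qed
  have big: "cap + 2 * 3 * m + 1 \<le> card (\<Union>u\<in>U. Nb u)" if U: "U \<subseteq> V" "m \<le> card U" for U
  proof -
    have "real N * 71 / 100 \<le> real (card (\<Union>u\<in>U. Nb u))"
    proof (rule lift[OF U(1)])
      fix A R assume AR: "(A = A1 \<and> R = R2) \<or> (A = A2 \<and> R = R1)" and h: "real (card U) / 2 \<le> real (card (U \<inter> A))"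
      have mU: "real m / 2 \<le> real (card (U \<inter> A))" using h U(2) by linarith
      show "real N * 71 / 100 \<le> real (card (\<Union>u\<in>U \<inter> A. nb u \<inter> R))"
        by (rule bigpart[OF Int_lower2 mU]) (use AR q fA fR c in auto)
    qed linarith
    then have "real (cap + 2 * 3 * m + 1) \<le> real (card (\<Union>u\<in>U. Nb u))" using cap(1) m(2) c(3) by simp
    then show ?thesis by (simp only: of_nat_le_iff)
  qed
  interpret extendable_graph V Nb 3 m cap E
  proof
    show "finite V" by (rule fV)
    show "Nb u \<subseteq> V" for u by (auto simp: Nb_def V_def A)
    show "cap + 2 * 3 * m + 1 \<le> card (\<Union>u\<in>U. Nb u)" if "U \<subseteq> V" "m \<le> card U" for U using big[OF that] .
    show "E w u" if "E u w" for u w using that by (rule Esym)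
    show "E u w" if "w \<in> Nb u" for u w using that by (simp add: Nb_def nb_def split: if_splits)
  qed (use m in auto)
  have dj: "Starts \<inter> R2 = {}" "Ends \<inter> R1 = {}" "R1 \<inter> R2 = {}" "Starts \<inter> R1 = {}" "Ends \<inter> R2 = {}" "Starts \<inter> Ends = {}" using An(3) A by auto
  have st: "ext B (\<lambda>_. 0)"
  proof (rule ext_start)
    show "B \<subseteq> V" by (auto simp: V_def B_def A)
    fix U assume U: "U \<subseteq> V" "card U \<le> 2 * m"
    have cU: "real (card U) \<le> N / 25" using U(2) m(2) by linarith
    have NB: "NB U - B = (\<Union>u\<in>U. Nb u)" using NbR[of U] dj unfolding NB_def B_def by blast
    have "3 * real (card U) \<le> real (card (\<Union>u\<in>U. Nb u))"
    proof (rule lift[OF U(1)])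
      fix A R assume AR: "(A = A1 \<and> R = R2) \<or> (A = A2 \<and> R = R1)" and h: "real (card U) / 2 \<le> real (card (U \<inter> A))"
      let ?W = "\<Union>u\<in>U \<inter> A. nb u \<inter> R"
      show "3 * real (card U) \<le> real (card ?W)"
      proof (cases "2 * d * real (card ?W) \<le> \<delta> * n")
        case True
        have qA: "qb A R (\<sigma>\<^sup>2)" "finite A" "finite R" "A \<subseteq> {..<n}" using AR q fA fR An by auto
        have dA: "\<delta> \<le> real (card (nb u \<inter> R))" if "u \<in> U \<inter> A" for u
          using AR deg[of u] that qA(4) by auto
        have "(\<delta> / (2 * \<sigma>))\<^sup>2 * real (card (U \<inter> A)) \<le> real (card ?W)"
          by (rule qb_expand[OF qA(1) s(1) Int_lower2 qA(2,3) dA _ order.refl _ True]) (use s in auto)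
        moreover have "4 \<le> \<delta> / (2 * \<sigma>)" using s by (simp add: field_simps)
        then have "4\<^sup>2 \<le> (\<delta> / (2 * \<sigma>))\<^sup>2" by (rule power_mono) simp
        then have "4\<^sup>2 * real (card (U \<inter> A)) \<le> (\<delta> / (2 * \<sigma>))\<^sup>2 * real (card (U \<inter> A))" by (rule mult_right_mono) simp
        ultimately have "16 * real (card (U \<inter> A)) \<le> real (card ?W)" by simp
        then show ?thesis using h by linarith
      next
        case False
        then have "6/10 * d * N < 2 * d * real (card ?W)" using s(3) by linarith
        then have "d * (6/10 * N) < d * (2 * real (card ?W))" by (simp add: ac_simps)
        then have "6/10 * N < 2 * real (card ?W)" using d0 by (simp only: mult_less_cancel_left_pos)
        then show ?thesis using cU by linarith
      qed
    qed linarith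
    then have "real (3 * card U) \<le> real (card (\<Union>u\<in>U. Nb u))" by simp
    then show "3 * card U \<le> card (NB U - B)" unfolding NB by (simp only: of_nat_le_iff)
  qed
  have k1: "1 \<le> k" using k(1) c(3) by (cases k) auto
  have chain1: "\<And>x. nbchain x xs \<Longrightarrow> x \<in> A1 \<Longrightarrow> xs \<noteq> [] \<Longrightarrow> last xs \<in> (if even (length xs) then R1 else R2)"
    and chain2: "\<And>x. nbchain x xs \<Longrightarrow> x \<in> A2 \<Longrightarrow> xs \<noteq> [] \<Longrightarrow> last xs \<in> (if even (length xs) then R2 else R1)" for xs
  proof (induction xs)
    case Nil { case 1 then show ?case by simp next case 2 then show ?case by simp }
  next
    case (Cons y ys)
    { case (1 x)
      then have yn: "y \<in> Nb x" and "nbchain y ys" by simp_all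
      moreover have "y \<in> R2" using yn 1(2) by (simp add: Nb_def)
      moreover have "y \<in> A2" using \<open>y \<in> R2\<close> A by simp
      ultimately show ?case using Cons(2)[of y] by (cases "ys = []") auto }
    { case (2 x)
      then have yn: "y \<in> Nb x" and "nbchain y ys" by simp_all
      moreover have "x \<notin> A1" using 2(2) An(3) by blast
      then have "y \<in> R1" using yn by (simp add: Nb_def)
      moreover have "y \<in> A1" using \<open>y \<in> R1\<close> A by simp
      ultimately show ?case using Cons(1)[of y] by (cases "ys = []") auto }
  qed
  have edge: "\<exists>u\<in>X. \<exists>w\<in>Y. E u w" if XY: "X \<subseteq> R1" "Y \<subseteq> R2" "card X = 2 ^ k" "card Y = 2 ^ k" for X Y
  proof (rule ccontr)
    assume no: "\<not> (\<exists>u\<in>X. \<exists>w\<in>Y. E u w)"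
    have "real (card X) * real (card Y) \<le> (\<sigma> * n / d)\<^sup>2"
      by (rule qb_nonadjacent[OF q(1)]) (use XY A fA fR s no in auto)
    also note rel2
    also have "(53/1000 * real N)\<^sup>2 < (2 ^ k)\<^sup>2" using k(1) by (intro power_strict_mono) auto
    finally show False by (simp add: XY power2_eq_square)
  qed
  have "\<exists>ts Q. set ts = set (concat ps) \<union> Q \<and> Q \<subseteq> V - B \<and> distinct ts \<and> successively E (b # ts @ [a0])"
  proof (rule link_all[OF st order.refl, of b a0 Ends Starts ps k])
    show "p \<noteq> [] \<and> hd p \<in> B \<inter> Starts \<and> last p \<in> B \<inter> Ends \<and> set p \<inter> V \<subseteq> B \<and> successively E p \<and> distinct p" if "p \<in> set ps" for p
      using ps(1)[OF that] by (auto simp: B_def V_def A)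
    show "card B + Suc (length ps) * (2 * k) + 4 * 2 ^ k \<le> cap"
    proof -
      have "real (card B + Suc (length ps) * (2 * k) + 4 * 2 ^ k) = real (card (Starts \<union> Ends) + Suc (length ps) * (2 * k)) + 4 * 2 ^ k"
        by (simp add: B_def)
      also have "\<dots> \<le> real cap" using small k(2) cap(2) c(3) by linarith
      finally show ?thesis by (simp only: of_nat_le_iff)
    qed
    fix x y B' X Y
    assume h: "x \<in> Ends" "y \<in> Starts" "X \<subseteq> V - B'" "Y \<subseteq> V - B'" "card X = 2 ^ k" "card Y = 2 ^ k"
      "\<forall>z\<in>X. \<exists>ps. length ps = k \<and> nbchain x ps \<and> last ps = z \<and> set ps \<inter> B' = {}"
      "\<forall>z\<in>Y. \<exists>ps. length ps = k \<and> nbchain y ps \<and> last ps = z \<and> set ps \<inter> B' = {}"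
    have X: "X \<subseteq> (if even k then R2 else R1)"
    proof
      fix z assume "z \<in> X"
      then obtain ps where p: "length ps = k" "nbchain x ps" "last ps = z" using h(7) by blast
      have "ps \<noteq> []" using p(1) k1 by auto
      then show "z \<in> (if even k then R2 else R1)" using chain2[OF p(2)] h(1) p by (simp add: A)
    qed
    have Y: "Y \<subseteq> (if even k then R1 else R2)"
    proof
      fix z assume "z \<in> Y"
      then obtain ps where p: "length ps = k" "nbchain y ps" "last ps = z" using h(8) by blast
      have "ps \<noteq> []" using p(1) k1 by auto
      then show "z \<in> (if even k then R1 else R2)" using chain1[OF p(2)] h(2) p by (simp add: A)
    qed
    show "\<exists>u\<in>X. \<exists>w\<in>Y. E u w"
    proof (cases "even k")
      case True
      then obtain u w where "u \<in> Y" "w \<in> X" "E u w" using edge[of Y X] X Y h(5,6) by auto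
      then show ?thesis using Esym by blast
    next
      case False
      then show ?thesis using edge[of X Y] X Y h(5,6) by auto
    qed
  qed (use ba ps k1 in \<open>auto simp: B_def\<close>)
  moreover have "V - B \<subseteq> R1 \<union> R2" by (auto simp: V_def B_def A)
  ultimately show ?thesis by (meson order_trans)
qed

end

lemma pow2_between:
  fixes x :: real
  assumes "1 \<le> x"
  shows "\<exists>k. x < 2 ^ k \<and> 2 ^ k \<le> 2 * x"
proof -
  define k where "k = (LEAST k. x < 2 ^ k)"
  have ex: "\<exists>k. x < 2 ^ k" using real_arch_pow[of 2 x] by simp
  have k: "x < 2 ^ k" unfolding k_def using ex by (rule LeastI_ex)
  have "2 ^ k \<le> 2 * x"
  proof (cases k)
    case 0 then show ?thesis using assms k by simp
  next
    case (Suc i)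
    then have "i < (LEAST k. x < 2 ^ k)" by (simp add: k_def)
    from not_less_Least[OF this] show ?thesis using Suc by simp
  qed
  then show ?thesis using k by blast
qed

section \<open>Single classes, and path covers from alternating layers\<close>

context expander
begin

text \<open>\<open>Y\<close> is trimmed to a multiple of \<open>K\<close>. Fewer than
  \<open>K\<close> vertices are dropped, which is the 1 subtracted in \<open>lower\<close>; of the
  resulting partition only the first class is kept.\<close>

lemma transversal_class:
  fixes J :: "nat set set" and s T :: "nat set \<Rightarrow> real"
  assumes Y: "Y \<subseteq> {..<n}" and K: "0 < K" and l: "0 < l" "real n \<le> exp (real l)" and J: "finite J"
    and lower: "\<And>v. v < n \<Longrightarrow> L \<le> real (card (nb v \<inter> Y)) / K - 1" "400 * real l \<le> L"
    and upper: "\<And>v. v < n \<Longrightarrow> real (card (nb v)) \<le> D"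
    and q: "\<And>S. S \<in> J \<Longrightarrow> S \<subseteq> {..<n} \<and> qb Y S (T S)" and row: "\<And>S w. S \<in> J \<Longrightarrow> w < n \<Longrightarrow> (\<Sum>u\<in>S. (wt w u)\<^sup>2) \<le> s S"
    and s0: "\<And>S. S \<in> J \<Longrightarrow> 0 < s S"
    and cnt: "(2 * real n + real (card J)) * real K * exp (- 2 * real l) < 1"
  shows "\<exists>R. R \<subseteq> Y \<and> card R = card Y div K \<and> (\<forall>v<n. 9/10 * L \<le> real (card (nb v \<inter> R)) \<and> real (card (nb v \<inter> R)) \<le> 2 * (D / K)) \<and>
    (\<forall>S\<in>J. qb R S (47 * real l * s S + 9/5 * T S / K))"
proof -
  have fY: "finite Y" by (rule finite_subset[OF Y]) simp
  define G where "G = card Y div K"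
  have "G * K \<le> card Y" unfolding G_def by (simp add: div_times_less_eq_dividend)
  then obtain Y' where Y': "Y' \<subseteq> Y" "card Y' = G * K" by (metis obtain_subset_with_card_n)
  have fY': "finite Y'" by (rule finite_subset[OF Y'(1) fY])
  have cD: "card (Y - Y') < K"
  proof -
    have "card (Y - Y') = card Y - G * K" using card_Diff_subset[OF fY' Y'(1)] Y'(2) by simp
    also have "\<dots> = card Y mod K" unfolding G_def by (metis minus_div_mult_eq_mod)
    finally show ?thesis using K by simp
  qed
  have low: "L \<le> real (card (nb v \<inter> Y')) / K" if v: "v < n" for v
  proof -
    have "nb v \<inter> Y \<subseteq> (nb v \<inter> Y') \<union> (Y - Y')" by blast
    then have "card (nb v \<inter> Y) \<le> card ((nb v \<inter> Y') \<union> (Y - Y'))" using fY by (intro card_mono) auto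
    also have "\<dots> \<le> card (nb v \<inter> Y') + card (Y - Y')" by (rule card_Un_le)
    finally have "real (card (nb v \<inter> Y)) \<le> real (card (nb v \<inter> Y')) + K" using cD by linarith
    then have "real (card (nb v \<inter> Y)) / K \<le> (real (card (nb v \<inter> Y')) + K) / K" using K by (intro divide_right_mono) auto
    also have "\<dots> = real (card (nb v \<inter> Y')) / K + 1" using K by (simp add: add_divide_distrib)
    finally show ?thesis using lower(1)[OF v] by linarith
  qed
  have "\<exists>C. (\<forall>k<K. C k \<subseteq> Y' \<and> card (C k) = G) \<and> (\<forall>k<K. \<forall>k'<K. k \<noteq> k' \<longrightarrow> C k \<inter> C k' = {}) \<and> (\<Union>k<K. C k) = Y' \<and>
     (\<forall>k<K. \<forall>v<n. 9/10 * (real (card (nb v \<inter> Y')) / K) \<le> real (card (nb v \<inter> C k)) \<and> real (card (nb v \<inter> C k)) \<le> 2 * (D / K)) \<and>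
     (\<forall>k<K. \<forall>S\<in>J. qb (C k) S (47 * real l * s S + 9/5 * T S / K))"
  proof (rule sampling[OF _ Y'(2) K l J _ upper _ row s0 cnt])
    show "Y' \<subseteq> {..<n}" using Y Y' by blast
    show "400 * real l \<le> real (card (nb v \<inter> Y')) / K" if "v < n" for v using low[OF that] lower(2) by linarith
    show "S \<subseteq> {..<n} \<and> qb Y' S (T S)" if "S \<in> J" for S
    proof -
      have Sn: "S \<subseteq> {..<n}" and qS: "qb Y S (T S)" using q[OF that] by auto
      show ?thesis using Sn qb_mono[OF qS Y'(1) order.refl fY finite_subset[OF Sn]] by simp
    qed
  qed
  then obtain C where C: "\<forall>k<K. C k \<subseteq> Y' \<and> card (C k) = G"
     "\<forall>k<K. \<forall>v<n. 9/10 * (real (card (nb v \<inter> Y')) / K) \<le> real (card (nb v \<inter> C k)) \<and> real (card (nb v \<inter> C k)) \<le> 2 * (D / K)"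
     "\<forall>k<K. \<forall>S\<in>J. qb (C k) S (47 * real l * s S + 9/5 * T S / K)" by auto
  show ?thesis
  proof (intro exI[of _ "C 0"] conjI allI impI)
    show "C 0 \<subseteq> Y" "card (C 0) = card Y div K" using C(1) K Y'(1) by (auto simp: G_def)
    fix v assume v: "v < n"
    have "9/10 * (real (card (nb v \<inter> Y')) / K) \<le> real (card (nb v \<inter> C 0))" using C(2) K v by blast
    then show "9/10 * L \<le> real (card (nb v \<inter> C 0))" using low[OF v] by linarith
    show "real (card (nb v \<inter> C 0)) \<le> 2 * (D / K)" using C(2) K v by blast
  qed (use C(3) K in blast)
qed

text \<open>The layers alternate between classes of \<open>Y1\<close> and classes of
  \<open>Y2\<close>, so every matching uses a block between the two sides, never one within a
  side.\<close>

lemma layer_paths: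
  fixes C1 C2 :: "nat \<Rightarrow> nat set" and \<sigma> \<delta> :: real
  assumes K: "0 < K" and sub: "\<And>k. k < K \<Longrightarrow> C1 k \<subseteq> Y1" "\<And>k. k < K \<Longrightarrow> C2 k \<subseteq> Y2" and Y: "Y1 \<inter> Y2 = {}" "finite Y1" "finite Y2"
    and c: "\<And>k. k < K \<Longrightarrow> card (C1 k) = M" "\<And>k. k < K \<Longrightarrow> card (C2 k) = M"
    and dj: "\<And>k k'. k < K \<Longrightarrow> k' < K \<Longrightarrow> k \<noteq> k' \<Longrightarrow> C1 k \<inter> C1 k' = {}" "\<And>k k'. k < K \<Longrightarrow> k' < K \<Longrightarrow> k \<noteq> k' \<Longrightarrow> C2 k \<inter> C2 k' = {}"
    and un: "(\<Union>k<K. C1 k) = Y1" "(\<Union>k<K. C2 k) = Y2"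
    and q: "\<And>k k'. k < K \<Longrightarrow> k' < K \<Longrightarrow> qb (C1 k) (C2 k') (\<sigma>\<^sup>2)" and s: "0 < \<sigma>" "2 * \<sigma> < \<delta>"
    and deg: "\<And>k v. k < K \<Longrightarrow> v \<in> Y1 \<union> Y2 \<Longrightarrow> \<delta> \<le> real (card (nb v \<inter> C1 k))" "\<And>k v. k < K \<Longrightarrow> v \<in> Y1 \<union> Y2 \<Longrightarrow> \<delta> \<le> real (card (nb v \<inter> C2 k))"
  shows "\<exists>ps. length ps = M \<and> (\<forall>p\<in>set ps. p \<noteq> [] \<and> hd p \<in> C1 0 \<and> last p \<in> C2 (K - 1) \<and> successively E p \<and> distinct p) \<and>
    distinct (map hd ps @ map last ps) \<and> distinct (concat ps) \<and> set (concat ps) = Y1 \<union> Y2"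
proof -
  define Ls where "Ls = (\<lambda>i. if even i then C1 (i div 2) else C2 (i div 2))"
  \<comment> \<open>There are \<open>2 * K\<close> layers numbered from 0; the last index is odd, so
    the paths end in \<open>C2 (K - 1)\<close>.\<close>
  define h where "h = 2 * K - 1"
  have idx: "i div 2 < K" if "i \<le> h" for i using that K unfolding h_def by linarith
  have fC: "finite (C1 k)" "finite (C2 k)" if "k < K" for k using finite_subset[OF sub(1)[OF that] Y(2)] finite_subset[OF sub(2)[OF that] Y(3)] .
  have sLs: "Ls i \<subseteq> (if even i then Y1 else Y2)" if "i \<le> h" for i using sub[OF idx[OF that]] by (simp add: Ls_def)
  have "\<exists>P. \<forall>a\<in>Ls 0. distinct (P a) \<and> successively E (P a) \<and> length (P a) = Suc h \<and> hd (P a) = a \<and> last (P a) \<in> Ls h \<and>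
     (\<forall>b\<in>Ls 0. a \<noteq> b \<longrightarrow> set (P a) \<inter> set (P b) = {}) \<and> (\<Union>a\<in>Ls 0. set (P a)) = (\<Union>i\<le>h. Ls i)"
  proof (rule layered_paths)
    show "finite (Ls i)" if "i \<le> h" for i using fC[OF idx[OF that]] by (simp add: Ls_def)
    show "card (Ls i) = M" if "i \<le> h" for i using c[OF idx[OF that]] by (simp add: Ls_def)
    show "Ls i \<inter> Ls j = {}" if ij: "i \<le> h" "j \<le> h" "i \<noteq> j" for i j
    proof (cases "even i = even j")
      case True
      have ne: "i div 2 \<noteq> j div 2"
      proof
        assume e: "i div 2 = j div 2"
        have m: "i mod 2 = j mod 2" unfolding mod2_eq_if True ..
        show False using div_mult_mod_eq[of i 2] div_mult_mod_eq[of j 2] e m ij(3) by simp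
      qed
      then show ?thesis using True dj[OF idx[OF ij(1)] idx[OF ij(2)] ne] by (simp add: Ls_def)
    next
      case False
      then show ?thesis using sLs[OF ij(1)] sLs[OF ij(2)] Y(1) by (auto split: if_splits)
    qed
    have d1: "\<delta> \<le> real (card (nb v \<inter> C2 k'))" if "k < K" "k' < K" "v \<in> C1 k" for k k' v
      by (rule deg(2)[OF that(2)]) (use sub(1)[OF that(1)] that(3) in auto)
    have d2: "\<delta> \<le> real (card (nb v \<inter> C1 k'))" if "k < K" "k' < K" "v \<in> C2 k" for k k' v
      by (rule deg(1)[OF that(2)]) (use sub(2)[OF that(1)] that(3) in auto)
    show "\<exists>f. inj_on f (Ls i) \<and> (\<forall>a\<in>Ls i. f a \<in> Ls (Suc i) \<and> E a (f a))" if i: "i < h" for i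
    proof -
      have i1: "i div 2 < K" "Suc i div 2 < K" using i by (auto intro: idx)
      show ?thesis
      proof (cases "even i")
        case True
        then have L: "Ls i = C1 (i div 2)" "Ls (Suc i) = C2 (Suc i div 2)" by (simp_all add: Ls_def)
        have e: "card (C1 (i div 2)) = card (C2 (Suc i div 2))" using c i1 by simp
        show ?thesis unfolding L
          by (rule matching[OF q[OF i1] s fC(1)[OF i1(1)] fC(2)[OF i1(2)] e d1[OF i1] d2[OF i1(2,1)]])
      next
        case False
        then have L: "Ls i = C2 (i div 2)" "Ls (Suc i) = C1 (Suc i div 2)" by (simp_all add: Ls_def)
        have e: "card (C2 (i div 2)) = card (C1 (Suc i div 2))" using c i1 by simp
        show ?thesis unfolding L
          by (rule matching[OF qb_sym[OF q[OF i1(2,1)]] s fC(2)[OF i1(1)] fC(1)[OF i1(2)] e d2[OF i1] d1[OF i1(2,1)]])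
      qed
    qed
  qed
  then obtain P where P: "\<forall>a\<in>Ls 0. distinct (P a) \<and> successively E (P a) \<and> length (P a) = Suc h \<and> hd (P a) = a \<and> last (P a) \<in> Ls h \<and>
     (\<forall>b\<in>Ls 0. a \<noteq> b \<longrightarrow> set (P a) \<inter> set (P b) = {}) \<and> (\<Union>a\<in>Ls 0. set (P a)) = (\<Union>i\<le>h. Ls i)" by blast
  have L0: "Ls 0 = C1 0" by (simp add: Ls_def)
  have Lh: "Ls h = C2 (K - 1)"
  proof -
    have "odd h" "h div 2 = K - 1" using K unfolding h_def by (auto simp: even_diff_nat) 
    then show ?thesis by (simp add: Ls_def)
  qed
  obtain as where as: "set as = C1 0" "distinct as" using finite_distinct_list[OF fC(1)[OF K]] by blast
  have Pne: "P a \<noteq> []" if "a \<in> C1 0" for a using P that L0 by force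
  have Phd: "hd (P a) = a" and Plast: "last (P a) \<in> C2 (K - 1)" and Pd: "distinct (P a)" and Ps: "successively E (P a)" if "a \<in> C1 0" for a
    using P that L0 Lh by auto
  have Pdj: "set (P a) \<inter> set (P b) = {}" if "a \<in> C1 0" "b \<in> C1 0" "a \<noteq> b" for a b
    using P that L0 by auto
  have M0: "length as = M" using as c(1)[OF K] distinct_card by metis
  have U: "(\<Union>a\<in>C1 0. set (P a)) = Y1 \<union> Y2"
  proof (cases "C1 0 = {}")
    case True
    then have "M = 0" using c(1)[OF K] by simp
    then have "\<And>k. k < K \<Longrightarrow> C1 k = {} \<and> C2 k = {}" using c fC by simp
    then have "Y1 = {}" "Y2 = {}" using un by auto
    then show ?thesis using True by simp
  next
    case False
    then obtain a where "a \<in> C1 0" by blast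
    then have "(\<Union>a\<in>C1 0. set (P a)) = (\<Union>i\<le>h. Ls i)" using P unfolding L0 by simp
    also have "\<dots> = Y1 \<union> Y2"
    proof
      show "(\<Union>i\<le>h. Ls i) \<subseteq> Y1 \<union> Y2"
      proof
        fix y assume "y \<in> (\<Union>i\<le>h. Ls i)"
        then obtain i where i: "i \<le> h" "y \<in> Ls i" by auto
        then show "y \<in> Y1 \<union> Y2" using sLs[OF i(1)] by (auto split: if_splits)
      qed
      have "C1 k \<subseteq> (\<Union>i\<le>h. Ls i)" "C2 k \<subseteq> (\<Union>i\<le>h. Ls i)" if k: "k < K" for k
      proof -
        have "Ls (2 * k) = C1 k" "Ls (2 * k + 1) = C2 k" by (simp_all add: Ls_def)
        moreover have "2 * k \<le> h" "2 * k + 1 \<le> h" using k unfolding h_def by linarith+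
        ultimately show "C1 k \<subseteq> (\<Union>i\<le>h. Ls i)" "C2 k \<subseteq> (\<Union>i\<le>h. Ls i)" by (metis UN_upper atMost_iff)+
      qed
      then show "Y1 \<union> Y2 \<subseteq> (\<Union>i\<le>h. Ls i)" using un by blast
    qed
    finally show ?thesis .
  qed
  let ?ps = "map P as"
  have mh: "map hd ?ps = as" using Phd as(1) by (auto intro!: map_idI)
  have li: "inj_on (\<lambda>a. last (P a)) (set as)"
  proof (rule inj_onI)
    fix a b assume ab: "a \<in> set as" "b \<in> set as" "last (P a) = last (P b)"
    show "a = b"
    proof (rule ccontr)
      assume "a \<noteq> b"
      then have "set (P a) \<inter> set (P b) = {}" using Pdj ab as by simp
      moreover have "last (P a) \<in> set (P a)" "last (P b) \<in> set (P b)"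
        using last_in_set Pne ab(1,2) unfolding as(1) by blast+
      ultimately show False using ab(3) by auto
    qed
  qed
  have Pinj: "inj_on P (set as)"
  proof (rule inj_onI)
    fix a b assume "a \<in> set as" "b \<in> set as" "P a = P b"
    then show "a = b" using Phd as(1) by metis
  qed
  show ?thesis
  proof (intro exI[of _ ?ps] conjI ballI)
    show "length ?ps = M" using M0 by simp
    have "distinct (map last ?ps)" using li as(2) by (simp add: distinct_map comp_def)
    moreover have "set as \<inter> set (map last ?ps) = {}"
    proof -
      have "set (map last ?ps) \<subseteq> Y2" using Plast as(1) sub(2)[of "K - 1"] K by auto
      then show ?thesis using as(1) sub(1)[OF K] Y(1) by blast
    qed
    ultimately show "distinct (map hd ?ps @ map last ?ps)" unfolding mh using as(2) by simp
    show "distinct (concat ?ps)"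
    proof (rule distinct_concat)
      show "distinct ?ps" using Pinj as(2) by (simp add: distinct_map)
      show "distinct ys" if "ys \<in> set ?ps" for ys using that Pd as(1) by auto
      show "set ys \<inter> set zs = {}" if yz: "ys \<in> set ?ps" "zs \<in> set ?ps" "ys \<noteq> zs" for ys zs
      proof -
        obtain a b where "a \<in> C1 0" "b \<in> C1 0" "ys = P a" "zs = P b" using yz(1,2) as(1) by auto
        then show ?thesis using Pdj[of a b] yz(3) by metis
      qed
    qed
    show "set (concat ?ps) = Y1 \<union> Y2" using U as(1) by simp
    fix p assume "p \<in> set ?ps"
    then obtain a where a: "a \<in> C1 0" "p = P a" using as(1) by auto
    show "p \<noteq> []" "hd p \<in> C1 0" "last p \<in> C2 (K - 1)" "successively E p" "distinct p"
      using Pne[OF a(1)] Phd[OF a(1)] Plast[OF a(1)] Ps[OF a(1)] Pd[OF a(1)] a by simp_all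
  qed
qed

end

section \<open>Partitioning a pseudorandom graph\<close>

text \<open>\<open>l\<close> is log n rounded up. Rounding accounts for the factor 2 in
  \<open>dl\<close>, and \<open>ln9\<close> lets \<open>n\<close> exceed the polynomials in
  \<open>l\<close> that occur.\<close>

locale dense_expander = expander +
  fixes l :: nat
  assumes deg_lo: "\<And>v. v < n \<Longrightarrow> 99/100 * d \<le> real (card (nb v))"
    and deg_hi: "\<And>v. v < n \<Longrightarrow> real (card (nb v)) \<le> 101/100 * d"
    and qV: "qb {..<n} {..<n} ((d / 150)\<^sup>2)"
    and l_big: "100000000000 \<le> real l" and nl: "real n \<le> exp (real l)"
    and dl: "real l ^ 6 \<le> 2 * d" and ln9: "real l ^ 9 \<le> real n"
begin

text \<open>What \<open>sampling\<close> yields for the squared norm of a block between one of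
  \<open>\<kappa>\<close> classes and all vertices, from row norms \<open>3 * d\<close> and the norm
  \<open>d / 150\<close>.\<close>

definition \<tau> :: "real \<Rightarrow> real" where "\<tau> \<kappa> = 47 * real l * (3 * d) + 9/5 * (d / 150)\<^sup>2 / \<kappa>"

lemma l0: "0 < l" and l1: "1 \<le> real l" using l_big by linarith+

lemma d_le_n: "d \<le> 102/100 * n"
proof -
  have "card (nb 0) \<le> card {..<n}" using nb_sub by (intro card_mono) auto
  then have "99/100 * d \<le> real n" using deg_lo[OF n0] by simp
  then show ?thesis using n0 by simp
qed

lemma n_l8: "100000000000 * real l ^ 8 \<le> real n"
proof -
  have "100000000000 * real l ^ 8 \<le> real l * real l ^ 8" using l_big by (intro mult_right_mono) auto
  also have "\<dots> = real l ^ 9" by (simp add: eval_nat_numeral)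
  finally show ?thesis using ln9 by linarith
qed

lemma n_pow: "i \<le> 8 \<Longrightarrow> 100000000000 * real l ^ i \<le> real n"
  using n_l8 power_increasing[OF _ l1, of i 8] by simp

lemma d_big: "50000000000 * real l ^ 5 \<le> d"
proof -
  have "100000000000 * real l ^ 5 \<le> real l * real l ^ 5" using l_big by (intro mult_right_mono) auto
  also have "\<dots> = real l ^ 6" by (simp add: eval_nat_numeral)
  finally show ?thesis using dl by linarith
qed

lemma kappa: "real (l ^ 3) \<le> real (200 * l ^ 4)" "0 < real (l ^ 3)" "0 < l ^ 3" "0 < 200 * l ^ 4"
proof -
  have "l ^ 3 \<le> l ^ 4" using l0 by (intro power_increasing) auto
  then show "real (l ^ 3) \<le> real (200 * l ^ 4)" by linarith
qed (use l0 in auto)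

text \<open>The six powers of log n are spent here: four on the number of layers, one on
  concentration, and the last, a huge number, on the constants.\<close>

lemma delta_big: "150000000 * real l \<le> d / real (200 * l ^ 4)" "150000000 * real l \<le> d / real (l ^ 3)"
proof -
  have p: "0 < real (200 * l ^ 4)" using l0 by simp
  have "150000000 * real l * real (200 * l ^ 4) = 30000000000 * real l ^ 5" by (simp add: eval_nat_numeral)
  also have "\<dots> \<le> d" using d_big zero_le_power[of "real l" 5] by linarith
  finally show a: "150000000 * real l \<le> d / real (200 * l ^ 4)" using p by (simp only: pos_le_divide_eq)
  have "d / real (200 * l ^ 4) \<le> d / real (l ^ 3)" using kappa d0 by (intro divide_left_mono mult_pos_pos) auto
  then show "150000000 * real l \<le> d / real (l ^ 3)" using a by linarith
qed

lemma tau_nonneg: "0 < \<kappa> \<Longrightarrow> 0 \<le> \<tau> \<kappa>"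
  using d0 unfolding \<tau>_def by (intro add_nonneg_nonneg mult_nonneg_nonneg divide_nonneg_pos) auto

text \<open>The squared norm once both sides are sampled. Each sampling multiplies the leading term
  by 9/5, and \<open>(9/5)^2 / 22500\<close> is 32.4/225000; the remaining 0.6/225000 must cover the
  terms linear in \<open>l\<close>, which add up to less than 395 times \<open>l * \<delta>\<close>.
  This is the origin of 150000000.\<close>

lemma tau_bound:
  assumes k: "0 < \<kappa>" "\<kappa> \<le> \<kappa>'" and b: "150000000 * real l \<le> d / \<kappa>"
  shows "47 * real l * (3 * (d / \<kappa>)) + 9/5 * \<tau> \<kappa> / \<kappa>' \<le> 33/225000 * (d / \<kappa>)\<^sup>2"
proof -
  define \<delta> where "\<delta> = d / \<kappa>"
  have d: "0 < \<delta>" using d0 k by (simp add: \<delta>_def)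
  have "9/5 * \<tau> \<kappa> / \<kappa>' \<le> 9/5 * \<tau> \<kappa> / \<kappa>" using k tau_nonneg[OF k(1)] by (intro divide_left_mono) auto
  also have "\<dots> = 9/5 * (141 * real l * \<delta>) + 81/25 * (\<delta>\<^sup>2 / 22500)"
    using k(1) by (simp add: \<tau>_def \<delta>_def power2_eq_square field_simps)
  finally have a: "9/5 * \<tau> \<kappa> / \<kappa>' \<le> 9/5 * (141 * real l * \<delta>) + 81/25 * (\<delta>\<^sup>2 / 22500)" .
  have "150000000 * real l * \<delta> \<le> \<delta> * \<delta>" using b d unfolding \<delta>_def[symmetric] by (intro mult_right_mono) auto
  then have c: "150000000 * (real l * \<delta>) \<le> \<delta>\<^sup>2" by (simp add: power2_eq_square mult.assoc)
  have e: "47 * real l * (3 * \<delta>) = 141 * (real l * \<delta>)" "9/5 * (141 * real l * \<delta>) = 1269/5 * (real l * \<delta>)" by simp_all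
  have lin: "141 * x + t \<le> 33/225000 * y" if "t \<le> 1269/5 * x + 81/25 * (y / 22500)" "150000000 * x \<le> y" "0 \<le> y" for x t y :: real
    using that by simp
  show ?thesis unfolding \<delta>_def[symmetric] e(1) by (rule lin[OF a[unfolded e(2)] c zero_le_power2])
qed

lemma cnt:
  assumes "\<kappa> \<le> 200 * l ^ 4" "c \<le> 200 * l ^ 4 + 1"
  shows "(2 * real n + real c) * real \<kappa> * exp (- 2 * real l) < 1"
proof -
  have big: "600 * real l ^ 4 < real n" using n_pow[of 4] zero_less_power[of "real l" 4] l1 by linarith
  have "real c \<le> real (200 * l ^ 4 + 1)" using assms(2) by (simp only: of_nat_le_iff)
  also have "\<dots> = 200 * real l ^ 4 + 1" by simp
  finally have c1: "real c \<le> 200 * real l ^ 4 + 1" .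
  have c2: "1 \<le> real l ^ 4" using l1 by (rule one_le_power)
  have c3: "2 * real n + real c \<le> 3 * real n" using big c1 c2 by linarith
  have "real \<kappa> \<le> real (200 * l ^ 4)" using assms(1) by (simp only: of_nat_le_iff)
  also have "\<dots> = 200 * real l ^ 4" by simp
  finally have c4: "real \<kappa> \<le> 200 * real l ^ 4" .
  have "(2 * real n + real c) * real \<kappa> \<le> 3 * real n * (200 * real l ^ 4)" using c3 c4 by (intro mult_mono) auto
  also have "\<dots> = real n * (600 * real l ^ 4)" by simp
  also have "\<dots> < real n * real n" using big n0 by (intro mult_strict_left_mono) auto
  finally have a: "(2 * real n + real c) * real \<kappa> < real n * real n" .
  have "real n * real n \<le> exp (real l) * exp (real l)" using nl by (intro mult_mono) auto
  also have "\<dots> = exp (2 * real l)" by (simp add: exp_add[symmetric])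
  finally have "(2 * real n + real c) * real \<kappa> < exp (2 * real l)" using a by linarith
  then have "(2 * real n + real c) * real \<kappa> * exp (- 2 * real l) < exp (2 * real l) * exp (- 2 * real l)"
    by (intro mult_strict_right_mono) auto
  also have "\<dots> = 1" by (simp add: exp_add[symmetric])
  finally show ?thesis .
qed

text \<open>Sampled degrees are at most doubled, which gives 202/100; the part from the subtracted
  constant matrix adds at most 51/100, as the class is small and \<open>d\<close> is at most
  \<open>102/100 * n\<close>.\<close>

lemma row_class:
  assumes S: "S \<subseteq> {..<n}" and k: "0 < \<kappa>" and c: "real (card (nb w \<inter> S)) \<le> 2 * (101/100 * d / \<kappa>)" "real (card S) \<le> n / (2 * \<kappa>)"
  shows "(\<Sum>u\<in>S. (wt w u)\<^sup>2) \<le> 3 * (d / \<kappa>)"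
proof -
  have "real (card S) * (d / n)\<^sup>2 \<le> n / (2 * \<kappa>) * (d / n)\<^sup>2" using c(2) by (rule mult_right_mono) simp
  also have "\<dots> = (d / \<kappa>) * (d / (2 * n))" using n0 by (simp add: power2_eq_square)
  also have "\<dots> \<le> (d / \<kappa>) * (51/100)" using d_le_n n0 d0 k by (intro mult_left_mono) (auto simp: field_simps)
  finally have "(\<Sum>u\<in>S. (wt w u)\<^sup>2) \<le> 2 * (101/100 * d / \<kappa>) + (d / \<kappa>) * (51/100)" using row_norm[OF S, of w] c(1) by linarith
  also have "\<dots> = 253/100 * (d / \<kappa>)" by simp
  also have "\<dots> \<le> 3 * (d / \<kappa>)" using d0 k by (intro mult_right_mono) auto
  finally show ?thesis .
qed

lemma row_all: "w < n \<Longrightarrow> (\<Sum>u<n. (wt w u)\<^sup>2) \<le> 3 * d"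
  using row_class[of "{..<n}" "1/2" w] row_norm[of "{..<n}" w] deg_hi[of w] 
proof -
  assume w: "w < n"
  have i: "nb w \<inter> {..<n} = nb w" using nb_sub by blast
  have "real n * (d / n)\<^sup>2 = d * (d / n)" using n0 by (simp add: power2_eq_square)
  also have "\<dots> \<le> d * (102/100)" using d_le_n n0 d0 by (intro mult_left_mono) (auto simp: field_simps)
  finally show ?thesis using row_norm[OF order.refl, of w] deg_hi[OF w] d0 unfolding i by simp
qed

text \<open>Bounds the depth of the binary trees, and with it the length of the links, by a multiple
  of log n.\<close>

lemma pow_le: "2 ^ k \<le> n \<Longrightarrow> k \<le> 2 * l"
proof (rule ccontr)
  assume k: "2 ^ k \<le> n" and "\<not> k \<le> 2 * l"
  then have "(2::real) ^ (2 * l) < 2 ^ k" by (intro power_strict_increasing) auto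
  also have "\<dots> \<le> real n" using k by (metis of_nat_le_iff of_nat_numeral of_nat_power)
  also have "\<dots> \<le> exp 1 ^ l" using nl by (simp add: exp_of_nat_mult[symmetric])
  also have "\<dots> \<le> 4 ^ l" using exp_le by (intro power_mono) auto
  finally show False by (simp add: power_mult)
qed

text \<open>Only degrees matter at this stage, so \<open>sampling\<close> is used without blocks.
  The third part also takes the \<open>n mod 3\<close> vertices left over; the absorber will live in
  it.\<close>

lemma coarse_split:
  "\<exists>C1 C2. C1 \<subseteq> {..<n} \<and> C2 \<subseteq> {..<n} \<and> C1 \<inter> C2 = {} \<and> card C1 = n div 3 \<and> card C2 = n div 3 \<and>
    (\<forall>v<n. \<forall>C\<in>{C1, C2, {..<n} - C1 - C2}. 29/100 * d \<le> real (card (nb v \<inter> C)))"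
proof -
  define g where "g = n div 3"
  define Y where "Y = {..<3 * g}"
  have Yn: "Y \<subseteq> {..<n}" unfolding Y_def g_def by auto
  have d1000: "1000 * real l \<le> d"
  proof -
    have "real l \<le> real l ^ 5" using l1 by (intro self_le_power) auto
    then show ?thesis using d_big l1 by linarith
  qed
  have low: "99/100 * d - 2 \<le> real (card (nb v \<inter> Y))" if v: "v < n" for v
  proof -
    have "nb v \<subseteq> (nb v \<inter> Y) \<union> {3 * g..<n}" using nb_sub unfolding Y_def by force
    then have "card (nb v) \<le> card ((nb v \<inter> Y) \<union> {3 * g..<n})" by (intro card_mono) auto
    also have "\<dots> \<le> card (nb v \<inter> Y) + card {3 * g..<n}" by (rule card_Un_le)
    also have "card {3 * g..<n} \<le> 2" unfolding g_def by simp
    finally show ?thesis using deg_lo[OF v] by linarith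
  qed
  have "\<exists>C :: nat \<Rightarrow> nat set. (\<forall>k<3. C k \<subseteq> Y \<and> card (C k) = g) \<and> (\<forall>k<3. \<forall>k'<3. k \<noteq> k' \<longrightarrow> C k \<inter> C k' = {}) \<and> (\<Union>k<3. C k) = Y \<and>
     (\<forall>k<3. \<forall>v<n. 9/10 * (real (card (nb v \<inter> Y)) / real 3) \<le> real (card (nb v \<inter> C k)) \<and> real (card (nb v \<inter> C k)) \<le> 2 * (101/100 * d / real 3)) \<and>
     (\<forall>k<3. \<forall>S\<in>{}. qb (C k) S (47 * real l * (\<lambda>_. 0) S + 9/5 * (\<lambda>_. 0) S / real 3))"
  proof (rule sampling[where J = "{}" and s = "\<lambda>_. 0" and T = "\<lambda>_. 0", OF Yn _ _ l0 nl])
    show "400 * real l \<le> real (card (nb v \<inter> Y)) / real 3" if "v < n" for v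
    proof -
      have "1200 * real l \<le> 99/100 * d - 2"
      proof -
        have "real l \<le> real l ^ 5" using l1 by (intro self_le_power) auto
        then show ?thesis using d_big l1 by linarith
      qed
      then show ?thesis using low[OF that] by simp
    qed
    show "(2 * real n + real (card {})) * real 3 * exp (- 2 * real l) < 1"
    proof (rule cnt)
      have "1 \<le> l ^ 4" using l0 by simp
      then show "3 \<le> 200 * l ^ 4" by linarith
    qed simp
  qed (use deg_hi in \<open>auto simp: Y_def\<close>)
  then obtain C :: "nat \<Rightarrow> nat set" where C': "\<forall>k<3. C k \<subseteq> Y \<and> card (C k) = g" "\<forall>k<3. \<forall>k'<3. k \<noteq> k' \<longrightarrow> C k \<inter> C k' = {}"
     "\<forall>k<3. \<forall>v<n. 9/10 * (real (card (nb v \<inter> Y)) / real 3) \<le> real (card (nb v \<inter> C k)) \<and> real (card (nb v \<inter> C k)) \<le> 2 * (101/100 * d / real 3)"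
    by (elim exE conjE)
  have C: "\<And>k. k < 3 \<Longrightarrow> C k \<subseteq> Y \<and> card (C k) = g" "\<And>k k'. k < 3 \<Longrightarrow> k' < 3 \<Longrightarrow> k \<noteq> k' \<Longrightarrow> C k \<inter> C k' = {}"
     "\<And>k v. k < 3 \<Longrightarrow> v < n \<Longrightarrow> 9/10 * (real (card (nb v \<inter> Y)) / real 3) \<le> real (card (nb v \<inter> C k))"
    using C' by blast+
  have deg: "29/100 * d \<le> real (card (nb v \<inter> C k))" if "k < 3" "v < n" for k v
    using C(3)[OF that] low[OF that(2)] d1000 l1 by simp
  show ?thesis
  proof (rule exI[of _ "C 0"], rule exI[of _ "C 1"], intro conjI allI impI ballI)
    show "C 0 \<subseteq> {..<n}" "C 1 \<subseteq> {..<n}" "C 0 \<inter> C 1 = {}" "card (C 0) = n div 3" "card (C 1) = n div 3"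
      using C(1)[of 0] C(1)[of 1] C(2)[of 0 1] Yn by (auto simp: g_def)
    fix v S assume v: "v < n" and S: "S \<in> {C 0, C 1, {..<n} - C 0 - C 1}"
    have "nb v \<inter> C 2 \<subseteq> nb v \<inter> ({..<n} - C 0 - C 1)" using C(1)[of 2] C(2)[of 2 0] C(2)[of 2 1] Yn by auto
    then have "card (nb v \<inter> C 2) \<le> card (nb v \<inter> ({..<n} - C 0 - C 1))" by (intro card_mono) auto
    then have "29/100 * d \<le> real (card (nb v \<inter> ({..<n} - C 0 - C 1)))" using deg[of 2 v] v by linarith
    then show "29/100 * d \<le> real (card (nb v \<inter> S))" using S deg[of 0 v] deg[of 1 v] v by auto
  qed
qed

end

lemma real_div_lower:
  assumes "0 < x"
  shows "real n / real x - 1 \<le> real (n div x)"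
proof -
  have "n < x + x * (n div x)" using assms by (rule dividend_less_times_div)
  then have "real n < real (x + x * (n div x))" by (simp only: of_nat_less_iff)
  then have "real n \<le> (real (n div x) + 1) * real x" by (simp add: algebra_simps)
  then have "real n / real x \<le> real (n div x) + 1" using assms by (simp only: pos_divide_le_eq of_nat_0_less_iff)
  then show ?thesis by linarith
qed

context dense_expander
begin

lemma reservoir:
  assumes C: "C \<subseteq> {..<n}" "card C = n div 3" and deg: "\<And>v. v < n \<Longrightarrow> 29/100 * d \<le> real (card (nb v \<inter> C))"
    and J: "finite J" "card J \<le> 2" "\<And>S. S \<in> J \<Longrightarrow> S \<subseteq> {..<n} \<and> qb C S (T S)"
    and row: "\<And>S w. S \<in> J \<Longrightarrow> w < n \<Longrightarrow> (\<Sum>u\<in>S. (wt w u)\<^sup>2) \<le> s S" "\<And>S. S \<in> J \<Longrightarrow> 0 < s S"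
  shows "\<exists>R. R \<subseteq> C \<and> card R = (n div 3) div (l ^ 3) \<and> (\<forall>v<n. 1/4 * (d / real (l ^ 3)) \<le> real (card (nb v \<inter> R)) \<and> real (card (nb v \<inter> R)) \<le> 2 * (101/100 * d / real (l ^ 3))) \<and>
    (\<forall>S\<in>J. qb R S (47 * real l * s S + 9/5 * T S / real (l ^ 3)))"
proof -
  let ?L = "29/100 * (d / real (l ^ 3)) - 1"
  have k0: "0 < real (l ^ 3)" by (rule kappa(2))
  have "\<exists>R. R \<subseteq> C \<and> card R = card C div (l ^ 3) \<and> (\<forall>v<n. 9/10 * ?L \<le> real (card (nb v \<inter> R)) \<and> real (card (nb v \<inter> R)) \<le> 2 * (101/100 * d / real (l ^ 3))) \<and>
    (\<forall>S\<in>J. qb R S (47 * real l * s S + 9/5 * T S / real (l ^ 3)))"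
  proof (rule transversal_class[OF C(1) kappa(3) l0 nl J(1) _ _ deg_hi J(3) row])
    show "?L \<le> real (card (nb v \<inter> C)) / real (l ^ 3) - 1" if "v < n" for v
      using divide_right_mono[OF deg[OF that] less_imp_le[OF k0]] by simp
    show "400 * real l \<le> ?L" using delta_big(2) l1 by linarith
    show "(2 * real n + real (card J)) * real (l ^ 3) * exp (- 2 * real l) < 1"
    proof (rule cnt)
      show "l ^ 3 \<le> 200 * l ^ 4" using kappa(1) by (simp only: of_nat_le_iff)
      have "1 \<le> l ^ 4" using l0 by simp
      then show "card J \<le> 200 * l ^ 4 + 1" using J(2) by linarith
    qed
  qed
  then obtain R where R: "R \<subseteq> C" "card R = card C div (l ^ 3)"
    "\<forall>v<n. 9/10 * ?L \<le> real (card (nb v \<inter> R)) \<and> real (card (nb v \<inter> R)) \<le> 2 * (101/100 * d / real (l ^ 3))"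
    "\<forall>S\<in>J. qb R S (47 * real l * s S + 9/5 * T S / real (l ^ 3))" by (elim exE conjE)
  have "1/4 * x \<le> 9/10 * (29/100 * x - 1)" if "150000000 * y \<le> x" "1 \<le> y" for x y :: real using that by simp
  from this[OF delta_big(2) l1] have "1/4 * (d / real (l ^ 3)) \<le> 9/10 * ?L" .
  then have "1/4 * (d / real (l ^ 3)) \<le> real (card (nb v \<inter> R)) \<and> real (card (nb v \<inter> R)) \<le> 2 * (101/100 * d / real (l ^ 3))" if "v < n" for v
    using R(3)[rule_format, OF that] by linarith
  then show ?thesis using R C(2) by (intro exI[of _ R]) simp
qed

lemma reservoir_card: "real ((n div 3) div (l ^ 3)) \<le> n / (2 * real (l ^ 3))" "33/100 * (n / real (l ^ 3)) \<le> real ((n div 3) div (l ^ 3))"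
  "real ((n div 3) div (l ^ 3)) \<le> n / (3 * real (l ^ 3))" 
proof -
  have k0: "0 < real (l ^ 3)" by (rule kappa(2))
  have a: "real ((n div 3) div (l ^ 3)) \<le> real (n div 3) / real (l ^ 3)" by (rule of_nat_div_le_of_nat)
  have b: "real (n div 3) \<le> real n / 3" using of_nat_div_le_of_nat[of n 3, where 'a = real] by simp
  have "real (n div 3) / real (l ^ 3) \<le> (real n / 3) / real (l ^ 3)" using b k0 by (intro divide_right_mono) auto
  then show c: "real ((n div 3) div (l ^ 3)) \<le> n / (3 * real (l ^ 3))" using a by simp
  have "n / (3 * real (l ^ 3)) \<le> n / (2 * real (l ^ 3))" using k0 by (intro divide_left_mono) auto
  then show "real ((n div 3) div (l ^ 3)) \<le> n / (2 * real (l ^ 3))" using c by linarith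
  have "real (n div 3) / real (l ^ 3) \<le> real ((n div 3) div (l ^ 3)) + 1" using real_div_lower[OF kappa(3), of "n div 3"] by linarith
  moreover have "(real n / 3 - 1) / real (l ^ 3) \<le> real (n div 3) / real (l ^ 3)" using k0 real_div_lower[of 3 n] by (intro divide_right_mono) auto
  moreover have "(real n / 3 - 1) / real (l ^ 3) = n / real (l ^ 3) / 3 - 1 / real (l ^ 3)" by (simp add: diff_divide_distrib)
  moreover have "1 / real (l ^ 3) \<le> 1" using l1 by simp
  moreover have "1000 \<le> n / real (l ^ 3)"
  proof -
    have "100000000000 * real (l ^ 3) \<le> real n" using n_pow[of 3] by simp
    then have "1000 * real (l ^ 3) \<le> real n" using k0 by linarith
    then show ?thesis using k0 by (simp only: pos_le_divide_eq)
  qed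
  moreover have "33/100 * x \<le> N" if "a \<le> N + 1" "z \<le> a" "z = x / 3 - b" "b \<le> 1" "1000 \<le> x" for x N a b z :: real
    using that by simp
  ultimately show "33/100 * (n / real (l ^ 3)) \<le> real ((n div 3) div (l ^ 3))" by blast
qed

abbreviation "reservoir_ok R \<equiv> (\<forall>v<n. 1/4 * (d / real (l ^ 3)) \<le> real (card (nb v \<inter> R)) \<and> real (card (nb v \<inter> R)) \<le> 2 * (101/100 * d / real (l ^ 3)))"

text \<open>\<open>R2\<close> is sampled first and is then one of the fixed column sets while
  \<open>R1\<close> is sampled; this gives a bound on the block between the two.\<close>

lemma reservoirs:
  assumes C: "C1 \<subseteq> {..<n}" "C2 \<subseteq> {..<n}" "C1 \<inter> C2 = {}" "card C1 = n div 3" "card C2 = n div 3"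
    and deg: "\<And>v. v < n \<Longrightarrow> 29/100 * d \<le> real (card (nb v \<inter> C1))" "\<And>v. v < n \<Longrightarrow> 29/100 * d \<le> real (card (nb v \<inter> C2))"
  shows "\<exists>R1 R2. R1 \<subseteq> C1 \<and> R2 \<subseteq> C2 \<and> card R1 = (n div 3) div (l ^ 3) \<and> card R2 = (n div 3) div (l ^ 3) \<and> reservoir_ok R1 \<and> reservoir_ok R2 \<and>
    qb R1 {..<n} (\<tau> (real (l ^ 3))) \<and> qb R2 {..<n} (\<tau> (real (l ^ 3))) \<and> qb R1 R2 (33/225000 * (d / real (l ^ 3))\<^sup>2)"
proof -
  have fC: "finite C1" "finite C2" using finite_subset[OF C(1)] finite_subset[OF C(2)] by simp_all
  have q: "qb C1 {..<n} ((d / 150)\<^sup>2)" "qb C2 {..<n} ((d / 150)\<^sup>2)"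
    by (rule qb_mono[OF qV C(1) order.refl], simp, simp, rule qb_mono[OF qV C(2) order.refl], simp, simp)
  have "\<exists>R. R \<subseteq> C2 \<and> card R = (n div 3) div (l ^ 3) \<and> reservoir_ok R \<and>
    (\<forall>S\<in>{{..<n}}. qb R S (47 * real l * (\<lambda>_. 3 * d) S + 9/5 * (\<lambda>_. (d / 150)\<^sup>2) S / real (l ^ 3)))"
    by (rule reservoir[OF C(2,5) deg(2)]) (use q row_all d0 in simp_all)
  then obtain R2 where R2: "R2 \<subseteq> C2" "card R2 = (n div 3) div (l ^ 3)" "reservoir_ok R2" "qb R2 {..<n} (\<tau> (real (l ^ 3)))"
    unfolding \<tau>_def by (elim exE conjE) simp
  define s where "s = (\<lambda>S. if S = R2 then 3 * (d / real (l ^ 3)) else 3 * d)"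
  define T where "T = (\<lambda>S. if S = R2 then \<tau> (real (l ^ 3)) else (d / 150)\<^sup>2)"
  have R2n: "R2 \<subseteq> {..<n}" using R2(1) C(2) by blast
  \<comment> \<open>\<open>s\<close> and \<open>T\<close> distinguish the two column sets by
    equality with \<open>R2\<close>, so these must differ.\<close>
  have ne: "{..<n} \<noteq> R2"
  proof
    assume "{..<n} = R2"
    then have "n = (n div 3) div (l ^ 3)" using R2(2) by (metis card_lessThan)
    also have "\<dots> \<le> n div 3" by (rule div_le_dividend)
    also have "\<dots> < n" using n0 by simp
    finally show False by simp
  qed
  have "\<exists>R. R \<subseteq> C1 \<and> card R = (n div 3) div (l ^ 3) \<and> reservoir_ok R \<and>
    (\<forall>S\<in>{{..<n}, R2}. qb R S (47 * real l * s S + 9/5 * T S / real (l ^ 3)))"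
  proof (rule reservoir[OF C(1,4) deg(1)])
    show "card {{..<n}, R2} \<le> 2" using ne by simp
    have "qb C1 R2 (\<tau> (real (l ^ 3)))" by (rule qb_mono[OF qb_sym[OF R2(4)] C(1) order.refl]) (use finite_subset[OF R2n] in auto)
    then show "S \<subseteq> {..<n} \<and> qb C1 S (T S)" if "S \<in> {{..<n}, R2}" for S using that q(1) R2n ne by (auto simp: T_def)
    show "(\<Sum>u\<in>S. (wt w u)\<^sup>2) \<le> s S" if S: "S \<in> {{..<n}, R2}" "w < n" for S w
    proof (cases "S = R2")
      case True
      have "(\<Sum>u\<in>R2. (wt w u)\<^sup>2) \<le> 3 * (d / real (l ^ 3))"
        by (rule row_class[OF R2n kappa(2)]) (use R2(2,3) S(2) reservoir_card(1) in simp_all)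
      then show ?thesis using True by (simp add: s_def)
    next
      case False
      then have "S = {..<n}" using S by simp
      then show ?thesis using False row_all[OF S(2)] by (simp add: s_def)
    qed
    show "0 < s S" for S using d0 kappa(2) by (simp add: s_def)
  qed (assumption, intro finite.intros)
  then obtain R1 where R1: "R1 \<subseteq> C1" "card R1 = (n div 3) div (l ^ 3)" "reservoir_ok R1"
    "\<forall>S\<in>{{..<n}, R2}. qb R1 S (47 * real l * s S + 9/5 * T S / real (l ^ 3))" by (elim exE conjE)
  have "qb R1 {..<n} (47 * real l * s {..<n} + 9/5 * T {..<n} / real (l ^ 3))" using R1(4) by blast
  then have a: "qb R1 {..<n} (\<tau> (real (l ^ 3)))" using ne by (simp add: s_def T_def \<tau>_def)
  have "qb R1 R2 (47 * real l * s R2 + 9/5 * T R2 / real (l ^ 3))" using R1(4) by blast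
  then have "qb R1 R2 (47 * real l * (3 * (d / real (l ^ 3))) + 9/5 * \<tau> (real (l ^ 3)) / real (l ^ 3))" by (simp add: s_def T_def)
  then have "qb R1 R2 (33/225000 * (d / real (l ^ 3))\<^sup>2)" by (rule qb_weaken[OF _ tau_bound[OF kappa(2) order.refl delta_big(2)]])
  then show ?thesis using R1 R2 a by (intro exI[of _ R1] exI[of _ R2] conjI)
qed

lemma layers:
  assumes Y: "Y \<subseteq> {..<n}" "card Y = M * (200 * l ^ 4)" and deg: "\<And>v. v < n \<Longrightarrow> 28/100 * d \<le> real (card (nb v \<inter> Y))"
    and J: "finite J" "card J \<le> 200 * l ^ 4 + 1" "\<And>S. S \<in> J \<Longrightarrow> S \<subseteq> {..<n} \<and> qb Y S (T S)"
    and row: "\<And>S w. S \<in> J \<Longrightarrow> w < n \<Longrightarrow> (\<Sum>u\<in>S. (wt w u)\<^sup>2) \<le> s S" "\<And>S. S \<in> J \<Longrightarrow> 0 < s S"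
  shows "\<exists>C. (\<forall>k<200 * l ^ 4. C k \<subseteq> Y \<and> card (C k) = M) \<and> (\<forall>k<200 * l ^ 4. \<forall>k'<200 * l ^ 4. k \<noteq> k' \<longrightarrow> C k \<inter> C k' = {}) \<and> (\<Union>k<200 * l ^ 4. C k) = Y \<and>
     (\<forall>k<200 * l ^ 4. \<forall>v<n. 1/4 * (d / real (200 * l ^ 4)) \<le> real (card (nb v \<inter> C k)) \<and> real (card (nb v \<inter> C k)) \<le> 2 * (101/100 * d / real (200 * l ^ 4))) \<and>
     (\<forall>k<200 * l ^ 4. \<forall>S\<in>J. qb (C k) S (47 * real l * s S + 9/5 * T S / real (200 * l ^ 4)))"
proof -
  let ?K = "200 * l ^ 4"
  have k0: "0 < real ?K" using kappa(4) by simp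
  have low: "28/100 * (d / real ?K) \<le> real (card (nb v \<inter> Y)) / real ?K" if "v < n" for v
    using divide_right_mono[OF deg[OF that] less_imp_le[OF k0]] by (simp only: times_divide_eq_right)
  have "\<exists>C. (\<forall>k<?K. C k \<subseteq> Y \<and> card (C k) = M) \<and> (\<forall>k<?K. \<forall>k'<?K. k \<noteq> k' \<longrightarrow> C k \<inter> C k' = {}) \<and> (\<Union>k<?K. C k) = Y \<and>
     (\<forall>k<?K. \<forall>v<n. 9/10 * (real (card (nb v \<inter> Y)) / real ?K) \<le> real (card (nb v \<inter> C k)) \<and> real (card (nb v \<inter> C k)) \<le> 2 * (101/100 * d / real ?K)) \<and>
     (\<forall>k<?K. \<forall>S\<in>J. qb (C k) S (47 * real l * s S + 9/5 * T S / real ?K))"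
  proof (rule sampling[OF Y kappa(4) l0 nl J(1) _ deg_hi J(3) row cnt[OF order.refl J(2)]])
    show "400 * real l \<le> real (card (nb v \<inter> Y)) / real ?K" if "v < n" for v
      using low[OF that] delta_big(1) l1 by linarith
  qed
  then obtain C where C: "\<forall>k<?K. C k \<subseteq> Y \<and> card (C k) = M" "\<forall>k<?K. \<forall>k'<?K. k \<noteq> k' \<longrightarrow> C k \<inter> C k' = {}" "(\<Union>k<?K. C k) = Y"
     "\<forall>k<?K. \<forall>v<n. 9/10 * (real (card (nb v \<inter> Y)) / real ?K) \<le> real (card (nb v \<inter> C k)) \<and> real (card (nb v \<inter> C k)) \<le> 2 * (101/100 * d / real ?K)"
     "\<forall>k<?K. \<forall>S\<in>J. qb (C k) S (47 * real l * s S + 9/5 * T S / real ?K)" by (elim exE conjE)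
  have dp: "0 \<le> d / real ?K" using delta_big(1) l1 by linarith
  have "1/4 * (d / real ?K) \<le> real (card (nb v \<inter> C k)) \<and> real (card (nb v \<inter> C k)) \<le> 2 * (101/100 * d / real ?K)" if "k < ?K" "v < n" for k v
  proof -
    have "1/4 * x \<le> 9/10 * y" if "28/100 * x \<le> y" "0 \<le> x" for x y :: real using that by simp
    from this[OF low[OF that(2)] dp] show ?thesis using C(4)[rule_format, OF that] by linarith
  qed
  then show ?thesis using C by (intro exI[of _ C] conjI allI impI) auto
qed

text \<open>\<open>Y2\<close> is split first, against all vertices and against \<open>R1\<close>.
  The bound against all vertices, transposed, is the input for splitting \<open>Y1\<close> against
  the classes of \<open>Y2\<close> and against \<open>R2\<close>.\<close>

lemma two_sided_layers:
  assumes Y: "Y1 \<subseteq> {..<n}" "Y2 \<subseteq> {..<n}" "Y1 \<inter> Y2 = {}" "card Y1 = M * (200 * l ^ 4)" "card Y2 = M * (200 * l ^ 4)" "0 < M"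
    and deg: "\<And>v. v < n \<Longrightarrow> 28/100 * d \<le> real (card (nb v \<inter> Y1))" "\<And>v. v < n \<Longrightarrow> 28/100 * d \<le> real (card (nb v \<inter> Y2))"
    and R: "R1 \<subseteq> {..<n}" "R2 \<subseteq> {..<n}" "R1 \<noteq> {..<n}" "R2 \<inter> Y2 = {}" "real (card R1) \<le> n / (2 * real (l ^ 3))" "real (card R2) \<le> n / (2 * real (l ^ 3))"
      "reservoir_ok R1" "reservoir_ok R2" "qb R1 {..<n} (\<tau> (real (l ^ 3)))" "qb R2 {..<n} (\<tau> (real (l ^ 3)))"
  shows "\<exists>C1 C2. (\<forall>k<200 * l ^ 4. C1 k \<subseteq> Y1 \<and> card (C1 k) = M) \<and> (\<forall>k<200 * l ^ 4. C2 k \<subseteq> Y2 \<and> card (C2 k) = M) \<and>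
     (\<forall>k<200 * l ^ 4. \<forall>k'<200 * l ^ 4. k \<noteq> k' \<longrightarrow> C1 k \<inter> C1 k' = {}) \<and> (\<forall>k<200 * l ^ 4. \<forall>k'<200 * l ^ 4. k \<noteq> k' \<longrightarrow> C2 k \<inter> C2 k' = {}) \<and>
     (\<Union>k<200 * l ^ 4. C1 k) = Y1 \<and> (\<Union>k<200 * l ^ 4. C2 k) = Y2 \<and>
     (\<forall>k<200 * l ^ 4. \<forall>v<n. 1/4 * (d / real (200 * l ^ 4)) \<le> real (card (nb v \<inter> C1 k))) \<and>
     (\<forall>k<200 * l ^ 4. \<forall>v<n. 1/4 * (d / real (200 * l ^ 4)) \<le> real (card (nb v \<inter> C2 k))) \<and>
     (\<forall>k<200 * l ^ 4. \<forall>k'<200 * l ^ 4. qb (C1 k) (C2 k') (33/225000 * (d / real (200 * l ^ 4))\<^sup>2)) \<and>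
     (\<forall>k<200 * l ^ 4. qb (C1 k) R2 (33/225000 * (d / real (l ^ 3))\<^sup>2)) \<and>
     (\<forall>k<200 * l ^ 4. qb (C2 k) R1 (33/225000 * (d / real (l ^ 3))\<^sup>2))"
proof -
  let ?K = "200 * l ^ 4"
  have fY: "finite Y1" "finite Y2" using finite_subset[OF Y(1)] finite_subset[OF Y(2)] by simp_all
  have fR: "finite R1" "finite R2" using finite_subset[OF R(1)] finite_subset[OF R(2)] by simp_all
  have qY: "qb Y2 {..<n} ((d / 150)\<^sup>2)" by (rule qb_mono[OF qV Y(2) order.refl]) simp_all
  have k0: "0 < real ?K" using kappa(4) by simp
  have M: "real M \<le> n / (2 * real ?K)"
  proof -
    have "card (Y1 \<union> Y2) \<le> card {..<n}" using Y(1,2) by (intro card_mono) auto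
    then have "M * ?K + M * ?K \<le> n" using card_Un_disjoint[OF fY Y(3)] Y(4,5) by simp
    then have "real (M * ?K + M * ?K) \<le> real n" by (simp only: of_nat_le_iff)
    then have "real M * (2 * real ?K) \<le> real n" by (simp add: algebra_simps)
    then show ?thesis using k0 by (simp only: pos_le_divide_eq mult_pos_pos zero_less_numeral)
  qed
  have qYR: "qb Y2 R1 (\<tau> (real (l ^ 3)))" by (rule qb_mono[OF qb_sym[OF R(9)] Y(2) order.refl]) (use fR in auto)
  have qYR2: "qb Y1 R2 (\<tau> (real (l ^ 3)))" by (rule qb_mono[OF qb_sym[OF R(10)] Y(1) order.refl]) (use fR in auto)
  have rowR: "(\<Sum>u\<in>R. (wt w u)\<^sup>2) \<le> 3 * (d / real (l ^ 3))" if "R \<subseteq> {..<n}" "real (card R) \<le> n / (2 * real (l ^ 3))" "reservoir_ok R" "w < n" for R w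
    by (rule row_class[OF that(1) kappa(2)]) (use that in simp_all)
  define s where "s = (\<lambda>S. if S = R1 then 3 * (d / real (l ^ 3)) else 3 * d)"
  define T where "T = (\<lambda>S. if S = R1 then \<tau> (real (l ^ 3)) else (d / 150)\<^sup>2)"
  have one: "1 \<le> l ^ 4" using l0 by simp
  have "\<exists>C. (\<forall>k<?K. C k \<subseteq> Y2 \<and> card (C k) = M) \<and> (\<forall>k<?K. \<forall>k'<?K. k \<noteq> k' \<longrightarrow> C k \<inter> C k' = {}) \<and> (\<Union>k<?K. C k) = Y2 \<and>
     (\<forall>k<?K. \<forall>v<n. 1/4 * (d / real ?K) \<le> real (card (nb v \<inter> C k)) \<and> real (card (nb v \<inter> C k)) \<le> 2 * (101/100 * d / real ?K)) \<and>
     (\<forall>k<?K. \<forall>S\<in>{{..<n}, R1}. qb (C k) S (47 * real l * s S + 9/5 * T S / real ?K))"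
  proof (rule layers[OF Y(2,5) deg(2)])
    show "finite {{..<n}, R1}" by (intro finite.intros)
    have "card {{..<n}, R1} \<le> 2" using R(3) by (simp add: card_insert_if)
    then show "card {{..<n}, R1} \<le> ?K + 1" using one by linarith
    show "S \<subseteq> {..<n} \<and> qb Y2 S (T S)" if "S \<in> {{..<n}, R1}" for S using that qY qYR R(1,3) by (auto simp: T_def)
    show "(\<Sum>u\<in>S. (wt w u)\<^sup>2) \<le> s S" if "S \<in> {{..<n}, R1}" "w < n" for S w
    proof (cases "S = R1")
      case True
      then show ?thesis using rowR[OF R(1,5,7) that(2)] by (simp add: s_def)
    next
      case False
      then have "S = {..<n}" using that by simp
      then show ?thesis using False row_all[OF that(2)] by (simp add: s_def)
    qed
    show "0 < s S" for S using d0 kappa(2) by (simp add: s_def)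
  qed assumption
  then obtain C2 where C2: "\<forall>k<?K. C2 k \<subseteq> Y2 \<and> card (C2 k) = M" "\<forall>k<?K. \<forall>k'<?K. k \<noteq> k' \<longrightarrow> C2 k \<inter> C2 k' = {}" "(\<Union>k<?K. C2 k) = Y2"
     "\<forall>k<?K. \<forall>v<n. 1/4 * (d / real ?K) \<le> real (card (nb v \<inter> C2 k)) \<and> real (card (nb v \<inter> C2 k)) \<le> 2 * (101/100 * d / real ?K)"
     "\<forall>k<?K. \<forall>S\<in>{{..<n}, R1}. qb (C2 k) S (47 * real l * s S + 9/5 * T S / real ?K)" by (elim exE conjE)
  have q2V: "qb (C2 k) {..<n} (\<tau> (real ?K))" if "k < ?K" for k
  proof -
    have "qb (C2 k) {..<n} (47 * real l * s {..<n} + 9/5 * T {..<n} / real ?K)" using C2(5)[rule_format, OF that, of "{..<n}"] by simp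
    then show ?thesis unfolding s_def T_def \<tau>_def if_not_P[OF R(3)[symmetric]] .
  qed
  have weak: "qb X S (33/225000 * (d / real (l ^ 3))\<^sup>2)" if "qb X S (47 * real l * (3 * (d / real (l ^ 3))) + 9/5 * \<tau> (real (l ^ 3)) / real ?K)" for X S
    by (rule qb_weaken[OF that tau_bound[OF kappa(2) kappa(1) delta_big(2)]])
  have q2R: "qb (C2 k) R1 (33/225000 * (d / real (l ^ 3))\<^sup>2)" if "k < ?K" for k
  proof (rule weak)
    have "qb (C2 k) R1 (47 * real l * s R1 + 9/5 * T R1 / real ?K)" using C2(5)[rule_format, OF that, of R1] by simp
    then show "qb (C2 k) R1 (47 * real l * (3 * (d / real (l ^ 3))) + 9/5 * \<tau> (real (l ^ 3)) / real ?K)" unfolding s_def T_def if_P[OF refl] .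
  qed
  define J where "J = insert R2 (C2 ` {..<?K})"
  define s' where "s' = (\<lambda>S. if S = R2 then 3 * (d / real (l ^ 3)) else 3 * (d / real ?K))"
  define T' where "T' = (\<lambda>S. if S = R2 then \<tau> (real (l ^ 3)) else \<tau> (real ?K))"
  have C2n: "C2 k \<subseteq> {..<n}" if "k < ?K" for k using C2(1) that Y(2) by blast
  have ne: "C2 k \<noteq> R2" if "k < ?K" for k
  proof
    assume e: "C2 k = R2"
    have "C2 k \<subseteq> Y2" "card (C2 k) = M" using C2(1)[rule_format, OF that] by simp_all
    then have "C2 k \<inter> Y2 = C2 k" "C2 k \<noteq> {}" using Y(6) by auto
    then show False using e R(4) by simp
  qed
  have "\<exists>C. (\<forall>k<?K. C k \<subseteq> Y1 \<and> card (C k) = M) \<and> (\<forall>k<?K. \<forall>k'<?K. k \<noteq> k' \<longrightarrow> C k \<inter> C k' = {}) \<and> (\<Union>k<?K. C k) = Y1 \<and>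
     (\<forall>k<?K. \<forall>v<n. 1/4 * (d / real ?K) \<le> real (card (nb v \<inter> C k)) \<and> real (card (nb v \<inter> C k)) \<le> 2 * (101/100 * d / real ?K)) \<and>
     (\<forall>k<?K. \<forall>S\<in>J. qb (C k) S (47 * real l * s' S + 9/5 * T' S / real ?K))"
  proof (rule layers[OF Y(1,4) deg(1)])
    show "finite J" unfolding J_def by (intro finite.intros finite_imageI finite_lessThan)
    have "card J \<le> Suc (card (C2 ` {..<?K}))" unfolding J_def by (rule card_insert_le_m1) simp_all
    also have "\<dots> \<le> ?K + 1" using card_image_le[of "{..<?K}" C2] by simp
    finally show "card J \<le> ?K + 1" .
    fix S assume S: "S \<in> J"
    have SJ: "S = R2 \<or> (S \<noteq> R2 \<and> (\<exists>k<?K. S = C2 k))" using S ne unfolding J_def by auto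
    show "0 < s' S" using d0 kappa(2) k0 by (simp add: s'_def)
    show "S \<subseteq> {..<n} \<and> qb Y1 S (T' S)" using SJ
    proof
      assume "S = R2" then show ?thesis using R(2) qYR2 by (simp add: T'_def)
    next
      assume "S \<noteq> R2 \<and> (\<exists>k<?K. S = C2 k)"
      then obtain k where k: "S \<noteq> R2" "k < ?K" "S = C2 k" by blast
      have "qb Y1 (C2 k) (\<tau> (real ?K))"
        by (rule qb_mono[OF qb_sym[OF q2V[OF k(2)]] Y(1) order.refl finite_lessThan finite_subset[OF C2n[OF k(2)] finite_lessThan]])
      then have "qb Y1 S (\<tau> (real ?K))" unfolding k(3) .
      moreover have "S \<subseteq> {..<n}" unfolding k(3) by (rule C2n[OF k(2)])
      ultimately show ?thesis unfolding T'_def if_not_P[OF k(1)] by (intro conjI)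
    qed
    fix w assume w: "w < n"
    show "(\<Sum>u\<in>S. (wt w u)\<^sup>2) \<le> s' S" using SJ
    proof
      assume "S = R2" then show ?thesis using rowR[OF R(2,6,8) w] by (simp add: s'_def)
    next
      assume "S \<noteq> R2 \<and> (\<exists>k<?K. S = C2 k)"
      then obtain k where k: "S \<noteq> R2" "k < ?K" "S = C2 k" by blast
      have c: "real (card (nb w \<inter> C2 k)) \<le> 2 * (101/100 * d / real ?K)" using C2(4)[rule_format, OF k(2) w] by blast
      have cM: "real (card (C2 k)) \<le> n / (2 * real ?K)" using C2(1)[rule_format, OF k(2)] M by simp
      show ?thesis unfolding s'_def if_not_P[OF k(1)] unfolding k(3) by (rule row_class[OF C2n[OF k(2)] k0 c cM])
    qed
  qed assumption
  then obtain C1 where C1: "\<forall>k<?K. C1 k \<subseteq> Y1 \<and> card (C1 k) = M" "\<forall>k<?K. \<forall>k'<?K. k \<noteq> k' \<longrightarrow> C1 k \<inter> C1 k' = {}" "(\<Union>k<?K. C1 k) = Y1"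
     "\<forall>k<?K. \<forall>v<n. 1/4 * (d / real ?K) \<le> real (card (nb v \<inter> C1 k)) \<and> real (card (nb v \<inter> C1 k)) \<le> 2 * (101/100 * d / real ?K)"
     "\<forall>k<?K. \<forall>S\<in>J. qb (C1 k) S (47 * real l * s' S + 9/5 * T' S / real ?K)" by (elim exE conjE)
  have q1R: "qb (C1 k) R2 (33/225000 * (d / real (l ^ 3))\<^sup>2)" if "k < ?K" for k
  proof (rule weak)
    have "qb (C1 k) R2 (47 * real l * s' R2 + 9/5 * T' R2 / real ?K)" by (rule C1(5)[rule_format, OF that]) (simp add: J_def)
    then show "qb (C1 k) R2 (47 * real l * (3 * (d / real (l ^ 3))) + 9/5 * \<tau> (real (l ^ 3)) / real ?K)" unfolding s'_def T'_def if_P[OF refl] .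
  qed
  have q12: "qb (C1 k) (C2 k') (33/225000 * (d / real ?K)\<^sup>2)" if "k < ?K" "k' < ?K" for k k'
  proof (rule qb_weaken[OF _ tau_bound[OF k0 order.refl delta_big(1)]])
    have "qb (C1 k) (C2 k') (47 * real l * s' (C2 k') + 9/5 * T' (C2 k') / real ?K)" by (rule C1(5)[rule_format, OF that(1)]) (use that(2) in \<open>simp add: J_def\<close>)
    then show "qb (C1 k) (C2 k') (47 * real l * (3 * (d / real ?K)) + 9/5 * \<tau> (real ?K) / real ?K)" unfolding s'_def T'_def if_not_P[OF ne[OF that(2)]] .
  qed
  show ?thesis
  proof (rule exI[of _ C1], rule exI[of _ C2], intro conjI)
    show "\<forall>k<?K. \<forall>v<n. 1/4 * (d / real ?K) \<le> real (card (nb v \<inter> C1 k))" using C1(4) by blast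
    show "\<forall>k<?K. \<forall>v<n. 1/4 * (d / real ?K) \<le> real (card (nb v \<inter> C2 k))" using C2(4) by blast
    show "\<forall>k<?K. \<forall>k'<?K. qb (C1 k) (C2 k') (33/225000 * (d / real ?K)\<^sup>2)" using q12 by blast
    show "\<forall>k<?K. qb (C1 k) R2 (33/225000 * (d / real (l ^ 3))\<^sup>2)" using q1R by blast
    show "\<forall>k<?K. qb (C2 k) R1 (33/225000 * (d / real (l ^ 3))\<^sup>2)" using q2R by blast
  qed (rule C1 C2)+
qed

section \<open>Assembly of the Hamilton cycle\<close>

theorem hamiltonian_list: "\<exists>cs. distinct cs \<and> successively E cs \<and> set cs = {..<n} \<and> cs \<noteq> [] \<and> E (last cs) (hd cs)"
proof -
  define g where "g = n div 3"
  define N where "N = g div l ^ 3"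
  define X where "X = n / real (l ^ 3)"
  define \<delta> where "\<delta> = d / real (l ^ 3)"
  define \<delta>' where "\<delta>' = d / real (200 * l ^ 4)"
  let ?K = "200 * l ^ 4"
  have k0: "0 < real (l ^ 3)" "0 < real ?K" using kappa by simp_all
  have N: "real N \<le> n / (2 * real (l ^ 3))" "33/100 * X \<le> real N" "real N \<le> X / 3"
    using reservoir_card unfolding N_def g_def X_def by simp_all
  have l3: "100000000000 \<le> real (l ^ 3)"
  proof -
    have "real l \<le> real l ^ 3" using l1 by (intro self_le_power) auto
    then show ?thesis using l_big unfolding of_nat_power by linarith
  qed
  have Xbig: "100000000000 * real l \<le> X"
  proof -
    have "100000000000 * real l * real (l ^ 3) = 100000000000 * real l ^ 4" by (simp add: eval_nat_numeral)
    also have "\<dots> \<le> real n" by (rule n_pow) simp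
    finally show ?thesis using k0 unfolding X_def by (simp only: pos_le_divide_eq)
  qed
  have Xn: "100000000000 * X \<le> real n"
  proof -
    have "100000000000 * X \<le> real (l ^ 3) * X" using l3 Xbig l1 by (intro mult_right_mono) auto
    also have "\<dots> = real n" using k0 by (simp add: X_def)
    finally show ?thesis .
  qed
  have dbig: "150000000 * real l \<le> \<delta>" "150000000 * real l \<le> \<delta>'" using delta_big by (simp_all add: \<delta>_def \<delta>'_def)
  have dsmall: "100000000000 * \<delta> \<le> d"
  proof -
    have "100000000000 * \<delta> \<le> real (l ^ 3) * \<delta>" using l3 dbig l1 by (intro mult_right_mono) auto
    also have "\<dots> = d" using k0 by (simp add: \<delta>_def)
    finally show ?thesis .
  qed
  have kn: "100000000000 * real ?K \<le> 200 * real n" using n_pow[of 4] by simp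
  have Ng: "N \<le> g" unfolding N_def by (rule div_le_dividend)
  obtain C1 C2 where C: "C1 \<subseteq> {..<n}" "C2 \<subseteq> {..<n}" "C1 \<inter> C2 = {}" "card C1 = n div 3" "card C2 = n div 3"
    "\<forall>v<n. \<forall>C\<in>{C1, C2, {..<n} - C1 - C2}. 29/100 * d \<le> real (card (nb v \<inter> C))" using coarse_split by (elim exE conjE)
  define Z where "Z = {..<n} - C1 - C2"
  have degC: "29/100 * d \<le> real (card (nb v \<inter> C1))" "29/100 * d \<le> real (card (nb v \<inter> C2))" "29/100 * d \<le> real (card (nb v \<inter> Z))" if "v < n" for v
    using C(6)[rule_format, OF that] by (simp_all add: Z_def)
  have fC: "finite C1" "finite C2" using finite_subset[OF C(1)] finite_subset[OF C(2)] by simp_all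
  obtain R1 R2 where R: "R1 \<subseteq> C1" "R2 \<subseteq> C2" "card R1 = N" "card R2 = N" "reservoir_ok R1" "reservoir_ok R2"
    "qb R1 {..<n} (\<tau> (real (l ^ 3)))" "qb R2 {..<n} (\<tau> (real (l ^ 3)))" "qb R1 R2 (33/225000 * (d / real (l ^ 3))\<^sup>2)"
    unfolding N_def g_def by atomize_elim (rule reservoirs[OF C(1-5) degC(1,2)])
  have fR: "finite R1" "finite R2" using finite_subset[OF R(1) fC(1)] finite_subset[OF R(2) fC(2)] .
  have Rn: "R1 \<subseteq> {..<n}" "R2 \<subseteq> {..<n}" using R(1,2) C(1,2) by auto
  have R12: "R1 \<inter> R2 = {}" using R(1,2) C(3) by auto
  define R where "R = R1 \<union> R2"
  have cR: "card R = 2 * N" unfolding R_def using card_Un_disjoint[OF fR R12] R(3,4) by simp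
  have N1: "0 < real N" using N(2) Xbig l1 by linarith
  have cZ: "card Z + 2 * g = n"
  proof -
    have "card Z = card ({..<n} - (C1 \<union> C2))" unfolding Z_def by (simp add: Diff_Diff_Int set_diff_eq)
    also have "\<dots> = n - card (C1 \<union> C2)" using C(1,2) fC by (subst card_Diff_subset) auto
    also have "card (C1 \<union> C2) = 2 * g" using card_Un_disjoint[OF fC C(3)] C(4,5) by (simp add: g_def)
    finally show ?thesis unfolding g_def by simp
  qed
  have fZ: "finite Z" by (simp add: Z_def)
  have g3: "3 * g \<le> n" unfolding g_def by simp
  have cZ3: "real n / 3 \<le> real (card Z)" using cZ g3 by linarith
  have "\<exists>c. real c \<le> n / 1000 \<and> (\<forall>j. real j \<le> n / 50 \<longrightarrow> (\<exists>x t S. S \<subseteq> Z \<and> card S = c + j \<and> x \<in> S \<and> t \<in> S \<and> x \<noteq> t \<and> absorbs E x t S R))"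
  proof (rule absorb_stage[OF qV _ _ _ _ _ degC(3)])
    show "Z \<subseteq> {..<n}" by (auto simp: Z_def)
    show "real n / 4 \<le> real (card Z)" using cZ3 by linarith
    show "R \<subseteq> {..<n}" using Rn by (simp add: R_def)
    show "R \<noteq> {}" using cR N1 by auto
    show "Z \<inter> R = {}" using R(1,2) by (auto simp: Z_def R_def)
    show "1000000 \<le> real n" using Xn Xbig l1 by linarith
    fix k :: nat assume "2 ^ k \<le> n"
    then have k: "k \<le> 2 * l" by (rule pow_le)
    have l2: "l \<le> l * l" using l0 by simp
    have "k * (2 * k) \<le> 2 * l * (2 * (2 * l))" using k by (intro mult_mono) auto
    then have a: "1 + (4 * k + 2 + k * (2 * k)) \<le> 19 * (l * l)" using k l2 l0 by linarith
    have "card R + card R * (4 * k + 2 + k * (2 * k)) = 2 * N * (1 + (4 * k + 2 + k * (2 * k)))" unfolding cR by simp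
    also have "\<dots> \<le> 2 * N * (19 * (l * l))" using a by (rule mult_left_mono) simp
    finally have "real (card R + card R * (4 * k + 2 + k * (2 * k))) \<le> real (2 * N * (19 * (l * l)))" by (simp only: of_nat_le_iff)
    also have "\<dots> = real N * (38 * (real l * real l))" by simp
    also have "\<dots> \<le> (X / 3) * (38 * (real l * real l))" using N(3) by (rule mult_right_mono) simp
    also have "\<dots> = 38/3 * (real n / real l)" using l1 by (simp add: X_def eval_nat_numeral field_simps)
    also have "\<dots> \<le> real n / 1000"
    proof -
      have "real n / real l \<le> real n / 100000000000" using l_big by (intro divide_left_mono) auto
      then show ?thesis by linarith
    qed
    finally show "real (card R + card R * (4 * k + 2 + k * (2 * k))) \<le> real n / 1000" .
  qed
  then obtain c where c: "real c \<le> n / 1000" "\<And>j. real j \<le> n / 50 \<Longrightarrow> \<exists>x t S. S \<subseteq> Z \<and> card S = c + j \<and> x \<in> S \<and> t \<in> S \<and> x \<noteq> t \<and> absorbs E x t S R" by blast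
  \<comment> \<open>The absorber is prolonged by \<open>j\<close> vertices, so that what lies
    outside it and the reservoirs divides evenly into \<open>2 * ?K\<close> layers of size
    \<open>M\<close>.\<close>
  define j where "j = (n - 2 * N - c) mod (2 * ?K)"
  define M where "M = (n - 2 * N - c) div (2 * ?K)"
  have jK: "j < 2 * ?K" unfolding j_def using kappa(4) by (intro mod_less_divisor) simp
  have "real j \<le> 2 * real ?K" using jK by linarith
  then have j50: "real j \<le> n / 50" using kn by linarith
  have cj: "2 * g + c + j \<le> n"
  proof -
    have "real (c + j) \<le> real (card Z)" using c(1) j50 cZ3 by simp
    then show ?thesis using cZ by linarith
  qed
  have Mj: "M * ?K + M * ?K + j + 2 * N + c = n"
  proof -
    have "M * (2 * ?K) + j = n - 2 * N - c" unfolding M_def j_def by (rule div_mult_mod_eq)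
    then show ?thesis using cj Ng by linarith
  qed
  obtain x t S where S: "S \<subseteq> Z" "card S = c + j" "x \<in> S" "t \<in> S" "x \<noteq> t" "absorbs E x t S R" using c(2)[OF j50] by blast
  have fS: "finite S" by (rule finite_subset[OF S(1) fZ])
  have cZS: "card (Z - S) + c + j = card Z" using card_Diff_subset[OF fS S(1)] card_mono[OF fZ S(1)] S(2) by linarith
  have gM: "g - N \<le> M * ?K" using Mj cj Ng by linarith
  have half: "card (Z - S) = 2 * (M * ?K - (g - N))" using Mj cj Ng gM cZS cZ by linarith
  \<comment> \<open>The vertices of \<open>Z\<close> that the absorber leaves free top up both sides
    to exactly \<open>M * ?K\<close>.\<close>
  obtain T1 where T1: "T1 \<subseteq> Z - S" "card T1 = M * ?K - (g - N)" using obtain_subset_with_card_n[of "M * ?K - (g - N)" "Z - S"] half by auto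
  have fT: "finite T1" using finite_subset[OF T1(1)] fZ by simp
  define Y1 where "Y1 = (C1 - R1) \<union> T1"
  define Y2 where "Y2 = (C2 - R2) \<union> (Z - S - T1)"
  have Yn: "Y1 \<subseteq> {..<n}" "Y2 \<subseteq> {..<n}" using C(1,2) T1(1) by (auto simp: Y1_def Y2_def Z_def)
  have Y12: "Y1 \<inter> Y2 = {}" using C(3) T1(1) by (auto simp: Y1_def Y2_def Z_def)
  have cY1: "card Y1 = M * ?K"
  proof -
    have "card Y1 = card (C1 - R1) + card T1" unfolding Y1_def using fC fT T1(1) by (intro card_Un_disjoint) (auto simp: Z_def)
    also have "card (C1 - R1) = g - N" using card_Diff_subset[OF fR(1) R(1)] C(4) R(3) by (simp add: g_def)
    finally show ?thesis using T1(2) gM by linarith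
  qed
  have cY2: "card Y2 = M * ?K"
  proof -
    have "card Y2 = card (C2 - R2) + card (Z - S - T1)" unfolding Y2_def using fC fZ by (intro card_Un_disjoint) (auto simp: Z_def)
    also have "card (C2 - R2) = g - N" using card_Diff_subset[OF fR(2) R(2)] C(5) R(4) by (simp add: g_def)
    also have "card (Z - S - T1) = card (Z - S) - card T1" by (rule card_Diff_subset[OF fT T1(1)])
    finally show ?thesis using T1(2) half gM by linarith
  qed
  have X0: "X \<ge> 0" using Xbig l1 by linarith
  have M0: "0 < M"
  proof (rule ccontr)
    assume "\<not> 0 < M"
    then have "j + 2 * N + c = n" using Mj by simp
    then have "real j + 2 * real N + real c = real n" by linarith
    then show False using c(1) j50 N(3) Xn X0 n0 by linarith
  qed
  have degY: "28/100 * d \<le> real (card (nb v \<inter> ((C - Q) \<union> T)))" if "29/100 * d \<le> real (card (nb v \<inter> C))" "reservoir_ok Q" "v < n" for v C Q T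
  proof -
    have "nb v \<inter> C \<subseteq> (nb v \<inter> ((C - Q) \<union> T)) \<union> (nb v \<inter> Q)" by blast
    then have "card (nb v \<inter> C) \<le> card ((nb v \<inter> ((C - Q) \<union> T)) \<union> (nb v \<inter> Q))" by (intro card_mono) auto
    also have "\<dots> \<le> card (nb v \<inter> ((C - Q) \<union> T)) + card (nb v \<inter> Q)" by (rule card_Un_le)
    finally have a: "real (card (nb v \<inter> C)) \<le> real (card (nb v \<inter> ((C - Q) \<union> T))) + real (card (nb v \<inter> Q))" by linarith
    have "real (card (nb v \<inter> Q)) \<le> 2 * (101/100 * d / real (l ^ 3))" using that(2,3) by blast
    also have "\<dots> = 202/100 * \<delta>" by (simp add: \<delta>_def)
    finally show ?thesis using a that(1) dsmall d0 by linarith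
  qed
  have RV: "R1 \<noteq> {..<n}"
  proof
    assume "R1 = {..<n}"
    then have "N = n" using R(3) by simp
    then show False using Ng g3 n0 by linarith
  qed
  have R2Y: "R2 \<inter> Y2 = {}" "R1 \<inter> Y1 = {}" "R1 \<inter> Y2 = {}" "R2 \<inter> Y1 = {}" using R(1,2) C(3) T1(1) by (auto simp: Y1_def Y2_def Z_def)
  have dY: "28/100 * d \<le> real (card (nb v \<inter> Y1))" "28/100 * d \<le> real (card (nb v \<inter> Y2))" if "v < n" for v
    unfolding Y1_def Y2_def using degY[OF degC(1)[OF that] R(5) that] degY[OF degC(2)[OF that] R(6) that] by blast+
  have cN: "real (card R1) \<le> n / (2 * real (l ^ 3))" "real (card R2) \<le> n / (2 * real (l ^ 3))" unfolding R(3,4) by (rule N(1))+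
  obtain D1 D2 where D: "\<forall>k<?K. D1 k \<subseteq> Y1 \<and> card (D1 k) = M" "\<forall>k<?K. D2 k \<subseteq> Y2 \<and> card (D2 k) = M"
     "\<forall>k<?K. \<forall>k'<?K. k \<noteq> k' \<longrightarrow> D1 k \<inter> D1 k' = {}" "\<forall>k<?K. \<forall>k'<?K. k \<noteq> k' \<longrightarrow> D2 k \<inter> D2 k' = {}"
     "(\<Union>k<?K. D1 k) = Y1" "(\<Union>k<?K. D2 k) = Y2"
     "\<forall>k<?K. \<forall>v<n. 1/4 * (d / real ?K) \<le> real (card (nb v \<inter> D1 k))"
     "\<forall>k<?K. \<forall>v<n. 1/4 * (d / real ?K) \<le> real (card (nb v \<inter> D2 k))"
     "\<forall>k<?K. \<forall>k'<?K. qb (D1 k) (D2 k') (33/225000 * (d / real ?K)\<^sup>2)"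
     "\<forall>k<?K. qb (D1 k) R2 (33/225000 * (d / real (l ^ 3))\<^sup>2)"
     "\<forall>k<?K. qb (D2 k) R1 (33/225000 * (d / real (l ^ 3))\<^sup>2)"
    by atomize_elim (rule two_sided_layers[OF Yn Y12 cY1 cY2 M0 dY Rn RV R2Y(1) cN R(5,6,7,8)])
  have d'0: "0 < \<delta>'" "0 < \<delta>" using dbig l1 by linarith+
  \<comment> \<open>\<open>matching\<close> expects a square: \<open>(2/150)^2\<close> is 40/225000,
    above 33/225000, and twice 2/150 is still below the 1/4 of the degree bound.\<close>
  have q12: "qb (D1 k) (D2 k') ((2/150 * \<delta>')\<^sup>2)" if "k < ?K" "k' < ?K" for k k'
  proof (rule qb_weaken)
    show "qb (D1 k) (D2 k') (33/225000 * \<delta>'\<^sup>2)" using D(9) that unfolding \<delta>'_def by blast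
    show "33/225000 * \<delta>'\<^sup>2 \<le> (2/150 * \<delta>')\<^sup>2" by (simp add: power2_eq_square)
  qed
  have fY: "finite Y1" "finite Y2" using finite_subset[OF Yn(1)] finite_subset[OF Yn(2)] by simp_all
  have "\<exists>ps. length ps = M \<and> (\<forall>p\<in>set ps. p \<noteq> [] \<and> hd p \<in> D1 0 \<and> last p \<in> D2 (?K - 1) \<and> successively E p \<and> distinct p) \<and>
    distinct (map hd ps @ map last ps) \<and> distinct (concat ps) \<and> set (concat ps) = Y1 \<union> Y2"
  proof (rule layer_paths[OF kappa(4) _ _ Y12 fY _ _ _ _ D(5,6) q12])
    show "0 < 2/150 * \<delta>'" "2 * (2/150 * \<delta>') < 1/4 * \<delta>'" using d'0 by simp_all
    have Y: "v < n" if "v \<in> Y1 \<union> Y2" for v using that Yn by auto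
    show "1/4 * \<delta>' \<le> real (card (nb v \<inter> D1 k))" if "k < ?K" "v \<in> Y1 \<union> Y2" for k v unfolding \<delta>'_def by (rule D(7)[rule_format, OF that(1) Y[OF that(2)]])
    show "1/4 * \<delta>' \<le> real (card (nb v \<inter> D2 k))" if "k < ?K" "v \<in> Y1 \<union> Y2" for k v unfolding \<delta>'_def by (rule D(8)[rule_format, OF that(1) Y[OF that(2)]])
  qed (use D(1-4) in blast)+
  then obtain ps where ps: "length ps = M" "\<And>p. p \<in> set ps \<Longrightarrow> p \<noteq> [] \<and> hd p \<in> D1 0 \<and> last p \<in> D2 (?K - 1) \<and> successively E p \<and> distinct p"
    "distinct (map hd ps @ map last ps)" "distinct (concat ps)" "set (concat ps) = Y1 \<union> Y2" by blast
  have K1: "?K - 1 < ?K" "0 < ?K" using kappa(4) by simp_all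
  \<comment> \<open>For the links the absorber is one more path: its first vertex \<open>x\<close>
    is entered like the head of a path, its last vertex \<open>t\<close> is left like an
    end.\<close>
  define Starts where "Starts = D1 0 \<union> {x}"
  define Ends where "Ends = D2 (?K - 1) \<union> {t}"
  have D1s: "D1 0 \<subseteq> Y1" "card (D1 0) = M" "D2 (?K - 1) \<subseteq> Y2" "card (D2 (?K - 1)) = M" using D(1,2) K1 by blast+
  have fD: "finite (D1 0)" "finite (D2 (?K - 1))" using finite_subset[OF D1s(1) fY(1)] finite_subset[OF D1s(3) fY(2)] .
  have SY: "S \<inter> Y1 = {}" "S \<inter> Y2 = {}" "S \<inter> R1 = {}" "S \<inter> R2 = {}" using S(1) T1(1) R(1,2) by (auto simp: Y1_def Y2_def Z_def)
  have Sn: "S \<subseteq> {..<n}" using S(1) by (auto simp: Z_def)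
  have xn: "x < n" "t < n" using Sn S(3,4) by auto
  have xt: "x \<notin> Y1" "x \<notin> Y2" "x \<notin> R1" "x \<notin> R2" "t \<notin> Y1" "t \<notin> Y2" "t \<notin> R1" "t \<notin> R2" using SY S(3,4) by auto
  \<comment> \<open>The rows split into a reservoir, a boundary layer and one vertex of the
    absorber, with squared norms 33/225000 and 33/225000 of \<open>\<delta>^2\<close>, and
    \<open>3 * \<delta>\<close>. The square of 26/1500 is 67.6/225000, which covers all
    three.\<close>
  define \<sigma> where "\<sigma> = 26/1500 * \<delta>"
  have sig: "33/225000 * \<delta>\<^sup>2 + (33/225000 * \<delta>\<^sup>2 + 3 * \<delta>) \<le> \<sigma>\<^sup>2"
  proof -
    have "1000000 * \<delta> \<le> \<delta> * \<delta>" using dbig(1) l1 d'0 by (intro mult_right_mono) auto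
    then show ?thesis using d'0(2) unfolding \<sigma>_def power2_eq_square by simp
  qed
  have rowR: "(\<Sum>u\<in>Q. (wt w u)\<^sup>2) \<le> 3 * \<delta>" if "Q \<subseteq> {..<n}" "card Q = N" "reservoir_ok Q" "w < n" for Q w
    unfolding \<delta>_def by (rule row_class[OF that(1) kappa(2)]) (use that N(1) in simp_all)
  have qA1: "qb (R1 \<union> Starts) R2 (\<sigma>\<^sup>2)"
  proof (rule qb_weaken[OF _ sig])
    have a: "qb R1 R2 (33/225000 * \<delta>\<^sup>2)" using R(9) unfolding \<delta>_def .
    have b: "qb (D1 0) R2 (33/225000 * \<delta>\<^sup>2)" using D(10) K1(2) unfolding \<delta>_def by blast
    show "qb (R1 \<union> Starts) R2 (33/225000 * \<delta>\<^sup>2 + (33/225000 * \<delta>\<^sup>2 + 3 * \<delta>))" unfolding Starts_def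
      by (rule qb_Un[OF a qb_Un[OF b qb_row[OF rowR[OF Rn(2) R(4,6) xn(1)]] fD(1)] fR(1)]) (use fD in simp_all)
  qed
  have qA2: "qb (R2 \<union> Ends) R1 (\<sigma>\<^sup>2)"
  proof (rule qb_weaken[OF _ sig])
    have a: "qb R2 R1 (33/225000 * \<delta>\<^sup>2)" using qb_sym[OF R(9)] unfolding \<delta>_def .
    have b: "qb (D2 (?K - 1)) R1 (33/225000 * \<delta>\<^sup>2)" using D(11) K1(1) unfolding \<delta>_def by blast
    show "qb (R2 \<union> Ends) R1 (33/225000 * \<delta>\<^sup>2 + (33/225000 * \<delta>\<^sup>2 + 3 * \<delta>))" unfolding Ends_def
      by (rule qb_Un[OF a qb_Un[OF b qb_row[OF rowR[OF Rn(1) R(3,5) xn(2)]] fD(2)] fR(2)]) (use fD in simp_all)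
  qed
  have N6: "1000000 \<le> real N" using N(2) Xbig l1 by linarith
  \<comment> \<open>Enough leaves for an edge between the two trees of a link, and few enough for
    the trees to fit into the reservoirs.\<close>
  obtain k where k: "53/1000 * real N < 2 ^ k" "2 ^ k \<le> 2 * (53/1000 * real N)"
    using pow2_between[of "53/1000 * real N"] N6 by auto
  have kl: "k \<le> 2 * l"
  proof (rule pow_le)
    have "2 ^ k \<le> real n" using k(2) N(3) Xn X0 N1 by linarith
    then have "real (2 ^ k) \<le> real n" by simp
    then show "2 ^ k \<le> n" by (simp only: of_nat_le_iff)
  qed
  \<comment> \<open>The number of layers is decisive here: \<open>2 * M * ?K \<le> n\<close> gives
    \<open>400 * M * l \<le> X\<close>, so all links together use a small part of the
    reservoirs.\<close>
  have small: "real (card (Starts \<union> Ends) + Suc (length ps) * (2 * k)) \<le> real N / 20"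
  proof -
    have a: "card Starts \<le> M + 1" unfolding Starts_def using card_Un_le[of "D1 0" "{x}"] D1s(2) by simp
    have b: "card Ends \<le> M + 1" unfolding Ends_def using card_Un_le[of "D2 (?K - 1)" "{t}"] D1s(4) by simp
    have "card (Starts \<union> Ends) \<le> 2 * Suc M" by (rule order_trans[OF card_Un_le order_trans[OF add_mono[OF a b]]]) simp
    moreover have "Suc M * (2 * k) \<le> Suc M * (4 * l)" using kl by (intro mult_le_mono2) simp
    ultimately have "card (Starts \<union> Ends) + Suc (length ps) * (2 * k) \<le> 2 * Suc M + Suc M * (4 * l)" unfolding ps(1) by (rule add_mono)
    also have "\<dots> = Suc M * (4 * l + 2)" by (simp add: algebra_simps)
    finally have "real (card (Starts \<union> Ends) + Suc (length ps) * (2 * k)) \<le> real (Suc M * (4 * l + 2))" by (simp only: of_nat_le_iff)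
    also have "\<dots> = (real M + 1) * (4 * real l + 2)" by (simp add: algebra_simps)
    also have "\<dots> \<le> (real M + 1) * (5 * real l)" using l_big by (intro mult_left_mono) auto
    also have "\<dots> = 5 * (real M * real l) + 5 * real l" by (simp add: algebra_simps)
    also have "\<dots> \<le> real N / 20"
    proof -
      have "M * ?K + M * ?K \<le> n" using Mj by linarith
      then have "real (M * ?K + M * ?K) \<le> real n" by (simp only: of_nat_le_iff)
      moreover have "real (M * ?K + M * ?K) = 400 * (real M * real l) * real (l ^ 3)" by (simp add: eval_nat_numeral)
      ultimately have "400 * (real M * real l) \<le> X" unfolding X_def using k0 by (simp only: pos_le_divide_eq)
      then show ?thesis using N(2) Xbig by linarith
    qed
    finally show ?thesis .
  qed
  have "\<exists>ts Q. set ts = set (concat ps) \<union> Q \<and> Q \<subseteq> R1 \<union> R2 \<and> distinct ts \<and> successively E (t # ts @ [x])"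
  proof (rule link_stage[of "R1 \<union> Starts" "R2 \<union> Ends" R1 Starts R2 Ends N \<sigma> "1/4 * \<delta>" k t x ps])
    show "R1 \<union> Starts \<subseteq> {..<n}" "R2 \<union> Ends \<subseteq> {..<n}" using Rn D1s Yn xn by (auto simp: Starts_def Ends_def)
    show "(R1 \<union> Starts) \<inter> (R2 \<union> Ends) = {}" using R12 R2Y D1s Y12 xt S(5) unfolding Starts_def Ends_def by blast
    show "R1 \<inter> Starts = {}" "R2 \<inter> Ends = {}" using R2Y D1s xt unfolding Starts_def Ends_def by blast+
    show "10000 \<le> real N" using N6 by linarith
    show "0 < \<sigma>" "8 * \<sigma> \<le> 1/4 * \<delta>" using d'0 by (simp_all add: \<sigma>_def)
    show "6/10 * d * N \<le> 1/4 * \<delta> * n"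
    proof -
      have "d * real N \<le> d * (X / 3)" using N(3) d0 by (intro mult_left_mono) auto
      also have "\<dots> = \<delta> * n / 3" by (simp add: X_def \<delta>_def)
      finally have "d * real N \<le> \<delta> * n / 3" .
      moreover have "0 \<le> d * real N" using d0 by simp
      ultimately show ?thesis by simp
    qed
    show "\<sigma> * n \<le> 53/1000 * N * d"
    proof -
      have "33/100 * X * d \<le> real N * d" using N(2) d0 by (intro mult_right_mono) auto
      moreover have "X * d = \<delta> * n" by (simp add: X_def \<delta>_def)
      moreover have "0 \<le> \<delta> * n" using d'0 by simp
      ultimately show ?thesis unfolding \<sigma>_def by (simp add: mult.assoc)
    qed
    show "1/4 * \<delta> \<le> real (card (nb v \<inter> R1))" "1/4 * \<delta> \<le> real (card (nb v \<inter> R2))" if "v < n" for v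
      using R(5,6) that unfolding \<delta>_def by blast+
    show "2 ^ k \<le> 107/1000 * real N" using k(2) N1 by linarith
    show "p \<noteq> [] \<and> hd p \<in> Starts \<and> last p \<in> Ends \<and> set p \<inter> (R1 \<union> R2) = {} \<and> successively E p \<and> distinct p" if "p \<in> set ps" for p
    proof -
      have "set p \<subseteq> Y1 \<union> Y2" using ps(5) that by auto
      then have "set p \<inter> (R1 \<union> R2) = {}" using R2Y by blast
      then show ?thesis using ps(2)[OF that] by (simp add: Starts_def Ends_def)
    qed
    have "set (map hd ps @ map last ps) \<subseteq> Y1 \<union> Y2" using ps(2) D1s(1,3) by fastforce
    then have "t \<notin> set (map hd ps @ map last ps)" "x \<notin> set (map hd ps @ map last ps)" using xt by blast+
    then show "distinct (t # x # map hd ps @ map last ps)" using ps(3) S(5) by simp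
  qed (use R qA1 qA2 k ps small in \<open>simp_all add: Starts_def Ends_def\<close>)
  then obtain ts Q where ts: "set ts = (Y1 \<union> Y2) \<union> Q" "Q \<subseteq> R" "distinct ts" "successively E (t # ts @ [x])"
    unfolding ps(5) R_def by blast
  have "\<exists>cs. distinct cs \<and> successively E cs \<and> set cs = S \<union> R \<union> (Y1 \<union> Y2) \<and> cs \<noteq> [] \<and> E (last cs) (hd cs)"
  proof (rule absorb_close[OF S(6) ts(3,4,1,2)])
    have "card Y1 > 0" using cY1 M0 kappa(4) by simp
    then have "Y1 \<noteq> {}" by auto
    then show "ts \<noteq> []" using ts(1) by auto
    show "S \<inter> R = {}" using SY by (auto simp: R_def)
    show "(Y1 \<union> Y2) \<inter> (S \<union> R) = {}" using SY R2Y by (auto simp: R_def)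
  qed
  moreover have "S \<union> R \<union> (Y1 \<union> Y2) = {..<n}"
  proof
    show "S \<union> R \<union> (Y1 \<union> Y2) \<subseteq> {..<n}" using Sn Rn Yn by (auto simp: R_def)
    show "{..<n} \<subseteq> S \<union> R \<union> (Y1 \<union> Y2)" by (auto simp: R_def Y1_def Y2_def Z_def)
  qed
  ultimately show ?thesis by simp
qed

end

section \<open>From singular values to quadratic bounds\<close>

context expander
begin

definition adj_op :: "(nat \<Rightarrow> real) \<Rightarrow> nat \<Rightarrow> real" where
  "adj_op x = (\<lambda>i. if i < n then \<Sum>j<n. (if E i j then 1 else 0) * x j else 0)"

lemma adj_op_vsp: "adj_op x \<in> vsp n" by (simp add: adj_op_def vsp_def)

lemma adj_op_lin: "adj_op (\<lambda>i. a * x i + b * y i) = (\<lambda>i. a * adj_op x i + b * adj_op y i)"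
  unfolding adj_op_def by (rule ext) (simp add: algebra_simps sum.distrib sum_distrib_left)

lemma adj_op_sym: "ip n (adj_op x) y = ip n x (adj_op y)"
proof -
  have "ip n (adj_op x) y = (\<Sum>i<n. \<Sum>j<n. (if E i j then 1 else 0) * x j * y i)"
    unfolding ip_def adj_op_def by (intro sum.cong refl) (simp add: sum_distrib_right)
  also have "\<dots> = (\<Sum>j<n. \<Sum>i<n. (if E i j then 1 else 0) * x j * y i)" by (rule sum.swap)
  also have "\<dots> = (\<Sum>j<n. x j * (\<Sum>i<n. (if E j i then 1 else 0) * y i))"
    unfolding sum_distrib_left by (intro sum.cong refl) (use Esym in auto)
  finally show ?thesis unfolding ip_def adj_op_def by simp
qed

text \<open>The adjacency matrix is symmetric, so its singular values are the square roots of the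
  eigenvalues of this square.\<close>

lemma selfadj_square: "selfadj n (\<lambda>x. adj_op (adj_op x))"
  unfolding selfadj_def by (simp add: adj_op_vsp adj_op_lin adj_op_sym)

lemma sum_adj: "(\<Sum>j<n. (if E i j then 1 else 0 :: real)) = real (card (nb i))"
proof -
  have "{..<n} \<inter> {j. E i j} = nb i" using EV Esym by (auto simp: nb_def)
  then show ?thesis by (simp add: sum.If_cases)
qed

text \<open>Schur's test: Cauchy-Schwarz within every row, then the column sums. It bounds the one
  eigenvalue that the hypothesis on the second singular value leaves free.\<close>

lemma schur:
  assumes D: "\<And>v. v < n \<Longrightarrow> real (card (nb v)) \<le> D" and D0: "0 \<le> D"
  shows "ip n (adj_op x) (adj_op x) \<le> D\<^sup>2 * ip n x x"
proof -
  let ?a = "\<lambda>i j. (if E i j then 1 else 0 :: real)"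
  have row: "adj_op x i * adj_op x i \<le> D * (\<Sum>j<n. ?a i j * (x j * x j))" if i: "i < n" for i
  proof -
    have "adj_op x i = (\<Sum>j<n. ?a i j * (?a i j * x j))" using i unfolding adj_op_def by (simp add: if_distrib cong: if_cong) (intro sum.cong refl, simp)
    then have "adj_op x i * adj_op x i = (\<Sum>j<n. ?a i j * (?a i j * x j))\<^sup>2" by (simp add: power2_eq_square)
    also have "\<dots> \<le> (\<Sum>j<n. (?a i j)\<^sup>2) * (\<Sum>j<n. (?a i j * x j)\<^sup>2)" by (rule Cauchy_Schwarz_ineq_sum)
    also have "(\<Sum>j<n. (?a i j)\<^sup>2) = real (card (nb i))" unfolding sum_adj[symmetric] by (intro sum.cong refl) auto
    also have "(\<Sum>j<n. (?a i j * x j)\<^sup>2) = (\<Sum>j<n. ?a i j * (x j * x j))" by (intro sum.cong refl) (auto simp: power2_eq_square)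
    also have "real (card (nb i)) * (\<Sum>j<n. ?a i j * (x j * x j)) \<le> D * (\<Sum>j<n. ?a i j * (x j * x j))"
      by (intro mult_right_mono D i sum_nonneg) auto
    finally show ?thesis .
  qed
  have "ip n (adj_op x) (adj_op x) \<le> (\<Sum>i<n. D * (\<Sum>j<n. ?a i j * (x j * x j)))" unfolding ip_def by (intro sum_mono row) simp
  also have "\<dots> = D * (\<Sum>i<n. \<Sum>j<n. ?a i j * (x j * x j))" by (simp only: sum_distrib_left)
  also have "(\<Sum>i<n. \<Sum>j<n. ?a i j * (x j * x j)) = (\<Sum>j<n. \<Sum>i<n. ?a i j * (x j * x j))" by (rule sum.swap)
  also have "\<dots> = (\<Sum>j<n. real (card (nb j)) * (x j * x j))"
    unfolding sum_adj[symmetric] sum_distrib_right by (intro sum.cong refl) (use Esym in auto)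
  also have "D * \<dots> \<le> D * (\<Sum>j<n. D * (x j * x j))"
    by (intro mult_left_mono D0 sum_mono mult_right_mono D) auto
  also have "\<dots> = D\<^sup>2 * ip n x x" by (simp add: ip_def sum_distrib_left power2_eq_square ac_simps)
  finally show ?thesis .
qed

text \<open>The hypothesis concerns A, the conclusion \<open>A - (d/n) J\<close>, and the graph is
  only nearly regular. The all-ones vector is nearly an eigenvector of A^2 for \<open>d^2\<close>,
  far from all eigenvalues other than \<open>\<mu> u\<close>, so nearly all its mass lies on
  \<open>e u\<close>. Hence a vector orthogonal to all-ones is nearly orthogonal to
  \<open>e u\<close>, and A is small on it.\<close>

theorem spectral_qb:
  assumes deg: "\<And>v. v < n \<Longrightarrow> \<bar>real (card (nb v)) - d\<bar> \<le> d / 400"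
    and e: "onb n e n" and eig: "\<And>j. j < n \<Longrightarrow> adj_op (adj_op (e j)) = (\<lambda>i. \<mu> j * e j i)"
    and u: "u < n" "\<And>j. j < n \<Longrightarrow> j \<noteq> u \<Longrightarrow> \<mu> j \<le> (d / 70000)\<^sup>2"
  shows "qb {..<n} {..<n} ((d / 150)\<^sup>2)"
proof -
  let ?o = "\<lambda>i. if i < n then 1 else (0::real)"
  let ?T = "\<lambda>x. adj_op (adj_op x)"
  have ev: "e j \<in> vsp n" and ee: "ip n (e j) (e j) = 1" if "j < n" for j using e that by (simp_all add: onb_def)
  have ov: "?o \<in> vsp n" by (simp add: vsp_def)
  have oo: "ip n ?o ?o = n" by (simp add: ip_def)
  have Tsym: "ip n (?T x) y = ip n x (?T y)" for x y by (simp add: adj_op_sym)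
  have Te: "ip n (e j) (?T x) = \<mu> j * ip n (e j) x" if "j < n" for j x
    using Tsym[of "e j" x] unfolding eig[OF that] by (simp add: ip_scale_left)
  have pars: "ip n x x = (\<Sum>j<n. (ip n (e j) x)\<^sup>2)" if "x \<in> vsp n" for x
    unfolding parseval[OF e that, of x] by (intro sum.cong refl) (simp add: power2_eq_square ip_sym[of n x])
  have normT: "ip n (adj_op x) (adj_op x) = (\<Sum>j<n. \<mu> j * (ip n (e j) x)\<^sup>2)" if "x \<in> vsp n" for x
  proof -
    have "ip n (adj_op x) (adj_op x) = ip n x (?T x)" by (rule adj_op_sym)
    also have "\<dots> = (\<Sum>j<n. ip n x (e j) * ip n (e j) (?T x))" by (rule parseval[OF e that])
    also have "\<dots> = (\<Sum>j<n. \<mu> j * (ip n (e j) x)\<^sup>2)"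
      by (intro sum.cong refl) (simp add: Te power2_eq_square ip_sym[of n x])
    finally show ?thesis .
  qed
  have D: "real (card (nb v)) \<le> 401/400 * d" if "v < n" for v using deg[OF that] by linarith
  have mu_u: "\<mu> u \<le> (401/400 * d)\<^sup>2"
  proof -
    have "ip n (adj_op (e u)) (adj_op (e u)) = ip n (e u) (?T (e u))" by (rule adj_op_sym)
    then have "ip n (adj_op (e u)) (adj_op (e u)) = \<mu> u" unfolding Te[OF u(1)] ee[OF u(1)] by simp
    then show ?thesis using schur[of "401/400 * d" "e u", OF D] d0 ee[OF u(1)] by simp
  qed
  have op_o: "adj_op ?o i = real (card (nb i))" if "i < n" for i
    using that unfolding adj_op_def sum_adj[symmetric] by simp
  \<comment> \<open>The defect of the all-ones vector as an eigenvector. Its entries are at most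
    \<open>(401/400)^2 - 1\<close>, below 501/100000, in units of \<open>d^2\<close>. On
    \<open>e j\<close> with \<open>j \<noteq> u\<close> it multiplies the coefficient of all-ones by
    at least \<open>999/1000 * d^2\<close> in absolute value, so it bounds the mass \<open>Q\<close>
    outside \<open>e u\<close>.\<close>
  define r where "r = (\<lambda>i. 1 * ?T ?o i + (- (d\<^sup>2)) * ?o i)"
  have rv: "r \<in> vsp n" unfolding r_def by (intro vsp_comb adj_op_vsp ov)
  have ri: "(r i)\<^sup>2 \<le> (501/100000 * d\<^sup>2)\<^sup>2" if i: "i < n" for i
  proof -
    have T: "?T ?o i = (\<Sum>j<n. (if E i j then 1 else 0) * real (card (nb j)))"
      using i op_o by (subst adj_op_def) (auto intro!: sum.cong)
    have "?T ?o i \<le> (\<Sum>j<n. (if E i j then 1 else 0) * (401/400 * d))" unfolding T by (intro sum_mono mult_left_mono D) auto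
    also have "\<dots> = real (card (nb i)) * (401/400 * d)" unfolding sum_distrib_right[symmetric] sum_adj ..
    also have "\<dots> \<le> (401/400 * d) * (401/400 * d)" using D[OF i] d0 by (intro mult_right_mono) auto
    finally have up: "?T ?o i \<le> 160801/160000 * d\<^sup>2" by (simp add: power2_eq_square)
    have L: "399/400 * d \<le> real (card (nb v))" if "v < n" for v using deg[OF that] by linarith
    have "(399/400 * d) * (399/400 * d) \<le> real (card (nb i)) * (399/400 * d)" using L[OF i] d0 by (intro mult_right_mono) auto
    also have "\<dots> = (\<Sum>j<n. (if E i j then 1 else 0) * (399/400 * d))" unfolding sum_distrib_right[symmetric] sum_adj ..
    also have "\<dots> \<le> ?T ?o i" unfolding T by (intro sum_mono mult_left_mono L) auto
    finally have lo: "159201/160000 * d\<^sup>2 \<le> ?T ?o i" by (simp add: power2_eq_square)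
    have "r i = ?T ?o i - d\<^sup>2" using i by (simp add: r_def)
    then have "\<bar>r i\<bar> \<le> 501/100000 * d\<^sup>2" using up lo zero_le_power2[of d] by linarith
    then have "\<bar>r i\<bar>\<^sup>2 \<le> (501/100000 * d\<^sup>2)\<^sup>2" by (rule power_mono) simp
    then show ?thesis by simp
  qed
  have rr: "ip n r r \<le> n * (501/100000 * d\<^sup>2)\<^sup>2"
    using sum_mono[of "{..<n}" "\<lambda>i. (r i)\<^sup>2" "\<lambda>_. (501/100000 * d\<^sup>2)\<^sup>2"] ri by (simp add: ip_def power2_eq_square)
  define R where "R = {..<n} - {u}"
  have split: "(\<Sum>j<n. f j) = f u + (\<Sum>j\<in>R. f j)" for f :: "nat \<Rightarrow> real"
    unfolding R_def using u(1) by (simp add: sum.remove)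
  define Q where "Q = (\<Sum>j\<in>R. (ip n (e j) ?o)\<^sup>2)"
  have Q: "Q \<le> 252/10000000 * n" 
  proof -
    have one: "(999/1000 * d\<^sup>2)\<^sup>2 * (ip n (e j) ?o)\<^sup>2 \<le> (ip n (e j) r)\<^sup>2" if j: "j \<in> R" for j
    proof -
      have jn: "j < n" "j \<noteq> u" using j by (auto simp: R_def)
      have "ip n (e j) r = (\<mu> j - d\<^sup>2) * ip n (e j) ?o"
        unfolding r_def ip_add_right Te[OF jn(1)] by (simp add: algebra_simps)
      then have "(ip n (e j) r)\<^sup>2 = (d\<^sup>2 - \<mu> j)\<^sup>2 * (ip n (e j) ?o)\<^sup>2" by (simp add: power_mult_distrib power2_commute)
      moreover have "999/1000 * d\<^sup>2 \<le> d\<^sup>2 - \<mu> j" 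
      proof -
        have "(d / 70000)\<^sup>2 = d\<^sup>2 / 4900000000" by (simp add: power_divide)
        then show ?thesis using u(2)[OF jn] zero_le_power2[of d] by linarith
      qed
      then have "(999/1000 * d\<^sup>2)\<^sup>2 \<le> (d\<^sup>2 - \<mu> j)\<^sup>2" by (rule power_mono) simp
      ultimately show ?thesis by (simp add: mult_right_mono)
    qed
    have "(999/1000 * d\<^sup>2)\<^sup>2 * Q \<le> (\<Sum>j\<in>R. (ip n (e j) r)\<^sup>2)" unfolding Q_def sum_distrib_left by (intro sum_mono one)
    also have "\<dots> \<le> (\<Sum>j<n. (ip n (e j) r)\<^sup>2)" unfolding R_def by (intro sum_mono2) auto
    also have "\<dots> \<le> n * (501/100000 * d\<^sup>2)\<^sup>2" using rr pars[OF rv] by simp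
    finally have "(d\<^sup>2)\<^sup>2 * ((999/1000)\<^sup>2 * Q) \<le> (d\<^sup>2)\<^sup>2 * ((501/100000)\<^sup>2 * n)" by (simp only: power_mult_distrib mult_ac)
    then have "(999/1000)\<^sup>2 * Q \<le> (501/100000)\<^sup>2 * n" using d0 by (simp only: mult_le_cancel_left_pos zero_less_power)
    then show ?thesis by (simp add: power2_eq_square)
  qed
  have Q0: "0 \<le> Q" unfolding Q_def by (intro sum_nonneg) simp
  have n1: "0 < real n" using n0 by simp
  have ortho: "ip n (adj_op y) (adj_op y) \<le> 262/10000000 * d\<^sup>2 * ip n y y" if y: "y \<in> vsp n" and oy: "ip n ?o y = 0" for y
  proof -
    let ?s = "ip n (e u) y" and ?c = "ip n (e u) ?o"
    define W where "W = (\<Sum>j\<in>R. (ip n (e j) y)\<^sup>2)"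
    have W: "ip n y y = ?s\<^sup>2 + W" unfolding pars[OF y] split W_def ..
    have W0: "0 \<le> W" unfolding W_def by (intro sum_nonneg) simp
    have nQ: "real n = ?c\<^sup>2 + Q" using pars[OF ov] unfolding oo split Q_def .
    have "0 = (\<Sum>j<n. ip n (e j) ?o * ip n (e j) y)" using parseval[OF e ov, of y] oy by (simp add: ip_sym[of n _ "e _"])
    then have "?c * ?s = - (\<Sum>j\<in>R. ip n (e j) ?o * ip n (e j) y)" unfolding split by linarith
    then have "(?c * ?s)\<^sup>2 = (\<Sum>j\<in>R. ip n (e j) ?o * ip n (e j) y)\<^sup>2" by simp
    also have "\<dots> \<le> Q * W" unfolding Q_def W_def by (rule Cauchy_Schwarz_ineq_sum)
    finally have cs: "?c\<^sup>2 * ?s\<^sup>2 \<le> Q * W" by (simp add: power_mult_distrib)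
    have "(999/1000 * n) * ?s\<^sup>2 \<le> ?c\<^sup>2 * ?s\<^sup>2" using nQ Q n1 by (intro mult_right_mono) auto
    also note cs
    also have "Q * W \<le> (252/10000000 * n) * W" using Q W0 by (rule mult_right_mono)
    finally have "n * (999/1000 * ?s\<^sup>2) \<le> n * (252/10000000 * W)" by (simp add: ac_simps)
    then have "999/1000 * ?s\<^sup>2 \<le> 252/10000000 * W" using n1 by (simp only: mult_le_cancel_left_pos)
    then have s: "?s\<^sup>2 \<le> 26/1000000 * ip n y y" using W0 W by simp
    have "ip n (adj_op y) (adj_op y) = \<mu> u * ?s\<^sup>2 + (\<Sum>j\<in>R. \<mu> j * (ip n (e j) y)\<^sup>2)" unfolding normT[OF y] split ..
    also have "\<dots> \<le> (401/400 * d)\<^sup>2 * ?s\<^sup>2 + (\<Sum>j\<in>R. (d / 70000)\<^sup>2 * (ip n (e j) y)\<^sup>2)"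
      by (intro add_mono mult_right_mono mu_u sum_mono u(2)) (auto simp: R_def)
    also have "\<dots> = (401/400 * d)\<^sup>2 * ?s\<^sup>2 + (d / 70000)\<^sup>2 * W" by (simp add: W_def sum_distrib_left)
    also have "\<dots> \<le> (401/400 * d)\<^sup>2 * (26/1000000 * ip n y y) + (d / 70000)\<^sup>2 * ip n y y"
      using s W by (intro add_mono mult_left_mono) auto
    also have "\<dots> = d\<^sup>2 * ip n y y * (160801/160000 * 26/1000000 + 1/4900000000)" by (simp add: power2_eq_square algebra_simps)
    also have "\<dots> \<le> d\<^sup>2 * ip n y y * (262/10000000)" by (intro mult_left_mono) auto
    finally show ?thesis by (simp add: ac_simps)
  qed
  show ?thesis unfolding qb_def
  proof (intro conjI allI)
    show "0 \<le> (d / 150)\<^sup>2" by simp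
    fix x :: "nat \<Rightarrow> real"
    \<comment> \<open>\<open>x\<close> is split into its mean and a part \<open>y\<close> orthogonal
      to all-ones. On the mean, a row of \<open>A - (d/n) J\<close> leaves only the deviation of the
      degree from \<open>d\<close>.\<close>
    define \<alpha> where "\<alpha> = (\<Sum>i<n. x i) / n"
    define y where "y = (\<lambda>i. if i < n then x i - \<alpha> else 0)"
    have yv: "y \<in> vsp n" by (simp add: y_def vsp_def)
    have sx: "(\<Sum>i<n. x i) = n * \<alpha>" using n1 by (simp add: \<alpha>_def)
    have oy: "ip n ?o y = 0" using sx by (simp add: ip_def y_def sum_subtractf)
    have xx: "(\<Sum>i<n. (x i)\<^sup>2) = n * \<alpha>\<^sup>2 + ip n y y"
    proof -
      have "ip n y y = (\<Sum>i<n. (x i)\<^sup>2 - 2 * \<alpha> * x i + \<alpha>\<^sup>2)" unfolding ip_def y_def by (intro sum.cong refl) (simp add: power2_eq_square algebra_simps)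
      also have "\<dots> = (\<Sum>i<n. (x i)\<^sup>2) - 2 * \<alpha> * (\<Sum>i<n. x i) + n * \<alpha>\<^sup>2" by (simp add: sum.distrib sum_subtractf sum_distrib_left)
      finally show ?thesis unfolding sx by (simp add: power2_eq_square)
    qed
    have row: "(\<Sum>u<n. wt w u * x u)\<^sup>2 \<le> 5 * (\<alpha>\<^sup>2 * (d / 400)\<^sup>2) + 5/4 * (adj_op y w * adj_op y w)" if w: "w < n" for w
    proof -
      define a where "a = \<alpha> * (real (card (nb w)) - d)"
      define b where "b = adj_op y w"
      have b: "b = (\<Sum>u<n. (if E w u then 1 else 0) * (x u - \<alpha>))" unfolding b_def adj_op_def y_def using w by simp
      have "(\<Sum>u<n. wt w u * x u) = (\<Sum>u<n. (if E w u then 1 else 0) * x u) - d / n * (\<Sum>u<n. x u)"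
        by (simp add: wt_def left_diff_distrib sum_subtractf sum_distrib_left)
      also have "(\<Sum>u<n. (if E w u then 1 else 0) * x u) = b + (\<Sum>u<n. (if E w u then 1 else 0)) * \<alpha>"
        unfolding b sum_distrib_right sum.distrib[symmetric] by (intro sum.cong refl) (simp add: algebra_simps)
      also have "\<dots> - d / n * (\<Sum>u<n. x u) = a + b" unfolding sum_adj sx a_def using n1 by (simp add: algebra_simps)
      finally have "(\<Sum>u<n. wt w u * x u)\<^sup>2 = (a + b)\<^sup>2" by simp
      \<comment> \<open>The weights balance the two parts: 5 times \<open>(1/400)^2\<close> and 5/4
        times 262/10000000 both stay below 1/22500.\<close>
      also have "\<dots> \<le> 5 * a\<^sup>2 + 5/4 * b\<^sup>2"
      proof -
        have "0 \<le> (2 * a - b / 2)\<^sup>2" by simp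
        then show ?thesis by (simp add: power2_eq_square algebra_simps)
      qed
      also have "a\<^sup>2 \<le> \<alpha>\<^sup>2 * (d / 400)\<^sup>2"
      proof -
        have "\<bar>real (card (nb w)) - d\<bar>\<^sup>2 \<le> (d / 400)\<^sup>2" using deg[OF w] by (rule power_mono) simp
        then show ?thesis unfolding a_def power_mult_distrib by (intro mult_left_mono) simp_all
      qed
      finally show ?thesis by (simp add: b_def power2_eq_square)
    qed
    have "(\<Sum>w<n. (\<Sum>u<n. wt w u * x u)\<^sup>2) \<le> (\<Sum>w<n. 5 * (\<alpha>\<^sup>2 * (d / 400)\<^sup>2) + 5/4 * (adj_op y w * adj_op y w))" by (intro sum_mono row) simp
    also have "\<dots> = 5 * (n * \<alpha>\<^sup>2 * (d / 400)\<^sup>2) + 5/4 * ip n (adj_op y) (adj_op y)" by (simp add: sum.distrib sum_distrib_left ip_def)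
    also have "\<dots> \<le> 5 * (n * \<alpha>\<^sup>2 * (d / 400)\<^sup>2) + 5/4 * (262/10000000 * d\<^sup>2 * ip n y y)" by (intro add_left_mono mult_left_mono ortho yv oy) simp
    also have "\<dots> = d\<^sup>2 * (n * \<alpha>\<^sup>2) * (5/160000) + d\<^sup>2 * ip n y y * (1310/40000000)" by (simp add: power2_eq_square algebra_simps)
    also have "\<dots> \<le> d\<^sup>2 * (n * \<alpha>\<^sup>2) * (1/22500) + d\<^sup>2 * ip n y y * (1/22500)" by (intro add_mono mult_left_mono) auto
    also have "\<dots> = (d / 150)\<^sup>2 * (\<Sum>i<n. (x i)\<^sup>2)" unfolding xx by (simp add: power2_eq_square algebra_simps)
    finally show "(\<Sum>w<n. (\<Sum>u<n. wt w u * x u)\<^sup>2) \<le> (d / 150)\<^sup>2 * (\<Sum>i<n. (x i)\<^sup>2)" .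
  qed
qed

end

text \<open>The matrix with the columns \<open>e j\<close> conjugates \<open>M\<close> to a diagonal
  matrix, and the characteristic polynomial is invariant under similarity; so multiplicities agree
  as well.\<close>

lemma proots_char_poly_onb:
  fixes M :: "real mat"
  assumes M: "M \<in> carrier_mat n n" and e: "onb n e n"
    and eig: "\<And>i j. i < n \<Longrightarrow> j < n \<Longrightarrow> (\<Sum>k<n. M $$ (i, k) * e j k) = \<mu> j * e j i"
  shows "proots (char_poly M) = mset (map \<mu> [0..<n])"
proof -
  define P where "P = Matrix.mat n n (\<lambda>(i, j). e j i)"
  define P' where "P' = Matrix.mat n n (\<lambda>(i, j). e i j)"
  define D where "D = Matrix.mat n n (\<lambda>(i, j). if i = j then \<mu> i else 0)"
  have car: "P \<in> carrier_mat n n" "P' \<in> carrier_mat n n" "D \<in> carrier_mat n n" by (simp_all add: P_def P'_def D_def)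
  have inv: "P' * P = 1\<^sub>m n"
  proof (rule eq_matI)
    fix i j assume ij: "i < dim_row (1\<^sub>m n :: real mat)" "j < dim_col (1\<^sub>m n :: real mat)"
    have "(P' * P) $$ (i, j) = (\<Sum>k<n. e i k * e j k)" using ij by (simp add: P_def P'_def scalar_prod_def atLeast0LessThan)
    also have "\<dots> = (if i = j then 1 else 0)" using e ij unfolding onb_def ip_def by simp
    finally show "(P' * P) $$ (i, j) = 1\<^sub>m n $$ (i, j)" using ij by simp
  qed (simp_all add: P_def P'_def)
  have inv': "P * P' = 1\<^sub>m n" by (rule mat_mult_left_right_inverse[OF car(2,1) inv])
  have MP: "M * P = P * D"
  proof (rule eq_matI)
    fix i j assume ij: "i < dim_row (P * D)" "j < dim_col (P * D)"
    then have ij': "i < n" "j < n" using car by simp_all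
    have "(M * P) $$ (i, j) = (\<Sum>k<n. M $$ (i, k) * e j k)"
      using ij' M by (simp add: P_def scalar_prod_def atLeast0LessThan)
    also have "\<dots> = \<mu> j * e j i" by (rule eig[OF ij'])
    also have "\<dots> = (\<Sum>k<n. e k i * (if k = j then \<mu> k else 0))" using ij' by (simp add: if_distrib cong: if_cong)
    also have "\<dots> = (P * D) $$ (i, j)" using ij' by (simp add: P_def D_def scalar_prod_def atLeast0LessThan)
    finally show "(M * P) $$ (i, j) = (P * D) $$ (i, j)" .
  qed (use M car in simp_all)
  have "M = M * (P * P')" unfolding inv' using M by simp
  also have "\<dots> = P * D * P'" unfolding MP[symmetric] using M car by simp
  finally have "similar_mat_wit M D P P'"
    unfolding similar_mat_wit_def Let_def using M car inv inv' by auto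
  then have "similar_mat M D" unfolding similar_mat_def by blast
  then have "char_poly M = char_poly D" by (rule char_poly_similar)
  also have "\<dots> = (\<Prod>a\<leftarrow>diag_mat D. [:- a, 1:])"
    by (rule char_poly_upper_triangular[OF car(3)]) (auto simp: D_def)
  also have "diag_mat D = map \<mu> [0..<n]" unfolding diag_mat_def by (rule nth_equalityI) (simp_all add: D_def)
  finally have cp: "char_poly M = (\<Prod>a\<leftarrow>map \<mu> [0..<n]. [:- a, 1:])" .
  have "proots (\<Prod>a\<leftarrow>xs. [:- a, 1:]) = mset xs" for xs :: "real list"
  proof (induction xs)
    case (Cons a xs)
    have "(\<Prod>a\<leftarrow>xs. [:- a, 1:]) \<noteq> (0 :: real poly)" by (auto simp: prod_list_zero_iff)
    then show ?case using Cons by (simp add: proots_mult del: mult_pCons_left)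
  qed simp
  then show ?thesis unfolding cp .
qed

text \<open>At most one entry can exceed \<open>c\<close>. Counting such entries is invariant under
  permutation, so the sorting permutation never has to be followed.\<close>

lemma second_largest:
  fixes xs :: "real list"
  assumes "rev (sort xs) ! 1 \<le> c" "2 \<le> length xs"
  shows "\<exists>u<length xs. \<forall>i<length xs. i \<noteq> u \<longrightarrow> xs ! i \<le> c"
proof -
  define ys where "ys = rev (sort xs)"
  have l: "length ys = length xs" by (simp add: ys_def)
  have s: "sorted (rev ys)" by (simp add: ys_def)
  have "filter (\<lambda>x. c < x) (tl ys) = []"
  proof (rule filter_False, rule ballI)
    fix x assume "x \<in> set (tl ys)"
    then obtain i where i: "i < length (tl ys)" "x = tl ys ! i" by (metis in_set_conv_nth)
    then have "x = ys ! Suc i" "Suc i < length ys" by (simp_all add: nth_tl)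
    moreover have "ys ! Suc i \<le> ys ! 1" using s \<open>Suc i < length ys\<close> by (intro sorted_rev_nth_mono) auto
    ultimately show "\<not> c < x" using assms(1) by (simp add: ys_def)
  qed
  moreover have "filter P ys = filter P [hd ys] @ filter P (tl ys)" for P using assms(2) l by (cases ys) auto
  moreover have "length (filter (\<lambda>x. c < x) [hd ys]) \<le> 1" by simp
  ultimately have "length (filter (\<lambda>x. c < x) ys) \<le> 1" by simp
  moreover have "length (filter (\<lambda>x. c < x) ys) = length (filter (\<lambda>x. c < x) xs)"
  proof -
    have "mset (filter (\<lambda>x. c < x) ys) = mset (filter (\<lambda>x. c < x) xs)" by (simp add: ys_def)
    then show ?thesis by (metis size_mset)
  qed
  ultimately have "card {i. i < length xs \<and> c < xs ! i} \<le> 1" by (simp add: length_filter_conv_card)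
  then have one: "i = j" if "i < length xs" "c < xs ! i" "j < length xs" "c < xs ! j" for i j
    using that card_le_Suc0_iff_eq[of "{i. i < length xs \<and> c < xs ! i}"] by auto
  show ?thesis
  proof (cases "\<exists>u<length xs. c < xs ! u")
    case True
    then obtain u where "u < length xs" "c < xs ! u" by blast
    then show ?thesis using one by (intro exI[of _ u]) (auto simp: not_less[symmetric])
  next
    case False
    then have "\<forall>u<length xs. xs ! u \<le> c" by (meson not_le)
    moreover have "0 < length xs" using assms(2) by linarith
    ultimately show ?thesis by blast
  qed
qed

lemma hamilton_cycle_of_list:
  fixes G :: "nat pair_pre_digraph"
  assumes G: "pverts G = {..<n}" and cs: "distinct cs" "set cs = {..<n}" "successively (\<lambda>u v. (u, v) \<in> parcs G) cs" "cs \<noteq> []"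
    "(last cs, hd cs) \<in> parcs G" and n: "3 \<le> n"
  shows "\<exists>p. hamilton_cycle G p"
proof -
  define arcs_of where "arcs_of = (\<lambda>u ws. zip (u # butlast ws) (ws :: nat list))"
  have Cons: "arcs_of u (w # ws) = (u, w) # arcs_of w ws" for u w ws by (cases ws) (simp_all add: arcs_of_def)
  have cas: "pre_digraph.cas (with_proj G) u (arcs_of u ws) (last (u # ws))" for u ws
  proof (induction ws arbitrary: u)
    case Nil then show ?case by (simp add: arcs_of_def pre_digraph.cas.simps)
  next
    case (Cons w ws)
    then show ?case using Cons(1)[of w] by (simp add: \<open>\<And>u w ws. arcs_of u (w # ws) = (u, w) # arcs_of w ws\<close> pre_digraph.cas.simps del: cas_with_proj_eq)
  qed
  have verts: "pre_digraph.awalk_verts (with_proj G) u (arcs_of u ws) = u # ws" for u ws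
  proof (induction ws arbitrary: u)
    case Nil then show ?case by (simp add: arcs_of_def pre_digraph.awalk_verts.simps)
  next
    case (Cons w ws)
    then show ?case using Cons(1)[of w] by (simp add: \<open>\<And>u w ws. arcs_of u (w # ws) = (u, w) # arcs_of w ws\<close> pre_digraph.awalk_verts.simps del: awalk_verts_with_proj_eq)
  qed
  have sub: "set (arcs_of u ws) \<subseteq> parcs G" if "successively (\<lambda>u v. (u, v) \<in> parcs G) (u # ws)" for u ws
    using that
  proof (induction ws arbitrary: u)
    case Nil then show ?case by (simp add: arcs_of_def)
  next
    case (Cons w ws)
    then show ?case by (simp add: \<open>\<And>u w ws. arcs_of u (w # ws) = (u, w) # arcs_of w ws\<close>)
  qed
  \<comment> \<open>Starting at \<open>last cs\<close> turns the closing arc into the first arc of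
    the walk.\<close>
  define p where "p = arcs_of (last cs) cs"
  have succ: "successively (\<lambda>u v. (u, v) \<in> parcs G) (last cs # cs)" using cs(3-5) by (cases cs) auto
  have "pre_digraph.cycle (with_proj G) p"
    unfolding pre_digraph.cycle_def pre_digraph.awalk_def
  proof (intro exI[of _ "last cs"] conjI)
    show "last cs \<in> verts (with_proj G)" using cs(2,4) G by (metis last_in_set with_proj_simps(1))
    show "set p \<subseteq> arcs (with_proj G)" unfolding p_def using sub[OF succ] by simp
    show "pre_digraph.cas (with_proj G) (last cs) p (last cs)" unfolding p_def using cas[of "last cs" cs] cs(4) by simp
    show "distinct (tl (pre_digraph.awalk_verts (with_proj G) (last cs) p))" unfolding p_def verts using cs(1) by simp
    show "p \<noteq> []" unfolding p_def arcs_of_def using cs(4) by (cases cs) auto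
  qed
  moreover have "length cs = n" using cs(1,2) distinct_card[of cs] by simp
  then have "3 \<le> length p" unfolding p_def arcs_of_def using n cs(4) by (simp add: Suc_le_eq)
  moreover have "fst ` set p = pverts G"
  proof -
    have "fst ` set p = set (map fst p)" by simp
    also have "map fst p = last cs # butlast cs" unfolding p_def arcs_of_def using cs(4) by (simp add: map_fst_zip)
    also have "set (last cs # butlast cs) = set cs" using cs(4) by (metis append_butlast_last_id rotate1.simps(2) rotate1_hd_tl set_rotate1 list.set(2) set_append Un_insert_right sup_bot.right_neutral list.set(1))
    finally show ?thesis using cs(2) G by simp
  qed
  ultimately show ?thesis unfolding hamilton_cycle_def by blast
qed

lemma pseudorandom_hamilton:
  assumes G: "pseudorandom_graph n \<gamma> d lam G" and \<gamma>: "\<gamma> \<le> 1 / 400" and lam: "lam \<le> d / 70000"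
    and l: "100000000000 \<le> real l" "real n \<le> exp (real l)" "real l ^ 6 \<le> 2 * d" "real l ^ 9 \<le> real n" and n3: "3 \<le> n"
  shows "\<exists>p. hamilton_cycle G p"
proof -
  have d0: "0 < d" and lam0: "0 < lam" and pg: "pair_graph G" and V: "pverts G = {0..<n}"
    and deg: "\<And>v. v \<in> pverts G \<Longrightarrow> real (out_degree (with_proj G) v) \<in> {(1 - \<gamma>) * d .. (1 + \<gamma>) * d}"
    and sv: "singular_value 2 (adjacency_matrix n G) \<le> lam"
    using G unfolding pseudorandom_graph_def by auto
  define E where "E = (\<lambda>u v. (u, v) \<in> parcs G)"
  interpret pg: pair_graph G by (rule pg)
  interpret expander n E d
  proof
    show "E v u" if "E u v" for u v
      using pg.pair_sym_arcs that unfolding symmetric_def E_def by (simp add: sym_def)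
    show "\<not> E u u" for u using pg.pair_no_loops[of "(u, u)"] unfolding E_def by auto
    show "v < n" if "E u v" for u v using pg.in_arcsD2[of u v] that V unfolding E_def by simp
  qed (use n3 d0 in auto)
  have card_nb: "real (card (nb v)) = real (out_degree (with_proj G) v)" for v
  proof -
    have "out_arcs (with_proj G) v = Pair v ` nb v" unfolding out_arcs_def nb_def unfolding E_def by auto
    then show ?thesis unfolding out_degree_def by (simp add: card_image inj_on_def)
  qed
  have degd: "\<bar>real (card (nb v)) - d\<bar> \<le> d / 400" if "v < n" for v
  proof -
    have "real (card (nb v)) \<in> {(1 - \<gamma>) * d .. (1 + \<gamma>) * d}" unfolding card_nb using deg[of v] that V by simp
    then have "\<bar>real (card (nb v)) - d\<bar> \<le> \<gamma> * d" by (auto simp: algebra_simps abs_le_iff)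
    also have "\<dots> \<le> 1 / 400 * d" using \<gamma> d0 by (intro mult_right_mono) auto
    finally show ?thesis by simp
  qed
  obtain e \<mu> where e: "onb n e n" and eig: "\<And>j. j < n \<Longrightarrow> adj_op (adj_op (e j)) = (\<lambda>i. \<mu> j * e j i)"
    using spectral_theorem[OF selfadj_square] by blast
  let ?A = "adjacency_matrix n G"
  let ?a = "\<lambda>i j. if E i j then 1 else (0::real)"
  have Ac: "?A \<in> carrier_mat n n" and Aij: "\<And>i j. i < n \<Longrightarrow> j < n \<Longrightarrow> ?A $$ (i, j) = ?a i j"
    unfolding adjacency_matrix_def E_def by simp_all
  have Mc: "transpose_mat ?A * ?A \<in> carrier_mat n n" using Ac by simp
  have Mij: "(transpose_mat ?A * ?A) $$ (i, k) = (\<Sum>t<n. ?a i t * ?a t k)" if "i < n" "k < n" for i k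
  proof -
    have "(transpose_mat ?A * ?A) $$ (i, k) = (\<Sum>t<n. ?A $$ (t, i) * ?A $$ (t, k))"
      using that Ac by (simp add: scalar_prod_def atLeast0LessThan)
    also have "\<dots> = (\<Sum>t<n. ?a i t * ?a t k)"
    proof (intro sum.cong refl)
      fix t assume "t \<in> {..<n}"
      then have "?A $$ (t, i) = ?a t i" "?A $$ (t, k) = ?a t k" using Aij that by simp_all
      moreover have "?a t i = ?a i t" using Esym by auto
      ultimately show "?A $$ (t, i) * ?A $$ (t, k) = ?a i t * ?a t k" by simp
    qed
    finally show ?thesis .
  qed
  have "proots (char_poly (transpose_mat ?A * ?A)) = mset (map \<mu> [0..<n])"
  proof (rule proots_char_poly_onb[OF Mc e])
    fix i j assume ij: "i < n" "j < n"
    have "(\<Sum>k<n. (transpose_mat ?A * ?A) $$ (i, k) * e j k) = (\<Sum>k<n. \<Sum>t<n. ?a i t * (?a t k * e j k))"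
      by (intro sum.cong refl) (simp only: Mij[OF ij(1)] lessThan_iff sum_distrib_right mult.assoc)
    also have "\<dots> = (\<Sum>t<n. \<Sum>k<n. ?a i t * (?a t k * e j k))" by (rule sum.swap)
    also have "\<dots> = (\<Sum>t<n. ?a i t * adj_op (e j) t)" 
    proof (intro sum.cong refl)
      fix t assume "t \<in> {..<n}"
      then have "adj_op (e j) t = (\<Sum>k<n. ?a t k * e j k)" unfolding adj_op_def by simp
      then show "(\<Sum>k<n. ?a i t * (?a t k * e j k)) = ?a i t * adj_op (e j) t" by (simp only: sum_distrib_left)
    qed
    also have "\<dots> = adj_op (adj_op (e j)) i" using ij by (subst (2) adj_op_def) simp
    finally show "(\<Sum>k<n. (transpose_mat ?A * ?A) $$ (i, k) * e j k) = \<mu> j * e j i" unfolding eig[OF ij(2)] .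
  qed
  then have sv': "rev (sort (map (\<lambda>j. sqrt (\<mu> j)) [0..<n])) ! 1 \<le> lam"
    using sv unfolding singular_value_def singular_values_def
    by (simp add: mset_map[symmetric] comp_def del: mset_map)
  have len: "2 \<le> length (map (\<lambda>j. sqrt (\<mu> j)) [0..<n])" using n3 by simp
  obtain u where u: "u < n" "\<And>j. j < n \<Longrightarrow> j \<noteq> u \<Longrightarrow> sqrt (\<mu> j) \<le> lam"
    using second_largest[OF sv' len] by auto
  have "qb {..<n} {..<n} ((d / 150)\<^sup>2)"
  proof (rule spectral_qb[OF degd e eig u(1)])
    fix j assume "j < n" "j \<noteq> u"
    then have "sqrt (\<mu> j) \<le> d / 70000" using u(2) lam by fastforce
    then show "\<mu> j \<le> (d / 70000)\<^sup>2" by (rule sqrt_le_D)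
  qed
  then interpret dense_expander n E d l
  proof unfold_locales
    show "99/100 * d \<le> real (card (nb v))" "real (card (nb v)) \<le> 101/100 * d" if "v < n" for v using degd[OF that] d0 by linarith+
  qed (use l in auto)
  obtain cs where cs: "distinct cs" "successively E cs" "set cs = {..<n}" "cs \<noteq> []" "E (last cs) (hd cs)"
    using hamiltonian_list by blast
  show ?thesis
    by (rule hamilton_cycle_of_list[OF _ cs(1,3) cs(2)[unfolded E_def] cs(4) cs(5)[unfolded E_def] n3]) (simp add: V atLeast0LessThan)
qed

theorem theorem7p1:
  fixes \<gamma> :: real
  assumes "0 < \<gamma>" and "\<gamma> \<le> 1 / 400"
  shows "\<forall>\<^sub>F n in sequentially. \<forall>(d::real) (lam::real) (G :: nat pair_pre_digraph).
           pseudorandom_graph n \<gamma> d lam G \<longrightarrow> lam \<le> d / 70000 \<longrightarrow> ln (real n) ^ 6 \<le> d \<longrightarrow>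
           (\<exists>p. hamilton_cycle G p)"
proof -
  have "\<forall>\<^sub>F n::nat in sequentially. 100000000000 \<le> ln (real n)" by real_asymp
  moreover have "\<forall>\<^sub>F n::nat in sequentially. (ln (real n) + 1) ^ 6 \<le> 2 * ln (real n) ^ 6" by real_asymp
  moreover have "\<forall>\<^sub>F n::nat in sequentially. (ln (real n) + 1) ^ 9 \<le> real n" by real_asymp
  moreover have "\<forall>\<^sub>F n::nat in sequentially. 3 \<le> n" by (rule eventually_ge_at_top)
  ultimately show ?thesis
  proof eventually_elim
    case (elim n)
    \<comment> \<open>Rounding up gives \<open>n \<le> exp l\<close>. The excess over the logarithm
      is at most 1, which for large \<open>n\<close> costs at most a factor 2 in the sixth
      power.\<close>
    define l where "l = nat \<lceil>ln (real n)\<rceil>"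
    have l: "ln (real n) \<le> real l" "real l \<le> ln (real n) + 1" using elim(1) unfolding l_def by linarith+
    have le: "real n \<le> exp (real l)" using l(1) elim(4) by (metis exp_ln exp_le_cancel_iff of_nat_0_less_iff less_le_trans zero_less_numeral)
    show ?case
    proof (intro allI impI)
      fix d lam :: real and G :: "nat pair_pre_digraph"
      assume G: "pseudorandom_graph n \<gamma> d lam G" and lam: "lam \<le> d / 70000" and d: "ln (real n) ^ 6 \<le> d"
      have "real l ^ 6 \<le> (ln (real n) + 1) ^ 6" using l(2) by (intro power_mono) auto
      then have l6: "real l ^ 6 \<le> 2 * d" using elim(2) d by linarith
      have "real l ^ 9 \<le> (ln (real n) + 1) ^ 9" using l(2) by (intro power_mono) auto
      then have l9: "real l ^ 9 \<le> real n" using elim(3) by linarith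
      have l11: "100000000000 \<le> real l" using l(1) elim(1) by linarith
      show "\<exists>p. hamilton_cycle G p" by (rule pseudorandom_hamilton[OF G assms(2) lam l11 le l6 l9 elim(4)])
    qed
  qed
qed

end
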